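(* Let $\kappa>0$, $a=\sqrt{2/\kappa}$, $b=\sqrt{\kappa/8}-\sqrt{2/\kappa}$. For every rooted vertex field $\mathcal O\equiv\mathcal O^{(\boldsymbol\sigma,\boldsymbol\sigma_*;\sigma_-,\sigma_+)}$ satisfying the neutrality condition $\sigma_-+\sigma_++\sum_j(\sigma_j+\sigma_{j*})=0$, the non-random field $$\frac{\mathbf E[\Psi(p)\star\mathcal O]}{\mathbf E[\Psi(p)]},\qquad \Psi=\mathcal O^{(a,0;-\frac12a,-\frac12a)},$$ is a dipolar $\mathrm{SLE}_\kappa$ martingale-observable.
   Context: Setting. $D\subsetneq\mathbb C$ is simply connected, $Q\subseteq\partial D$ a boundary arc with endpoints $q_-,q_+$, and $p\in\partial D\setminus\bar Q$, with $q_-,p,q_+$ positively oriented. $\mathbb S=\{0<\Im z<\pi\}$, $\mathbb H=\{\Im z>0\}$; $w:(D,q_-,q_+)\to(\mathbb H,-1,1)$ is a conformal map. Free field. $\Phi_{(0)}$ is the Gaussian free field in $D$ with Dirichlet boundary condition, $\mathbf E[\Phi_{(0)}(\zeta)\Phi_{(0)}(z)]=2G(\zeta,z)$ with $G$ the Green's function ($\sim-\log|\zeta-z|$), regarded as a correlational (Fock space) field; $\odot$ is Wick's product; $\mathbf E[e^{\odot F}]=1$ for $F$ a centered linear Gaussian functional. Formally $\Phi_{(0)}=\Phi^+_{(0)}+\Phi^-_{(0)}$, $\Phi^-_{(0)}=\overline{\Phi^+_{(0)}}$, with $\mathbf E[\Phi^+_{(0)}(z)\Phi^+_{(0)}(z_0)]=\log\frac1{w(z)-w(z_0)}$,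 $\mathbf E[\Phi^+_{(0)}(z)\Phi^-_{(0)}(z_0)]=\log(w(z)-\overline{w(z_0)})$. Rooted vertex fields. For real $\boldsymbol\sigma=(\sigma_1,\dots,\sigma_n)$, $\boldsymbol\sigma_*=(\sigma_{1*},\dots,\sigma_{n*})$, $\sigma_\pm$, and nodes $\mathbf z=(z_1,\dots,z_n)$ (so $\boldsymbol\sigma,\boldsymbol\sigma_*$ are viewed as divisors, i.e. finitely supported real functions), with $w_j=w(z_j)$, $w'_j=w'(z_j)$, $w'_\pm=w'(q_\pm)$, $$\mathcal O^{(\boldsymbol\sigma,\boldsymbol\sigma_*;\sigma_-,\sigma_+)}(\mathbf z)=(w'_-)^{h_-}(w'_+)^{h_+}\prod_jM_j\prod_{j<k}I_{j,k}\;e^{\odot i(\sigma_-\Phi^+_{(0)}(q_-)+\sigma_+\Phi^+_{(0)}(q_+)+\sum_j\sigma_j\Phi^+_{(0)}(z_j)-\sigma_{j*}\Phi^-_{(0)}(z_j))},$$ $$M_j=(w_j')^{h_j}(\overline{w_j'})^{h_{j*}}(1-w_j)^{\nu_j^+}(1+w_j)^{\nu_j^-}(1-\bar w_j)^{\nu_{j*}^+}(1+\bar w_j)^{\nu_{j*}^-}(w_j-\bar w_j)^{\sigma_j\sigma_{j*}},$$ $$I_{j,k}=(w_j-w_k)^{\sigma_j\sigma_k}(w_j-\bar w_k)^{\sigma_j\sigma_{k*}}(\bar w_j-w_k)^{\sigma_{j*}\sigma_k}(\bar w_j-\bar w_k)^{\sigma_{j*}\sigma_{k*}},$$ $\nu_j^\pm=\sigma_j(b+\sigma_\pm)$,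 $\nu_{j*}^\pm=\sigma_{j*}(b+\sigma_\pm)$, $h_j=\frac{\sigma_j^2}2-\sigma_jb$, $h_{j*}=\frac{\sigma_{j*}^2}2-\sigma_{j*}b$, $h_\pm=\frac{\sigma_\pm^2}2$. These are (multivalued; a branch is fixed) differentials with dimensions $h_j,h_{j*}$ at $z_j$ and boundary dimensions $h_\pm$ at $q_\pm$. The boundary point $p$ is allowed as a node of $\Psi$. Thus $\Psi(z)=(w'_-)^{a^2/8}(w'_+)^{a^2/8}\big(\frac{w'(z)}{1-w(z)^2}\big)^{a^2/2-ab}e^{\odot\frac{ia}2(\Phi^+_{(0)}(z,q_-)+\Phi^+_{(0)}(z,q_+))}$ with $\Phi^+_{(0)}(z,z_0)=\Phi^+_{(0)}(z)-\Phi^+_{(0)}(z_0)$. Normalized tensor product: $\mathcal O^{(\boldsymbol\sigma,\boldsymbol\sigma_*;\sigma_-,\sigma_+)}\star\mathcal O^{(\boldsymbol\tau,\boldsymbol\tau_*;\tau_-,\tau_+)}=\mathcal O^{(\boldsymbol\sigma+\boldsymbol\tau,\boldsymbol\sigma_*+\boldsymbol\tau_*;\sigma_-+\tau_-,\sigma_++\tau_+)}$ (sums of divisors). Dipolar SLE. $\psi_t$ solves $\partial_t\psi_t(z)=\coth\big(\tfrac12(\psi_t(z)-\xi_t)\big)$, $\xi_t=\sqrt\kappa B_t$ ($B$ standard one-dimensional Brownian motion, $B_0=0$), $\psi_0:(D,p,Q)\to(\mathbb S,0,\mathbb R+\pi i)$ conformal; the solution exists up to $\tau_z\in(0,\infty]$.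 $D_t=\{z\in D:\tau_z>t\}$, $w_t=\psi_t-\xi_t:D_t\to\mathbb S$, $\gamma_t=\lim_{z\to0}w_t^{-1}(z)$. Martingale-observables. A non-random conformal field $M$ (assigning a function to each local chart), defined for each $(D,p,Q)$, is a martingale-observable for dipolar $\mathrm{SLE}_\kappa$ if for all $z_1,\dots,z_n\in D$ the process $M_t(z_1,\dots,z_n)=(M_{D_t,\gamma_t,Q}\,\|\,\mathrm{id})(z_1,\dots,z_n)=(M\,\|\,w_t^{-1})(z_1,\dots,z_n)$, stopped when any $z_j$ exits $D_t$, is a local martingale. For a $[h,h_*]$-differential of one variable with boundary dimensions $h_\pm$ at $q_\pm$ this means $M_t(z)=(w_t'(z))^h(\overline{w_t'(z)})^{h_*}(w_t'(q_-))^{h_-}(w_t'(q_+))^{h_+}M(w_t(z))$ (derivatives at $q_\pm$ taken in fixed local charts, equivalently using uniformization in $(\mathbb H,-1,1)$ instead of $\mathbb S$), and similarly for several variables. *)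

theory Defs
  imports "HOL-Probability.Probability" "HOL-Complex_Analysis.Complex_Analysis"
    "HOL-Library.Multiset" "HOL-Library.Set_Algebras"
begin

section \<open>Domains, boundary points, uniformizations\<close>

definition upper_half_plane :: "complex set" where
  "upper_half_plane = {z. 0 < Im z}"

definition strip :: "complex set" where
  "strip = {z. 0 < Im z \<and> Im z < pi}"

definition conformal_onto :: "(complex \<Rightarrow> complex) \<Rightarrow> complex set \<Rightarrow> complex set \<Rightarrow> bool" where
  "conformal_onto f D E \<longleftrightarrow> f holomorphic_on D \<and> bij_betw f D E"

text \<open>A boundary point (prime end) of a simply connected domain \<open>D\<close> is represented by the
  filter of the traces on \<open>D\<close> of its neighbourhoods: it is carried by \<open>D\<close>, and a conformal map
  from \<open>D\<close> onto a half-plane or strip sends it to the trace filter of a boundary point there.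
  For a Jordan domain the boundary point \<open>q\<close> is \<open>at q within D\<close>. This
  allows rough boundaries and boundary points at infinity (such as the two ends of the strip).\<close>

type_synonym bpoint = "complex filter"

definition bmaps :: "(complex \<Rightarrow> complex) \<Rightarrow> complex set \<Rightarrow> bpoint \<Rightarrow> bpoint \<Rightarrow> bool" where
  "bmaps f D q q' \<longleftrightarrow> q \<le> principal D \<and> filtermap f q = q'"

definition strip_minus_infinity :: bpoint where
  "strip_minus_infinity = inf (filtercomap Re at_bot) (principal strip)"

definition strip_plus_infinity :: bpoint where
  "strip_plus_infinity = inf (filtercomap Re at_top) (principal strip)"

text \<open>\<open>f : (D, p, Q) \<rightarrow> (strip, 0, \<real> + \<pi>i)\<close> where \<open>Q\<close> is an open boundary arc with endpoints
  \<open>qm\<close>, \<open>qp\<close>. The existence of such an \<open>f\<close> says that \<open>p\<close> is a boundary point off the closed arc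
  and that \<open>qm, p, qp\<close> are positively oriented.\<close>

definition dipolar_conformal ::
    "(complex \<Rightarrow> complex) \<Rightarrow> complex set \<Rightarrow> bpoint \<Rightarrow> bpoint set \<Rightarrow> bpoint \<Rightarrow> bpoint \<Rightarrow> bool" where
  "dipolar_conformal f D p Q qm qp \<longleftrightarrow>
     conformal_onto f D strip \<and>
     bmaps f D p (at 0 within strip) \<and>
     Q = {q. \<exists>x::real. bmaps f D q (at (of_real x + of_real pi * \<i>) within strip)} \<and>
     bmaps f D qm strip_minus_infinity \<and>
     bmaps f D qp strip_plus_infinity"

definition uniformization ::
    "(complex \<Rightarrow> complex) \<Rightarrow> complex set \<Rightarrow> bpoint \<Rightarrow> bpoint \<Rightarrow> bool" where
  "uniformization w D qm qp \<longleftrightarrow>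
     conformal_onto w D upper_half_plane \<and>
     bmaps w D qm (at (- 1) within upper_half_plane) \<and>
     bmaps w D qp (at 1 within upper_half_plane)"

text \<open>A local chart \<open>\<phi>\<close> at a boundary point \<open>q\<close> takes values in the upper half-plane and, read in
  a uniformizing coordinate \<open>v\<close>, continues across the real line to a map \<open>g\<close> with nonvanishing
  derivative at the image of \<open>q\<close>.\<close>

definition boundary_chart :: "complex set \<Rightarrow> bpoint \<Rightarrow> (complex \<Rightarrow> complex) \<Rightarrow> bool" where
  "boundary_chart D q \<phi> \<longleftrightarrow>
     (\<exists>v g (x::real) r. conformal_onto v D upper_half_plane \<and>
        bmaps v D q (at (of_real x) within upper_half_plane) \<and>
        0 < r \<and> g holomorphic_on ball (of_real x) r \<and> deriv g (of_real x) \<noteq> 0 \<and>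
        (\<forall>u\<in>ball (of_real x) r. Im u = 0 \<longrightarrow> Im (g u) = 0) \<and>
        (\<forall>u\<in>ball (of_real x) r. 0 < Im u \<longrightarrow> 0 < Im (g u)) \<and>
        (\<forall>z\<in>D. v z \<in> ball (of_real x) r \<longrightarrow> \<phi> z = g (v z)))"

section \<open>Fock space functionals\<close>

text \<open>The correlational Fock space is modelled formally: a functional is a formal series of Wick
  monomials in the chiral generators \<open>\<Phi>\<^sup>+\<close>, \<open>\<Phi>\<^sup>-\<close> at nodes, stored as its coefficients indexed by
  the multisets of generators. Wick's product is the commutative product of such series. The
  expectation annihilates all Wick monomials of positive degree.\<close>

datatype node = Pt complex | Bd bpoint

datatype chiral = Phi_plus node | Phi_minus node

type_synonym fock = "chiral multiset \<Rightarrow> complex"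

definition generator :: "chiral \<Rightarrow> fock" where
  "generator g = (\<lambda>m. if m = {#g#} then 1 else 0)"

definition wick_prod :: "fock \<Rightarrow> fock \<Rightarrow> fock" where
  "wick_prod X Y = (\<lambda>m. \<Sum>k | k \<subseteq># m. X k * Y (m - k))"

fun wick_power :: "fock \<Rightarrow> nat \<Rightarrow> fock" where
  "wick_power X 0 = (\<lambda>m. if m = {#} then 1 else 0)"
| "wick_power X (Suc n) = wick_prod X (wick_power X n)"

text \<open>For linear \<open>X\<close>, the only nonzero term at \<open>m\<close> is \<open>n = size m\<close>.\<close>

definition wick_exp :: "fock \<Rightarrow> fock" where
  "wick_exp X = (\<lambda>m. \<Sum>n. wick_power X n m / fact n)"

definition fock_expectation :: "fock \<Rightarrow> complex" where
  "fock_expectation X = X {#}"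

section \<open>Rooted vertex fields\<close>

text \<open>The set of all values of the multivalued power. The convention for exponent \<open>0\<close> matters at
  a boundary node, where the base \<open>w\<^sub>j - cnj w\<^sub>j\<close> vanishes.

  Products of sets below are elementwise, so a multivalued expression denotes the set of all its
  values.\<close>

definition mpow :: "complex \<Rightarrow> real \<Rightarrow> complex set" where
  "mpow x e = (if e = 0 then {1} else {exp (of_real e * l) |l. exp l = x})"

text \<open>The divisors \<open>\<sigma>\<close>, \<open>\<sigma>\<^sub>*\<close> are real functions of the nodes with finite support.\<close>

record rooted_charge =
  chg :: "node \<Rightarrow> real"
  chg_conj :: "node \<Rightarrow> real"
  root_minus :: real
  root_plus :: real

text \<open>Values and derivatives at nodes. Interior nodes use the identity chart; \<open>\<phi>\<close> assigns a local
  chart to each boundary node.\<close>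

fun node_val :: "(complex \<Rightarrow> complex) \<Rightarrow> node \<Rightarrow> complex" where
  "node_val w (Pt z) = w z"
| "node_val w (Bd q) = Lim q w"

fun node_deriv :: "(bpoint \<Rightarrow> complex \<Rightarrow> complex) \<Rightarrow> (complex \<Rightarrow> complex) \<Rightarrow> node \<Rightarrow> complex" where
  "node_deriv \<phi> w (Pt z) = deriv w z"
| "node_deriv \<phi> w (Bd q) = Lim q (\<lambda>z. (w z - Lim q w) / (\<phi> q z - Lim q (\<phi> q)))"

definition dim_bulk :: "real \<Rightarrow> real \<Rightarrow> real" where
  "dim_bulk b s = s\<^sup>2 / 2 - s * b"

definition dim_root :: "real \<Rightarrow> real" where
  "dim_root s = s\<^sup>2 / 2"

definition vertex_self ::
    "real \<Rightarrow> (bpoint \<Rightarrow> complex \<Rightarrow> complex) \<Rightarrow> (complex \<Rightarrow> complex) \<Rightarrow> rooted_charge \<Rightarrow> node \<Rightarrow> complex set" where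
  "vertex_self b \<phi> w c x =
    (let wx = node_val w x; dx = node_deriv \<phi> w x; s = chg c x; s' = chg_conj c x in
       mpow dx (dim_bulk b s) * mpow (cnj dx) (dim_bulk b s') *
       mpow (1 - wx) (s * (b + root_plus c)) * mpow (1 + wx) (s * (b + root_minus c)) *
       mpow (1 - cnj wx) (s' * (b + root_plus c)) * mpow (1 + cnj wx) (s' * (b + root_minus c)) *
       mpow (wx - cnj wx) (s * s'))"

definition vertex_interaction ::
    "(complex \<Rightarrow> complex) \<Rightarrow> rooted_charge \<Rightarrow> node \<Rightarrow> node \<Rightarrow> complex set" where
  "vertex_interaction w c x y =
    (let wx = node_val w x; wy = node_val w y in
       mpow (wx - wy) (chg c x * chg c y) *
       mpow (wx - cnj wy) (chg c x * chg_conj c y) *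
       mpow (cnj wx - wy) (chg_conj c x * chg c y) *
       mpow (cnj wx - cnj wy) (chg_conj c x * chg_conj c y))"

definition vertex_coeff ::
    "real \<Rightarrow> bpoint \<Rightarrow> bpoint \<Rightarrow> (bpoint \<Rightarrow> complex \<Rightarrow> complex) \<Rightarrow> (complex \<Rightarrow> complex) \<Rightarrow>
     rooted_charge \<Rightarrow> node list \<Rightarrow> complex set" where
  "vertex_coeff b qm qp \<phi> w c xs =
     mpow (node_deriv \<phi> w (Bd qm)) (dim_root (root_minus c)) *
     mpow (node_deriv \<phi> w (Bd qp)) (dim_root (root_plus c)) *
     (\<Prod>j<length xs. vertex_self b \<phi> w c (xs ! j)) *
     (\<Prod>k<length xs. \<Prod>j<k. vertex_interaction w c (xs ! j) (xs ! k))"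

definition vertex_exponent :: "bpoint \<Rightarrow> bpoint \<Rightarrow> rooted_charge \<Rightarrow> node list \<Rightarrow> fock" where
  "vertex_exponent qm qp c xs = (\<lambda>m.
     \<i> * (of_real (root_minus c) * generator (Phi_plus (Bd qm)) m +
          of_real (root_plus c) * generator (Phi_plus (Bd qp)) m +
          (\<Sum>j<length xs. of_real (chg c (xs ! j)) * generator (Phi_plus (xs ! j)) m
                         - of_real (chg_conj c (xs ! j)) * generator (Phi_minus (xs ! j)) m)))"

text \<open>The multivalued rooted vertex field (the set of its branches) with charges \<open>c\<close>, evaluated
  at the list \<open>xs\<close> of distinct nodes, which has to cover the supports of the divisors.\<close>

definition rooted_vertex_field ::
    "real \<Rightarrow> bpoint \<Rightarrow> bpoint \<Rightarrow> (bpoint \<Rightarrow> complex \<Rightarrow> complex) \<Rightarrow> (complex \<Rightarrow> complex) \<Rightarrow>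
     rooted_charge \<Rightarrow> node list \<Rightarrow> fock set" where
  "rooted_vertex_field b qm qp \<phi> w c xs =
     (\<lambda>k m. k * wick_exp (vertex_exponent qm qp c xs) m) ` vertex_coeff b qm qp \<phi> w c xs"

text \<open>The normalized tensor product of rooted vertex fields acts on their charges.\<close>

definition star :: "rooted_charge \<Rightarrow> rooted_charge \<Rightarrow> rooted_charge" where
  "star c d = \<lparr>chg = (\<lambda>x. chg c x + chg d x), chg_conj = (\<lambda>x. chg_conj c x + chg_conj d x),
     root_minus = root_minus c + root_minus d, root_plus = root_plus c + root_plus d\<rparr>"

definition Psi_charge :: "real \<Rightarrow> bpoint \<Rightarrow> rooted_charge" where
  "Psi_charge a p = \<lparr>chg = (\<lambda>x. if x = Bd p then a else 0), chg_conj = (\<lambda>_. 0),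
     root_minus = - a / 2, root_plus = - a / 2\<rparr>"

definition tuple_charge ::
    "nat \<Rightarrow> (nat \<Rightarrow> real) \<Rightarrow> (nat \<Rightarrow> real) \<Rightarrow> real \<Rightarrow> real \<Rightarrow> (nat \<Rightarrow> complex) \<Rightarrow> rooted_charge" where
  "tuple_charge n \<sigma> \<sigma>s \<sigma>m \<sigma>p z =
     \<lparr>chg = (\<lambda>x. \<Sum>j<n. if x = Pt (z j) then \<sigma> j else 0),
      chg_conj = (\<lambda>x. \<Sum>j<n. if x = Pt (z j) then \<sigma>s j else 0),
      root_minus = \<sigma>m, root_plus = \<sigma>p\<rparr>"

section \<open>Non-random fields and martingale-observables\<close>

text \<open>A (multivalued) non-random field assigns to a domain with boundary points \<open>p, qm, qp\<close>, local
  charts at \<open>qm, qp\<close>, and interior nodes the set of its values, in identity charts at the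
  interior nodes.\<close>

type_synonym nonrandom_field =
  "complex set \<Rightarrow> bpoint \<Rightarrow> bpoint \<Rightarrow> bpoint \<Rightarrow> (complex \<Rightarrow> complex) \<Rightarrow> (complex \<Rightarrow> complex) \<Rightarrow>
   (nat \<Rightarrow> complex) \<Rightarrow> complex set"

text \<open>\<open>\<^bold>E[\<Psi>(p) \<star> \<O>] / \<^bold>E[\<Psi>(p)]\<close>. The local chart at \<open>p\<close> is arbitrary because numerator and denominator
  have the same dimension at \<open>p\<close>.\<close>

definition vertex_observable ::
    "real \<Rightarrow> real \<Rightarrow> nat \<Rightarrow> (nat \<Rightarrow> real) \<Rightarrow> (nat \<Rightarrow> real) \<Rightarrow> real \<Rightarrow> real \<Rightarrow> nonrandom_field" where
  "vertex_observable a b n \<sigma> \<sigma>s \<sigma>m \<sigma>p D p qm qp \<phi>m \<phi>p z =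
     {fock_expectation X / fock_expectation Y |X Y w \<phi>.
        uniformization w D qm qp \<and>
        \<phi> qm = \<phi>m \<and> \<phi> qp = \<phi>p \<and> boundary_chart D p (\<phi> p) \<and>
        X \<in> rooted_vertex_field b qm qp \<phi> w
              (star (Psi_charge a p) (tuple_charge n \<sigma> \<sigma>s \<sigma>m \<sigma>p z))
              (Bd p # map (\<lambda>j. Pt (z j)) [0..<n]) \<and>
        Y \<in> rooted_vertex_field b qm qp \<phi> w (Psi_charge a p) [Bd p]}"

text \<open>Time runs over \<open>t \<ge> 0\<close>; the \<open>\<sigma>\<close>-algebras \<open>F t\<close> at negative \<open>t\<close> are irrelevant.\<close>

definition brownian_motion ::
    "'a measure \<Rightarrow> (real \<Rightarrow> 'a measure) \<Rightarrow> (real \<Rightarrow> 'a \<Rightarrow> real) \<Rightarrow> bool" where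
  "brownian_motion P F B \<longleftrightarrow>
     prob_space P \<and> filtration (space P) F \<and> (\<forall>t. subalgebra P (F t)) \<and>
     (\<forall>t\<ge>0. B t \<in> borel_measurable (F t)) \<and>
     (\<forall>\<omega>\<in>space P. B 0 \<omega> = 0) \<and>
     (\<forall>\<omega>\<in>space P. continuous_on {0..} (\<lambda>t. B t \<omega>)) \<and>
     (\<forall>s t. 0 \<le> s \<and> s < t \<longrightarrow>
        distributed P lborel (\<lambda>\<omega>. B t \<omega> - B s \<omega>) (normal_density 0 (sqrt (t - s))) \<and>
        prob_space.indep_set P (sets (F s))
          {(\<lambda>\<omega>. B t \<omega> - B s \<omega>) -` A \<inter> space P |A. A \<in> sets borel})"

definition complex_martingale ::
    "'a measure \<Rightarrow> (real \<Rightarrow> 'a measure) \<Rightarrow> (real \<Rightarrow> 'a \<Rightarrow> complex) \<Rightarrow> bool" where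
  "complex_martingale P F M \<longleftrightarrow>
     (\<forall>t\<ge>0. M t \<in> borel_measurable (F t) \<and> integrable P (M t)) \<and>
     (\<forall>s t. 0 \<le> s \<and> s \<le> t \<longrightarrow>
        (AE \<omega> in P. real_cond_exp P (F s) (\<lambda>\<omega>. Re (M t \<omega>)) \<omega> = Re (M s \<omega>)) \<and>
        (AE \<omega> in P. real_cond_exp P (F s) (\<lambda>\<omega>. Im (M t \<omega>)) \<omega> = Im (M s \<omega>)))"

text \<open>Local martingale on the stochastic interval \<open>[0, \<tau>)\<close>; the process need not have a limit
  at \<open>\<tau>\<close>.\<close>

definition local_martingale_upto ::
    "'a measure \<Rightarrow> (real \<Rightarrow> 'a measure) \<Rightarrow> ('a \<Rightarrow> ereal) \<Rightarrow> (real \<Rightarrow> 'a \<Rightarrow> complex) \<Rightarrow> bool" where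
  "local_martingale_upto P F \<tau> M \<longleftrightarrow>
     (\<exists>T :: nat \<Rightarrow> 'a \<Rightarrow> real.
        (\<forall>k. stopping_time F (T k)) \<and>
        (\<forall>k. \<forall>\<omega>\<in>space P. 0 \<le> T k \<omega> \<and> T k \<omega> \<le> T (Suc k) \<omega> \<and> ereal (T k \<omega>) < \<tau> \<omega>) \<and>
        (AE \<omega> in P. (\<lambda>k. ereal (T k \<omega>)) \<longlonglongrightarrow> \<tau> \<omega>) \<and>
        (\<forall>k. complex_martingale P F (\<lambda>t \<omega>. M (min t (T k \<omega>)) \<omega>)))"

definition dipolar_solution :: "(real \<Rightarrow> real) \<Rightarrow> complex \<Rightarrow> ereal \<Rightarrow> (real \<Rightarrow> complex) \<Rightarrow> bool" where
  "dipolar_solution \<xi> z\<^sub>0 T y \<longleftrightarrow>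
     y 0 = z\<^sub>0 \<and>
     (\<forall>t. 0 \<le> t \<and> ereal t < T \<longrightarrow>
        y t \<in> strip \<and>
        (y has_vector_derivative
           cosh ((y t - of_real (\<xi> t)) / 2) / sinh ((y t - of_real (\<xi> t)) / 2)) (at t within {0..}))"

text \<open>\<open>\<psi> t z\<close> is the solution started from \<open>\<psi>\<^sub>0 z\<close>, and \<open>\<tau> z\<close> its maximal time of existence.\<close>

definition dipolar_flow ::
    "(real \<Rightarrow> real) \<Rightarrow> complex set \<Rightarrow> (complex \<Rightarrow> complex) \<Rightarrow>
     (real \<Rightarrow> complex \<Rightarrow> complex) \<Rightarrow> (complex \<Rightarrow> ereal) \<Rightarrow> bool" where
  "dipolar_flow \<xi> D \<psi>\<^sub>0 \<psi> \<tau> \<longleftrightarrow>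
     (\<forall>z\<in>D. 0 < \<tau> z \<and>
        dipolar_solution \<xi> (\<psi>\<^sub>0 z) (\<tau> z) (\<lambda>t. \<psi> t z) \<and>
        (\<forall>T y. dipolar_solution \<xi> (\<psi>\<^sub>0 z) T y \<longrightarrow> T \<le> \<tau> z))"

definition flow_domain :: "complex set \<Rightarrow> (complex \<Rightarrow> ereal) \<Rightarrow> real \<Rightarrow> complex set" where
  "flow_domain D \<tau> t = {z\<in>D. ereal t < \<tau> z}"

text \<open>The tip, as a boundary point of the domain at time \<open>t\<close>: the limit of the inverse of \<open>w\<^sub>t\<close> at \<open>0\<close>.\<close>

definition flow_tip ::
    "(real \<Rightarrow> real) \<Rightarrow> complex set \<Rightarrow> (real \<Rightarrow> complex \<Rightarrow> complex) \<Rightarrow> (complex \<Rightarrow> ereal) \<Rightarrow> real \<Rightarrow> bpoint" where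
  "flow_tip \<xi> D \<psi> \<tau> t =
     filtermap (inv_into (flow_domain D \<tau> t) (\<lambda>z. \<psi> t z - of_real (\<xi> t))) (at 0 within strip)"

text \<open>\<open>M\<close> is a field of \<open>n\<close> interior variables. Since it is multivalued, the process is any choice
  \<open>X\<close> of values of the field in the domains at time \<open>t\<close> that is continuous in time and starts
  from a non-random value.\<close>

definition dipolar_martingale_observable ::
    "'a measure \<Rightarrow> (real \<Rightarrow> 'a measure) \<Rightarrow> (real \<Rightarrow> 'a \<Rightarrow> real) \<Rightarrow> real \<Rightarrow> nat \<Rightarrow> nonrandom_field \<Rightarrow> bool" where
  "dipolar_martingale_observable P F B \<kappa> n M \<longleftrightarrow>
     (\<forall>D p Q qm qp \<phi>m \<phi>p \<psi>\<^sub>0 \<xi> \<psi> \<tau> z X.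
        open D \<and> simply_connected D \<and> D \<noteq> UNIV \<and>
        dipolar_conformal \<psi>\<^sub>0 D p Q qm qp \<and>
        boundary_chart D qm \<phi>m \<and> boundary_chart D qp \<phi>p \<and>
        \<xi> = (\<lambda>\<omega> t. sqrt \<kappa> * B t \<omega>) \<and>
        (\<forall>\<omega>\<in>space P. dipolar_flow (\<xi> \<omega>) D \<psi>\<^sub>0 (\<psi> \<omega>) (\<tau> \<omega>)) \<and>
        (\<forall>j<n. z j \<in> D) \<and> inj_on z {..<n} \<and>
        (\<forall>\<omega>\<in>space P. \<forall>t. 0 \<le> t \<and> ereal t < (INF j\<in>{..<n}. \<tau> \<omega> (z j)) \<longrightarrow>
           X t \<omega> \<in> M (flow_domain D (\<tau> \<omega>) t) (flow_tip (\<xi> \<omega>) D (\<psi> \<omega>) (\<tau> \<omega>) t) qm qp \<phi>m \<phi>p z) \<and>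
        (\<forall>\<omega>\<in>space P.
           continuous_on {t. 0 \<le> t \<and> ereal t < (INF j\<in>{..<n}. \<tau> \<omega> (z j))} (\<lambda>t. X t \<omega>)) \<and>
        (\<exists>x\<^sub>0. \<forall>\<omega>\<in>space P. X 0 \<omega> = x\<^sub>0)
        \<longrightarrow> local_martingale_upto P F (\<lambda>\<omega>. INF j\<in>{..<n}. \<tau> \<omega> (z j)) X)"

end

(*
By neutrality the observable depends neither on the choice of the uniformization nor on the chart at
the tip. Writing y_i for the flow started from the nodes and from their conjugates, with charges q_i,
and xi for the driving function, every continuous choice of its values along the flow therefore equals
its initial value times the quotient exp(L_t) / exp(L_0), where
  L_t = A_t + beta xi_t + sum_i q_i phi(y_i(t) - xi_t),  phi(Z) = d Z / 2 + a log sinh(Z / 2),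
d = sigma_- - sigma_+, and A_t is the time integral of a quadratic polynomial in coth((y_i - xi) / 2):
the logarithms of w_t'(z_j) and of sinh((y_i - y_j) / 2) change by such integrals, and the values of a
multivalued power at a point form a countable set, so that a continuous branch is determined by its
initial value.

As a function of time and x = xi_t, exp(L) solves the backward heat equation
d/dt + (kappa/2) d^2/dx^2 = 0; this uses kappa a^2 = 2 and b = kappa a / 4 - a. In place of the Ito
formula, exp(L) is expanded over small time steps up to a stopping time that keeps the driving function
bounded and the nodes away from the real line: each increment is a combination of (Delta B) and
(Delta B)^2 - Delta t, which are uncorrelated with the past, up to an error of order
|Delta B|^3 + o(Delta t).
*)
theory Submission
  imports Defs
begin

section \<open>Martingales from increments\<close>

text \<open>The main obstacle is adaptedness. The flow is given only as some maximal solution of an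
  equation with a random driving term, so nothing in its definition makes it measurable. Freezing
  the vector field below a height e makes it bounded and globally Lipschitz: its solutions exist for
  all times, are limits of Euler polygons and hence adapted, and agree with the flow while the nodes
  stay above e, because heights only decrease. A stopping time does not lie on a time grid, so the
  last step of the expansion overshoots it. This is why nodes are stopped at height 2e and not e,
  why the driving function is clamped at k + 1, and why bounds reach slightly beyond the stopping
  time. The o(Delta t) error is small only path by path; a deterministic O(Delta t) bound then
  permits dominated convergence. The terms linear in t and xi_t come from the roots: up to
  constants, the derivatives of w_t at q_- and q_+ are exp(-t - xi_t) and exp(-t + xi_t), and after
  division by E[Psi(p)] their exponents are sigma (sigma - a) / 2.\<close>

lemma normal_moment2:
  assumes "\<sigma> > 0"
  shows "integrable lborel (\<lambda>x. normal_density 0 \<sigma> x * x^2)"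
    and "(\<integral>x. normal_density 0 \<sigma> x * x^2 \<partial>lborel) = \<sigma>\<^sup>2"
  using normal_moment_even[OF assms, of 0 1]
  by (simp_all add: has_bochner_integral_iff fact_numeral numeral_2_eq_2)

lemma normal_moment4:
  assumes "\<sigma> > 0"
  shows "integrable lborel (\<lambda>x. normal_density 0 \<sigma> x * x^4)"
    and "(\<integral>x. normal_density 0 \<sigma> x * x^4 \<partial>lborel) = 3 * \<sigma>^4"
  using normal_moment_even[OF assms, of 0 2] 
  by (simp_all add: has_bochner_integral_iff fact_numeral eval_nat_numeral)

lemma normal_moment1:
  assumes "\<sigma> > 0"
  shows "integrable lborel (\<lambda>x. normal_density 0 \<sigma> x * x)"
    and "(\<integral>x. normal_density 0 \<sigma> x * x \<partial>lborel) = 0"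
  using normal_moment_odd[OF assms, of 0 0]
  by (simp_all add: has_bochner_integral_iff)

text \<open>The absolute third moment is reduced to even moments: |x|^3 is at most the mean of
  \<sigma> x^2 and x^4 / \<sigma>, and (1 + 3) / 2 gives the constant 2.\<close>

lemma (in prob_space) normal_increment_moments:
  fixes X :: "'a \<Rightarrow> real"
  assumes d: "distributed M lborel X (normal_density 0 \<sigma>)" and s: "\<sigma> > 0"
  shows "integrable M X" "expectation X = 0"
    "integrable M (\<lambda>\<omega>. (X \<omega>)\<^sup>2)" "expectation (\<lambda>\<omega>. (X \<omega>)\<^sup>2) = \<sigma>\<^sup>2"
    "integrable M (\<lambda>\<omega>. \<bar>X \<omega>\<bar>^3)" "expectation (\<lambda>\<omega>. \<bar>X \<omega>\<bar>^3) \<le> 2 * \<sigma>^3"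
proof -
  have d': "distributed M lborel X (\<lambda>x. ennreal (normal_density 0 \<sigma> x))"
    using d by simp
  have Xm[measurable]: "X \<in> borel_measurable M"
    using distributed_measurable[OF d'] by simp
  have I: "integrable M (\<lambda>\<omega>. g (X \<omega>)) \<longleftrightarrow> integrable lborel (\<lambda>x. normal_density 0 \<sigma> x * g x)"
    if "g \<in> borel_measurable borel" for g :: "real \<Rightarrow> real"
    using distributed_integrable[OF d', of g] that by (simp add: normal_density_nonneg)
  have E: "expectation (\<lambda>\<omega>. g (X \<omega>)) = (\<integral>x. normal_density 0 \<sigma> x * g x \<partial>lborel)"
    if "g \<in> borel_measurable borel" for g :: "real \<Rightarrow> real"
    using distributed_integral[OF d', of g] that by (simp add: normal_density_nonneg)
  show "integrable M X" using I[of "\<lambda>x. x"] normal_moment1[OF s] by simp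
  show "expectation X = 0" using E[of "\<lambda>x. x"] normal_moment1[OF s] by simp
  show i2: "integrable M (\<lambda>\<omega>. (X \<omega>)\<^sup>2)" using I[of "\<lambda>x. x^2"] normal_moment2[OF s] by simp
  show e2: "expectation (\<lambda>\<omega>. (X \<omega>)\<^sup>2) = \<sigma>\<^sup>2" using E[of "\<lambda>x. x^2"] normal_moment2[OF s] by simp
  have i4: "integrable M (\<lambda>\<omega>. (X \<omega>)^4)" using I[of "\<lambda>x. x^4"] normal_moment4[OF s] by simp
  have e4: "expectation (\<lambda>\<omega>. (X \<omega>)^4) = 3 * \<sigma>^4" using E[of "\<lambda>x. x^4"] normal_moment4[OF s] by simp
  have le: "\<bar>x\<bar>^3 \<le> (\<sigma> * x\<^sup>2 + x^4 / \<sigma>) / 2" for x :: real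
  proof -
    have "0 \<le> x\<^sup>2 * (\<sigma> - \<bar>x\<bar>)\<^sup>2 / \<sigma>" using s by simp
    also have "\<dots> = (\<sigma> * x\<^sup>2 + x^4 / \<sigma>) - 2 * \<bar>x\<bar>^3"
      using s by (simp add: field_simps power2_eq_square power3_eq_cube power4_eq_xxxx abs_mult_self_eq flip: abs_mult)
    finally show ?thesis by simp
  qed
  have i: "integrable M (\<lambda>\<omega>. (\<sigma> * (X \<omega>)\<^sup>2 + (X \<omega>)^4 / \<sigma>) / 2)" using i2 i4 by simp
  show i3: "integrable M (\<lambda>\<omega>. \<bar>X \<omega>\<bar>^3)"
    by (rule Bochner_Integration.integrable_bound[OF i]) (use le in \<open>auto intro!: AE_I2 order_trans[OF _ abs_ge_self]\<close>)
  have "expectation (\<lambda>\<omega>. \<bar>X \<omega>\<bar>^3) \<le> expectation (\<lambda>\<omega>. (\<sigma> * (X \<omega>)\<^sup>2 + (X \<omega>)^4 / \<sigma>) / 2)"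
    by (rule integral_mono[OF i3 i]) (use le in auto)
  also have "\<dots> = (\<sigma> * \<sigma>\<^sup>2 + 3 * \<sigma>^4 / \<sigma>) / 2"
    using i2 i4 by (simp add: e2 e4)
  also have "\<dots> = 2 * \<sigma>^3" using s by (simp add: power2_eq_square power3_eq_cube power4_eq_xxxx field_simps)
  finally show "expectation (\<lambda>\<omega>. \<bar>X \<omega>\<bar>^3) \<le> 2 * \<sigma>^3" .
qed

text \<open>Real and imaginary parts of \<open>D\<close> are treated separately. Independence of
  \<open>G\<close> from the events of \<open>X\<close> becomes independence of random variables
  because the preimages under a \<open>G\<close>-measurable function form a \<sigma>-algebra
  contained in \<open>G\<close>.\<close>

lemma (in prob_space) indep_set_expectation_mult:
  fixes D :: "'a \<Rightarrow> complex" and X :: "'a \<Rightarrow> real"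
  assumes sub: "subalgebra M G"
    and ind: "indep_set (sets G) {X -` A \<inter> space M |A. A \<in> sets borel}"
    and D: "D \<in> borel_measurable G" and bd: "\<And>\<omega>. \<omega> \<in> space M \<Longrightarrow> norm (D \<omega>) \<le> C"
    and X: "X \<in> borel_measurable M" and g: "g \<in> borel_measurable borel"
    and ig: "integrable M (\<lambda>\<omega>. g (X \<omega>) :: real)"
  shows "integrable M (\<lambda>\<omega>. D \<omega> * of_real (g (X \<omega>)))"
    and "expectation (\<lambda>\<omega>. D \<omega> * of_real (g (X \<omega>))) = expectation D * of_real (expectation (\<lambda>\<omega>. g (X \<omega>)))"
proof -
  have sp: "space G = space M" using sub by (simp add: subalgebra_def)
  have DM[measurable]: "D \<in> borel_measurable M" using measurable_from_subalg[OF sub D] .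
  have iD: "integrable M D"
    by (rule integrable_const_bound[of _ C]) (use bd in auto)
  have indr: "indep_var borel f borel (\<lambda>\<omega>. g (X \<omega>))" if f: "f \<in> borel_measurable G" for f :: "'a \<Rightarrow> real"
  proof -
    have "indep_var borel f borel X"
    proof -
      have fM: "f \<in> borel_measurable M" using measurable_from_subalg[OF sub f] .
      have s1: "{f -` A \<inter> space M |A. A \<in> sets borel} \<subseteq> sets G"
        using f sp by (auto simp: measurable_def)
      have "indep_set (sigma_sets (space M) {f -` A \<inter> space M |A. A \<in> sets borel})
         (sigma_sets (space M) {X -` A \<inter> space M |A. A \<in> sets borel})"
      proof -
        have "{f -` A \<inter> space M |A. A \<in> sets borel} = sets (vimage_algebra (space M) f borel)"
          by (auto simp: sets_vimage_algebra2)
        then have a1: "sigma_sets (space M) {f -` A \<inter> space M |A. A \<in> sets borel} = {f -` A \<inter> space M |A. A \<in> sets borel}"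
          by (metis sets.sigma_sets_eq space_vimage_algebra)
        have "{X -` A \<inter> space M |A. A \<in> sets borel} = sets (vimage_algebra (space M) X borel)"
          by (auto simp: sets_vimage_algebra2)
        then have a2: "sigma_sets (space M) {X -` A \<inter> space M |A. A \<in> sets borel} = {X -` A \<inter> space M |A. A \<in> sets borel}"
          by (metis sets.sigma_sets_eq space_vimage_algebra)
        show ?thesis unfolding a1 a2
          using indep_setD[OF ind] indep_setD_ev1[OF ind] indep_setD_ev2[OF ind] s1
           by (smt (verit, ccfv_threshold) \<open>{f -` A \<inter> space M |A. A \<in> sets borel} = sets (vimage_algebra (space M) f borel)\<close> f fM indep_setI measurable_sets mem_Collect_eq sets_image_in_sets sp)
      qed
      then show ?thesis unfolding indep_var_eq using fM X by auto
    qed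
    then have "indep_var borel (id \<circ> f) borel (g \<circ> X)"
      by (rule indep_var_compose) (use g in auto)
    then show ?thesis by (simp add: comp_def)
  qed
  have iRe: "integrable M (\<lambda>\<omega>. Re (D \<omega>))" "integrable M (\<lambda>\<omega>. Im (D \<omega>))" using iD by auto
  have mRe: "(\<lambda>\<omega>. Re (D \<omega>)) \<in> borel_measurable G" "(\<lambda>\<omega>. Im (D \<omega>)) \<in> borel_measurable G" using D by auto
  note 1 = indep_var_integrable[OF indr[OF mRe(1)] iRe(1) ig] indep_var_lebesgue_integral[OF indr[OF mRe(1)] iRe(1) ig]
  note 2 = indep_var_integrable[OF indr[OF mRe(2)] iRe(2) ig] indep_var_lebesgue_integral[OF indr[OF mRe(2)] iRe(2) ig]
  have dec: "D \<omega> * of_real (g (X \<omega>)) = of_real (Re (D \<omega>) * g (X \<omega>)) + \<i> * of_real (Im (D \<omega>) * g (X \<omega>))" for \<omega>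
    by (simp add: complex_eq_iff)
  show "integrable M (\<lambda>\<omega>. D \<omega> * of_real (g (X \<omega>)))" unfolding dec
    using 1(1) 2(1) by (intro Bochner_Integration.integrable_add integrable_mult_right integrable_of_real) auto
  have ED: "expectation D = of_real (expectation (\<lambda>\<omega>. Re (D \<omega>))) + \<i> * of_real (expectation (\<lambda>\<omega>. Im (D \<omega>)))"
    using iD by (simp add: complex_eq_iff)
  have "expectation (\<lambda>\<omega>. D \<omega> * of_real (g (X \<omega>))) = of_real (expectation (\<lambda>\<omega>. Re (D \<omega>) * g (X \<omega>))) + \<i> * of_real (expectation (\<lambda>\<omega>. Im (D \<omega>) * g (X \<omega>)))"
    unfolding dec
    by (subst Bochner_Integration.integral_add, intro integrable_of_real 1(1), intro integrable_mult_right integrable_of_real 2(1))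
      (simp del: of_real_mult)
  also have "\<dots> = expectation D * of_real (expectation (\<lambda>\<omega>. g (X \<omega>)))"
    unfolding ED 1(2) 2(2) by (simp add: algebra_simps)
  finally show "expectation (\<lambda>\<omega>. D \<omega> * of_real (g (X \<omega>))) = expectation D * of_real (expectation (\<lambda>\<omega>. g (X \<omega>)))" .
qed

text \<open>Only steps that start before \<open>T\<close> are counted, but these are counted whole.
  The sum therefore telescopes up to the first grid point \<open>g\<close> not below
  \<open>T\<close>, or to the last grid point, and \<open>g\<close> exceeds \<open>T\<close> by less
  than one step. The last alternative covers the empty sum for \<open>T \<le> s\<close>.\<close>

lemma stopped_telescope:
  fixes V :: "real \<Rightarrow> complex"
  assumes "0 < d"
  shows "\<exists>g. (\<Sum>i<k. if s + real i * d < T then V (s + real (Suc i) * d) - V (s + real i * d) else 0) = V g - V (min s T)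
     \<and> min s T \<le> g \<and> (g = s + real k * d \<or> T \<le> g) \<and> g \<le> max (min s T) (s + real k * d) \<and> g < T + d \<or> T \<le> s \<and> (\<Sum>i<k. if s + real i * d < T then V (s + real (Suc i) * d) - V (s + real i * d) else 0) = 0"
proof (cases "T \<le> s")
  case True
  have "\<not> s + real i * d < T" for i using True assms by (simp add: add_increasing2 not_less)
  then have "(\<Sum>i<k. if s + real i * d < T then V (s + real (Suc i) * d) - V (s + real i * d) else 0) = 0"
    by simp
  then show ?thesis using True by blast
next
  case False
  have "\<exists>g. (\<Sum>i<k. if s + real i * d < T then V (s + real (Suc i) * d) - V (s + real i * d) else 0) = V g - V s
     \<and> s \<le> g \<and> (g = s + real k * d \<or> T \<le> g) \<and> g \<le> s + real k * d \<and> g < T + d"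
  proof (induction k)
    case 0
    show ?case using False assms by (intro exI[of _ s]) auto
  next
    case (Suc k)
    then obtain g where g: "(\<Sum>i<k. if s + real i * d < T then V (s + real (Suc i) * d) - V (s + real i * d) else 0) = V g - V s"
      "s \<le> g" "g = s + real k * d \<or> T \<le> g" "g \<le> s + real k * d" "g < T + d" by blast
    show ?case
    proof (cases "s + real k * d < T")
      case True
      then have "g = s + real k * d" using g by auto
      then show ?thesis using True g assms by (intro exI[of _ "s + real (Suc k) * d"]) (auto simp: algebra_simps)
    next
      case F: False
      then have "T \<le> g" using g by auto
      then show ?thesis using F g assms by (intro exI[of _ g]) (auto simp: algebra_simps)
    qed
  qed
  then show ?thesis using False by (auto simp: min_def)
qed

section \<open>Discrete stochastic calculus up to a stopping time\<close>

lemma brownian_motionD: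
  assumes "brownian_motion P F B"
  shows "prob_space P" "filtration (space P) F" "subalgebra P (F t)"
    "t \<ge> 0 \<Longrightarrow> B t \<in> borel_measurable (F t)" "t \<ge> 0 \<Longrightarrow> B t \<in> borel_measurable P"
    "\<omega> \<in> space P \<Longrightarrow> B 0 \<omega> = 0" "\<omega> \<in> space P \<Longrightarrow> continuous_on {0..} (\<lambda>t. B t \<omega>)"
    "0 \<le> s \<Longrightarrow> s < u \<Longrightarrow> distributed P lborel (\<lambda>\<omega>. B u \<omega> - B s \<omega>) (normal_density 0 (sqrt (u - s)))"
    "0 \<le> s \<Longrightarrow> s < u \<Longrightarrow> prob_space.indep_set P (sets (F s))
          {(\<lambda>\<omega>. B u \<omega> - B s \<omega>) -` A \<inter> space P |A. A \<in> sets borel}"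
    "space (F t) = space P"
  using assms measurable_from_subalg[of P "F t" "B t"] unfolding brownian_motion_def
  by (auto simp: subalgebra_def)

text \<open>\<open>D1\<close> and \<open>D2\<close> are known at time \<open>r\<close>, while the
  increment of \<open>B\<close> and its square minus \<open>d\<close> are centred and independent of
  the past. Both products have mean zero, and only the remainder is left; its cubic part has mean at
  most 2 C d^(3/2).\<close>

lemma step_expectation:
  fixes D1 D2 R :: "'a \<Rightarrow> complex" and B :: "real \<Rightarrow> 'a \<Rightarrow> real"
  assumes bm: "brownian_motion P F B" and r: "0 \<le> r" "0 < d"
    and D1: "D1 \<in> borel_measurable (F r)" "\<And>\<omega>. \<omega> \<in> space P \<Longrightarrow> norm (D1 \<omega>) \<le> C"
    and D2: "D2 \<in> borel_measurable (F r)" "\<And>\<omega>. \<omega> \<in> space P \<Longrightarrow> norm (D2 \<omega>) \<le> C"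
    and W: "W \<in> borel_measurable P" and e: "e \<in> borel_measurable P" "integrable P e"
    and iW: "integrable P W"
    and rem: "\<And>\<omega>. \<omega> \<in> space P \<Longrightarrow> norm (W \<omega> - (D1 \<omega> * of_real (B (r + d) \<omega> - B r \<omega>) + D2 \<omega> * of_real (((B (r + d) \<omega> - B r \<omega>)\<^sup>2 - d) / 2)))
        \<le> C * \<bar>B (r + d) \<omega> - B r \<omega>\<bar>^3 + e \<omega>"
    and C: "0 \<le> C"
  shows "norm (\<integral>\<omega>. W \<omega> \<partial>P) \<le> 2 * C * (d * sqrt d) + (\<integral>\<omega>. e \<omega> \<partial>P)"
proof -
  interpret prob_space P using brownian_motionD(1)[OF bm] .
  define X where "X = (\<lambda>\<omega>. B (r + d) \<omega> - B r \<omega>)"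
  have dist: "distributed P lborel X (normal_density 0 (sqrt d))"
    unfolding X_def using brownian_motionD(8)[OF bm r(1), of "r + d"] r by simp
  have ind: "indep_set (sets (F r)) {X -` A \<inter> space P |A. A \<in> sets borel}"
    unfolding X_def using brownian_motionD(9)[OF bm r(1), of "r + d"] r by simp
  have sq: "sqrt d > 0" using r by simp
  note m = normal_increment_moments[OF dist sq]
  have Xm[measurable]: "X \<in> borel_measurable P" unfolding X_def
    using brownian_motionD(5)[OF bm, of r] brownian_motionD(5)[OF bm, of "r + d"] r by simp
  have sub: "subalgebra P (F r)" using brownian_motionD(3)[OF bm] .
  have i2: "integrable P (\<lambda>\<omega>. ((X \<omega>)\<^sup>2 - d) / 2)" using m(3) by simp
  have E2: "expectation (\<lambda>\<omega>. ((X \<omega>)\<^sup>2 - d) / 2) = 0"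
    using m(3) m(4) r by (simp add: prob_space)
  note A1 = indep_set_expectation_mult[OF sub ind D1(1) D1(2) Xm, of "\<lambda>x. x"]
  note A2 = indep_set_expectation_mult[OF sub ind D2(1) D2(2) Xm, of "\<lambda>x. (x\<^sup>2 - d) / 2"]
  have J1: "integrable P (\<lambda>\<omega>. D1 \<omega> * of_real (X \<omega>))" "expectation (\<lambda>\<omega>. D1 \<omega> * of_real (X \<omega>)) = 0"
    using A1 m(1,2) by auto
  have J2: "integrable P (\<lambda>\<omega>. D2 \<omega> * of_real (((X \<omega>)\<^sup>2 - d) / 2))"
    "expectation (\<lambda>\<omega>. D2 \<omega> * of_real (((X \<omega>)\<^sup>2 - d) / 2)) = 0"
    using A2(1)[OF _ _ i2] A2(2)[OF _ _ i2] E2 by auto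
  define R where "R = (\<lambda>\<omega>. W \<omega> - (D1 \<omega> * of_real (X \<omega>) + D2 \<omega> * of_real (((X \<omega>)\<^sup>2 - d) / 2)))"
  have iR: "integrable P R" unfolding R_def using iW J1(1) J2(1) by simp
  have "expectation W = expectation R"
    unfolding R_def using iW J1 J2 by (simp del: of_real_divide of_real_diff)
  also have "norm (expectation R) \<le> expectation (\<lambda>\<omega>. norm (R \<omega>))" by (rule integral_norm_bound)
  also have "\<dots> \<le> expectation (\<lambda>\<omega>. C * \<bar>X \<omega>\<bar>^3 + e \<omega>)"
    by (rule integral_mono) (use iR m(5) e rem in \<open>auto simp: R_def X_def\<close>)
  also have "\<dots> = C * expectation (\<lambda>\<omega>. \<bar>X \<omega>\<bar>^3) + expectation e" using m(5) e by simp
  also have "\<dots> \<le> C * (2 * (sqrt d)^3) + expectation e" using m(6) C by (simp add: mult_left_mono)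
  also have "C * (2 * (sqrt d)^3) = 2 * C * (d * sqrt d)" using r by (simp add: power3_eq_cube)
  finally show ?thesis .
qed

text \<open>The conclusion is the martingale property of the stopped process, tested on
  \<open>A\<close>. The two bounds on the remainder \<open>R\<close> serve different purposes: in
  \<open>rem2\<close> the admissible step depends on the path, so it yields pointwise convergence
  only, and \<open>rem1\<close> supplies the dominating function. The bounds on \<open>V\<close>
  reach to \<open>T + d0\<close> because the last step may end after \<open>T\<close>.\<close>

lemma stopped_increment_expectation:
  fixes V D1 D2 :: "real \<Rightarrow> 'a \<Rightarrow> complex" and B :: "real \<Rightarrow> 'a \<Rightarrow> real"
  defines "R \<equiv> (\<lambda>r d \<omega>. norm (V (r + d) \<omega> - V r \<omega> - (D1 r \<omega> * of_real (B (r + d) \<omega> - B r \<omega>)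
        + D2 r \<omega> * of_real (((B (r + d) \<omega> - B r \<omega>)\<^sup>2 - d) / 2))))"
  assumes bm: "brownian_motion P F B" and T: "stopping_time F T"
    and T0: "\<And>\<omega>. \<omega> \<in> space P \<Longrightarrow> 0 \<le> T \<omega>" and d0: "0 < d0" and C: "0 \<le> C"
    and V: "\<And>r. 0 \<le> r \<Longrightarrow> V r \<in> borel_measurable P"
    and VT: "\<And>r. 0 \<le> r \<Longrightarrow> (\<lambda>\<omega>. V (min r (T \<omega>)) \<omega>) \<in> borel_measurable P"
    and D1: "\<And>r. 0 \<le> r \<Longrightarrow> D1 r \<in> borel_measurable (F r)"
    and D2: "\<And>r. 0 \<le> r \<Longrightarrow> D2 r \<in> borel_measurable (F r)"
    and b1: "\<And>r \<omega>. \<omega> \<in> space P \<Longrightarrow> 0 \<le> r \<Longrightarrow> r < T \<omega> \<Longrightarrow> norm (D1 r \<omega>) \<le> C"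
    and b2: "\<And>r \<omega>. \<omega> \<in> space P \<Longrightarrow> 0 \<le> r \<Longrightarrow> r < T \<omega> \<Longrightarrow> norm (D2 r \<omega>) \<le> C"
    and bV: "\<And>r \<omega>. \<omega> \<in> space P \<Longrightarrow> 0 \<le> r \<Longrightarrow> r < T \<omega> + d0 \<Longrightarrow> norm (V r \<omega>) \<le> C"
    and cV: "\<And>\<omega>. \<omega> \<in> space P \<Longrightarrow> continuous_on {0..<T \<omega> + d0} (\<lambda>r. V r \<omega>)"
    and rem1: "\<And>r d \<omega>. \<omega> \<in> space P \<Longrightarrow> 0 \<le> r \<Longrightarrow> r < T \<omega> \<Longrightarrow> 0 < d \<Longrightarrow> d < d0 \<Longrightarrow>
        R r d \<omega> \<le> C * \<bar>B (r + d) \<omega> - B r \<omega>\<bar>^3 + C * d"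
    and rem2: "\<And>\<omega> \<eta>. \<omega> \<in> space P \<Longrightarrow> 0 < \<eta> \<Longrightarrow> \<exists>d1>0. \<forall>r d. 0 \<le> r \<and> r < T \<omega> \<and> r \<le> t \<and> 0 < d \<and> d < d1 \<longrightarrow>
        R r d \<omega> \<le> C * \<bar>B (r + d) \<omega> - B r \<omega>\<bar>^3 + \<eta> * d"
    and A: "A \<in> sets (F s)" and st: "0 \<le> s" "s \<le> t"
  shows "(\<integral>\<omega>. indicator A \<omega> *\<^sub>R V (min t (T \<omega>)) \<omega> \<partial>P) = (\<integral>\<omega>. indicator A \<omega> *\<^sub>R V (min s (T \<omega>)) \<omega> \<partial>P)"
proof (cases "s = t")
  case False
  then have st': "s < t" using st by simp
  interpret prob_space P using brownian_motionD(1)[OF bm] .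
  note sub = brownian_motionD(3)[OF bm] and spF = brownian_motionD(10)[OF bm]
  have filt: "subalgebra (F r') (F r)" if "r \<le> r'" for r r'
    using filtration.sets_F_mono[OF brownian_motionD(2)[OF bm] that] spF by (auto simp: subalgebra_def)
  have [measurable]: "A \<in> sets P" using A sub[of s] by (auto simp: subalgebra_def)
  have AF: "A \<in> sets (F r)" if "s \<le> r" for r using A filt[OF that] by (auto simp: subalgebra_def)
  have TF: "Measurable.pred (F r) (\<lambda>\<omega>. r < T \<omega>)" for r
  proof -
    have "Measurable.pred (F r) (\<lambda>\<omega>. \<not> (T \<omega> \<le> r))"
      by (rule measurable_compose[OF stopping_timeD[OF T]]) simp
    then show ?thesis by (simp add: not_le)
  qed
  have TFs: "{\<omega> \<in> space (F r). r < T \<omega>} \<in> sets (F r)" for r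
    using TF[of r] by (simp add: pred_def)
  have TPs: "{\<omega> \<in> space P. r < T \<omega>} \<in> sets P" for r
    using TFs[of r] sub[of r] by (auto simp: subalgebra_def)
  have Bm[measurable]: "B r \<in> borel_measurable P" if "0 \<le> r" for r using brownian_motionD(5)[OF bm that] .
  \<comment> \<open>Starting with \<open>N0\<close> makes every mesh smaller than \<open>d0\<close>,
    so no step leaves the region where the bounds hold.\<close>
  obtain N0 :: nat where N0: "(t - s) / d0 < real N0" using reals_Archimedean2 by blast
  define dd where "dd = (\<lambda>m. (t - s) / real (Suc (m + N0)))"
  have dd: "0 < dd m" "dd m < d0" for m
  proof -
    show "0 < dd m" using st' by (simp add: dd_def)
    have "t - s < d0 * real (Suc (m + N0))" using N0 d0 by (auto simp: field_simps intro: less_le_trans)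
    then show "dd m < d0" using d0 by (simp add: dd_def divide_less_eq)
  qed
  have dd0: "dd \<longlonglongrightarrow> 0"
    unfolding dd_def using LIMSEQ_ignore_initial_segment[OF lim_const_over_n[of "t - s"], of "Suc N0"]
    by (simp add: add.commute)
  have ddm: "real (Suc (m + N0)) * dd m = t - s" for m by (simp add: dd_def)
  define r where "r = (\<lambda>m i. s + real i * dd m)"
  have r0: "0 \<le> r m i" "s \<le> r m i" for m i using st dd(1)[of m] by (auto simp: r_def)
  have rS: "r m (Suc i) = r m i + dd m" for m i by (simp add: r_def algebra_simps)
  have rt: "r m i \<le> t" if "i < Suc (m + N0)" for m i
  proof -
    have "real i * dd m \<le> real (Suc (m + N0)) * dd m" using that dd(1)[of m] by (intro mult_right_mono) auto
    then show ?thesis using ddm[of m] by (simp add: r_def)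
  qed
  \<comment> \<open>A step is kept if it starts before \<open>T\<close>. This event belongs to
    \<open>F (r m i)\<close>, so its indicator can be absorbed into the coefficients known at that
    time.\<close>
  define W where "W = (\<lambda>m i \<omega>. if r m i < T \<omega> then indicator A \<omega> *\<^sub>R (V (r m (Suc i)) \<omega> - V (r m i) \<omega>) else 0)"
  \<comment> \<open>The excess of the remainder over its cubic bound; along each path it is small
    compared with the mesh.\<close>
  define e where "e = (\<lambda>m i \<omega>. if r m i < T \<omega> then indicator A \<omega> * max 0 (R (r m i) (dd m) \<omega> - C * \<bar>B (r m i + dd m) \<omega> - B (r m i) \<omega>\<bar>^3) else 0)"
  have Wm[measurable]: "W m i \<in> borel_measurable P" for m i
    unfolding W_def using V[of "r m i"] V[of "r m (Suc i)"] r0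
    by (intro measurable_If TPs borel_measurable_scaleR borel_measurable_diff borel_measurable_indicator) auto
  have DP: "D1 r \<in> borel_measurable P" "D2 r \<in> borel_measurable P" if "0 \<le> r" for r
    using measurable_from_subalg[OF sub D1[OF that]] measurable_from_subalg[OF sub D2[OF that]] .
  have Rm: "R r d \<in> borel_measurable P" if "0 \<le> r" "0 \<le> d" for r d
    unfolding R_def using V[of r] V[of "r + d"] DP[of r] Bm[of r] Bm[of "r + d"] that by simp
  have em[measurable]: "e m i \<in> borel_measurable P" for m i
  proof -
    have [measurable]: "R (r m i) (dd m) \<in> borel_measurable P" "B (r m i + dd m) \<in> borel_measurable P" "B (r m i) \<in> borel_measurable P"
      using Rm[of "r m i" "dd m"] Bm[of "r m i"] Bm[of "r m i + dd m"] r0 dd(1)[of m] by (auto simp: add_nonneg_nonneg less_imp_le)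
    show ?thesis unfolding e_def
      by (intro measurable_If TPs borel_measurable_times borel_measurable_max borel_measurable_diff borel_measurable_power borel_measurable_abs borel_measurable_indicator) simp_all
  qed
  have e0: "0 \<le> e m i \<omega>" for m i \<omega> by (simp add: e_def)
  have e1: "e m i \<omega> \<le> C * dd m" if "\<omega> \<in> space P" for m i \<omega>
    using rem1[OF that r0(1) _ dd(1) dd(2), of m i m] C dd(1)[of m]
    by (auto simp: e_def indicator_def mult_nonneg_nonneg less_imp_le algebra_simps)
  have ie: "integrable P (e m i)" for m i
    by (rule integrable_const_bound[of _ "C * dd m"]) (use e0 e1 in \<open>auto intro!: AE_I2\<close>)
  have bW: "norm (W m i \<omega>) \<le> 2 * C" if "\<omega> \<in> space P" for m i \<omega>
  proof (cases "r m i < T \<omega>")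
    case True
    then have "norm (V (r m (Suc i)) \<omega> - V (r m i) \<omega>) \<le> C + C"
      using that r0 dd(1)[of m] dd(2)[of m] rS[of m i]
      by (intro norm_triangle_le_diff add_mono bV) (auto simp: less_imp_le)
    then show ?thesis using C by (auto simp: W_def indicator_def)
  qed (use C in \<open>simp add: W_def\<close>)
  have iW: "integrable P (W m i)" for m i
    by (rule integrable_const_bound[of _ "2 * C"]) (use bW in \<open>auto intro!: AE_I2\<close>)
  have stepW: "norm (expectation (W m i)) \<le> 2 * C * (dd m * sqrt (dd m)) + expectation (e m i)" for m i
  proof (rule step_expectation[OF bm r0(1)[of m i] dd(1)[of m], where
      ?D1.0 = "\<lambda>\<omega>. if r m i < T \<omega> then indicator A \<omega> *\<^sub>R D1 (r m i) \<omega> else 0" and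
      ?D2.0 = "\<lambda>\<omega>. if r m i < T \<omega> then indicator A \<omega> *\<^sub>R D2 (r m i) \<omega> else 0"])
    have m: "A \<in> sets (F (r m i))"
      "D1 (r m i) \<in> borel_measurable (F (r m i))" "D2 (r m i) \<in> borel_measurable (F (r m i))"
      using AF r0 D1 D2 by auto
    show "(\<lambda>\<omega>. if r m i < T \<omega> then indicator A \<omega> *\<^sub>R D1 (r m i) \<omega> else 0) \<in> borel_measurable (F (r m i))"
      by (intro measurable_If TFs borel_measurable_scaleR borel_measurable_indicator) (use m in auto)
    show "(\<lambda>\<omega>. if r m i < T \<omega> then indicator A \<omega> *\<^sub>R D2 (r m i) \<omega> else 0) \<in> borel_measurable (F (r m i))"
      by (intro measurable_If TFs borel_measurable_scaleR borel_measurable_indicator) (use m in auto)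
    show "norm (if r m i < T \<omega> then indicator A \<omega> *\<^sub>R D1 (r m i) \<omega> else 0) \<le> C" if "\<omega> \<in> space P" for \<omega>
      using b1[OF that r0(1), of m i] C by (auto simp: indicator_def)
    show "norm (if r m i < T \<omega> then indicator A \<omega> *\<^sub>R D2 (r m i) \<omega> else 0) \<le> C" if "\<omega> \<in> space P" for \<omega>
      using b2[OF that r0(1), of m i] C by (auto simp: indicator_def)
    show "W m i \<in> borel_measurable P" by (rule Wm)
    show "e m i \<in> borel_measurable P" by (rule em)
    show "integrable P (e m i)" by (rule ie)
    show "integrable P (W m i)" by (rule iW)
    show "0 \<le> C" by (rule C)
    fix \<omega> assume "\<omega> \<in> space P"
    show "norm (W m i \<omega> - ((if r m i < T \<omega> then indicator A \<omega> *\<^sub>R D1 (r m i) \<omega> else 0) * of_real (B (r m i + dd m) \<omega> - B (r m i) \<omega>) +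
        (if r m i < T \<omega> then indicator A \<omega> *\<^sub>R D2 (r m i) \<omega> else 0) * of_real (((B (r m i + dd m) \<omega> - B (r m i) \<omega>)\<^sup>2 - dd m) / 2)))
        \<le> C * \<bar>B (r m i + dd m) \<omega> - B (r m i) \<omega>\<bar> ^ 3 + e m i \<omega>"
    proof (cases "r m i < T \<omega> \<and> \<omega> \<in> A")
      case True
      then have "e m i \<omega> = max 0 (R (r m i) (dd m) \<omega> - C * \<bar>B (r m i + dd m) \<omega> - B (r m i) \<omega>\<bar>^3)"
        by (simp add: e_def)
      then have "R (r m i) (dd m) \<omega> \<le> C * \<bar>B (r m i + dd m) \<omega> - B (r m i) \<omega>\<bar> ^ 3 + e m i \<omega>" by linarith
      then show ?thesis using True by (simp add: W_def R_def rS)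
    next
      case False
      then have "W m i \<omega> = 0" "e m i \<omega> = 0" by (auto simp: W_def e_def indicator_def)
      then show ?thesis using False C by (auto simp: indicator_def)
    qed
  qed
  define S where "S = (\<lambda>m \<omega>. \<Sum>i<Suc (m + N0). W m i \<omega>)"
  define E where "E = (\<lambda>m \<omega>. \<Sum>i<Suc (m + N0). e m i \<omega>)"
  \<comment> \<open>Summing d sqrt d over (t - s) / d steps leaves a factor sqrt d.\<close>
  have bd: "norm (expectation (S m)) \<le> 2 * C * (t - s) * sqrt (dd m) + expectation (E m)" for m
  proof -
    have "expectation (S m) = (\<Sum>i<Suc (m + N0). expectation (W m i))"
      unfolding S_def using iW by (intro Bochner_Integration.integral_sum) auto
    then have "norm (expectation (S m)) \<le> (\<Sum>i<Suc (m + N0). 2 * C * (dd m * sqrt (dd m)) + expectation (e m i))"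
      by (simp only:) (rule order_trans[OF norm_sum sum_mono[OF stepW]])
    also have "\<dots> = 2 * C * (real (Suc (m + N0)) * dd m) * sqrt (dd m) + (\<Sum>i<Suc (m + N0). expectation (e m i))"
      by (simp only: sum.distrib sum_constant card_lessThan) (simp add: mult_ac)
    also have "(\<Sum>i<Suc (m + N0). expectation (e m i)) = expectation (E m)"
      unfolding E_def using ie by (intro Bochner_Integration.integral_sum[symmetric]) auto
    finally show ?thesis unfolding ddm .
  qed
  have E0: "(\<lambda>m. expectation (E m)) \<longlonglongrightarrow> expectation (\<lambda>_. 0)"
  proof (rule integral_dominated_convergence[where w = "\<lambda>_. C * (t - s)"])
    show "AE \<omega> in P. (\<lambda>m. E m \<omega>) \<longlonglongrightarrow> 0"
    proof (rule AE_I2)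
      fix \<omega> assume w: "\<omega> \<in> space P"
      show "(\<lambda>m. E m \<omega>) \<longlonglongrightarrow> 0"
      proof (rule LIMSEQ_I)
        fix \<epsilon> :: real assume ep: "0 < \<epsilon>"
        define \<eta> where "\<eta> = \<epsilon> / (2 * (t - s))"
        have eta: "0 < \<eta>" using ep st' by (simp add: \<eta>_def)
        obtain d1 where d1: "d1 > 0" "\<And>r d. 0 \<le> r \<Longrightarrow> r < T \<omega> \<Longrightarrow> r \<le> t \<Longrightarrow> 0 < d \<Longrightarrow> d < d1 \<Longrightarrow>
          R r d \<omega> \<le> C * \<bar>B (r + d) \<omega> - B r \<omega>\<bar>^3 + \<eta> * d" using rem2[OF w eta] by blast
        obtain M where M: "\<And>m. m \<ge> M \<Longrightarrow> dd m < d1"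
          using order_tendstoD(2)[OF dd0 d1(1)] by (auto simp: eventually_sequentially)
        have "norm (E m \<omega> - 0) < \<epsilon>" if "m \<ge> M" for m
        proof -
          have "e m i \<omega> \<le> \<eta> * dd m" if "i < Suc (m + N0)" for i
            using d1(2)[OF r0(1) _ rt[OF that] dd(1) M[OF \<open>m \<ge> M\<close>]] eta dd(1)[of m]
            by (auto simp: e_def indicator_def mult_nonneg_nonneg less_imp_le)
          then have "E m \<omega> \<le> (\<Sum>i<Suc (m + N0). \<eta> * dd m)" unfolding E_def by (intro sum_mono) auto
          also have "\<dots> = \<eta> * (real (Suc (m + N0)) * dd m)" by (simp only: sum_constant card_lessThan) (simp add: mult_ac)
          also have "\<dots> = \<epsilon> / 2" using st' unfolding ddm by (simp add: \<eta>_def field_simps)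
          also have "\<dots> < \<epsilon>" using ep by simp
          finally show ?thesis using e0 by (simp add: E_def sum_nonneg)
        qed
        then show "\<exists>no. \<forall>m\<ge>no. norm (E m \<omega> - 0) < \<epsilon>" by blast
      qed
    qed
    show "AE \<omega> in P. norm (E m \<omega>) \<le> C * (t - s)" for m
    proof (rule AE_I2)
      fix \<omega> assume w: "\<omega> \<in> space P"
      have "E m \<omega> \<le> (\<Sum>i<Suc (m + N0). C * dd m)" unfolding E_def using e1[OF w] by (intro sum_mono) auto
      also have "\<dots> = C * (real (Suc (m + N0)) * dd m)" by (simp only: sum_constant card_lessThan) (simp add: mult_ac)
      finally show "norm (E m \<omega>) \<le> C * (t - s)" unfolding ddm using e0 by (simp add: E_def sum_nonneg)
    qed
    show "E m \<in> borel_measurable P" for m unfolding E_def by measurable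
  qed auto
  \<comment> \<open>The sum ends at a grid point \<open>g\<close> within one mesh of
    \<open>min t (T \<omega>)\<close>, so path continuity identifies the limit.\<close>
  have Slim: "(\<lambda>m. expectation (S m)) \<longlonglongrightarrow> expectation (\<lambda>\<omega>. indicator A \<omega> *\<^sub>R (V (min t (T \<omega>)) \<omega> - V (min s (T \<omega>)) \<omega>))"
  proof -
    have g: "\<exists>g. S m \<omega> = indicator A \<omega> *\<^sub>R (V g \<omega> - V (min s (T \<omega>)) \<omega>) \<and> \<bar>g - min t (T \<omega>)\<bar> \<le> dd m \<and> 0 \<le> g \<and> g < T \<omega> + d0"
      if w: "\<omega> \<in> space P" for m \<omega>
    proof -
      define Q where "Q = (\<Sum>i<Suc (m + N0). if s + real i * dd m < T \<omega> then V (s + real (Suc i) * dd m) \<omega> - V (s + real i * dd m) \<omega> else 0)"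
      have SQ: "S m \<omega> = indicator A \<omega> *\<^sub>R Q"
        unfolding S_def Q_def W_def r_def scaleR_sum_right by (rule sum.cong) auto
      have km: "s + real (Suc (m + N0)) * dd m = t" using ddm[of m] by simp
      from stopped_telescope[OF dd(1)[of m], where k = "Suc (m + N0)" and s = s and T = "T \<omega>" and V = "\<lambda>r. V r \<omega>"]
      consider g where "Q = V g \<omega> - V (min s (T \<omega>)) \<omega>" "min s (T \<omega>) \<le> g" "g = t \<or> T \<omega> \<le> g"
          "g \<le> max (min s (T \<omega>)) t" "g < T \<omega> + dd m"
        | "T \<omega> \<le> s" "Q = 0" unfolding Q_def[symmetric] km by blast
      then show ?thesis
      proof cases
        case 1
        then show ?thesis using SQ T0[OF w] st' dd(1)[of m] dd(2)[of m]
          by (smt (verit, best) assms(18))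
      next
        \<comment> \<open>The sum is empty and both stopped times equal \<open>T \<omega>\<close>,
          which then serves as \<open>g\<close>.\<close>
        case 2
        then show ?thesis using SQ T0[OF w] st' dd(1)[of m] d0
          by (intro exI[of _ "T \<omega>"]) (auto simp: min_def)
      qed
    qed
    show ?thesis
    proof (rule integral_dominated_convergence[where w = "\<lambda>_. 2 * C"])
      show "S m \<in> borel_measurable P" for m unfolding S_def by measurable
      show "(\<lambda>\<omega>. indicator A \<omega> *\<^sub>R (V (min t (T \<omega>)) \<omega> - V (min s (T \<omega>)) \<omega>)) \<in> borel_measurable P"
        using VT[of t] VT[of s] st by auto
      show "AE \<omega> in P. norm (S m \<omega>) \<le> 2 * C" for m
      proof (rule AE_I2)
        fix \<omega> assume w: "\<omega> \<in> space P"
        obtain g where g: "S m \<omega> = indicator A \<omega> *\<^sub>R (V g \<omega> - V (min s (T \<omega>)) \<omega>)" "0 \<le> g" "g < T \<omega> + d0" using g[OF w, of m] by blast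
        have "norm (V g \<omega> - V (min s (T \<omega>)) \<omega>) \<le> C + C"
          using g w T0[OF w] st d0 by (intro norm_triangle_le_diff add_mono bV) (auto simp: min_def)
        then show "norm (S m \<omega>) \<le> 2 * C" using C by (auto simp: g(1) indicator_def)
      qed
      show "AE \<omega> in P. (\<lambda>m. S m \<omega>) \<longlonglongrightarrow> indicator A \<omega> *\<^sub>R (V (min t (T \<omega>)) \<omega> - V (min s (T \<omega>)) \<omega>)"
      proof (rule AE_I2)
        fix \<omega> assume w: "\<omega> \<in> space P"
        obtain g where g: "\<And>m. S m \<omega> = indicator A \<omega> *\<^sub>R (V (g m) \<omega> - V (min s (T \<omega>)) \<omega>)"
          "\<And>m. \<bar>g m - min t (T \<omega>)\<bar> \<le> dd m" "\<And>m. 0 \<le> g m" "\<And>m. g m < T \<omega> + d0" using g[OF w] by metis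
        have "(\<lambda>m. g m - min t (T \<omega>)) \<longlonglongrightarrow> 0"
          by (rule tendsto_0_le[OF dd0, of _ 1]) (use g(2) dd(1) in \<open>auto simp: abs_of_pos\<close>)
        then have gl: "g \<longlonglongrightarrow> min t (T \<omega>)" by (simp add: LIM_zero_iff)
        have "(\<lambda>m. V (g m) \<omega>) \<longlonglongrightarrow> V (min t (T \<omega>)) \<omega>"
          by (rule continuous_on_tendsto_compose[OF cV[OF w] gl]) (use g T0[OF w] st d0 in \<open>auto simp: min_def\<close>)
        then show "(\<lambda>m. S m \<omega>) \<longlonglongrightarrow> indicator A \<omega> *\<^sub>R (V (min t (T \<omega>)) \<omega> - V (min s (T \<omega>)) \<omega>)"
          unfolding g(1) by (intro tendsto_intros)
      qed
    qed auto
  qed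
  have S0: "(\<lambda>m. expectation (S m)) \<longlonglongrightarrow> 0"
  proof (rule Lim_null_comparison)
    show "\<forall>\<^sub>F m in sequentially. norm (expectation (S m)) \<le> 2 * C * (t - s) * sqrt (dd m) + expectation (E m)"
      using bd by simp
    have "(\<lambda>m. 2 * C * (t - s) * sqrt (dd m) + expectation (E m)) \<longlonglongrightarrow> 2 * C * (t - s) * sqrt 0 + expectation (\<lambda>_. 0)"
      by (intro tendsto_intros dd0 E0)
    then show "(\<lambda>m. 2 * C * (t - s) * sqrt (dd m) + expectation (E m)) \<longlonglongrightarrow> 0" by simp
  qed
  have "expectation (\<lambda>\<omega>. indicator A \<omega> *\<^sub>R (V (min t (T \<omega>)) \<omega> - V (min s (T \<omega>)) \<omega>)) = 0"
    using LIMSEQ_unique[OF Slim S0] .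
  moreover have iV: "integrable P (\<lambda>\<omega>. indicator A \<omega> *\<^sub>R V (min u (T \<omega>)) \<omega>)" if "0 \<le> u" for u
  proof (rule integrable_const_bound[of _ C])
    show "AE \<omega> in P. norm (indicator A \<omega> *\<^sub>R V (min u (T \<omega>)) \<omega>) \<le> C"
      using bV T0 that d0 C by (intro AE_I2) (auto simp: indicator_def min_def)
    show "(\<lambda>\<omega>. indicator A \<omega> *\<^sub>R V (min u (T \<omega>)) \<omega>) \<in> borel_measurable P" using VT[OF that] by measurable
  qed
  ultimately show ?thesis using iV[of s] iV[of t] st by (simp add: scaleR_diff_right)
qed simp

section \<open>Adapted solutions and hitting times\<close>

text \<open>Picard iteration on the whole half-line at once, in place of gluing local solutions: the
  unknown is exp(-K t) y(t), which is bounded because \<open>b\<close> is, and with this weight the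
  integral operator contracts by 1/2.\<close>

lemma global_ode_exists:
  fixes b :: "real \<Rightarrow> complex \<Rightarrow> complex"
  assumes cont: "continuous_on UNIV (\<lambda>p. b (fst p) (snd p))"
    and lip: "\<And>s u v. norm (b s u - b s v) \<le> L * norm (u - v)"
    and bd: "\<And>s u. norm (b s u) \<le> M"
  obtains y where "y 0 = z0" "\<And>t. 0 \<le> t \<Longrightarrow> (y has_vector_derivative b t (y t)) (at t within {0..})"
proof -
  have L0: "0 \<le> L"
    using order_trans[OF norm_ge_zero lip[of 0 1 0]] by simp
  have M0: "0 \<le> M" using order_trans[OF norm_ge_zero bd] .
  \<comment> \<open>\<open>2 * L \<le> K\<close> yields the contraction factor 1/2; the summand 1
    makes K at least 1, whence t exp(-K t) \<le> 1.\<close>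
  define K where "K = 2 * L + 1"
  have K: "1 \<le> K" "2 * L \<le> K" "0 < K" using L0 by (auto simp: K_def)
  define g where "g = (\<lambda>(v :: real \<Rightarrow>\<^sub>C complex) s. b s (exp (K * s) *\<^sub>R apply_bcontfun v s))"
  have cb: "continuous_on S (\<lambda>s. b s (f s))" if "continuous_on S f" for S and f :: "real \<Rightarrow> complex"
  proof -
    have "continuous_on S ((\<lambda>p. b (fst p) (snd p)) \<circ> (\<lambda>s. (s, f s)))"
      by (intro continuous_on_compose continuous_on_Pair continuous_on_id that continuous_on_subset[OF cont]) auto
    then show ?thesis by (simp add: comp_def)
  qed
  have gc: "continuous_on S (g v)" for v S
    unfolding g_def by (intro cb continuous_intros continuous_on_apply_bcontfun)
  have gi: "(g v) integrable_on {0..t}" for v t using gc by (rule integrable_continuous_interval)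
  define J where "J = (\<lambda>v t. integral {0..t} (g v))"
  have Jb: "norm (J v t) \<le> M * t" if "0 \<le> t" for v t
  proof -
    have "(g v has_integral J v t) (cbox 0 t)" unfolding J_def using gi by (simp add: integrable_integral)
    then have "norm (J v t) \<le> M * measure lborel (cbox 0 t)"
      by (rule has_integral_bound[OF M0]) (use bd in \<open>auto simp: g_def\<close>)
    then show ?thesis using that by simp
  qed
  have J': "(J v has_vector_derivative g v t) (at t within {0..T})" if "0 \<le> t" "t \<le> T" for v t T
    unfolding J_def using integral_has_vector_derivative[OF gc, of t 0 T v] that by simp
  have Jc: "continuous_on {0..T} (J v)" for v T
    by (rule continuous_on_vector_derivative) (use J' in auto)
  \<comment> \<open>Bounded continuous functions live on all of \<real>, hence negative times are
    sent to 0.\<close>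
  define Op where "Op = (\<lambda>v t. exp (- K * max t 0) *\<^sub>R (z0 + J v (max t 0)))"
  have te: "exp (- K * t) * t \<le> 1" if "0 \<le> t" for t
  proof -
    have "t \<le> K * t" using K that by (simp add: mult_le_cancel_right1)
    also have "K * t \<le> exp (K * t)" using exp_ge_add_one_self[of "K * t"] by linarith
    finally show ?thesis by (simp add: exp_minus field_simps)
  qed
  have Opb: "norm (Op v t) \<le> norm z0 + M" for v t
  proof -
    define s where "s = max t 0"
    have s: "0 \<le> s" by (simp add: s_def)
    have e1: "exp (- K * s) \<le> 1" using K s by simp
    have "norm (Op v t) \<le> exp (- K * s) * (norm z0 + M * s)"
      unfolding Op_def s_def[symmetric] using norm_triangle_le[OF add_mono[OF order_refl Jb[OF s]]] by simp
    also have "\<dots> = exp (- K * s) * norm z0 + M * (exp (- K * s) * s)" by (simp add: algebra_simps)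
    also have "\<dots> \<le> 1 * norm z0 + M * 1"
      using te[OF s] e1 M0 by (intro add_mono mult_right_mono mult_left_mono) auto
    finally show ?thesis by simp
  qed
  have Opc: "continuous_on UNIV (Op v)" for v
  proof -
    have "continuous_on {..T} (Op v)" for T
    proof -
      have "continuous_on {..T} (\<lambda>t. J v (max t 0))"
        by (rule continuous_on_compose2[OF Jc[of "max T 0" v]]) (auto intro!: continuous_intros)
      then show ?thesis unfolding Op_def by (intro continuous_intros)
    qed
    then have "isCont (Op v) x" for x
      by (rule continuous_on_interior[of "{..x+1}"]) (rule interiorI[of "{..<x+1}"], auto)
    then show ?thesis by (simp add: continuous_at_imp_continuous_on)
  qed
  have OpB: "Op v \<in> bcontfun" for v
    unfolding bcontfun_def using Opc Opb[of v] by (auto intro!: boundedI[of _ "norm z0 + M"])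
  define P where "P = (\<lambda>v. Bcontfun (Op v))"
  have Pa: "apply_bcontfun (P v) = Op v" for v unfolding P_def by (simp add: Bcontfun_inverse OpB)
  have contr: "dist (P v) (P w) \<le> (1/2) * dist v w" for v w
  proof (rule dist_bound)
    fix t :: real
    define s where "s = max t 0"
    have s: "0 \<le> s" by (simp add: s_def)
    have dv: "norm (apply_bcontfun v x - apply_bcontfun w x) \<le> dist v w" for x
      using dist_bounded[of v x w] by (simp add: dist_norm)
    have gd: "norm (g v x - g w x) \<le> L * dist v w * exp (K * x)" for x
    proof -
      have "norm (g v x - g w x) \<le> L * norm (exp (K * x) *\<^sub>R apply_bcontfun v x - exp (K * x) *\<^sub>R apply_bcontfun w x)"
        unfolding g_def by (rule lip)
      also have "\<dots> = L * (exp (K * x) * norm (apply_bcontfun v x - apply_bcontfun w x))"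
        by (simp flip: scaleR_diff_right)
      also have "\<dots> \<le> L * (exp (K * x) * dist v w)" using L0 dv by (intro mult_left_mono) auto
      finally show ?thesis by (simp add: mult_ac)
    qed
    have ei: "((\<lambda>x. L * dist v w * exp (K * x)) has_integral (L * dist v w * exp (K * s) / K - L * dist v w * exp (K * 0) / K)) {0..s}"
      by (rule fundamental_theorem_of_calculus[OF s])
        (auto simp flip: has_real_derivative_iff_has_vector_derivative intro!: derivative_eq_intros simp: K(3)[THEN less_imp_neq, symmetric])
    have "J v s - J w s = integral {0..s} (\<lambda>x. g v x - g w x)"
      unfolding J_def by (rule Henstock_Kurzweil_Integration.integral_diff[symmetric]) (rule gi)+
    then have "norm (J v s - J w s) \<le> integral {0..s} (\<lambda>x. L * dist v w * exp (K * x))"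
      using gd by (simp only:) (intro integral_norm_bound_integral Henstock_Kurzweil_Integration.integrable_diff gi has_integral_integrable[OF ei])
    also have "\<dots> = L * dist v w * exp (K * s) / K - L * dist v w * exp (K * 0) / K" using ei by (rule integral_unique)
    also have "\<dots> \<le> L * dist v w * exp (K * s) / K" using L0 K by simp
    also have "\<dots> = (L / K) * dist v w * exp (K * s)" by simp
    also have "\<dots> \<le> (1/2) * dist v w * exp (K * s)" using K by (intro mult_right_mono) (auto simp: field_simps)
    finally have le: "norm (J v s - J w s) \<le> (1/2) * dist v w * exp (K * s)" .
    have "dist (apply_bcontfun (P v) t) (apply_bcontfun (P w) t) = exp (- K * s) * norm (J v s - J w s)"
      unfolding Pa Op_def s_def[symmetric] dist_norm by (simp flip: scaleR_diff_right)
    also have "\<dots> \<le> exp (- K * s) * ((1/2) * dist v w * exp (K * s))" using le by (intro mult_left_mono) auto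
    also have "\<dots> = (1/2) * dist v w" by (simp add: exp_minus)
    finally show "dist (apply_bcontfun (P v) t) (apply_bcontfun (P w) t) \<le> (1/2) * dist v w" .
  qed
  have "\<exists>!x. P x = x" by (rule banach_fix_type[of "1/2"]) (use contr in auto)
  then obtain v where v: "P v = v" by blast
  define y where "y = (\<lambda>t. z0 + J v t)"
  have yv: "exp (K * t) *\<^sub>R apply_bcontfun v t = y t" if "0 \<le> t" for t
  proof -
    have "apply_bcontfun v t = Op v t" using Pa[of v] v by simp
    then show ?thesis using that by (simp add: Op_def y_def exp_minus flip: exp_add)
  qed
  show thesis
  proof (rule that[of y])
    show "y 0 = z0" by (simp add: y_def J_def)
    fix t :: real assume t: "0 \<le> t"
    have "(y has_vector_derivative g v t) (at t within {0..t+1})"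
      unfolding y_def using J'[of t "t + 1" v] t by (auto intro!: derivative_eq_intros)
    moreover have "g v t = b t (y t)" unfolding g_def using yv[OF t] by simp
    moreover have "at t within {0..t+1} = at t within {0..}"
      by (rule at_within_nhd[of t "{t-1<..<t+1}"]) auto
    ultimately show "(y has_vector_derivative b t (y t)) (at t within {0..})" by simp
  qed
qed

section \<open>Comparison of solutions and Euler polygons\<close>

lemma has_real_derivative_exp_sum_squares:
  fixes p q :: "real \<Rightarrow> real"
  assumes "(p has_real_derivative p') (at s)" "(q has_real_derivative q') (at s)"
  shows "((\<lambda>s. exp (c * s) * ((p s)\<^sup>2 + (q s)\<^sup>2)) has_real_derivative
    exp (c * s) * (2 * (p s * p' + q s * q') + c * ((p s)\<^sup>2 + (q s)\<^sup>2))) (at s)"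
  using assms by (auto intro!: derivative_eq_intros simp: algebra_simps)

text \<open>The function exp(-2 L s) |y1 - y2|^2 is nonincreasing. The square replaces the norm,
  which is not differentiable at 0.\<close>

lemma gronwall_difference:
  fixes y1 y2 f1 f2 :: "real \<Rightarrow> complex"
  assumes t: "0 \<le> t"
    and y1: "\<And>s. 0 \<le> s \<Longrightarrow> s \<le> t \<Longrightarrow> (y1 has_vector_derivative f1 s) (at s within {0..t})"
    and y2: "\<And>s. 0 \<le> s \<Longrightarrow> s \<le> t \<Longrightarrow> (y2 has_vector_derivative f2 s) (at s within {0..t})"
    and le: "\<And>s. 0 \<le> s \<Longrightarrow> s \<le> t \<Longrightarrow> norm (f1 s - f2 s) \<le> L * norm (y1 s - y2 s)"
  shows "norm (y1 t - y2 t) \<le> exp (L * t) * norm (y1 0 - y2 0)"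
proof -
  define D where "D = (\<lambda>s. y1 s - y2 s)"
  define N where "N = (\<lambda>s. (Re (D s))\<^sup>2 + (Im (D s))\<^sup>2)"
  have N: "N s = (norm (D s))\<^sup>2" for s by (simp add: N_def cmod_power2)
  have D: "(D has_vector_derivative f1 s - f2 s) (at s within {0..t})" if "0 \<le> s" "s \<le> t" for s
    unfolding D_def using y1[OF that] y2[OF that] by (rule has_vector_derivative_diff)
  have cD: "continuous_on {0..t} D"
    by (rule continuous_on_vector_derivative) (use D in auto)
  define h where "h = (\<lambda>s. exp (- 2 * L * s) * N s)"
  have "h t \<le> h 0"
  proof (rule DERIV_nonpos_imp_decreasing_open[OF t])
    show "continuous_on {0..t} h" unfolding h_def N_def by (intro continuous_intros cD)
    fix s assume s: "0 < s" "s < t"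
    have at: "at s within {0..t} = at s" using s by (intro at_within_interior) (auto simp: interior_atLeastAtMost_real)
    have "(D has_vector_derivative f1 s - f2 s) (at s)" using D[of s] s at by simp
    then have R: "((\<lambda>s. Re (D s)) has_real_derivative Re (f1 s - f2 s)) (at s)"
      and I: "((\<lambda>s. Im (D s)) has_real_derivative Im (f1 s - f2 s)) (at s)"
      by (auto simp: has_real_derivative_iff_has_vector_derivative has_vector_derivative_complex_iff)
    define d where "d = exp (- 2 * L * s) * (2 * (Re (D s) * Re (f1 s - f2 s) + Im (D s) * Im (f1 s - f2 s)) - 2 * L * N s)"
    have "(h has_real_derivative d) (at s)"
      using has_real_derivative_exp_sum_squares[OF R I, of "- 2 * L"] by (simp add: h_def N_def d_def)
    moreover have "d \<le> 0"
    proof -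
      have "Re (D s) * Re (f1 s - f2 s) + Im (D s) * Im (f1 s - f2 s) = Re (D s * cnj (f1 s - f2 s))" by (simp add: algebra_simps)
      also have "\<dots> \<le> norm (D s * cnj (f1 s - f2 s))" by (rule complex_Re_le_cmod)
      also have "\<dots> = norm (D s) * norm (f1 s - f2 s)" by (simp add: norm_mult del: complex_cnj_diff)
      also have "\<dots> \<le> norm (D s) * (L * norm (D s))" using le[of s] s by (intro mult_left_mono) (auto simp: D_def)
      also have "\<dots> = L * N s" by (simp add: N power2_eq_square)
      finally show ?thesis unfolding d_def by (intro mult_nonneg_nonpos) auto
    qed
    ultimately show "\<exists>y. (h has_real_derivative y) (at s) \<and> y \<le> 0" by blast
  qed
  then have "exp (- 2 * L * t) * (norm (D t))\<^sup>2 \<le> (norm (D 0))\<^sup>2" by (simp add: h_def N)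
  then have "(norm (D t))\<^sup>2 \<le> (exp (L * t) * norm (D 0))\<^sup>2"
    by (simp add: exp_minus field_simps power_mult_distrib flip: exp_double)
  then have "norm (D t) \<le> exp (L * t) * norm (D 0)" by (rule power2_le_imp_le) simp
  then show ?thesis by (simp add: D_def)
qed

primrec euler :: "(real \<Rightarrow> complex \<Rightarrow> complex) \<Rightarrow> complex \<Rightarrow> real \<Rightarrow> nat \<Rightarrow> complex" where
  "euler b z0 h 0 = z0"
| "euler b z0 h (Suc i) = euler b z0 h i + h *\<^sub>R b (real i * h) (euler b z0 h i)"

text \<open>Along the exact solution the right-hand side is uniformly continuous, so each step
  commits an error of at most \<eta> h; the Lipschitz bound propagates earlier errors by a factor of
  at most exp(L h) per step. Continuity in time is asked only along \<open>y\<close>.\<close>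

lemma euler_tendsto:
  assumes t: "0 < t" and L: "0 \<le> L"
    and y: "\<And>s. 0 \<le> s \<Longrightarrow> s \<le> t \<Longrightarrow> (y has_vector_derivative b s (y s)) (at s within {0..t})"
    and c: "continuous_on {0..t} (\<lambda>s. b s (y s))"
    and lip: "\<And>s u v. 0 \<le> s \<Longrightarrow> s \<le> t \<Longrightarrow> norm (b s u - b s v) \<le> L * norm (u - v)"
  shows "(\<lambda>N. euler b (y 0) (t / real (Suc N)) (Suc N)) \<longlonglongrightarrow> y t"
proof (rule LIMSEQ_I)
  fix \<epsilon> :: real assume ep: "0 < \<epsilon>"
  \<comment> \<open>The accumulated error t \<eta> exp(L t) becomes half of \<epsilon>.\<close>
  define \<eta> where "\<eta> = \<epsilon> / (2 * t * exp (L * t))"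
  have eta: "0 < \<eta>" using ep t by (simp add: \<eta>_def)
  have "uniformly_continuous_on {0..t} (\<lambda>s. b s (y s))" using c by (rule compact_uniformly_continuous) simp
  then obtain \<delta> where del: "\<delta> > 0" "\<And>s s'. s \<in> {0..t} \<Longrightarrow> s' \<in> {0..t} \<Longrightarrow> \<bar>s' - s\<bar> < \<delta> \<Longrightarrow> norm (b s' (y s') - b s (y s)) < \<eta>"
    using eta unfolding uniformly_continuous_on_def dist_norm real_norm_def by metis
  obtain N0 :: nat where N0: "t / \<delta> < real N0" using reals_Archimedean2 by blast
  have "norm (euler b (y 0) (t / real (Suc N)) (Suc N) - y t) < \<epsilon>" if N: "N \<ge> N0" for N
  proof -
    define h where "h = t / real (Suc N)"
    have h0: "0 < h" using t by (simp add: h_def)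
    have hd: "h < \<delta>"
    proof -
      have "t < \<delta> * real N0" using N0 del(1) by (simp add: field_simps)
      also have "\<dots> \<le> \<delta> * real (Suc N)" using N del(1) by (intro mult_left_mono) auto
      finally have "t < \<delta> * real (Suc N)" .
      then show ?thesis by (simp add: h_def divide_less_eq)
    qed
    have hN: "real (Suc N) * h = t" by (simp add: h_def)
    have le: "real i * h \<le> t" if "i \<le> Suc N" for i
    proof -
      have "real i * h \<le> real (Suc N) * h" using that h0 by (intro mult_right_mono) auto
      then show ?thesis unfolding hN .
    qed
    have err: "norm (euler b (y 0) h i - y (real i * h)) \<le> real i * h * \<eta> * exp (L * (real i * h))" if "i \<le> Suc N" for i
      using that
    proof (induction i)
      case (Suc i)
      define a where "a = real i * h"
      define E where "E = euler b (y 0) h i"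
      have a: "0 \<le> a" "a + h \<le> t" "real (Suc i) * h = a + h" using le[OF Suc.prems] h0 by (auto simp: a_def algebra_simps)
      have IH: "norm (E - y a) \<le> a * \<eta> * exp (L * a)" using Suc unfolding E_def a_def by simp
      have "((\<lambda>s. b s (y s)) has_integral (y (a + h) - y a)) {a..a+h}"
        by (rule fundamental_theorem_of_calculus) (use h0 a in \<open>auto intro: has_vector_derivative_within_subset[OF y]\<close>)
      then have "((\<lambda>s. b s (y s) - b a (y a)) has_integral (y (a + h) - y a - h *\<^sub>R b a (y a))) {a..a+h}"
        using has_integral_const_real[of "b a (y a)" a "a + h"] h0 by (auto dest: has_integral_diff)
      then have "norm (y (a + h) - y a - h *\<^sub>R b a (y a)) \<le> \<eta> * measure lborel {a..a+h}"
        by (rule has_integral_bound_real[where S = "{}", rotated 2]) (use del(2)[of a] a h0 hd eta in \<open>auto intro!: less_imp_le\<close>)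
      then have 1: "norm (y (a + h) - y a - h *\<^sub>R b a (y a)) \<le> \<eta> * h" using h0 by simp
      have 2: "norm (b a E - b a (y a)) \<le> L * norm (E - y a)" using lip a h0 by auto
      \<comment> \<open>The three terms are the error carried over, its propagation through
        \<open>b\<close>, and the local error of the step.\<close>
      have "euler b (y 0) h (Suc i) - y (a + h) = (E - y a) + h *\<^sub>R (b a E - b a (y a)) - (y (a + h) - y a - h *\<^sub>R b a (y a))"
        by (simp add: E_def a_def algebra_simps)
      also have "norm \<dots> \<le> norm (E - y a) + h * norm (b a E - b a (y a)) + \<eta> * h"
        using norm_triangle_ineq4[of "(E - y a) + h *\<^sub>R (b a E - b a (y a))" "y (a + h) - y a - h *\<^sub>R b a (y a)"]
          norm_triangle_ineq[of "E - y a" "h *\<^sub>R (b a E - b a (y a))"] 1 h0 by simp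
      also have "\<dots> \<le> norm (E - y a) + h * (L * norm (E - y a)) + \<eta> * h" using 2 h0 by (simp add: mult_left_mono)
      also have "\<dots> = (1 + L * h) * norm (E - y a) + \<eta> * h" by (simp add: algebra_simps)
      also have "\<dots> \<le> exp (L * h) * (a * \<eta> * exp (L * a)) + \<eta> * h * exp (L * (a + h))"
      proof (rule add_mono[OF mult_mono])
        show "norm (E - y a) \<le> a * \<eta> * exp (L * a)" by (rule IH)
        show "1 + L * h \<le> exp (L * h)" using exp_ge_add_one_self by simp
        show "\<eta> * h \<le> \<eta> * h * exp (L * (a + h))" using mult_left_mono[of 1 "exp (L * (a + h))" "\<eta> * h"] eta h0 L a by simp
      qed auto
      also have "\<dots> = (a + h) * \<eta> * exp (L * (a + h))" by (simp add: exp_add distrib_left algebra_simps)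
      finally show ?case using a by simp
    qed simp
    have "norm (euler b (y 0) h (Suc N) - y t) \<le> t * \<eta> * exp (L * t)" using err[of "Suc N"] unfolding hN by simp
    also have "\<dots> = \<epsilon> / 2" using t by (simp add: \<eta>_def)
    also have "\<dots> < \<epsilon>" using ep by simp
    finally show ?thesis unfolding h_def .
  qed
  then show "\<exists>no. \<forall>N\<ge>no. norm (euler b (y 0) (t / real (Suc N)) (Suc N) - y t) < \<epsilon>" by blast
qed

text \<open>An Euler polygon results from finitely many measurable operations, and it converges
  pointwise to \<open>y t\<close>. The argument applies to any solution, however it was selected for
  each \<omega>.\<close>

lemma adapted_solution:
  fixes y :: "real \<Rightarrow> 'a \<Rightarrow> complex" and b :: "'a \<Rightarrow> real \<Rightarrow> complex \<Rightarrow> complex"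
  assumes t: "0 \<le> t" and L: "0 \<le> L"
    and y0: "\<And>\<omega>. \<omega> \<in> space G \<Longrightarrow> y 0 \<omega> = z0"
    and y: "\<And>s \<omega>. \<omega> \<in> space G \<Longrightarrow> 0 \<le> s \<Longrightarrow> s \<le> t \<Longrightarrow> ((\<lambda>s. y s \<omega>) has_vector_derivative b \<omega> s (y s \<omega>)) (at s within {0..t})"
    and c: "\<And>\<omega>. \<omega> \<in> space G \<Longrightarrow> continuous_on {0..t} (\<lambda>s. b \<omega> s (y s \<omega>))"
    and lip: "\<And>\<omega> s u v. \<omega> \<in> space G \<Longrightarrow> 0 \<le> s \<Longrightarrow> s \<le> t \<Longrightarrow> norm (b \<omega> s u - b \<omega> s v) \<le> L * norm (u - v)"
    and meas: "\<And>s U. 0 \<le> s \<Longrightarrow> s \<le> t \<Longrightarrow> U \<in> borel_measurable G \<Longrightarrow> (\<lambda>\<omega>. b \<omega> s (U \<omega>)) \<in> borel_measurable G"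
  shows "y t \<in> borel_measurable G"
proof (cases "t = 0")
  case True
  have "y t \<in> borel_measurable G \<longleftrightarrow> (\<lambda>\<omega>. z0) \<in> borel_measurable G"
    by (rule measurable_cong) (simp add: y0 True)
  then show ?thesis by simp
next
  case False
  then have t: "0 < t" using t by simp
  have E: "(\<lambda>\<omega>. euler (b \<omega>) z0 h i) \<in> borel_measurable G" if "0 \<le> h" "real i * h \<le> t" for h i
    using that(2)
  proof (induction i)
    case (Suc i)
    have "real i * h \<le> t" using Suc.prems that(1) by (simp add: algebra_simps)
    then show ?case using Suc.IH meas[of "real i * h" "\<lambda>\<omega>. euler (b \<omega>) z0 h i"] that(1) by simp
  qed simp
  show ?thesis
  proof (rule borel_measurable_LIMSEQ_metric)
    show "(\<lambda>\<omega>. euler (b \<omega>) z0 (t / real (Suc N)) (Suc N)) \<in> borel_measurable G" for N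
      using t by (intro E) auto
    show "(\<lambda>N. euler (b \<omega>) z0 (t / real (Suc N)) (Suc N)) \<longlonglongrightarrow> y t \<omega>" if "\<omega> \<in> space G" for \<omega>
      using euler_tendsto[OF t L y[OF that] c[OF that] lip[OF that]] y0[OF that] by simp
  qed
qed

text \<open>The time \<open>min r (T \<omega>)\<close> is approximated by points of a grid on
  [0, r]. At each of the finitely many grid times the value is known at time \<open>r\<close>, and
  path continuity gives the limit.\<close>

lemma adapted_stopped:
  fixes Y :: "real \<Rightarrow> 'a \<Rightarrow> complex"
  assumes fl: "filtration \<Omega> F" and T: "stopping_time F T"
    and T0: "\<And>\<omega>. \<omega> \<in> \<Omega> \<Longrightarrow> 0 \<le> T \<omega>" and r: "0 \<le> (r::real)"
    and Y: "\<And>s. 0 \<le> s \<Longrightarrow> Y s \<in> borel_measurable (F s)"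
    and c: "\<And>\<omega>. \<omega> \<in> \<Omega> \<Longrightarrow> continuous_on {0..} (\<lambda>s. Y s \<omega>)"
  shows "(\<lambda>\<omega>. Y (min r (T \<omega>)) \<omega>) \<in> borel_measurable (F r)"
proof (cases "r = 0")
  case True
  have "(\<lambda>\<omega>. Y (min r (T \<omega>)) \<omega>) \<in> borel_measurable (F r) \<longleftrightarrow> Y r \<in> borel_measurable (F r)"
    using T0 by (intro measurable_cong) (simp add: True filtration.space_F[OF fl] min_def)
  then show ?thesis using Y[OF r] by simp
next
  case False
  then have r: "0 < r" using r by simp
  \<comment> \<open>Index of the first grid point not before \<open>T\<close>; the alternative
    \<open>i \<ge> Suc N\<close> caps it, so that the approximating time never exceeds
    \<open>r\<close>.\<close>
  define gr where "gr = (\<lambda>N \<omega>. LEAST i. T \<omega> \<le> r * real i / real (Suc N) \<or> i \<ge> Suc N)"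
  define Z where "Z = (\<lambda>N \<omega>. \<Sum>i\<le>Suc N. if gr N \<omega> = i then Y (r * real i / real (Suc N)) \<omega> else 0)"
  have grle: "gr N \<omega> \<le> Suc N" for N \<omega> unfolding gr_def by (rule Least_le) simp
  have Z: "Z N \<omega> = Y (r * real (gr N \<omega>) / real (Suc N)) \<omega>" for N \<omega>
    unfolding Z_def using grle[of N \<omega>] by (subst sum.delta') auto
  have le: "r * real i / real (Suc N) \<le> r" if "i \<le> Suc N" for i N
    using that r by (simp add: divide_le_eq mult_left_mono)
  have Ym: "Y s \<in> borel_measurable (F r)" if "0 \<le> s" "s \<le> r" for s
    using measurable_from_subalg[of "F r" "F s"] Y that filtration.sets_F_mono[OF fl] filtration.space_F[OF fl]
    by (auto simp: subalgebra_def)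
  have Tm: "Measurable.pred (F r) (\<lambda>\<omega>. T \<omega> \<le> s)" if "s \<le> r" for s
  proof (rule measurable_from_subalg[of "F r" "F s"])
    show "subalgebra (F r) (F s)" using filtration.sets_F_mono[OF fl that] filtration.space_F[OF fl] by (auto simp: subalgebra_def)
    show "Measurable.pred (F s) (\<lambda>\<omega>. T \<omega> \<le> s)" using stopping_timeD[OF T] .
  qed
  have [measurable]: "gr N \<in> measurable (F r) (count_space UNIV)" for N
    unfolding gr_def
  proof (rule measurable_Least)
    fix i show "(\<lambda>\<omega>. T \<omega> \<le> r * real i / real (Suc N) \<or> Suc N \<le> i) \<in> measurable (F r) (count_space UNIV)"
    proof (cases "Suc N \<le> i")
      case False
      then have "Measurable.pred (F r) (\<lambda>\<omega>. T \<omega> \<le> r * real i / real (Suc N))" by (intro Tm le) simp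
      then show ?thesis using False by simp
    qed simp
  qed
  show ?thesis
  proof (rule borel_measurable_LIMSEQ_metric)
    fix N
    have "Y (r * real i / real (Suc N)) \<in> borel_measurable (F r)" if "i \<le> Suc N" for i
      using le[OF that] r by (intro Ym) auto
    then show "Z N \<in> borel_measurable (F r)" unfolding Z_def
      by (intro borel_measurable_sum measurable_If) auto
  next
    fix \<omega> assume "\<omega> \<in> space (F r)"
    then have w: "\<omega> \<in> \<Omega>" by (simp add: filtration.space_F[OF fl])
    define m where "m = min r (T \<omega>)"
    have close: "\<bar>r * real (gr N \<omega>) / real (Suc N) - m\<bar> \<le> r / real (Suc N)" for N
    proof -
      define i where "i = gr N \<omega>"
      have P: "T \<omega> \<le> r * real i / real (Suc N) \<or> i \<ge> Suc N"
        unfolding i_def gr_def by (rule LeastI[of _ "Suc N"]) simp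
      have "m \<le> r * real i / real (Suc N)"
        using P
      proof
        assume "i \<ge> Suc N"
        then have "i = Suc N" using grle[of N \<omega>] by (simp add: i_def)
        then show ?thesis by (simp add: m_def del: of_nat_Suc)
      qed (simp add: m_def)
      moreover have "r * real i / real (Suc N) \<le> m + r / real (Suc N)"
      proof (cases i)
        case 0
        then show ?thesis using T0[OF w] r by (simp add: m_def)
      next
        case (Suc j)
        then have "\<not> (T \<omega> \<le> r * real j / real (Suc N) \<or> j \<ge> Suc N)"
          using not_less_Least[of j] unfolding i_def gr_def by (metis lessI)
        then have "r * real j / real (Suc N) \<le> m" using le[of j N] by (auto simp: m_def)
        then show ?thesis using Suc by (simp add: add_divide_distrib distrib_left)
      qed
      ultimately show ?thesis by (simp add: i_def)
    qed
    have "(\<lambda>N. r * real (gr N \<omega>) / real (Suc N) - m) \<longlonglongrightarrow> 0"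
      by (rule tendsto_0_le[OF LIMSEQ_Suc[OF lim_const_over_n[of r]], of _ 1])
        (use close r in \<open>auto simp: abs_of_pos\<close>)
    then have "(\<lambda>N. r * real (gr N \<omega>) / real (Suc N)) \<longlonglongrightarrow> m" by (simp add: LIM_zero_iff)
    then have "(\<lambda>N. Y (r * real (gr N \<omega>) / real (Suc N)) \<omega>) \<longlonglongrightarrow> Y m \<omega>"
      by (rule continuous_on_tendsto_compose[OF c[OF w]]) (use r T0[OF w] in \<open>auto simp: m_def\<close>)
    then show "(\<lambda>N. Z N \<omega>) \<longlonglongrightarrow> Y (min r (T \<omega>)) \<omega>" by (simp add: Z m_def)
  qed
qed

section \<open>Hitting times of closed sets\<close>

lemma hitting_time:
  fixes G :: "'i \<Rightarrow> real \<Rightarrow> real"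
  assumes I: "finite I" and c: "\<And>i. i \<in> I \<Longrightarrow> continuous_on {0..} (G i)"
    and ne: "\<exists>i\<in>I. \<exists>s\<ge>0. 0 \<le> G i s"
  defines "T \<equiv> Inf {t. 0 \<le> t \<and> (\<exists>i\<in>I. 0 \<le> G i t)}"
  shows "0 \<le> T" "\<exists>i\<in>I. 0 \<le> G i T" "\<And>s i. 0 \<le> s \<Longrightarrow> s < T \<Longrightarrow> i \<in> I \<Longrightarrow> G i s < 0"
    "T \<le> t \<longleftrightarrow> (\<exists>i\<in>I. \<exists>s\<in>{0..t}. 0 \<le> G i s)"
proof -
  define S where "S = {t. 0 \<le> t \<and> (\<exists>i\<in>I. 0 \<le> G i t)}"
  have S: "S = (\<Union>i\<in>I. {t \<in> {0..}. 0 \<le> G i t})" by (auto simp: S_def)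
  have cl: "closed S" unfolding S
  proof (rule closed_UN[OF I], rule ballI)
    fix i assume "i \<in> I"
    then have "closed ({0..} \<inter> G i -` {0..})" by (intro continuous_closed_preimage c) auto
    moreover have "{0..} \<inter> G i -` {0..} = {t \<in> {0..}. 0 \<le> G i t}" by auto
    ultimately show "closed {t \<in> {0..}. 0 \<le> G i t}" by simp
  qed
  have bb: "bdd_below S" by (auto simp: S_def intro!: bdd_belowI[of _ 0])
  have nS: "S \<noteq> {}" using ne by (auto simp: S_def)
  \<comment> \<open>The set of times is closed, so the infimum is attained; all four claims rest on
    this.\<close>
  have TS: "T \<in> S" unfolding T_def S_def[symmetric] by (rule closed_contains_Inf[OF nS bb cl])
  then show "0 \<le> T" "\<exists>i\<in>I. 0 \<le> G i T" by (auto simp: S_def)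
  have Tle: "T \<le> s" if "s \<in> S" for s unfolding T_def S_def[symmetric] using cInf_lower[OF that bb] .
  show less: "G i s < 0" if "0 \<le> s" "s < T" "i \<in> I" for s i
    using Tle[of s] that by (force simp: S_def)
  show "T \<le> t \<longleftrightarrow> (\<exists>i\<in>I. \<exists>s\<in>{0..t}. 0 \<le> G i s)"
  proof
    assume "T \<le> t"
    moreover obtain i where "i \<in> I" "0 \<le> G i T" "0 \<le> T" using TS by (auto simp: S_def)
    ultimately show "\<exists>i\<in>I. \<exists>s\<in>{0..t}. 0 \<le> G i s" by (intro bexI[of _ i] bexI[of _ T]) auto
  next
    assume "\<exists>i\<in>I. \<exists>s\<in>{0..t}. 0 \<le> G i s"
    then obtain i s where "i \<in> I" "0 \<le> s" "s \<le> t" "0 \<le> G i s" by auto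
    then show "T \<le> t" using Tle[of s] by (force simp: S_def)
  qed
qed

text \<open>By continuity the level 0 is reached on [0, t] iff for every m some rational time gives
  a value above -1 / (m + 1): compactness provides a maximum, density provides the rational times.
  This replaces an uncountable union by countable operations.\<close>

lemma stopping_time_hitting:
  fixes G :: "'i \<Rightarrow> real \<Rightarrow> 'a \<Rightarrow> real"
  assumes fl: "filtration \<Omega> F" and I: "finite I"
    and c: "\<And>i \<omega>. i \<in> I \<Longrightarrow> \<omega> \<in> \<Omega> \<Longrightarrow> continuous_on {0..} (\<lambda>s. G i s \<omega>)"
    and ne: "\<And>\<omega>. \<omega> \<in> \<Omega> \<Longrightarrow> \<exists>i\<in>I. \<exists>s\<ge>0. 0 \<le> G i s \<omega>"
    and G: "\<And>i s. i \<in> I \<Longrightarrow> 0 \<le> s \<Longrightarrow> G i s \<in> borel_measurable (F s)"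
  shows "stopping_time F (\<lambda>\<omega>. Inf {t. 0 \<le> t \<and> (\<exists>i\<in>I. 0 \<le> G i t \<omega>)})"
proof (rule stopping_timeI)
  fix t :: real
  \<comment> \<open>Clamping the time to [0, t] lets \<open>q\<close> run through all rationals
    while only information up to time \<open>t\<close> enters.\<close>
  define f where "f = (\<lambda>i q \<omega>. G i (min t (max q 0)) \<omega>)"
  have eq: "Inf {t. 0 \<le> t \<and> (\<exists>i\<in>I. 0 \<le> G i t \<omega>)} \<le> t \<longleftrightarrow> 0 \<le> t \<and> (\<exists>i\<in>I. \<forall>m::nat. \<exists>q\<in>\<rat>. - 1 / real (Suc m) < f i q \<omega>)"
    if w: "\<omega> \<in> space (F t)" for \<omega>
  proof -
    have w: "\<omega> \<in> \<Omega>" using w by (simp add: filtration.space_F[OF fl])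
    have "(\<exists>s\<in>{0..t}. 0 \<le> G i s \<omega>) \<longleftrightarrow> 0 \<le> t \<and> (\<forall>m::nat. \<exists>q\<in>\<rat>. - 1 / real (Suc m) < f i q \<omega>)" if i: "i \<in> I" for i
    proof
      assume "\<exists>s\<in>{0..t}. 0 \<le> G i s \<omega>"
      then obtain s where s: "0 \<le> s" "s \<le> t" "0 \<le> G i s \<omega>" by auto
      have cf: "continuous_on UNIV (\<lambda>q. f i q \<omega>)"
        unfolding f_def by (rule continuous_on_compose2[OF c[OF i w]]) (use s in \<open>auto intro!: continuous_intros\<close>)
      have "\<exists>q\<in>\<rat>. - 1 / real (Suc m) < f i q \<omega>" for m
      proof -
        have "open ((\<lambda>q. f i q \<omega>) -` {- 1 / real (Suc m)<..})" using cf by (intro open_vimage) auto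
        moreover have "f i s \<omega> = G i s \<omega>" using s by (simp add: f_def)
        then have "s \<in> (\<lambda>q. f i q \<omega>) -` {- 1 / real (Suc m)<..}"
          using s by (auto intro: less_le_trans[of _ 0] simp: divide_less_0_iff)
        ultimately obtain e where e: "e > 0" "\<And>q. \<bar>q - s\<bar> < e \<Longrightarrow> - 1 / real (Suc m) < f i q \<omega>"
          by (auto simp: open_dist dist_real_def)
        obtain q where "q \<in> \<rat>" "s < q" "q < s + e" using Rats_dense_in_real[of s "s + e"] e by auto
        then show ?thesis using e(2)[of q] by (intro bexI[of _ q]) auto
      qed
      then show "0 \<le> t \<and> (\<forall>m::nat. \<exists>q\<in>\<rat>. - 1 / real (Suc m) < f i q \<omega>)" using s by auto
    next
      assume A: "0 \<le> t \<and> (\<forall>m::nat. \<exists>q\<in>\<rat>. - 1 / real (Suc m) < f i q \<omega>)"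
      have "continuous_on {0..t} (\<lambda>s. G i s \<omega>)" using c[OF i w] by (rule continuous_on_subset) auto
      then obtain x where x: "x \<in> {0..t}" "\<And>s. s \<in> {0..t} \<Longrightarrow> G i s \<omega> \<le> G i x \<omega>"
        using continuous_attains_sup[of "{0..t}" "\<lambda>s. G i s \<omega>"] A by auto
      have "- 1 / real (Suc m) < G i x \<omega>" for m
      proof -
        obtain q where "- 1 / real (Suc m) < f i q \<omega>" using A by blast
        then show ?thesis using x(2)[of "min t (max q 0)"] A by (simp add: f_def)
      qed
      then have lim: "0 \<le> G i x \<omega>"
      proof (intro LIMSEQ_le_const2[of "\<lambda>m. - 1 / real (Suc m)" 0])
        show "(\<lambda>m. - 1 / real (Suc m)) \<longlonglongrightarrow> 0" using LIMSEQ_Suc[OF lim_const_over_n[of "-1::real"]] by simp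
      qed (auto intro: less_imp_le)
      then show "\<exists>s\<in>{0..t}. 0 \<le> G i s \<omega>" using x by auto
    qed
    then show ?thesis
      using hitting_time(4)[where G = "\<lambda>i s. G i s \<omega>", OF I c[OF _ w] ne[OF w], of t] by auto
  qed
  have "Measurable.pred (F t) (\<lambda>\<omega>. 0 \<le> t \<and> (\<exists>i\<in>I. \<forall>m::nat. \<exists>q\<in>\<rat>. - 1 / real (Suc m) < f i q \<omega>))"
  proof (cases "0 \<le> t")
    case True
    have [measurable]: "f i q \<in> borel_measurable (F t)" if "i \<in> I" for i q
    proof -
      have "G i s \<in> borel_measurable (F t)" if "0 \<le> s" "s \<le> t" for s
        using measurable_from_subalg[of "F t" "F s"] G[OF \<open>i \<in> I\<close>] that filtration.sets_F_mono[OF fl] filtration.space_F[OF fl]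
        by (auto simp: subalgebra_def)
      then show ?thesis using True unfolding f_def by auto
    qed
    have "Measurable.pred (F t) (\<lambda>\<omega>. \<exists>q\<in>\<rat>. - 1 / real (Suc m) < f i q \<omega>)" if "i \<in> I" for i and m :: nat
    proof -
      have "(\<Union>q\<in>\<rat>. {\<omega> \<in> space (F t). - 1 / real (Suc m) < f i q \<omega>}) \<in> sets (F t)"
        using that by (intro sets.countable_UN'[OF countable_rat] subsetI) (auto intro!: borel_measurable_less)
      also have "(\<Union>q\<in>\<rat>. {\<omega> \<in> space (F t). - 1 / real (Suc m) < f i q \<omega>}) = {\<omega> \<in> space (F t). \<exists>q\<in>\<rat>. - 1 / real (Suc m) < f i q \<omega>}" by auto
      finally show ?thesis by (simp add: pred_def)
    qed
    then have "Measurable.pred (F t) (\<lambda>\<omega>. \<forall>m::nat. \<exists>q\<in>\<rat>. - 1 / real (Suc m) < f i q \<omega>)" if "i \<in> I" for i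
      using that by (intro pred_intros_countable)
    then have "Measurable.pred (F t) (\<lambda>\<omega>. \<exists>i\<in>I. \<forall>m::nat. \<exists>q\<in>\<rat>. - 1 / real (Suc m) < f i q \<omega>)"
      by (rule pred_intros_finite(4)[OF I])
    then show ?thesis using True by simp
  qed simp
  then show "Measurable.pred (F t) (\<lambda>\<omega>. Inf {t. 0 \<le> t \<and> (\<exists>i\<in>I. 0 \<le> G i t \<omega>)} \<le> t)"
    by (rule measurable_cong[THEN iffD1, rotated]) (use eq in auto)
qed

section \<open>The dipolar flow\<close>

definition cth :: "complex \<Rightarrow> complex" where
  "cth Z = cosh (Z / 2) / sinh (Z / 2)"

lemma Re_Im_sinh_cosh:
  "Re (sinh z) = sinh (Re z) * cos (Im z)" "Im (sinh z) = cosh (Re z) * sin (Im z)"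
  "Re (cosh z) = cosh (Re z) * cos (Im z)" "Im (cosh z) = sinh (Re z) * sin (Im z)"
  by (auto simp: sinh_field_def cosh_field_def Re_exp Im_exp field_simps)

lemma sinh_cosh_cnj: "sinh (cnj z) = cnj (sinh z)" "cosh (cnj z) = cnj (cosh z)"
  by (simp_all add: complex_eq_iff Re_Im_sinh_cosh)

lemma norm_sinh_complex: "(norm (sinh z))\<^sup>2 = (sinh (Re z))\<^sup>2 + (sin (Im z))\<^sup>2"
proof -
  have "(norm (sinh z))\<^sup>2 = (sinh (Re z))\<^sup>2 * (cos (Im z))\<^sup>2 + (1 + (sinh (Re z))\<^sup>2) * (sin (Im z))\<^sup>2"
    by (simp add: cmod_power2 Re_Im_sinh_cosh power_mult_distrib cosh_square_eq add.commute)
  also have "\<dots> = (sinh (Re z))\<^sup>2 * ((sin (Im z))\<^sup>2 + (cos (Im z))\<^sup>2) + (sin (Im z))\<^sup>2" by algebra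
  finally show ?thesis by simp
qed

lemma norm_sinh_ge: "\<bar>sin (Im z)\<bar> \<le> norm (sinh z)" "\<bar>sinh (Re z)\<bar> \<le> norm (sinh z)"
  by (rule power2_le_imp_le; simp add: norm_sinh_complex)+

text \<open>The flow is followed together with its complex conjugate, whence two strips.\<close>

definition dstrip :: "complex set" where "dstrip = {Z. 0 < \<bar>Im Z\<bar> \<and> \<bar>Im Z\<bar> \<le> pi}"

lemma strip_dstrip: "Z \<in> strip \<Longrightarrow> Z \<in> dstrip" "Z \<in> strip \<Longrightarrow> cnj Z \<in> dstrip"
  by (auto simp: strip_def dstrip_def)

lemma dstrip_sin: "Z \<in> dstrip \<Longrightarrow> sin (Im Z / 2) \<noteq> 0"
proof -
  assume Z: "Z \<in> dstrip"
  have "0 < sin (\<bar>Im Z\<bar> / 2)" using Z by (intro sin_gt_zero) (auto simp: dstrip_def)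
  then show ?thesis by (cases "Im Z \<ge> 0") (auto simp: abs_if)
qed

lemma sinh_half_nonzero: "Z \<in> dstrip \<Longrightarrow> sinh (Z / 2) \<noteq> 0"
  using dstrip_sin[of Z] norm_sinh_ge(1)[of "Z / 2"] by auto

lemma sinh_half_nonpos: "Z \<in> dstrip \<Longrightarrow> sinh (Z / 2) \<notin> \<real>\<^sub>\<le>\<^sub>0"
  using dstrip_sin[of Z] by (auto simp: complex_nonpos_Reals_iff Re_Im_sinh_cosh)

lemma sin_half_ge:
  assumes "0 < e" "e \<le> \<bar>Im Z\<bar>" "\<bar>Im Z\<bar> \<le> pi"
  shows "0 < sin (e / 2)" "sin (e / 2) \<le> norm (sinh (Z / 2))"
proof -
  show "0 < sin (e / 2)" using assms by (intro sin_gt_zero) auto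
  have "sin (e / 2) \<le> sin (\<bar>Im Z\<bar> / 2)" using assms by (intro sin_monotone_2pi_le) auto
  also have "\<dots> \<le> \<bar>sin (Im Z / 2)\<bar>" by (auto simp: abs_if)
  also have "\<dots> \<le> norm (sinh (Z / 2))" using norm_sinh_ge(1)[of "Z / 2"] by simp
  finally show "sin (e / 2) \<le> norm (sinh (Z / 2))" .
qed

lemma cth_square: "Z \<in> dstrip \<Longrightarrow> (cth Z)\<^sup>2 - 1 = 1 / (sinh (Z / 2))\<^sup>2"
  using sinh_half_nonzero[of Z] by (simp add: cth_def power_divide cosh_square_eq field_simps)

lemma cth_cnj: "cth (cnj Z) = cnj (cth Z)"
  using sinh_cosh_cnj[of "Z / 2"] by (simp add: cth_def)

lemma cth_minus_cnj: "cth (- cnj Z) = - cnj (cth Z)"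
  using cth_cnj[of Z] by (simp add: cth_def)

text \<open>From coth^2 = 1 + 1/sinh^2 and |sinh(Z/2)| \<ge> s = sin(e/2); the square root of 1 +
  1/s^2 is at most 1 + 1/s.\<close>

lemma cth_bound:
  assumes "0 < e" "e \<le> \<bar>Im Z\<bar>" "\<bar>Im Z\<bar> \<le> pi"
  shows "norm (cth Z) \<le> 1 + 1 / sin (e / 2)"
proof -
  define s where "s = sin (e / 2)"
  have s: "0 < s" "s \<le> norm (sinh (Z / 2))" using sin_half_ge[OF assms] by (auto simp: s_def)
  have "(cth Z)\<^sup>2 = 1 + 1 / (sinh (Z / 2))\<^sup>2"
    using cth_square[of Z] assms by (simp add: dstrip_def algebra_simps)
  then have "(norm (cth Z))\<^sup>2 \<le> 1 + 1 / (norm (sinh (Z / 2)))\<^sup>2"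
    by (metis norm_power norm_triangle_ineq norm_one norm_divide)
  also have "\<dots> \<le> 1 + 1 / s\<^sup>2" using s by (intro add_mono divide_left_mono power_mono mult_pos_pos zero_less_power) auto
  also have "\<dots> \<le> (1 + 1 / s)\<^sup>2" using s by (simp add: power2_sum power_divide)
  finally show ?thesis using s unfolding s_def[symmetric] by auto
qed

lemma cth_deriv:
  assumes "Z \<in> dstrip"
  shows "(cth has_field_derivative (- ((cth Z)\<^sup>2 - 1) / 2)) (at Z within S)"
proof -
  have s: "sinh (Z / 2) \<noteq> 0" using sinh_half_nonzero[OF assms] .
  have "((\<lambda>Z. cosh (Z / 2) / sinh (Z / 2)) has_field_derivative (- ((cth Z)\<^sup>2 - 1) / 2)) (at Z within S)"
    using s by (auto intro!: derivative_eq_intros simp: cth_def divide_simps power2_eq_square)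
  then show ?thesis by (simp add: cth_def[abs_def])
qed

text \<open>Addition theorems at A/2 and B/2. The second identity computes the derivative of sinh((A
  - B)/2) along the flow. It contains no division by sinh((A - B)/2), hence it is valid also for A =
  B.\<close>

lemma cth_diff:
  assumes "A \<in> dstrip" "B \<in> dstrip"
  shows "cosh ((A - B) / 2) = (cth A * cth B - 1) * (sinh (A / 2) * sinh (B / 2))"
    and "(cth A - cth B) * cosh ((A - B) / 2) = - sinh ((A - B) / 2) * (cth A * cth B - 1)"
proof -
  have s: "sinh (A / 2) \<noteq> 0" "sinh (B / 2) \<noteq> 0" using sinh_half_nonzero assms by auto
  have eq: "cosh (A / 2) = cth A * sinh (A / 2)" "cosh (B / 2) = cth B * sinh (B / 2)"
    using s by (simp_all add: cth_def)
  show 1: "cosh ((A - B) / 2) = (cth A * cth B - 1) * (sinh (A / 2) * sinh (B / 2))"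
    using eq by (simp add: diff_divide_distrib cosh_diff algebra_simps)
  have 2: "sinh ((A - B) / 2) = (cth B - cth A) * (sinh (A / 2) * sinh (B / 2))"
    using eq  by (simp add: diff_divide_distrib left_diff_distrib' sinh_diff)
  show "(cth A - cth B) * cosh ((A - B) / 2) = - sinh ((A - B) / 2) * (cth A * cth B - 1)"
    unfolding 1 2 by algebra
qed

text \<open>Multiplying by the conjugate of the denominator displays the signs. For heights between
  0 and pi the imaginary part is nonpositive, so heights decrease; the real part has the sign of
  \<open>Re Z\<close>, so points are pushed away from the driving point.\<close>

lemma cth_Re_Im:
  "Re (cth Z) = sinh (Re Z / 2) * cosh (Re Z / 2) / (norm (sinh (Z / 2)))\<^sup>2"
  "Im (cth Z) = - (sin (Im Z / 2) * cos (Im Z / 2)) / (norm (sinh (Z / 2)))\<^sup>2"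
proof -
  have eq: "cth Z = cosh (Z / 2) * cnj (sinh (Z / 2)) / of_real ((norm (sinh (Z / 2)))\<^sup>2)"
    using complex_div_cnj[of "cosh (Z / 2)" "sinh (Z / 2)"] by (simp add: cth_def)
  have "Re (cosh (Z / 2) * cnj (sinh (Z / 2))) = sinh (Re Z / 2) * cosh (Re Z / 2) * ((sin (Im Z / 2))\<^sup>2 + (cos (Im Z / 2))\<^sup>2)"
    unfolding power2_eq_square by (simp add: Re_Im_sinh_cosh del: sin_cos_squared_add) algebra
  then show "Re (cth Z) = sinh (Re Z / 2) * cosh (Re Z / 2) / (norm (sinh (Z / 2)))\<^sup>2"
    unfolding eq by (simp del: of_real_power)
  have "Im (cosh (Z / 2) * cnj (sinh (Z / 2))) = - (sin (Im Z / 2) * cos (Im Z / 2)) * ((cosh (Re Z / 2))\<^sup>2 - (sinh (Re Z / 2))\<^sup>2)"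
    by (simp add: Re_Im_sinh_cosh) algebra
  then show "Im (cth Z) = - (sin (Im Z / 2) * cos (Im Z / 2)) / (norm (sinh (Z / 2)))\<^sup>2"
    unfolding eq by (simp del: of_real_power add: cosh_square_eq)
qed

lemma Im_cth_nonpos: "0 \<le> Im Z \<Longrightarrow> Im Z \<le> pi \<Longrightarrow> Im (cth Z) \<le> 0"
  unfolding cth_Re_Im by (intro divide_nonpos_nonneg) (auto intro!: mult_nonneg_nonneg sin_ge_zero cos_ge_zero)

lemma Re_cth_nonneg: "0 \<le> Re Z \<Longrightarrow> 0 \<le> Re (cth Z)"
  unfolding cth_Re_Im by (intro divide_nonneg_nonneg mult_nonneg_nonneg) auto

text \<open>Since coth(x) - 1 = exp(-x) / sinh(x), the vector field tends to 1 at the right end,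
  whatever the height.\<close>

lemma cth_near_one:
  assumes "0 < Re Z"
  shows "norm (cth Z - 1) \<le> exp (- Re Z / 2) / sinh (Re Z / 2)"
proof -
  have s: "0 < sinh (Re Z / 2)" "sinh (Re Z / 2) \<le> norm (sinh (Z / 2))"
    using assms norm_sinh_ge(2)[of "Z / 2"] by auto
  then have nz: "sinh (Z / 2) \<noteq> 0" by auto
  have "cth Z - 1 = exp (- Z / 2) / sinh (Z / 2)"
    using nz by (simp add: cth_def divide_simps) (simp add: sinh_field_def cosh_field_def field_simps)
  then have "norm (cth Z - 1) = exp (- Re Z / 2) / norm (sinh (Z / 2))"
    by (simp add: norm_divide)
  also have "\<dots> \<le> exp (- Re Z / 2) / sinh (Re Z / 2)" using s by (intro divide_left_mono mult_pos_pos) auto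
  finally show ?thesis .
qed

text \<open>Cutting the vector field off below height \<open>e\<close> makes it globally Lipschitz.\<close>

definition clampi :: "real \<Rightarrow> complex \<Rightarrow> complex" where
  "clampi e u = Complex (Re u) (max e (min pi (Im u)))"

definition cthe :: "real \<Rightarrow> complex \<Rightarrow> complex" where
  "cthe e u = cth (clampi e u)"

lemma clampi_id: "e \<le> Im u \<Longrightarrow> Im u \<le> pi \<Longrightarrow> clampi e u = u"
  by (simp add: clampi_def complex_eq_iff)

lemma clampi_Im: "e \<le> pi \<Longrightarrow> e \<le> Im (clampi e u) \<and> Im (clampi e u) \<le> pi"
  by (auto simp: clampi_def)

lemma clampi_lipschitz: "norm (clampi e u - clampi e v) \<le> norm (u - v)"
proof -
  have "\<bar>max e (min pi (Im u)) - max e (min pi (Im v))\<bar> \<le> \<bar>Im u - Im v\<bar>" by (auto simp: max_def min_def)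
  then show ?thesis unfolding cmod_def clampi_def
    by (intro real_sqrt_le_mono add_mono) (auto simp: abs_le_square_iff)
qed

lemma cthe_bound: "0 < e \<Longrightarrow> e \<le> pi \<Longrightarrow> norm (cthe e u) \<le> 1 + 1 / sin (e / 2)"
  unfolding cthe_def using clampi_Im[of e u] by (intro cth_bound) auto

text \<open>Mean value inequality on the convex strip between the heights e and pi, where the
  derivative -(cth^2 - 1)/2 is controlled by the bound M on \<open>cth\<close>. Clamping itself does
  not increase distances.\<close>

lemma cthe_lipschitz:
  assumes "0 < e" "e \<le> pi"
  shows "norm (cthe e u - cthe e v) \<le> ((1 + 1 / sin (e / 2))\<^sup>2 + 1) * norm (u - v)"
proof -
  define M where "M = 1 + 1 / sin (e / 2)"
  define S where "S = {Z. e \<le> Im Z} \<inter> {Z. Im Z \<le> pi}"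
  have sub: "S \<subseteq> dstrip" using assms by (auto simp: S_def dstrip_def)
  have "convex S" unfolding S_def by (intro convex_Int convex_halfspace_Im_ge convex_halfspace_Im_le)
  then have "norm (cth (clampi e u) - cth (clampi e v)) \<le> (M\<^sup>2 + 1) * norm (clampi e u - clampi e v)"
  proof (rule field_differentiable_bound)
    fix Z assume Z: "Z \<in> S"
    then show "(cth has_field_derivative (- ((cth Z)\<^sup>2 - 1) / 2)) (at Z within S)" using sub by (intro cth_deriv) auto
    have "norm (cth Z) \<le> M" unfolding M_def using Z assms by (intro cth_bound) (auto simp: S_def)
    then have "(norm (cth Z))\<^sup>2 \<le> M\<^sup>2" by (intro power_mono) auto
    moreover have "norm (- ((cth Z)\<^sup>2 - 1) / 2) \<le> ((norm (cth Z))\<^sup>2 + 1) / 2"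
      using norm_triangle_ineq4[of "(cth Z)\<^sup>2" 1] by (simp add: norm_power norm_divide norm_minus_commute)
    ultimately show "norm (- ((cth Z)\<^sup>2 - 1) / 2) \<le> M\<^sup>2 + 1" using zero_le_power2[of "norm (cth Z)"] by argo
  qed (use clampi_Im[OF assms(2)] in \<open>auto simp: S_def\<close>)
  also have "\<dots> \<le> (M\<^sup>2 + 1) * norm (u - v)" using clampi_lipschitz by (intro mult_left_mono) auto
  finally show ?thesis unfolding cthe_def M_def .
qed

lemma continuous_cthe: "0 < e \<Longrightarrow> e \<le> pi \<Longrightarrow> continuous_on S (cthe e)"
proof (rule lipschitz_on_continuous_on)
  assume "0 < e" "e \<le> pi"
  then show "((1 + 1 / sin (e / 2))\<^sup>2 + 1)-lipschitz_on S (cthe e)"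
    using cthe_lipschitz by (intro lipschitz_onI) (auto simp: dist_norm)
qed

lemma cthe_borel: "0 < e \<Longrightarrow> e \<le> pi \<Longrightarrow> cthe e \<in> borel_measurable borel"
  using continuous_cthe[of e UNIV] by (rule borel_measurable_continuous_onI)

lemma cthe_eq: "e \<le> Im u \<Longrightarrow> Im u \<le> pi \<Longrightarrow> cthe e u = cth u"
  by (simp add: cthe_def clampi_id)

lemma Im_cthe_nonpos: "0 < e \<Longrightarrow> e \<le> pi \<Longrightarrow> Im (cthe e u) \<le> 0"
  unfolding cthe_def using clampi_Im[of e u] by (intro Im_cth_nonpos) auto

section \<open>The flow cut off at a fixed height\<close>

definition is_tf :: "(real \<Rightarrow> real) \<Rightarrow> real \<Rightarrow> complex \<Rightarrow> (real \<Rightarrow> complex) \<Rightarrow> bool" where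
  "is_tf \<xi> e u y \<longleftrightarrow> y 0 = u \<and> (\<forall>t\<ge>0. (y has_vector_derivative cthe e (y t - of_real (\<xi> t))) (at t within {0..}))"

text \<open>A solution is picked arbitrarily; by \<open>tf_unique\<close> the choice is immaterial
  at nonnegative times, for continuous driving functions.\<close>

definition tf :: "(real \<Rightarrow> real) \<Rightarrow> real \<Rightarrow> complex \<Rightarrow> real \<Rightarrow> complex" where
  "tf \<xi> e u = (SOME y. is_tf \<xi> e u y)"

definition Lc :: "real \<Rightarrow> real" where "Lc e = (1 + 1 / sin (e / 2))\<^sup>2 + 1"

lemma Lc_nonneg: "0 \<le> Lc e" by (simp add: Lc_def add_nonneg_nonneg)

text \<open>The factor \<open>c\<close> is 1 for the flow and -1 for the reversed flow that proves
  surjectivity.\<close>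

lemma cthe_ode_exists:
  assumes "continuous_on UNIV x" and e: "0 < e" "e \<le> pi" and c: "\<bar>c\<bar> \<le> (1::real)"
  obtains y where "y 0 = u" "\<And>t. 0 \<le> t \<Longrightarrow> (y has_vector_derivative c *\<^sub>R cthe e (y t - of_real (x t))) (at t within {0..})"
proof (rule global_ode_exists[where b = "\<lambda>t y. c *\<^sub>R cthe e (y - of_real (x t))" and L = "Lc e" and M = "1 + 1 / sin (e / 2)" and ?z0.0 = u])
  show "continuous_on UNIV (\<lambda>p. c *\<^sub>R cthe e (snd p - of_real (x (fst p))))"
    by (intro continuous_on_scaleR continuous_on_const continuous_on_compose2[OF continuous_cthe[OF e, of UNIV]] continuous_intros
        continuous_on_compose2[OF assms(1)]) auto
  fix s u v
  have "norm (c *\<^sub>R cthe e (u - of_real (x s)) - c *\<^sub>R cthe e (v - of_real (x s)))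
      = \<bar>c\<bar> * norm (cthe e (u - of_real (x s)) - cthe e (v - of_real (x s)))"
    by (simp flip: scaleR_diff_right)
  also have "\<dots> \<le> 1 * norm (cthe e (u - of_real (x s)) - cthe e (v - of_real (x s)))" using c by (intro mult_right_mono) auto
  also have "\<dots> \<le> Lc e * norm (u - v)" using cthe_lipschitz[OF e, of "u - of_real (x s)" "v - of_real (x s)"] by (simp add: Lc_def)
  finally show "norm (c *\<^sub>R cthe e (u - of_real (x s)) - c *\<^sub>R cthe e (v - of_real (x s))) \<le> Lc e * norm (u - v)" .
  have "norm (c *\<^sub>R cthe e (u - of_real (x s))) \<le> 1 * norm (cthe e (u - of_real (x s)))" 
    using c by (simp add: mult_le_cancel_right2)
  then show "norm (c *\<^sub>R cthe e (u - of_real (x s))) \<le> 1 + 1 / sin (e / 2)"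
    using cthe_bound[OF e, of "u - of_real (x s)"] by simp
qed (use that in auto)

lemma tf_is_tf:
  assumes x: "continuous_on {0..} \<xi>" and e: "0 < e" "e \<le> pi"
  shows "is_tf \<xi> e u (tf \<xi> e u)"
proof -
  have "continuous_on UNIV (\<lambda>s. \<xi> (max 0 s))" by (rule continuous_on_compose2[OF x]) (auto intro!: continuous_intros)
  from cthe_ode_exists[OF this e, of 1 u] obtain y where y: "y 0 = u"
    "\<And>t. 0 \<le> t \<Longrightarrow> (y has_vector_derivative 1 *\<^sub>R cthe e (y t - of_real (\<xi> (max 0 t)))) (at t within {0..})" by auto
  then have "is_tf \<xi> e u y" by (auto simp: is_tf_def)
  then show ?thesis unfolding tf_def by (simp add: someI)
qed

lemma
  assumes x: "continuous_on {0..} \<xi>" and e: "0 < e" "e \<le> pi"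
  shows tf_0: "tf \<xi> e u 0 = u"
    and tf_deriv: "0 \<le> t \<Longrightarrow> (tf \<xi> e u has_vector_derivative cthe e (tf \<xi> e u t - of_real (\<xi> t))) (at t within {0..})"
    and tf_deriv': "0 \<le> s \<Longrightarrow> s \<le> t \<Longrightarrow> (tf \<xi> e u has_vector_derivative cthe e (tf \<xi> e u s - of_real (\<xi> s))) (at s within {0..t})"
    and tf_cont: "continuous_on {0..} (tf \<xi> e u)"
proof -
  note T = tf_is_tf[OF x e, of u]
  show "tf \<xi> e u 0 = u" using T by (simp add: is_tf_def)
  show d: "(tf \<xi> e u has_vector_derivative cthe e (tf \<xi> e u t - of_real (\<xi> t))) (at t within {0..})" if "0 \<le> t" for t
    using T that by (simp add: is_tf_def)
  show "(tf \<xi> e u has_vector_derivative cthe e (tf \<xi> e u s - of_real (\<xi> s))) (at s within {0..t})" if "0 \<le> s" "s \<le> t"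
    using d[OF that(1)] by (rule has_vector_derivative_within_subset) auto
  show "continuous_on {0..} (tf \<xi> e u)"
    by (rule continuous_on_vector_derivative[where f' = "\<lambda>t. cthe e (tf \<xi> e u t - of_real (\<xi> t))"]) (use d in auto)
qed

lemma cthe_gronwall:
  assumes e: "0 < e" "e \<le> pi" and t: "0 \<le> t"
    and "\<And>s. 0 \<le> s \<Longrightarrow> s \<le> t \<Longrightarrow> (y1 has_vector_derivative cthe e (y1 s - of_real (\<xi> s))) (at s within {0..t})"
    and "\<And>s. 0 \<le> s \<Longrightarrow> s \<le> t \<Longrightarrow> (y2 has_vector_derivative cthe e (y2 s - of_real (\<xi> s))) (at s within {0..t})"
  shows "norm (y1 t - y2 t) \<le> exp (Lc e * t) * norm (y1 0 - y2 0)"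
proof (rule gronwall_difference[OF t assms(4,5)])
  show "norm (cthe e (y1 s - of_real (\<xi> s)) - cthe e (y2 s - of_real (\<xi> s))) \<le> Lc e * norm (y1 s - y2 s)" for s
    using cthe_lipschitz[OF e, of "y1 s - of_real (\<xi> s)" "y2 s - of_real (\<xi> s)"] by (simp add: Lc_def)
qed auto

lemma tf_unique:
  assumes x: "continuous_on {0..} \<xi>" and e: "0 < e" "e \<le> pi" and t: "0 \<le> t"
    and y: "\<And>s. 0 \<le> s \<Longrightarrow> s \<le> t \<Longrightarrow> (y has_vector_derivative cthe e (y s - of_real (\<xi> s))) (at s within {0..t})"
  shows "y t = tf \<xi> e (y 0) t"
  using cthe_gronwall[OF e t y tf_deriv'[OF x e, where u = "y 0"]] tf_0[OF x e] by simp

lemma tf_lipschitz: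
  assumes x: "continuous_on {0..} \<xi>" and e: "0 < e" "e \<le> pi" and t: "0 \<le> t"
  shows "norm (tf \<xi> e u t - tf \<xi> e v t) \<le> exp (Lc e * t) * norm (u - v)"
  using cthe_gronwall[OF e t tf_deriv'[OF x e, where u = u] tf_deriv'[OF x e, where u = v]] tf_0[OF x e] by simp

lemma Im_antimono:
  fixes y :: "real \<Rightarrow> complex"
  assumes "a \<le> b" and y: "\<And>s. a \<le> s \<Longrightarrow> s \<le> b \<Longrightarrow> (y has_vector_derivative f s) (at s within S)"
    and S: "{a..b} \<subseteq> S" and le: "\<And>s. a \<le> s \<Longrightarrow> s \<le> b \<Longrightarrow> Im (f s) \<le> 0"
  shows "Im (y b) \<le> Im (y a)"
proof (rule DERIV_nonpos_imp_decreasing_open[OF assms(1)])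
  have d: "(y has_vector_derivative f s) (at s within {a..b})" if "a \<le> s" "s \<le> b" for s
    using y[OF that] S by (rule has_vector_derivative_within_subset)
  have "continuous_on {a..b} y"
    by (rule continuous_on_vector_derivative) (use d in auto)
  then show "continuous_on {a..b} (\<lambda>s. Im (y s))" by (intro continuous_intros)
  fix s assume s: "a < s" "s < b"
  have "at s within {a..b} = at s" using s by (intro at_within_interior) (auto simp: interior_atLeastAtMost_real)
  then have "((\<lambda>s. Im (y s)) has_real_derivative Im (f s)) (at s)"
    using d[of s] s by (simp add: has_real_derivative_iff_has_vector_derivative has_vector_derivative_complex_iff)
  then show "\<exists>z. ((\<lambda>s. Im (y s)) has_real_derivative z) (at s) \<and> z \<le> 0" using le[of s] s by auto
qed

lemma tf_Im_antimono:
  assumes x: "continuous_on {0..} \<xi>" and e: "0 < e" "e \<le> pi" and t: "0 \<le> s" "s \<le> t"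
  shows "Im (tf \<xi> e u t) \<le> Im (tf \<xi> e u s)"
  by (rule Im_antimono[OF t(2) tf_deriv[OF x e]]) (use t e in \<open>auto intro!: Im_cthe_nonpos\<close>)

lemma dipolar_solution_deriv:
  "dipolar_solution \<xi> u T y \<Longrightarrow> 0 \<le> t \<Longrightarrow> ereal t < T \<Longrightarrow>
     (y has_vector_derivative cth (y t - of_real (\<xi> t))) (at t within {0..})"
  by (simp add: dipolar_solution_def cth_def)

lemma dipolar_solution_Im:
  assumes sol: "dipolar_solution \<xi> u T y" and t: "0 \<le> s" "s \<le> t" "ereal t < T"
  shows "Im (y t) \<le> Im (y s)"
proof (rule Im_antimono[OF t(2)])
  fix r assume r: "s \<le> r" "r \<le> t"
  then have rT: "ereal r < T" using t(3) by (metis ereal_less_eq(3) le_less_trans)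
  show "(y has_vector_derivative cth (y r - of_real (\<xi> r))) (at r within {0..})"
    using dipolar_solution_deriv[OF sol] rT r t by auto
  have "y r \<in> strip" using sol rT r t by (auto simp: dipolar_solution_def)
  then show "Im (cth (y r - of_real (\<xi> r))) \<le> 0" by (intro Im_cth_nonpos) (auto simp: strip_def)
qed (use t in auto)

text \<open>Heights decrease, so a solution that is at least at height \<open>e\<close> at time
  \<open>t\<close> has been so from the start, where the cut-off field and the original one agree.
  Lipschitz uniqueness does the rest.\<close>

lemma dipolar_solution_tf:
  assumes x: "continuous_on {0..} \<xi>" and sol: "dipolar_solution \<xi> u T y"
    and t: "0 \<le> t" "ereal t < T" and e: "0 < e" "e \<le> Im (y t)"
  shows "y t = tf \<xi> e u t"
proof -
  have yt: "y t \<in> strip" using sol t by (auto simp: dipolar_solution_def)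
  then have e': "e \<le> pi" using e by (auto simp: strip_def)
  have "y t = tf \<xi> e (y 0) t"
  proof (rule tf_unique[OF x e(1) e' t(1)])
    fix s assume s: "0 \<le> s" "s \<le> t"
    then have sT: "ereal s < T" using t(2) by (metis ereal_less_eq(3) le_less_trans)
    have "y s \<in> strip" using sol s sT by (auto simp: dipolar_solution_def)
    then have "cthe e (y s - of_real (\<xi> s)) = cth (y s - of_real (\<xi> s))"
      using dipolar_solution_Im[OF sol s t(2)] e by (intro cthe_eq) (auto simp: strip_def)
    then show "(y has_vector_derivative cthe e (y s - of_real (\<xi> s))) (at s within {0..t})"
      using dipolar_solution_deriv[OF sol s(1) sT] by (auto intro: has_vector_derivative_within_subset)
  qed
  then show ?thesis using sol by (simp add: dipolar_solution_def)
qed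

text \<open>Conversely, a cut-off path that has not fallen below the cut-off solves the dipolar
  equation. A strict inequality at time \<open>t\<close> persists for a short while, which gives a
  lifetime strictly beyond \<open>t\<close>.\<close>

lemma tf_dipolar_solution:
  assumes x: "continuous_on {0..} \<xi>" and e: "0 < e" and u: "u \<in> strip"
    and t: "0 \<le> t" "e \<le> Im (tf \<xi> e u t)" and pi: "e \<le> pi"
  shows "dipolar_solution \<xi> u (ereal t) (tf \<xi> e u)"
    and "e < Im (tf \<xi> e u t) \<Longrightarrow> \<exists>t'>t. dipolar_solution \<xi> u (ereal t') (tf \<xi> e u)"
proof -
  have *: "dipolar_solution \<xi> u (ereal t') (tf \<xi> e u)" if t': "0 \<le> t'" "e \<le> Im (tf \<xi> e u t')" for t'
    unfolding dipolar_solution_def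
  proof (intro conjI allI impI)
    show "tf \<xi> e u 0 = u" by (rule tf_0[OF x e pi])
    fix s assume s: "0 \<le> s \<and> ereal s < ereal t'"
    have I: "e \<le> Im (tf \<xi> e u s)" using tf_Im_antimono[OF x e pi, of s t' u] s t' by auto
    have I2: "Im (tf \<xi> e u s) \<le> Im u" using tf_Im_antimono[OF x e pi, of 0 s u] s tf_0[OF x e pi] by auto
    show "tf \<xi> e u s \<in> strip" using I I2 u e by (auto simp: strip_def)
    have "cthe e (tf \<xi> e u s - of_real (\<xi> s)) = cth (tf \<xi> e u s - of_real (\<xi> s))"
      using I I2 u by (intro cthe_eq) (auto simp: strip_def)
    then show "(tf \<xi> e u has_vector_derivative cosh ((tf \<xi> e u s - of_real (\<xi> s)) / 2) / sinh ((tf \<xi> e u s - of_real (\<xi> s)) / 2)) (at s within {0..})"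
      using tf_deriv[OF x e pi, of s u] s by (simp add: cth_def)
  qed
  show "dipolar_solution \<xi> u (ereal t) (tf \<xi> e u)" using * t by auto
  assume l: "e < Im (tf \<xi> e u t)"
  have "continuous_on {0..} (\<lambda>s. Im (tf \<xi> e u s))" using tf_cont[OF x e pi, of u] by (intro continuous_intros)
  then obtain d where d: "d > 0" "\<And>s. 0 \<le> s \<Longrightarrow> dist s t < d \<Longrightarrow> dist (Im (tf \<xi> e u s)) (Im (tf \<xi> e u t)) < Im (tf \<xi> e u t) - e"
    using l t unfolding continuous_on_iff by (metis atLeast_iff diff_gt_0_iff_gt)
  have "e \<le> Im (tf \<xi> e u (t + d/2))" using d(2)[of "t + d/2"] d(1) t by (auto simp: dist_real_def abs_less_iff)
  then show "\<exists>t'>t. dipolar_solution \<xi> u (ereal t') (tf \<xi> e u)"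
    using * t d(1) by (intro exI[of _ "t + d/2"]) auto
qed

text \<open>The choice of \<open>e\<close> is irrelevant: a path that stays above height \<open>e\<close> does not feel a lower cut-off.\<close>

definition alive :: "(real \<Rightarrow> real) \<Rightarrow> real \<Rightarrow> complex set" where
  "alive \<xi> t = {u \<in> strip. \<exists>e. 0 < e \<and> e \<le> pi \<and> e < Im (tf \<xi> e u t)}"

definition fl :: "(real \<Rightarrow> real) \<Rightarrow> real \<Rightarrow> complex \<Rightarrow> complex" where
  "fl \<xi> t u = tf \<xi> (SOME e. 0 < e \<and> e \<le> pi \<and> e < Im (tf \<xi> e u t)) u t"

lemma tf_decrease_e:
  assumes x: "continuous_on {0..} \<xi>" and e: "0 < e'" "e' \<le> e" "e \<le> pi" and u: "u \<in> strip"
    and t: "0 \<le> t" "e \<le> Im (tf \<xi> e u t)"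
  shows "tf \<xi> e' u t = tf \<xi> e u t"
proof -
  have e0: "0 < e" using e by simp
  have "tf \<xi> e u t = tf \<xi> e' (tf \<xi> e u 0) t"
  proof (rule tf_unique[OF x e(1) _ t(1)])
    show "e' \<le> pi" using e by simp
    fix s assume s: "0 \<le> s" "s \<le> t"
    have I: "e \<le> Im (tf \<xi> e u s)" using tf_Im_antimono[OF x e0 e(3) s, of u] t by auto
    have I2: "Im (tf \<xi> e u s) \<le> Im u" using tf_Im_antimono[OF x e0 e(3), of 0 s u] s tf_0[OF x e0 e(3)] by auto
    have "cthe e' (tf \<xi> e u s - of_real (\<xi> s)) = cthe e (tf \<xi> e u s - of_real (\<xi> s))"
      using I I2 u e by (auto simp: strip_def cthe_eq)
    then show "(tf \<xi> e u has_vector_derivative cthe e' (tf \<xi> e u s - of_real (\<xi> s))) (at s within {0..t})"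
      using tf_deriv'[OF x e0 e(3) s] by simp
  qed
  then show ?thesis using tf_0[OF x e0 e(3)] by simp
qed

lemma fl_eq:
  assumes x: "continuous_on {0..} \<xi>" and e: "0 < e" "e \<le> pi" and u: "u \<in> strip"
    and t: "0 \<le> t" "e < Im (tf \<xi> e u t)"
  shows "fl \<xi> t u = tf \<xi> e u t"
proof -
  define e' where "e' = (SOME e. 0 < e \<and> e \<le> pi \<and> e < Im (tf \<xi> e u t))"
  have e': "0 < e' \<and> e' \<le> pi \<and> e' < Im (tf \<xi> e' u t)" unfolding e'_def by (rule someI[of _ e]) (use e t in auto)
  have "tf \<xi> e' u t = tf \<xi> e u t"
    using tf_decrease_e[OF x e(1) _ _ u t(1), of e'] tf_decrease_e[OF x _ _ e(2) u t(1), of e'] e' e t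
    by argo
  then show ?thesis by (simp add: fl_def e'_def)
qed

text \<open>One height \<open>e\<close>, chosen at time \<open>t\<close>, serves the whole interval
  [0, t] because heights decrease.\<close>

lemma alive_obtain:
  assumes x: "continuous_on {0..} \<xi>" and u: "u \<in> alive \<xi> t" and t: "0 \<le> t"
  obtains e where "0 < e" "e \<le> pi" "u \<in> strip" "e < Im (tf \<xi> e u t)" "fl \<xi> t u = tf \<xi> e u t"
    "\<And>s. 0 \<le> s \<Longrightarrow> s \<le> t \<Longrightarrow> e < Im (tf \<xi> e u s) \<and> Im (tf \<xi> e u s) < pi"
    "\<And>s. 0 \<le> s \<Longrightarrow> s \<le> t \<Longrightarrow> (tf \<xi> e u has_vector_derivative cth (tf \<xi> e u s - of_real (\<xi> s))) (at s within {0..t})"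
proof -
  obtain e where e: "0 < e" "e \<le> pi" "u \<in> strip" "e < Im (tf \<xi> e u t)" using u by (auto simp: alive_def)
  have I: "e < Im (tf \<xi> e u s) \<and> Im (tf \<xi> e u s) < pi" if "0 \<le> s" "s \<le> t" for s
    using tf_Im_antimono[OF x e(1,2), of 0 s u] tf_Im_antimono[OF x e(1,2) that, of u] e that tf_0[OF x e(1,2)]
    by (auto simp: strip_def)
  have "(tf \<xi> e u has_vector_derivative cth (tf \<xi> e u s - of_real (\<xi> s))) (at s within {0..t})" if "0 \<le> s" "s \<le> t" for s
    using tf_deriv'[OF x e(1,2) that, of u] I[OF that] by (simp add: cthe_eq less_imp_le)
  then show thesis using that[OF e(1-4) fl_eq[OF x e(1-3) t e(4)] I] by blast
qed

text \<open>The abstract flow is known only through its equation and the maximality of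
  \<open>\<tau>\<close>; here it is identified with the concrete \<open>fl\<close> on
  \<open>alive\<close>. Maximality is applied to the slightly longer lifetime given by
  \<open>tf_dipolar_solution\<close>.\<close>

lemma dipolar_flow_alive:
  assumes x: "continuous_on {0..} \<xi>" and fw: "dipolar_flow \<xi> D \<psi>\<^sub>0 \<psi> \<tau>"
    and z: "z \<in> D" "\<psi>\<^sub>0 z \<in> strip" and t: "0 \<le> t"
  shows "ereal t < \<tau> z \<longleftrightarrow> \<psi>\<^sub>0 z \<in> alive \<xi> t" and "ereal t < \<tau> z \<Longrightarrow> \<psi> t z = fl \<xi> t (\<psi>\<^sub>0 z)"
proof -
  have sol: "dipolar_solution \<xi> (\<psi>\<^sub>0 z) (\<tau> z) (\<lambda>t. \<psi> t z)" and mx: "\<And>T y. dipolar_solution \<xi> (\<psi>\<^sub>0 z) T y \<Longrightarrow> T \<le> \<tau> z"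
    using fw z by (auto simp: dipolar_flow_def)
  have *: "\<psi>\<^sub>0 z \<in> alive \<xi> t \<and> \<psi> t z = fl \<xi> t (\<psi>\<^sub>0 z)" if l: "ereal t < \<tau> z"
  proof -
    have st: "\<psi> t z \<in> strip" using sol t l by (auto simp: dipolar_solution_def)
    define e where "e = Im (\<psi> t z) / 2"
    have e: "0 < e" "e \<le> pi" "e < Im (\<psi> t z)" using st by (auto simp: e_def strip_def)
    have eq: "\<psi> t z = tf \<xi> e (\<psi>\<^sub>0 z) t" using dipolar_solution_tf[OF x sol t l e(1)] e by simp
    then show ?thesis using fl_eq[OF x e(1,2) z(2) t] e z by (auto simp: alive_def)
  qed
  show "ereal t < \<tau> z \<Longrightarrow> \<psi> t z = fl \<xi> t (\<psi>\<^sub>0 z)" using * by blast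
  show "ereal t < \<tau> z \<longleftrightarrow> \<psi>\<^sub>0 z \<in> alive \<xi> t"
  proof
    assume "\<psi>\<^sub>0 z \<in> alive \<xi> t"
    then obtain e where e: "0 < e" "e \<le> pi" "\<psi>\<^sub>0 z \<in> strip" "e < Im (tf \<xi> e (\<psi>\<^sub>0 z) t)" by (auto simp: alive_def)
    then obtain t' where "t' > t" "dipolar_solution \<xi> (\<psi>\<^sub>0 z) (ereal t') (tf \<xi> e (\<psi>\<^sub>0 z))"
      using tf_dipolar_solution(2)[OF x e(1,3) t _ e(2)] by auto
    then show "ereal t < \<tau> z" using mx by (metis ereal_less(2) less_ereal.simps(1) less_le_trans)
  qed (use * in auto)
qed

section \<open>Differences, derivative and range of the flow\<close>

lemma has_vector_derivative_chain:
  assumes "(f has_vector_derivative f') (at s within S)" "(g has_field_derivative g') (at (f s))"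
  shows "((\<lambda>s. g (f s)) has_vector_derivative f' * g') (at s within S)"
  using field_vector_diff_chain_within[OF assms(1) has_field_derivative_at_within[OF assms(2)]]
  by (simp add: comp_def)

lemma cth_path_continuous:
  assumes y: "continuous_on S y" and x: "continuous_on S \<xi>"
    and d: "\<And>s. s \<in> S \<Longrightarrow> y s - of_real (\<xi> s) \<in> dstrip"
  shows "continuous_on S (\<lambda>s. cth (y s - of_real (\<xi> s)))"
proof (rule continuous_on_compose2[of dstrip cth])
  show "continuous_on dstrip cth"
    by (rule DERIV_continuous_on) (rule cth_deriv)
  show "continuous_on S (\<lambda>s. y s - of_real (\<xi> s))" by (intro continuous_intros y x)
qed (use d in auto)

text \<open>By \<open>cth_diff\<close> the logarithmic derivative of sinh((y1 - y2)/2) is -(c1 c2 -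
  1)/2, where c1 and c2 are the velocities. To include a vanishing sinh, the product
  \<open>Q\<close> with the integrating factor is shown to be constant.\<close>

lemma sinh_half_diff:
  fixes y1 y2 :: "real \<Rightarrow> complex"
  assumes t: "0 \<le> t" and x: "continuous_on {0..} \<xi>"
    and y1: "\<And>s. 0 \<le> s \<Longrightarrow> s \<le> t \<Longrightarrow> (y1 has_vector_derivative cth (y1 s - of_real (\<xi> s))) (at s within {0..t})"
    and y2: "\<And>s. 0 \<le> s \<Longrightarrow> s \<le> t \<Longrightarrow> (y2 has_vector_derivative cth (y2 s - of_real (\<xi> s))) (at s within {0..t})"
    and d1: "\<And>s. 0 \<le> s \<Longrightarrow> s \<le> t \<Longrightarrow> y1 s - of_real (\<xi> s) \<in> dstrip"
    and d2: "\<And>s. 0 \<le> s \<Longrightarrow> s \<le> t \<Longrightarrow> y2 s - of_real (\<xi> s) \<in> dstrip"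
  shows "sinh ((y1 t - y2 t) / 2) = sinh ((y1 0 - y2 0) / 2) *
     exp (- (1/2) * integral {0..t} (\<lambda>s. cth (y1 s - of_real (\<xi> s)) * cth (y2 s - of_real (\<xi> s)) - 1))"
proof -
  define k where "k = (\<lambda>s. cth (y1 s - of_real (\<xi> s)) * cth (y2 s - of_real (\<xi> s)) - 1)"
  define J where "J = (\<lambda>s. integral {0..s} k)"
  define Q where "Q = (\<lambda>s. sinh ((y1 s - y2 s) / 2) * exp (J s / 2))"
  have x': "continuous_on {0..t} \<xi>" using x by (rule continuous_on_subset) auto
  have cy: "continuous_on {0..t} y1" "continuous_on {0..t} y2"
    by (rule continuous_on_vector_derivative, use y1 in auto) (rule continuous_on_vector_derivative, use y2 in auto)
  have kc: "continuous_on {0..t} k" unfolding k_def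
    by (intro continuous_intros cth_path_continuous cy x') (use d1 d2 in auto)
  have Jd: "(J has_vector_derivative k s) (at s within {0..t})" if "0 \<le> s" "s \<le> t" for s
    unfolding J_def using integral_has_vector_derivative[OF kc, of s] that by simp
  have Q': "(Q has_vector_derivative 0) (at s within {0..t})" if s: "0 \<le> s" "s \<le> t" for s
  proof -
    define c1 where "c1 = cth (y1 s - of_real (\<xi> s))"
    define c2 where "c2 = cth (y2 s - of_real (\<xi> s))"
    have 1: "((\<lambda>s. (y1 s - y2 s) / 2) has_vector_derivative (c1 - c2) / 2) (at s within {0..t})"
      unfolding c1_def c2_def by (intro has_vector_derivative_divide has_vector_derivative_diff y1 y2 s)
    have 2: "((\<lambda>s. sinh ((y1 s - y2 s) / 2)) has_vector_derivative (c1 - c2) / 2 * cosh ((y1 s - y2 s) / 2)) (at s within {0..t})"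
      by (rule has_vector_derivative_chain[OF 1]) (auto intro!: derivative_eq_intros)
    have 3: "((\<lambda>s. J s / 2) has_vector_derivative k s / 2) (at s within {0..t})"
      by (intro has_vector_derivative_divide Jd s)
    have 4: "((\<lambda>s. exp (J s / 2)) has_vector_derivative k s / 2 * exp (J s / 2)) (at s within {0..t})"
      by (rule has_vector_derivative_chain[OF 3]) (auto intro!: derivative_eq_intros)
    have "(c1 - c2) * cosh ((y1 s - y2 s) / 2) = - sinh ((y1 s - y2 s) / 2) * k s"
      using cth_diff(2)[OF d1[OF s] d2[OF s]] by (simp add: c1_def c2_def k_def)
    then have "exp (J s / 2) / 2 * (sinh ((y1 s - y2 s) / 2) * k s + (c1 - c2) * cosh ((y1 s - y2 s) / 2)) = 0"
      by simp
    then have "sinh ((y1 s - y2 s) / 2) * (k s / 2 * exp (J s / 2)) + (c1 - c2) / 2 * cosh ((y1 s - y2 s) / 2) * exp (J s / 2) = 0"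
      by (simp add: field_simps)
    then show ?thesis unfolding Q_def using has_vector_derivative_mult[OF 2 4] by simp
  qed
  have "\<exists>c. \<forall>s\<in>{0..t}. Q s = c"
    by (rule has_vector_derivative_zero_constant[of "{0..t}" Q]) (use Q' in auto)
  then have "Q t = Q 0" using t by auto
  then have "sinh ((y1 t - y2 t) / 2) * exp (J t / 2) = sinh ((y1 0 - y2 0) / 2)" by (simp add: Q_def J_def)
  then have "sinh ((y1 t - y2 t) / 2) = sinh ((y1 0 - y2 0) / 2) * exp (- (J t / 2))"
    by (metis (no_types, lifting) exp_minus_inverse mult.assoc mult.right_neutral)
  then show ?thesis by (simp add: J_def k_def)
qed

lemma alive_path:
  assumes x: "continuous_on {0..} \<xi>" and u: "u \<in> alive \<xi> t" and s: "0 \<le> s" "s \<le> t"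
  shows "u \<in> alive \<xi> s" "fl \<xi> s u \<in> strip" "fl \<xi> 0 u = u" "u \<in> strip"
    "((\<lambda>s. fl \<xi> s u) has_vector_derivative cth (fl \<xi> s u - of_real (\<xi> s))) (at s within {0..t})"
    "fl \<xi> s u - of_real (\<xi> s) \<in> strip"
proof -
  have t: "0 \<le> t" using s by simp
  obtain e where e: "0 < e" "e \<le> pi" "u \<in> strip" "e < Im (tf \<xi> e u t)" "fl \<xi> t u = tf \<xi> e u t"
    "\<And>s. 0 \<le> s \<Longrightarrow> s \<le> t \<Longrightarrow> e < Im (tf \<xi> e u s) \<and> Im (tf \<xi> e u s) < pi"
    "\<And>s. 0 \<le> s \<Longrightarrow> s \<le> t \<Longrightarrow> (tf \<xi> e u has_vector_derivative cth (tf \<xi> e u s - of_real (\<xi> s))) (at s within {0..t})"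
    using alive_obtain[OF x u t] by metis
  have eq: "fl \<xi> r u = tf \<xi> e u r" if "0 \<le> r" "r \<le> t" for r
    using fl_eq[OF x e(1-3) that(1)] e(6)[OF that] by simp
  show "u \<in> alive \<xi> s" using e s by (auto simp: alive_def)
  show "fl \<xi> s u \<in> strip" "fl \<xi> s u - of_real (\<xi> s) \<in> strip" using eq[OF s] e(1) e(6)[OF s] by (auto simp: strip_def)
  show "u \<in> strip" by fact
  show "fl \<xi> 0 u = u" using eq[of 0] t tf_0[OF x e(1,2)] by simp
  have "((\<lambda>s. fl \<xi> s u) has_vector_derivative cth (tf \<xi> e u s - of_real (\<xi> s))) (at s within {0..t})"
    by (rule has_vector_derivative_transform[OF _ _ e(7)[OF s]]) (use eq s in auto)
  then show "((\<lambda>s. fl \<xi> s u) has_vector_derivative cth (fl \<xi> s u - of_real (\<xi> s))) (at s within {0..t})"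
    using eq[OF s] by simp
qed

text \<open>Lipschitz dependence on the starting point over a bounded time interval: one height
  \<open>e\<close> and one constant \<open>K\<close> serve all starting points near
  \<open>u0\<close>.\<close>

lemma alive_nbhd:
  assumes x: "continuous_on {0..} \<xi>" and u0: "u0 \<in> alive \<xi> t" and t: "0 \<le> t"
  obtains e d K where "0 < e" "e \<le> pi" "0 < d" "0 \<le> K"
    "\<And>u. dist u u0 < d \<Longrightarrow> u \<in> alive \<xi> t"
    "\<And>u s. dist u u0 < d \<Longrightarrow> 0 \<le> s \<Longrightarrow> s \<le> t \<Longrightarrow> e < Im (fl \<xi> s u) \<and> Im (fl \<xi> s u) < pi \<and> norm (fl \<xi> s u - fl \<xi> s u0) \<le> K * norm (u - u0)"
proof -
  obtain e where e: "0 < e" "e \<le> pi" "u0 \<in> strip" "e < Im (tf \<xi> e u0 t)"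
    using alive_obtain[OF x u0 t] by metis
  define K where "K = exp (Lc e * t)"
  have lip: "norm (tf \<xi> e u s - tf \<xi> e u0 s) \<le> K * norm (u - u0)" if "0 \<le> s" "s \<le> t" for u s
  proof -
    have "exp (Lc e * s) \<le> K" using that Lc_nonneg[of e] by (auto simp: K_def intro: mult_left_mono)
    then show ?thesis using tf_lipschitz[OF x e(1,2) that(1), of u u0] by (meson mult_right_mono norm_ge_zero order_trans)
  qed
  have so: "open strip" 
    unfolding strip_def by (intro open_Collect_conj open_halfspace_Im_gt open_halfspace_Im_lt)
  then obtain d1 where d1: "d1 > 0" "\<And>u. dist u u0 < d1 \<Longrightarrow> u \<in> strip" using e(3) by (auto simp: open_dist)
  define d where "d = min d1 ((Im (tf \<xi> e u0 t) - e) / K)"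
  have K: "K > 0" by (simp add: K_def)
  have d: "d > 0" using d1 e K by (simp add: d_def)
  have A: "u \<in> strip" "e < Im (tf \<xi> e u t)" if "dist u u0 < d" for u
  proof -
    show "u \<in> strip" using d1 that by (simp add: d_def)
    have "K * norm (u - u0) < Im (tf \<xi> e u0 t) - e" using that K by (simp add: d_def dist_norm field_simps)
    then have "norm (tf \<xi> e u t - tf \<xi> e u0 t) < Im (tf \<xi> e u0 t) - e" using lip[OF t order_refl, of u] by simp
    then show "e < Im (tf \<xi> e u t)" using abs_Im_le_cmod[of "tf \<xi> e u t - tf \<xi> e u0 t"] by simp
  qed
  have B: "e < Im (tf \<xi> e u s)" "Im (tf \<xi> e u s) < pi" "fl \<xi> s u = tf \<xi> e u s" if "dist u u0 < d" "0 \<le> s" "s \<le> t" for u s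
  proof -
    show 1: "e < Im (tf \<xi> e u s)" using tf_Im_antimono[OF x e(1,2) that(2,3), of u] A[OF that(1)] by simp
    show "Im (tf \<xi> e u s) < pi"
      using tf_Im_antimono[OF x e(1,2), of 0 s u] A[OF that(1)] that tf_0[OF x e(1,2)] by (simp add: strip_def)
    show "fl \<xi> s u = tf \<xi> e u s" using fl_eq[OF x e(1,2) A(1)[OF that(1)] that(2) 1] .
  qed
  show thesis
  proof (rule that[OF e(1,2) d, of K])
    show "0 \<le> K" using K by simp
    show "u \<in> alive \<xi> t" if "dist u u0 < d" for u using A[OF that] e by (auto simp: alive_def)
    show "e < Im (fl \<xi> s u) \<and> Im (fl \<xi> s u) < pi \<and> norm (fl \<xi> s u - fl \<xi> s u0) \<le> K * norm (u - u0)"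
      if "dist u u0 < d" "0 \<le> s" "s \<le> t" for u s
      using B[OF that] B[of u0 s] that d lip[OF that(2,3), of u] by simp
  qed
qed

lemma sinh_eq_0_small: "sinh z = 0 \<Longrightarrow> \<bar>Im z\<bar> < pi \<Longrightarrow> z = (0::complex)"
proof -
  assume "sinh z = 0" and i: "\<bar>Im z\<bar> < pi"
  then have "(sinh (Re z))\<^sup>2 + (sin (Im z))\<^sup>2 = 0" using norm_sinh_complex[of z] by simp
  then have "sinh (Re z) = 0" "sin (Im z) = 0" by (auto simp: sum_power2_eq_zero_iff)
  then show "z = 0" using i sin_eq_0_pi[of "Im z"] by (auto simp: complex_eq_iff abs_less_iff)
qed

lemma sinh_half_strip_eq_0: 
  assumes "u \<in> strip" "v \<in> strip" "sinh ((u - v) / 2) = 0"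
  shows "u = v"
proof -
  have "\<bar>Im ((u - v) / 2)\<bar> < pi" using assms(1,2) unfolding strip_def by simp linarith
  then have "(u - v) / 2 = 0" by (rule sinh_eq_0_small[OF assms(3)])
  then show ?thesis by simp
qed

lemma sinh_over_id: "((\<lambda>z. sinh z / z) \<longlongrightarrow> (1::complex)) (at 0)"
proof -
  have "(sinh has_field_derivative cosh 0) (at (0::complex))" by (auto intro!: derivative_eq_intros)
  then show ?thesis by (simp add: has_field_derivative_iff)
qed

lemma fl_sinh:
  assumes x: "continuous_on {0..} \<xi>" and u: "u \<in> alive \<xi> t" "v \<in> alive \<xi> t" and t: "0 \<le> t"
  shows "sinh ((fl \<xi> t u - fl \<xi> t v) / 2) = sinh ((u - v) / 2) *
     exp (- (1/2) * integral {0..t} (\<lambda>s. cth (fl \<xi> s u - of_real (\<xi> s)) * cth (fl \<xi> s v - of_real (\<xi> s)) - 1))"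
  using sinh_half_diff[OF t x alive_path(5)[OF x u(1)] alive_path(5)[OF x u(2)] strip_dstrip(1) strip_dstrip(1),
      OF _ _ _ _ alive_path(6)[OF x u(1)] alive_path(6)[OF x u(2)]]
    alive_path(3)[OF x u(1) t order_refl] alive_path(3)[OF x u(2) t order_refl] by simp

text \<open>The exponential factor in \<open>fl_sinh\<close> never vanishes, and for points of the
  strip sinh((u - v)/2) vanishes only if u = v.\<close>

lemma fl_inj:
  assumes x: "continuous_on {0..} \<xi>" and u: "u \<in> alive \<xi> t" "v \<in> alive \<xi> t" and t: "0 \<le> t"
    and eq: "fl \<xi> t u = fl \<xi> t v"
  shows "u = v"
proof -
  have "sinh ((u - v) / 2) = 0" using fl_sinh[OF x u t] eq by simp
  then show ?thesis
    using sinh_half_strip_eq_0 alive_path(4)[OF x u(1) t order_refl] alive_path(4)[OF x u(2) t order_refl] by blast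
qed

text \<open>No variational equation is solved. By \<open>fl_sinh\<close> the quotient of the sinh of
  half differences at times t and 0 is exp(-I(u)/2); the integral I is continuous at
  \<open>u0\<close>, and sinh z / z tends to 1.\<close>

lemma fl_has_derivative:
  assumes x: "continuous_on {0..} \<xi>" and u0: "u0 \<in> alive \<xi> t" and t: "0 \<le> t"
  shows "(fl \<xi> t has_field_derivative exp (- (1/2) * integral {0..t} (\<lambda>s. (cth (fl \<xi> s u0 - of_real (\<xi> s)))\<^sup>2 - 1))) (at u0)"
proof -
  obtain e d K where e: "0 < e" "e \<le> pi" "0 < d" "0 \<le> K"
    "\<And>u. dist u u0 < d \<Longrightarrow> u \<in> alive \<xi> t"
    "\<And>u s. dist u u0 < d \<Longrightarrow> 0 \<le> s \<Longrightarrow> s \<le> t \<Longrightarrow> e < Im (fl \<xi> s u) \<and> Im (fl \<xi> s u) < pi \<and> norm (fl \<xi> s u - fl \<xi> s u0) \<le> K * norm (u - u0)"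
    using alive_nbhd[OF x u0 t] by metis
  define c where "c = (\<lambda>u s. cth (fl \<xi> s u - of_real (\<xi> s)))"
  define I where "I = (\<lambda>u. integral {0..t} (\<lambda>s. c u s * c u0 s - 1))"
  have x': "continuous_on {0..t} \<xi>" using x by (rule continuous_on_subset) auto
  have cc: "continuous_on {0..t} (c u)" if "u \<in> alive \<xi> t" for u
    unfolding c_def
    by (intro cth_path_continuous x' strip_dstrip(1) alive_path(6)[OF x that] continuous_on_vector_derivative[OF alive_path(5)[OF x that]]) auto
  have cl: "norm (c u s - c u0 s) \<le> Lc e * (K * norm (u - u0))" and cb: "norm (c u0 s) \<le> 1 + 1 / sin (e / 2)"
    if "dist u u0 < d" "0 \<le> s" "s \<le> t" for u s
  proof -
    have 1: "c u s = cthe e (fl \<xi> s u - of_real (\<xi> s))" "c u0 s = cthe e (fl \<xi> s u0 - of_real (\<xi> s))"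
      using e(6)[OF that] e(6)[of u0 s] that e(3) by (auto simp: c_def cthe_eq)
    have "norm (c u s - c u0 s) \<le> Lc e * norm (fl \<xi> s u - fl \<xi> s u0)"
      unfolding 1 using cthe_lipschitz[OF e(1,2), of "fl \<xi> s u - of_real (\<xi> s)" "fl \<xi> s u0 - of_real (\<xi> s)"] by (simp add: Lc_def)
    also have "\<dots> \<le> Lc e * (K * norm (u - u0))" using e(6)[OF that] Lc_nonneg by (intro mult_left_mono) auto
    finally show "norm (c u s - c u0 s) \<le> Lc e * (K * norm (u - u0))" .
    show "norm (c u0 s) \<le> 1 + 1 / sin (e / 2)" unfolding 1 by (rule cthe_bound[OF e(1,2)])
  qed
  define M where "M = 1 + 1 / sin (e / 2)"
  have M: "0 \<le> M" using cb[of u0 0] e t by (auto simp: M_def intro: order_trans[OF norm_ge_zero])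
  have Ib: "norm (I u - I u0) \<le> (Lc e * K * M * t) * norm (u - u0)" if u: "dist u u0 < d" for u
  proof -
    have i: "(\<lambda>s. c u s * c u0 s - 1) integrable_on {0..t}" if "u \<in> alive \<xi> t" for u
      by (intro integrable_continuous_interval continuous_intros cc u0 that)
    have "I u - I u0 = integral {0..t} (\<lambda>s. (c u s - c u0 s) * c u0 s)"
      unfolding I_def using i[OF e(5)[OF u]] i[OF u0]
      by (subst Henstock_Kurzweil_Integration.integral_diff[symmetric]) (auto simp: algebra_simps)
    moreover have "((\<lambda>s. (c u s - c u0 s) * c u0 s) has_integral integral {0..t} (\<lambda>s. (c u s - c u0 s) * c u0 s)) {0..t}"
      by (intro integrable_integral integrable_continuous_interval continuous_intros cc u0 e(5)[OF u])
    then have "norm (integral {0..t} (\<lambda>s. (c u s - c u0 s) * c u0 s)) \<le> (Lc e * (K * norm (u - u0)) * M) * measure lborel {0..t}"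
    proof (rule has_integral_bound_real[where S = "{}", rotated 2])
      show "norm ((c u s - c u0 s) * c u0 s) \<le> Lc e * (K * norm (u - u0)) * M" if "s \<in> {0..t} - {}" for s
        unfolding norm_mult M_def using cl[OF u] cb[OF u] that by (intro mult_mono) (auto intro!: mult_nonneg_nonneg Lc_nonneg e)
      show "0 \<le> Lc e * (K * norm (u - u0)) * M" using M e(4) Lc_nonneg by (intro mult_nonneg_nonneg) auto
    qed auto
    ultimately show ?thesis using t by (simp add: mult_ac)
  qed
  have n0: "\<forall>\<^sub>F u in at u0. dist u u0 < d \<and> u \<noteq> u0"
    using e(3) by (auto simp: eventually_at)
  have nl: "((\<lambda>u. B * norm (u - u0)) \<longlongrightarrow> 0) (at u0)" for B :: real
    by (rule tendsto_eq_intros refl | simp)+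
  have Il: "(I \<longlongrightarrow> I u0) (at u0)"
    by (rule LIM_zero_cancel, rule Lim_null_comparison[OF _ nl[of "Lc e * K * M * t"]])
      (use n0 Ib in \<open>auto elim!: eventually_mono\<close>)
  define Dt where "Dt = (\<lambda>u. fl \<xi> t u - fl \<xi> t u0)"
  have S: "sinh (Dt u / 2) = sinh ((u - u0) / 2) * exp (- (1/2) * I u)" if "dist u u0 < d" for u
    unfolding Dt_def I_def c_def by (rule fl_sinh[OF x e(5)[OF that] u0 t])
  have ne: "sinh ((u - u0) / 2) \<noteq> 0" "Dt u \<noteq> 0" if "dist u u0 < d" "u \<noteq> u0" for u
  proof -
    show 1: "sinh ((u - u0) / 2) \<noteq> 0"
    proof
      assume "sinh ((u - u0) / 2) = 0"
      then have "u = u0"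
        using sinh_half_strip_eq_0 alive_path(4)[OF x u0 t order_refl] alive_path(4)[OF x e(5)[OF that(1)] t order_refl] by blast
      then show False using that by simp
    qed
    show "Dt u \<noteq> 0" using 1 S[OF that(1)] by auto
  qed
  have Dl: "(Dt \<longlongrightarrow> 0) (at u0)"
    by (rule Lim_null_comparison[OF _ nl[of K]]) (use n0 e(6)[OF _ t order_refl] in \<open>auto simp: Dt_def elim!: eventually_mono\<close>)
  have A: "((\<lambda>u. sinh (Dt u / 2) / (Dt u / 2)) \<longlongrightarrow> 1) (at u0)"
  proof (rule filterlim_compose[OF sinh_over_id])
    show "filterlim (\<lambda>u. Dt u / 2) (at 0) (at u0)"
      unfolding filterlim_at using tendsto_divide[OF Dl tendsto_const[of 2]] n0 ne by (auto elim!: eventually_mono)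
  qed
  have B: "((\<lambda>u. sinh ((u - u0) / 2) / ((u - u0) / 2)) \<longlongrightarrow> 1) (at u0)"
  proof (rule filterlim_compose[OF sinh_over_id])
    have "((\<lambda>u. (u - u0) / 2) \<longlongrightarrow> (u0 - u0) / 2) (at u0)" by (intro tendsto_intros) simp
    then show "filterlim (\<lambda>u. (u - u0) / 2) (at 0) (at u0)"
      unfolding filterlim_at using n0 by (auto elim!: eventually_mono)
  qed
  have lim: "((\<lambda>u. (sinh ((u - u0) / 2) / ((u - u0) / 2)) * exp (- (1/2) * I u) / (sinh (Dt u / 2) / (Dt u / 2))) \<longlongrightarrow> 1 * exp (- (1/2) * I u0) / 1) (at u0)"
    by (intro tendsto_intros A B Il) simp
  have "((\<lambda>u. (fl \<xi> t u - fl \<xi> t u0) / (u - u0)) \<longlongrightarrow> exp (- (1/2) * I u0)) (at u0)"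
  proof (rule Lim_transform_eventually)
    show "\<forall>\<^sub>F u in at u0. sinh ((u - u0) / 2) / ((u - u0) / 2) * exp (- (1/2) * I u) / (sinh (Dt u / 2) / (Dt u / 2)) = (fl \<xi> t u - fl \<xi> t u0) / (u - u0)"
      using n0
    proof eventually_elim
      case (elim u)
      then have "sinh ((u - u0) / 2) \<noteq> 0" "Dt u \<noteq> 0" "u - u0 \<noteq> 0" using ne by auto
      moreover have "s1 / (w / 2) * E / ((s1 * E) / (D / 2)) = D / w" if "s1 \<noteq> 0" "E \<noteq> 0" "D \<noteq> 0" "w \<noteq> 0" for s1 w E D :: complex
        using that by (simp add: field_simps)
      moreover have "fl \<xi> t u - fl \<xi> t u0 = Dt u" by (simp add: Dt_def)
      ultimately show ?case using S[of u] elim by simp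
    qed
    show "((\<lambda>u. sinh ((u - u0) / 2) / ((u - u0) / 2) * exp (- (1/2) * I u) / (sinh (Dt u / 2) / (Dt u / 2))) \<longlongrightarrow> exp (- (1/2) * I u0)) (at u0)"
      using lim by simp
  qed
  then show ?thesis by (simp add: has_field_derivative_iff I_def c_def power2_eq_square)
qed

lemma open_alive:
  assumes x: "continuous_on {0..} \<xi>" and t: "0 \<le> t"
  shows "open (alive \<xi> t)"
  unfolding open_dist using alive_nbhd[OF x _ t] by metis

text \<open>The preimage is found by running the cut-off equation backwards from
  \<open>Z + of_real (\<xi> t)\<close>. Backwards, heights increase, so the lower cut-off is not
  met; what must be excluded is that the path reaches height pi.\<close>

lemma fl_surj:
  assumes x: "continuous_on {0..} \<xi>" and t: "0 \<le> t" and Z: "Z \<in> strip"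
  shows "\<exists>u\<in>alive \<xi> t. fl \<xi> t u - of_real (\<xi> t) = Z"
proof -
  define e where "e = Im Z / 2"
  have e: "0 < e" "e \<le> pi" "e < Im Z" "Im Z < pi" using Z by (auto simp: e_def strip_def)
  have "continuous_on UNIV (\<lambda>s. \<xi> (max 0 (t - s)))"
    by (rule continuous_on_compose2[OF x]) (auto intro!: continuous_intros)
  from cthe_ode_exists[OF this e(1,2), of "-1" "Z + of_real (\<xi> t)"] obtain Y where Y: "Y 0 = Z + of_real (\<xi> t)"
    "\<And>s. 0 \<le> s \<Longrightarrow> (Y has_vector_derivative - cthe e (Y s - of_real (\<xi> (max 0 (t - s))))) (at s within {0..})" by auto
  have rev: "((\<lambda>s. Y (r - s)) has_vector_derivative cthe e (Y (r - s) - of_real (\<xi> (t - (r - s))))) (at s within {0..r})"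
    if "0 \<le> s" "s \<le> r" "r \<le> t" for r s
  proof -
    have 1: "((\<lambda>s. r - s) has_vector_derivative - 1) (at s within {0..r})" by (auto intro!: derivative_eq_intros)
    have 2: "(Y has_vector_derivative - cthe e (Y (r - s) - of_real (\<xi> (t - (r - s))))) (at (r - s) within (\<lambda>s. r - s) ` {0..r})"
      using Y(2)[of "r - s"] that by (auto intro: has_vector_derivative_within_subset)
    show ?thesis using vector_diff_chain_within[OF 1 2] by (simp add: comp_def)
  qed
  have ImY: "Im Z \<le> Im (Y r)" if "0 \<le> r" "r \<le> t" for r
  proof -
    have "Im (Y (r - r)) \<le> Im (Y (r - 0))"
      by (rule Im_antimono[of 0 r "\<lambda>s. Y (r - s)", OF that(1) rev[OF _ _ that(2)]]) (use e Im_cthe_nonpos in auto)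
    then show ?thesis using Y(1) by simp
  qed
  have Ycont: "continuous_on {0..} Y"
    by (rule continuous_on_vector_derivative) (use Y(2) in auto)
  have Ypi: "Im (Y r) < pi" if r: "0 \<le> r" "r \<le> t" for r
  proof (rule ccontr)
    assume "\<not> Im (Y r) < pi"
    then have "\<exists>r'\<ge>0. r' \<le> r \<and> Im (Y r') = pi"
      using Y(1) e r by (intro IVT') (auto intro!: continuous_intros continuous_on_subset[OF Ycont])
    then obtain r' where r': "0 \<le> r'" "r' \<le> t" "Im (Y r') = pi" using r by auto
    \<comment> \<open>The line of height pi is invariant, since the field is real there. A Gronwall
      comparison of the path with its projection to that line, started where the two coincide, would
      keep the path on the line up to \<open>Y 0\<close>, whose height is less than pi.\<close>
    define f1 where "f1 = (\<lambda>s. cthe e (Y (r' - s) - of_real (\<xi> (t - (r' - s)))))"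
    have d1: "((\<lambda>s. Y (r' - s)) has_vector_derivative f1 s) (at s within {0..r'})" if "0 \<le> s" "s \<le> r'" for s
      unfolding f1_def using rev[OF that r'(2)] by simp
    have d2: "((\<lambda>s. Complex (Re (Y (r' - s))) pi) has_vector_derivative of_real (Re (f1 s))) (at s within {0..r'})" if "0 \<le> s" "s \<le> r'" for s
      using d1[OF that] by (auto simp: has_vector_derivative_complex_iff)
    have le: "norm (f1 s - of_real (Re (f1 s))) \<le> Lc e * norm (Y (r' - s) - Complex (Re (Y (r' - s))) pi)" for s
    proof -
      define W where "W = Y (r' - s) - of_real (\<xi> (t - (r' - s)))"
      have "Im (cthe e (Complex (Re W) pi)) = 0"
        using e by (simp add: cthe_def clampi_def cth_Re_Im)
      then have "\<bar>Im (f1 s)\<bar> = \<bar>Im (cthe e W - cthe e (Complex (Re W) pi))\<bar>" by (simp add: f1_def W_def)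
      also have "\<dots> \<le> norm (cthe e W - cthe e (Complex (Re W) pi))" by (rule abs_Im_le_cmod)
      also have "\<dots> \<le> Lc e * norm (W - Complex (Re W) pi)" using cthe_lipschitz[OF e(1,2)] by (simp add: Lc_def)
      finally have "\<bar>Im (f1 s)\<bar> \<le> Lc e * norm (W - Complex (Re W) pi)" .
      moreover have "W - Complex (Re W) pi = Y (r' - s) - Complex (Re (Y (r' - s))) pi" by (simp add: W_def complex_eq_iff)
      moreover have "\<bar>Im (f1 s)\<bar> = norm (f1 s - of_real (Re (f1 s)))" by (simp add: cmod_def)
      ultimately show ?thesis by simp
    qed
    have G: "norm (Y (r' - r') - Complex (Re (Y (r' - r'))) pi) \<le> exp (Lc e * r') * norm (Y (r' - 0) - Complex (Re (Y (r' - 0))) pi)"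
      by (rule gronwall_difference[of r' "\<lambda>s. Y (r' - s)" f1 "\<lambda>s. Complex (Re (Y (r' - s))) pi" "\<lambda>s. of_real (Re (f1 s))" "Lc e", OF r'(1) d1 d2 le])
    have "Y (r' - 0) - Complex (Re (Y (r' - 0))) pi = 0" using r' by (simp add: complex_eq_iff)
    then have "Y 0 = Complex (Re (Y 0)) pi" using G by simp
    then have "Im (Y 0) = pi" by (metis complex.sel(2))
    then show False using Y(1) e by simp
  qed
  have eq: "tf \<xi> e (Y t) t = Z + of_real (\<xi> t)"
    using tf_unique[OF x e(1,2) t, of "\<lambda>s. Y (t - s)"] rev[of _ t] Y(1) by simp
  have uS: "Y t \<in> strip" using ImY[OF t order_refl] Ypi[OF t order_refl] e by (auto simp: strip_def)
  have "fl \<xi> t (Y t) = Z + of_real (\<xi> t)" using fl_eq[OF x e(1,2) uS t] eq e by simp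
  moreover have "Y t \<in> alive \<xi> t" using uS eq e by (auto simp: alive_def)
  ultimately show ?thesis by (intro bexI[of _ "Y t"]) auto
qed

lemma conformal_flow:
  assumes x: "continuous_on {0..} \<xi>" and t: "0 \<le> t"
  shows "conformal_onto (\<lambda>u. fl \<xi> t u - of_real (\<xi> t)) (alive \<xi> t) strip"
  unfolding conformal_onto_def
proof
  show "(\<lambda>u. fl \<xi> t u - of_real (\<xi> t)) holomorphic_on alive \<xi> t"
    unfolding holomorphic_on_open[OF open_alive[OF x t]]
    using fl_has_derivative[OF x _ t] by (force intro!: derivative_eq_intros)
  show "bij_betw (\<lambda>u. fl \<xi> t u - of_real (\<xi> t)) (alive \<xi> t) strip"
    unfolding bij_betw_def
  proof
    show "inj_on (\<lambda>u. fl \<xi> t u - of_real (\<xi> t)) (alive \<xi> t)"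
      by (rule inj_onI) (use fl_inj[OF x _ _ t] in auto)
    show "(\<lambda>u. fl \<xi> t u - of_real (\<xi> t)) ` alive \<xi> t = strip"
      using fl_surj[OF x t] alive_path(6)[OF x _ t order_refl] by (force simp: image_iff)
  qed
qed

section \<open>Uniformizations and derivatives at boundary points\<close>

lemma conformal_onto_inverse:
  assumes "conformal_onto f D E" "open D"
  obtains g where "conformal_onto g E D" "\<And>z. z \<in> D \<Longrightarrow> g (f z) = z" "\<And>z. z \<in> E \<Longrightarrow> f (g z) = z"
proof -
  have f: "f holomorphic_on D" "inj_on f D" "f ` D = E" using assms by (auto simp: conformal_onto_def bij_betw_def)
  obtain g where g: "g holomorphic_on (f ` D)" "\<And>z. z \<in> D \<Longrightarrow> g (f z) = z"
    using holomorphic_has_inverse[OF f(1) assms(2) f(2)] by metis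
  have fg: "f (g z) = z" if "z \<in> E" for z using that g(2) f(3) by auto
  have "bij_betw g E D"
    by (rule bij_betw_byWitness[where f' = f]) (use f g fg in auto)
  then show thesis using that[of g] g f fg by (auto simp: conformal_onto_def)
qed

lemma conformal_onto_comp:
  assumes "conformal_onto f A B" "conformal_onto g B C"
  shows "conformal_onto (\<lambda>z. g (f z)) A C"
proof -
  have "g \<circ> f holomorphic_on A"
    using assms by (intro holomorphic_on_compose) (auto simp: conformal_onto_def bij_betw_def)
  moreover have "bij_betw (g \<circ> f) A C" using assms by (auto simp: conformal_onto_def intro: bij_betw_trans)
  ultimately show ?thesis by (simp add: conformal_onto_def comp_def)
qed

lemma conformal_exp: "conformal_onto exp strip upper_half_plane"
proof -
  have "bij_betw exp strip upper_half_plane"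
  proof (rule bij_betw_byWitness[where f' = Ln])
    show "\<forall>a\<in>strip. Ln (exp a) = a" by (auto simp: strip_def)
    show "\<forall>a\<in>upper_half_plane. exp (Ln a) = a"  by (metis Arg_of_real Complex_Transcendental.Arg_def exp_Ln mem_Collect_eq of_real_eq_0_iff pi_neq_zero upper_half_plane_def zero_complex.sel(2))
    show "exp ` strip \<subseteq> upper_half_plane" by (auto simp: strip_def upper_half_plane_def Im_exp intro!: mult_pos_pos sin_gt_zero)
    show "Ln ` upper_half_plane \<subseteq> strip"
      using Im_Ln_pos_lt_imp Im_Ln_pos_lt by (auto simp: strip_def upper_half_plane_def)
  qed
  then show ?thesis by (auto simp: conformal_onto_def intro!: holomorphic_intros)
qed

section \<open>Automorphisms of the disc and of the half-plane\<close>

definition cayley :: "complex \<Rightarrow> complex" where "cayley z = (z - \<i>) / (z + \<i>)"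
definition cayley_inv :: "complex \<Rightarrow> complex" where "cayley_inv z = \<i> * (1 + z) / (1 - z)"

lemma conformal_cayley_inv: "conformal_onto cayley_inv (ball 0 1) upper_half_plane"
  and cayley_inv_cayley: "z \<in> upper_half_plane \<Longrightarrow> cayley_inv (cayley z) = z"
  and cayley_in: "z \<in> upper_half_plane \<Longrightarrow> cayley z \<in> ball 0 1"
  and cayley_holomorphic: "cayley holomorphic_on upper_half_plane"
proof -
  have nz: "z + \<i> \<noteq> 0" if "z \<in> upper_half_plane" for z
    using that by (auto simp: upper_half_plane_def complex_eq_iff)
  have n1: "1 - z \<noteq> 0" if "z \<in> ball 0 1" for z :: complex using that by auto
  show a: "cayley_inv (cayley z) = z" if "z \<in> upper_half_plane" for z
  proof -
    have "1 + (z - \<i>) / (z + \<i>) = 2 * z / (z + \<i>)" "1 - (z - \<i>) / (z + \<i>) = 2 * \<i> / (z + \<i>)"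
      using nz[OF that] by (simp_all add: field_simps)
    then show ?thesis using nz[OF that] by (simp add: cayley_inv_def cayley_def)
  qed
  show b: "cayley z \<in> ball 0 1" if "z \<in> upper_half_plane" for z
  proof -
    have "(norm (z - \<i>))\<^sup>2 < (norm (z + \<i>))\<^sup>2"
      using that by (simp add: cmod_power2 upper_half_plane_def) (simp add: power2_eq_square algebra_simps)
    then have "norm (z - \<i>) < norm (z + \<i>)" by (rule power2_less_imp_less) simp
    then show ?thesis using nz[OF that] by (simp add: cayley_def norm_divide)
  qed
  have c: "cayley_inv z \<in> upper_half_plane" if "z \<in> ball 0 1" for z
  proof -
    have "(norm z)\<^sup>2 < 1" using that by (simp add: power_less_one_iff abs_square_less_1)
    then have l: "(Re z)\<^sup>2 + (Im z)\<^sup>2 < 1" by (simp add: cmod_power2)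
    have eq: "cayley_inv z = \<i> * (1 + z) * cnj (1 - z) / of_real ((norm (1 - z))\<^sup>2)"
      using complex_div_cnj[of "\<i> * (1 + z)" "1 - z"] by (simp add: cayley_inv_def)
    have "Im (cayley_inv z) = Im (\<i> * (1 + z) * cnj (1 - z)) / (norm (1 - z))\<^sup>2"
      unfolding eq by (simp del: of_real_power)
    also have "Im (\<i> * (1 + z) * cnj (1 - z)) = 1 - ((Re z)\<^sup>2 + (Im z)\<^sup>2)"
      by (simp add: power2_eq_square algebra_simps)
    finally show ?thesis using l n1[OF that] by (simp add: upper_half_plane_def)
  qed
  have d: "cayley (cayley_inv z) = z" if "z \<in> ball 0 1" for z
    using n1[OF that] nz[OF c[OF that]] unfolding cayley_def cayley_inv_def by (simp add: field_simps)
  show "cayley holomorphic_on upper_half_plane"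
    unfolding cayley_def[abs_def] by (intro holomorphic_intros) (rule nz)
  have "cayley_inv holomorphic_on ball 0 1"
    unfolding cayley_inv_def[abs_def] by (intro holomorphic_intros) (rule n1)
  moreover have "bij_betw cayley_inv (ball 0 1) upper_half_plane"
    by (rule bij_betw_byWitness[where f' = cayley]) (use a b c d in auto)
  ultimately show "conformal_onto cayley_inv (ball 0 1) upper_half_plane" by (simp add: conformal_onto_def)
qed

lemma conformal_cayley: "conformal_onto cayley upper_half_plane (ball 0 1)"
proof -
  have "bij_betw cayley upper_half_plane (ball 0 1)"
    by (rule bij_betw_byWitness[where f' = cayley_inv])
      (use cayley_inv_cayley cayley_in conformal_cayley_inv in \<open>auto simp: conformal_onto_def bij_betw_def, metis (no_types, lifting) cayley_in cayley_inv_cayley conformal_cayley_inv image_eqI inj_on_def mem_ball_0\<close>)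
  then show ?thesis using cayley_holomorphic by (simp add: conformal_onto_def)
qed

text \<open>Schwarz's lemma for the map and for its inverse gives equality of norms, which is the
  rigid case of the lemma.\<close>

lemma disc_automorphism_fixing_0:
  assumes k: "conformal_onto k (ball 0 1) (ball 0 1)" and k0: "k 0 = 0"
  obtains \<alpha> where "norm \<alpha> = 1" "\<And>z. z \<in> ball 0 1 \<Longrightarrow> k z = \<alpha> * z"
proof -
  obtain l where l: "conformal_onto l (ball 0 1) (ball 0 1)" "\<And>z. z \<in> ball 0 1 \<Longrightarrow> l (k z) = z"
    using conformal_onto_inverse[OF k] by (metis Elementary_Metric_Spaces.open_ball)
  have l0: "l 0 = 0" using l(2)[of 0] k0 by simp
  have bk: "norm (k z) < 1" "norm (l z) < 1" if "norm z < 1" for z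
  proof -
    have "k ` ball 0 1 = ball 0 1" "l ` ball 0 1 = ball 0 1" using k l(1) by (simp_all add: conformal_onto_def bij_betw_def)
    then have "k z \<in> ball 0 1" "l z \<in> ball 0 1" using that by (metis imageI mem_ball_0)+
    then show "norm (k z) < 1" "norm (l z) < 1" by auto
  qed
  have kh: "k holomorphic_on ball 0 1" "l holomorphic_on ball 0 1" using k l by (auto simp: conformal_onto_def)
  have le: "norm (k z) \<le> norm z" "norm (l z) \<le> norm z" if "norm z < 1" for z
    using Schwarz_Lemma(1)[OF kh(1) k0 bk(1) that] Schwarz_Lemma(1)[OF kh(2) l0 bk(2) that] by auto
  have h: "norm (1/2 :: complex) < 1" by simp
  have "norm (k (1/2)) = norm (1/2 :: complex)"
    using le(1)[OF h] le(2)[OF bk(1)[OF h]] l(2)[of "1/2"] by simp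
  then have "\<exists>\<alpha>. (\<forall>z. norm z < 1 \<longrightarrow> k z = \<alpha> * z) \<and> norm \<alpha> = 1"
    using Schwarz_Lemma(3)[OF kh(1) k0 bk(1) h] h by (metis divide_eq_0_iff zero_neq_numeral zero_neq_one)
  then show thesis using that by auto
qed

text \<open>Undoes an affine substitution in matrix form: a formula for h(rp + Ip z) becomes one for
  h, with determinant Ip (u^2 + v^2) = Ip.\<close>

lemma moebius_affine_change:
  fixes h :: "complex \<Rightarrow> complex"
  assumes "0 < Ip" and uv: "u * u + v * v = (1::real)"
    and g: "\<And>z. z \<in> upper_half_plane \<Longrightarrow> of_real (- v) * z + of_real u \<noteq> 0 \<and>
      h (of_real rp + of_real Ip * z) = (of_real u * z + of_real v) / (of_real (- v) * z + of_real u)"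
  obtains a b c d :: real where "a * d - b * c \<noteq> 0"
    "\<And>z. z \<in> upper_half_plane \<Longrightarrow> of_real c * z + of_real d \<noteq> 0"
    "\<And>z. z \<in> upper_half_plane \<Longrightarrow> h z = (of_real a * z + of_real b) / (of_real c * z + of_real d)"
proof (rule that[of u "Ip * u + v * rp" "Ip * v - u * rp" "- v"])
  have "u * (Ip * u + v * rp) - (Ip * v - u * rp) * - v = Ip * (u * u + v * v)" by (simp add: algebra_simps)
  then show "u * (Ip * u + v * rp) - (Ip * v - u * rp) * - v \<noteq> 0" using uv assms(1) by simp
  fix z assume z: "z \<in> upper_half_plane"
  define y where "y = (z - of_real rp) / of_real Ip"
  have y: "y \<in> upper_half_plane" using z assms(1) by (simp add: y_def upper_half_plane_def)
  have zy: "z = of_real rp + of_real Ip * y" using assms(1) by (simp add: y_def)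
  have d: "of_real (- v) * z + of_real (Ip * u + v * rp) = of_real Ip * (of_real (- v) * y + of_real u)"
    unfolding zy by (simp add: algebra_simps)
  have n: "of_real u * z + of_real (Ip * v - u * rp) = of_real Ip * (of_real u * y + of_real v)"
    unfolding zy by (simp add: algebra_simps)
  show "of_real (- v) * z + of_real (Ip * u + v * rp) \<noteq> 0" unfolding d using g[OF y] assms(1) by simp
  show "h z = (of_real u * z + of_real (Ip * v - u * rp)) / (of_real (- v) * z + of_real (Ip * u + v * rp))"
    unfolding d n using g[OF y] assms(1) by (subst zy) simp
qed

text \<open>An affine map \<open>A\<close> takes \<i> to the preimage \<open>p\<close> of \<i>, so h
  after \<open>A\<close> fixes \<i>; conjugated by the Cayley transform it is a rotation of the
  disc.\<close>

lemma half_plane_automorphism: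
  assumes h: "conformal_onto h upper_half_plane upper_half_plane"
  obtains a b c d :: real where "a * d - b * c \<noteq> 0"
    "\<And>z. z \<in> upper_half_plane \<Longrightarrow> of_real c * z + of_real d \<noteq> 0"
    "\<And>z. z \<in> upper_half_plane \<Longrightarrow> h z = (of_real a * z + of_real b) / (of_real c * z + of_real d)"
proof -
  have i: "\<i> \<in> upper_half_plane" by (simp add: upper_half_plane_def)
  have "h ` upper_half_plane = upper_half_plane" using h by (simp add: conformal_onto_def bij_betw_def)
  then have "\<i> \<in> h ` upper_half_plane" using i by simp
  then obtain p where p: "p \<in> upper_half_plane" "h p = \<i>" by auto
  define A where "A = (\<lambda>z::complex. of_real (Re p) + of_real (Im p) * z)"
  have Ip: "0 < Im p" using p by (simp add: upper_half_plane_def)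
  have cA: "conformal_onto A upper_half_plane upper_half_plane"
    unfolding conformal_onto_def
  proof
    show "A holomorphic_on upper_half_plane" unfolding A_def by (intro holomorphic_intros)
    show "bij_betw A upper_half_plane upper_half_plane"
      by (rule bij_betw_byWitness[where f' = "\<lambda>z. (z - of_real (Re p)) / of_real (Im p)"])
        (use Ip in \<open>auto simp: A_def upper_half_plane_def\<close>)
  qed
  define k where "k = (\<lambda>z. cayley (h (A (cayley_inv z))))"
  have ck: "conformal_onto k (ball 0 1) (ball 0 1)"
    unfolding k_def by (intro conformal_onto_comp[OF conformal_onto_comp[OF conformal_onto_comp[OF conformal_cayley_inv cA] h] conformal_cayley])
  have "A \<i> = p" by (simp add: A_def complex_eq_iff)
  then have k0: "k 0 = 0" by (simp add: k_def cayley_inv_def p cayley_def)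
  obtain \<alpha> where al: "norm \<alpha> = 1" "\<And>z. z \<in> ball 0 1 \<Longrightarrow> k z = \<alpha> * z" using disc_automorphism_fixing_0[OF ck k0] by blast
  \<comment> \<open>Dividing the matrix by a square root of the rotation factor makes its entries
    real: up to sign they are the real and imaginary parts of \<beta>.\<close>
  define \<beta> where "\<beta> = csqrt \<alpha>"
  have be: "\<beta> * \<beta> = \<alpha>" "norm \<beta> = 1"
    using al power2_csqrt[of \<alpha>] by (auto simp: \<beta>_def power2_eq_square)
  define u v where "u = Re \<beta>" and "v = Im \<beta>"
  have uv: "u * u + v * v = 1" using be(2) cmod_power2[of \<beta>] by (simp add: u_def v_def power2_eq_square)
  have beq: "\<beta> = of_real u + \<i> * of_real v" by (simp add: u_def v_def complex_eq_iff)
  have g: "of_real (- v) * z + of_real u \<noteq> 0 \<and> h (A z) = (of_real u * z + of_real v) / (of_real (- v) * z + of_real u)"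
    if z: "z \<in> upper_half_plane" for z
  proof -
    have Az: "h (A z) \<in> upper_half_plane" using h cA z by (auto simp: conformal_onto_def bij_betw_def)
    have zi: "z + \<i> \<noteq> 0" using z by (auto simp: upper_half_plane_def complex_eq_iff)
    have "cayley (h (A z)) = \<alpha> * cayley z"
      using al(2)[OF cayley_in[OF z]] cayley_inv_cayley[OF z] by (simp add: k_def)
    then have 1: "h (A z) = cayley_inv (\<alpha> * cayley z)" using cayley_inv_cayley[OF Az] by simp
    have nz: "of_real (- v) * z + of_real u \<noteq> 0"
    proof
      assume 0: "of_real (- v) * z + of_real u = 0"
      then have "Im (of_real (- v) * z + of_real u) = 0" by simp
      then have "v = 0" using z by (auto simp: upper_half_plane_def)
      then show False using 0 uv by auto
    qed
    have N: "(1 + \<alpha> * cayley z) * (z + \<i>) = 2 * \<beta> * (of_real u * z + of_real v)"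
    proof -
      have "(1 + \<alpha> * cayley z) * (z + \<i>) = (z + \<i>) + \<beta> * \<beta> * (z - \<i>)" using zi by (simp add: cayley_def be(1) field_simps)
      also have "\<dots> = \<beta> * cnj \<beta> * (z + \<i>) + \<beta> * \<beta> * (z - \<i>)" using be(2) complex_norm_square[of \<beta>] by simp
      also have "\<dots> = \<beta> * (cnj \<beta> * (z + \<i>) + \<beta> * (z - \<i>))" by (simp add: algebra_simps)
      finally show ?thesis by (simp add: beq algebra_simps)
    qed
    have Dn: "(1 - \<alpha> * cayley z) * (z + \<i>) = 2 * \<i> * \<beta> * (of_real (- v) * z + of_real u)"
    proof -
      have "(1 - \<alpha> * cayley z) * (z + \<i>) = (z + \<i>) - \<beta> * \<beta> * (z - \<i>)" using zi by (simp add: cayley_def be(1) field_simps)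
      also have "\<dots> = \<beta> * cnj \<beta> * (z + \<i>) - \<beta> * \<beta> * (z - \<i>)" using be(2) complex_norm_square[of \<beta>] by simp
      also have "\<dots> = \<beta> * (cnj \<beta> * (z + \<i>) - \<beta> * (z - \<i>))" by (simp add: algebra_simps)
      finally show ?thesis by (simp add: beq algebra_simps)
    qed
    have b0: "\<beta> \<noteq> 0" using be by auto
    have "h (A z) = \<i> * ((1 + \<alpha> * cayley z) * (z + \<i>)) / ((1 - \<alpha> * cayley z) * (z + \<i>))"
      using zi by (simp add: 1 cayley_inv_def)
    also have "\<dots> = (of_real u * z + of_real v) / (of_real (- v) * z + of_real u)"
      unfolding N Dn using b0 nz by (simp add: divide_simps)
    finally show ?thesis using nz by simp
  qed
  show thesis
    by (rule moebius_affine_change[OF Ip uv, of h "Re p"]) (use g that in \<open>auto simp: A_def\<close>)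
qed

text \<open>Both \<open>w\<close> and exp after \<open>f\<close> map D onto the half-plane, so they
  differ by an automorphism of it.\<close>

lemma strip_to_half_plane:
  assumes f: "conformal_onto f D strip" and D: "open D" and w: "conformal_onto w D upper_half_plane"
  obtains a b c d :: real where "a * d - b * c \<noteq> 0"
    "\<And>z. z \<in> D \<Longrightarrow> of_real c * exp (f z) + of_real d \<noteq> 0"
    "\<And>z. z \<in> D \<Longrightarrow> w z = (of_real a * exp (f z) + of_real b) / (of_real c * exp (f z) + of_real d)"
proof -
  have e: "conformal_onto (\<lambda>z. exp (f z)) D upper_half_plane"
    using conformal_onto_comp[OF f conformal_exp] .
  obtain g where g: "conformal_onto g upper_half_plane D" "\<And>z. z \<in> D \<Longrightarrow> g (exp (f z)) = z"
    "\<And>z. z \<in> upper_half_plane \<Longrightarrow> exp (f (g z)) = z"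
    using conformal_onto_inverse[OF e D] by auto
  obtain a b c d :: real where h: "a * d - b * c \<noteq> 0"
    "\<And>z. z \<in> upper_half_plane \<Longrightarrow> of_real c * z + of_real d \<noteq> 0"
    "\<And>z. z \<in> upper_half_plane \<Longrightarrow> w (g z) = (of_real a * z + of_real b) / (of_real c * z + of_real d)"
    using half_plane_automorphism[OF conformal_onto_comp[OF g(1) w]] by metis
  have "exp (f z) \<in> upper_half_plane" if "z \<in> D" for z using e that by (auto simp: conformal_onto_def bij_betw_def)
  then show thesis using that[OF h(1)] h(2,3) g(2) by metis
qed

text \<open>Only limits along the filter are known. Denominators are cleared before passing to the
  limit, which gives \<open>b = x * d\<close>; then d = 0 would make the determinant vanish.\<close>

lemma moebius_limit_at_0:
  fixes a b c d x :: real and E v :: "complex \<Rightarrow> complex"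
  assumes det: "a * d - b * c \<noteq> 0" and q: "q \<noteq> bot" and E: "(E \<longlongrightarrow> 0) q"
    and v: "(v \<longlongrightarrow> of_real x) q"
    and eq: "\<forall>\<^sub>F z in q. of_real c * E z + of_real d \<noteq> 0 \<and> v z = (of_real a * E z + of_real b) / (of_real c * E z + of_real d)"
  shows "d \<noteq> 0" "b = x * d"
proof -
  have 1: "((\<lambda>z. v z * (of_real c * E z + of_real d)) \<longlongrightarrow> of_real x * (of_real c * 0 + of_real d)) q"
    by (intro tendsto_intros v E)
  have 2: "((\<lambda>z. of_real a * E z + of_real b) \<longlongrightarrow> of_real a * 0 + of_real b) q"
    by (intro tendsto_intros E)
  have "\<forall>\<^sub>F z in q. v z * (of_real c * E z + of_real d) = of_real a * E z + of_real b"
    using eq by eventually_elim auto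
  then have 3: "((\<lambda>z. of_real a * E z + of_real b) \<longlongrightarrow> of_real x * (of_real c * 0 + of_real d)) q"
    using 1 by (rule Lim_transform_eventually[rotated])
  have "of_real x * (of_real c * 0 + of_real d) = (of_real a * 0 + of_real b :: complex)"
    using tendsto_unique[OF q 3 2] .
  then have "complex_of_real (x * d) = of_real b" by simp
  then show b: "b = x * d" using of_real_eq_iff by metis
  then show "d \<noteq> 0" using det by auto
qed

lemma at_half_plane_neq_bot: "at (of_real x) within upper_half_plane \<noteq> bot"
proof -
  have "of_real x islimpt upper_half_plane"
    unfolding islimpt_approachable
  proof (intro allI impI)
    fix e :: real assume "0 < e"
    then show "\<exists>y\<in>upper_half_plane. y \<noteq> of_real x \<and> dist y (of_real x) < e"
      by (intro bexI[of _ "of_real x + \<i> * of_real (e / 2)"]) (auto simp: upper_half_plane_def dist_norm norm_mult complex_eq_iff)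
  qed
  then show ?thesis by (simp add: trivial_limit_within)
qed

lemma at_0_strip_neq_bot: "at 0 within strip \<noteq> bot"
proof -
  have "0 islimpt strip"
    unfolding islimpt_approachable
  proof (intro allI impI)
    fix e :: real assume e: "0 < e"
    define m where "m = min (e / 2) 1"
    have m: "0 < m" "m < e" "m < pi" using e pi_gt3 by (auto simp: m_def)
    then show "\<exists>y\<in>strip. y \<noteq> 0 \<and> dist y 0 < e"
      by (intro bexI[of _ "\<i> * of_real m"]) (auto simp: strip_def norm_mult)
  qed
  then show ?thesis by (simp add: trivial_limit_within)
qed

section \<open>Boundary points and boundary charts\<close>

lemma bmaps_filterlim: "bmaps f D q q' \<Longrightarrow> filterlim f q' q"
  by (simp add: bmaps_def filterlim_def)

lemma bmaps_half_plane:
  assumes "bmaps w D q (at (of_real x) within upper_half_plane)"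
  shows "q \<noteq> bot" "(w \<longlongrightarrow> of_real x) q" "eventually (\<lambda>z. z \<in> D) q"
proof -
  show "q \<noteq> bot" using assms at_half_plane_neq_bot[of x] by (auto simp: bmaps_def filtermap_bot)
  show "(w \<longlongrightarrow> of_real x) q" using bmaps_filterlim[OF assms] by (simp add: filterlim_at)
  show "eventually (\<lambda>z. z \<in> D) q" using assms by (auto simp: bmaps_def le_principal)
qed

text \<open>Let \<open>v\<close> be the coordinate of the chart and \<open>x\<close> the image of
  the boundary point. \<open>E / (v - x)\<close> converges because \<open>v\<close> is a Moebius
  function of \<open>E\<close>, and the difference quotient of \<open>g\<close> converges to its
  derivative, which is not 0. Later, \<open>K\<close> is all that is remembered of the
  chart.\<close>

lemma boundary_chart_limit:
  fixes E :: "complex \<Rightarrow> complex"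
  assumes chart: "boundary_chart D q \<phi>" and E0: "(E \<longlongrightarrow> 0) q" and En: "\<And>z. E z \<noteq> 0"
    and moeb: "\<And>v. conformal_onto v D upper_half_plane \<Longrightarrow> \<exists>a b c d :: real. a * d - b * c \<noteq> 0 \<and>
      (\<forall>z\<in>D. of_real c * E z + of_real d \<noteq> 0 \<and> v z = (of_real a * E z + of_real b) / (of_real c * E z + of_real d))"
  obtains K where "K \<noteq> 0" "((\<lambda>z. E z / (\<phi> z - Lim q \<phi>)) \<longlongrightarrow> K) q"
proof -
  obtain v g x r where v: "conformal_onto v D upper_half_plane" "bmaps v D q (at (of_real x) within upper_half_plane)"
    and r: "0 < r" and g: "g holomorphic_on ball (of_real x) r" "deriv g (of_real x) \<noteq> 0"
    and gv: "\<And>z. z \<in> D \<Longrightarrow> v z \<in> ball (of_real x) r \<Longrightarrow> \<phi> z = g (v z)"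
    using chart unfolding boundary_chart_def by blast
  note b = bmaps_half_plane[OF v(2)]
  have vx: "filterlim v (at (of_real x)) q"
    by (rule filterlim_mono[OF bmaps_filterlim[OF v(2)] at_le[OF subset_UNIV] order_refl])
  obtain a b c d :: real where m: "a * d - b * c \<noteq> 0"
    "\<And>z. z \<in> D \<Longrightarrow> of_real c * E z + of_real d \<noteq> 0 \<and> v z = (of_real a * E z + of_real b) / (of_real c * E z + of_real d)"
    using moeb[OF v(1)] by blast
  have ev: "\<forall>\<^sub>F z in q. of_real c * E z + of_real d \<noteq> 0 \<and> v z = (of_real a * E z + of_real b) / (of_real c * E z + of_real d)"
    using b(3) by eventually_elim (use m in blast)
  note L = moebius_limit_at_0[OF m(1) b(1) E0 b(2) ev]
  define g' where "g' = deriv g (of_real x)"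
  have gd: "(g has_field_derivative g') (at (of_real x))"
    unfolding g'_def using g(1) r by (intro holomorphic_derivI[of _ "ball (of_real x) r"]) auto
  have gl: "((\<lambda>z. (g (v z) - g (of_real x)) / (v z - of_real x)) \<longlongrightarrow> g') q"
    using gd vx unfolding has_field_derivative_iff by (rule filterlim_compose)
  have evb: "\<forall>\<^sub>F z in q. v z \<in> ball (of_real x) r"
    using tendstoD[OF b(2) r] by eventually_elim (simp add: dist_commute)
  have phi: "\<forall>\<^sub>F z in q. \<phi> z = g (v z)" using b(3) evb by eventually_elim (use gv in blast)
  have "((\<lambda>z. g (v z)) \<longlongrightarrow> g (of_real x)) q"
    using isCont_tendsto_compose[OF DERIV_isCont[OF gd] b(2)] .
  then have "(\<phi> \<longlongrightarrow> g (of_real x)) q"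
    by (rule Lim_transform_eventually) (use phi in \<open>auto elim!: eventually_mono\<close>)
  then have Lphi: "Lim q \<phi> = g (of_real x)" using b(1) by (intro tendsto_Lim) auto
  have vne: "\<forall>\<^sub>F z in q. v z \<noteq> of_real x" using vx by (simp add: filterlim_at)
  \<comment> \<open>Since b = x d, the difference \<open>v z - of_real x\<close> is a multiple of
    \<open>E z\<close>, so the quotient is an affine function of \<open>E z\<close>.\<close>
  have R: "\<forall>\<^sub>F z in q. E z / (v z - of_real x) = of_real d * (of_real c * E z + of_real d) / of_real (a * d - b * c)"
    using ev vne
  proof eventually_elim
    case (elim z)
    have nz: "of_real c * E z + of_real d \<noteq> 0" using elim by simp
    have "v z - of_real x = (of_real a * E z + of_real b - of_real x * (of_real c * E z + of_real d)) / (of_real c * E z + of_real d)"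
      using elim by (simp add: field_simps)
    also have "of_real a * E z + of_real b - of_real x * (of_real c * E z + of_real d) = (of_real a - of_real x * of_real c) * E z"
      using L(2) by (simp add: algebra_simps)
    finally have vz: "v z - of_real x = (of_real a - of_real x * of_real c) * E z / (of_real c * E z + of_real d)" .
    have dd: "complex_of_real (a * d - b * c) = of_real d * (of_real a - of_real x * of_real c)"
      using L(2) by (simp add: algebra_simps)
    have nz2: "of_real a - of_real x * of_real c \<noteq> (0::complex)" using dd m(1) by (metis mult_zero_right of_real_eq_0_iff)
    show ?case unfolding vz dd using nz nz2 En[of z] L(1) by (simp add: field_simps)
  qed
  have "((\<lambda>z. of_real d * (of_real c * E z + of_real d) / of_real (a * d - b * c)) \<longlongrightarrow> of_real d * (of_real c * 0 + of_real d) / of_real (a * d - b * c)) q"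
    by (intro tendsto_intros E0) (use m(1) in \<open>simp only: of_real_eq_0_iff not_False_eq_True\<close>)
  then have "((\<lambda>z. of_real d * (of_real c * E z + of_real d) / of_real (a * d - b * c) / ((g (v z) - g (of_real x)) / (v z - of_real x)))
     \<longlongrightarrow> of_real d * (of_real c * 0 + of_real d) / of_real (a * d - b * c) / g') q"
    by (rule tendsto_divide[OF _ gl]) (use g(2) in \<open>simp_all add: g'_def\<close>)
  then have "((\<lambda>z. E z / (\<phi> z - Lim q \<phi>)) \<longlongrightarrow> of_real d * (of_real c * 0 + of_real d) / of_real (a * d - b * c) / g') q"
  proof (rule Lim_transform_eventually)
    show "\<forall>\<^sub>F z in q. of_real d * (of_real c * E z + of_real d) / of_real (a * d - b * c) / ((g (v z) - g (of_real x)) / (v z - of_real x)) = E z / (\<phi> z - Lim q \<phi>)"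
      using R phi vne
    proof eventually_elim
      case (elim z)
      show ?case unfolding elim(1)[symmetric] Lphi elim(2) using elim(3) by simp
    qed
  qed
  moreover have "of_real d * (of_real c * 0 + of_real d) / of_real (a * d - b * c) / g' \<noteq> 0"
    using L(1) m(1) g(2) unfolding g'_def by (simp only: divide_eq_0_iff mult_eq_0_iff of_real_eq_0_iff) simp
  ultimately show thesis using that by blast
qed

section \<open>Branches of multivalued powers\<close>

definition br :: "real \<Rightarrow> complex set" where
  "br e = range (\<lambda>k::int. exp (of_real e * (2 * of_real pi * \<i> * of_int k)))"

text \<open>A set of values is described by one logarithm \<open>L\<close> and a set
  \<open>U\<close> of branch factors, so that products of multivalued expressions become sums of
  logarithms. The aim is that \<open>U\<close> is countable and independent of the values.\<close>

definition near :: "complex set \<Rightarrow> complex \<Rightarrow> complex set \<Rightarrow> bool" where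
  "near A L U \<longleftrightarrow> A \<subseteq> {exp L} * U"

lemma countable_br: "countable (br e)" by (simp add: br_def)

lemma countable_set_times: "countable A \<Longrightarrow> countable B \<Longrightarrow> countable (A * B :: complex set)"
proof -
  assume "countable A" "countable B"
  then have "countable ((\<lambda>(a, b). a * b) ` (A \<times> B))" by (intro countable_image countable_SIGMA)
  then show ?thesis by (rule countable_subset[rotated]) (auto simp: set_times_def)
qed

lemma countable_set_prod: "finite I \<Longrightarrow> (\<And>i. i \<in> I \<Longrightarrow> countable (f i)) \<Longrightarrow> countable (\<Prod>i\<in>I. f i :: complex set)"
  by (induction I rule: finite_induct) (auto simp: set_one intro!: countable_set_times)

lemma near_mult: "near A L U \<Longrightarrow> near B M V \<Longrightarrow> near (A * B) (L + M) (U * V)"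
proof -
  assume "near A L U" "near B M V"
  then have "A * B \<subseteq> ({exp L} * U) * ({exp M} * V)" unfolding near_def by (rule set_times_mono2)
  also have "\<dots> = ({exp L} * {exp M}) * (U * V)" by (simp add: mult_ac)
  also have "{exp L} * {exp M} = {exp (L + M)}" by (simp add: set_times_def exp_add)
  finally show ?thesis by (simp add: near_def)
qed

lemma near_one: "near 1 0 1"
  by (simp add: near_def set_one set_times_def)

lemma near_prod: "finite I \<Longrightarrow> (\<And>i. i \<in> I \<Longrightarrow> near (A i) (L i) (U i)) \<Longrightarrow> near (\<Prod>i\<in>I. A i) (\<Sum>i\<in>I. L i) (\<Prod>i\<in>I. U i)"
  by (induction I rule: finite_induct) (auto simp del: set_one intro: near_one near_mult)

text \<open>Two logarithms of the same number differ by an integral multiple of 2 pi i.\<close>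

lemma mpow_branches:
  assumes "x \<in> mpow (exp l) e"
  shows "\<exists>k::int. x = exp (of_real e * l) * exp (of_real e * (2 * of_real pi * \<i> * of_int k))"
proof (cases "e = 0")
  case False
  then obtain l' where l': "x = exp (of_real e * l')" "exp l' = exp l" using assms by (auto simp: mpow_def)
  then obtain k :: int where "l' = l + of_int (2 * k) * of_real pi * \<i>" unfolding exp_eq by auto
  then have "of_real e * l' = of_real e * l + of_real e * (2 * of_real pi * \<i> * of_int k)" by (simp add: algebra_simps)
  then show ?thesis using l'(1) by (auto simp: exp_add)
qed (use assms in \<open>auto simp: mpow_def\<close>)

lemma near_mpow: "exp l = x \<Longrightarrow> near (mpow x e) (of_real e * l) (br e)"
  using mpow_branches[of _ l e] by (force simp: near_def br_def set_times_def)

lemma mpow_zero: "mpow x 0 = 1"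
  by (simp add: mpow_def set_one)

text \<open>Values of \<open>mpow\<close> are 1 or exponentials, hence nonzero whatever the base.
  Powers of the derivative at the tip can thus be divided without computing that derivative.\<close>

lemma mpow_ratio:
  assumes "m1 \<in> mpow x e" "m2 \<in> mpow x e"
  shows "m2 \<noteq> 0" "m1 / m2 \<in> br e"
proof -
  have "m2 \<noteq> 0 \<and> m1 / m2 \<in> br e"
  proof (cases "e = 0")
    case True
    then have "m1 = 1" "m2 = 1" using assms by (auto simp: mpow_def)
    then show ?thesis using True by (auto simp: br_def image_iff)
  next
    case False
    then obtain l where l: "m2 = exp (of_real e * l)" "exp l = x" using assms by (auto simp: mpow_def)
    then obtain k :: int where "m1 = exp (of_real e * l) * exp (of_real e * (2 * of_real pi * \<i> * of_int k))"
      using mpow_branches[of m1 l e] assms by auto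
    then show ?thesis using l by (auto simp: br_def)
  qed
  then show "m2 \<noteq> 0" "m1 / m2 \<in> br e" by auto
qed

section \<open>Logarithms of the vertex coefficient\<close>

lemma sum_pairs_sym:
  fixes T R :: "nat \<Rightarrow> complex"
  shows "(\<Sum>k<n. \<Sum>j<k. T j * R k + R j * T k) = (\<Sum>k<n. T k) * (\<Sum>k<n. R k) - (\<Sum>k<n. T k * R k)"
proof (induction n)
  case (Suc n)
  have "(\<Sum>j<n. T j * R n + R j * T n) = (\<Sum>k<n. T k) * R n + (\<Sum>k<n. R k) * T n"
    by (simp add: sum.distrib sum_distrib_right)
  then show ?case using Suc by (simp add: algebra_simps)
qed simp

lemma sum_pairs_square:
  fixes T R :: "nat \<Rightarrow> complex"
  shows "(\<Sum>k<n. \<Sum>j<k. T j * T k) = ((\<Sum>k<n. T k)\<^sup>2 - (\<Sum>k<n. (T k)\<^sup>2)) / 2"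
proof -
  have "(\<Sum>k<n. \<Sum>j<k. T j * T k + T j * T k) = (\<Sum>k<n. T k) * (\<Sum>k<n. T k) - (\<Sum>k<n. T k * T k)" by (rule sum_pairs_sym)
  moreover have "(\<Sum>k<n. \<Sum>j<k. T j * T k + T j * T k) = 2 * (\<Sum>k<n. \<Sum>j<k. T j * T k)"
    by (simp only: mult_2 sum.distrib)
  ultimately show ?thesis by (simp add: power2_eq_square)
qed

definition U_self :: "real \<Rightarrow> real \<Rightarrow> real \<Rightarrow> real \<Rightarrow> real \<Rightarrow> complex set" where
  "U_self b \<rho>m \<rho>p s s' = br (dim_bulk b s) * br (dim_bulk b s') * br (s * (b + \<rho>p)) * br (s * (b + \<rho>m)) *
     br (s' * (b + \<rho>p)) * br (s' * (b + \<rho>m)) * br (s * s')"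

definition U_int :: "real \<Rightarrow> real \<Rightarrow> real \<Rightarrow> real \<Rightarrow> complex set" where
  "U_int s s' r r' = br (s * r) * br (s * r') * br (s' * r) * br (s' * r')"

text \<open>Branch factors in the order of the factors of \<open>vertex_coeff\<close>, with the tip
  as first node. Those of the derivative at the tip are left out; they enter when numerator and
  denominator are compared.\<close>

definition U_all :: "real \<Rightarrow> real \<Rightarrow> nat \<Rightarrow> (nat \<Rightarrow> real) \<Rightarrow> (nat \<Rightarrow> real) \<Rightarrow> real \<Rightarrow> real \<Rightarrow> complex set" where
  "U_all a b n \<sigma> \<sigma>s \<rho>m \<rho>p = br (dim_root \<rho>m) * br (dim_root \<rho>p) * ((br (a * (b + \<rho>p)) * br (a * (b + \<rho>m))) *
     (\<Prod>k<n. U_self b \<rho>m \<rho>p (\<sigma> k) (\<sigma>s k))) *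
     (\<Prod>k<n. (br (a * \<sigma> k) * br (a * \<sigma>s k)) * (\<Prod>j<k. U_int (\<sigma> j) (\<sigma>s j) (\<sigma> k) (\<sigma>s k)))"

lemma countable_U_all: "countable (U_all a b n \<sigma> \<sigma>s \<rho>m \<rho>p)"
  unfolding U_all_def U_self_def U_int_def
  by (intro countable_set_times countable_br countable_set_prod) auto

text \<open>In a strip coordinate the uniformization is w = tanh(u/2), and 1 - w and 1 + w are
  exp(-u/2) and exp(u/2), each over cosh(u/2). \<open>A\<close> is a logarithm of 1/cosh(u/2);
  isolating it prepares the cancellation by neutrality.\<close>

lemma tanh_logs:
  fixes u A :: complex
  assumes A: "exp A * cosh (u / 2) = 1"
  shows "exp (- u / 2 + A) = 1 - tanh (u / 2)" "exp (u / 2 + A) = 1 + tanh (u / 2)"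
    "exp (- cnj u / 2 + cnj A) = 1 - cnj (tanh (u / 2))" "exp (cnj u / 2 + cnj A) = 1 + cnj (tanh (u / 2))"
proof -
  have c: "cosh (u / 2) \<noteq> 0" using A by auto
  have eA: "exp A = 1 / cosh (u / 2)" using A c by (simp add: field_simps)
  show 1: "exp (- u / 2 + A) = 1 - tanh (u / 2)"
  proof -
    have "cosh (u / 2) - sinh (u / 2) = exp (- u / 2)" by (simp add: cosh_minus_sinh)
    then show ?thesis unfolding exp_add eA tanh_def using c by (simp add: field_simps)
  qed
  show 2: "exp (u / 2 + A) = 1 + tanh (u / 2)"
  proof -
    have "cosh (u / 2) + sinh (u / 2) = exp (u / 2)" by (simp add: cosh_plus_sinh)
    then show ?thesis unfolding exp_add eA tanh_def using c by (simp add: field_simps)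
  qed
  have "cnj (exp (- u / 2 + A)) = 1 - cnj (tanh (u / 2))" unfolding 1 by simp
  then show "exp (- cnj u / 2 + cnj A) = 1 - cnj (tanh (u / 2))" by (simp add: exp_cnj)
  have "cnj (exp (u / 2 + A)) = 1 + cnj (tanh (u / 2))" unfolding 2 by simp
  then show "exp (cnj u / 2 + cnj A) = 1 + cnj (tanh (u / 2))" by (simp add: exp_cnj)
qed

text \<open>The addition theorem tanh x - tanh y = sinh(x - y) / (cosh x cosh y) in logarithmic
  form.\<close>

lemma tanh_diff_log:
  fixes u v A B :: complex
  assumes A: "exp A * cosh (u / 2) = 1" and B: "exp B * cosh (v / 2) = 1" and l: "exp l = sinh ((u - v) / 2)"
  shows "exp (l + A + B) = tanh (u / 2) - tanh (v / 2)"
proof -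
  have c: "cosh (u / 2) \<noteq> 0" "cosh (v / 2) \<noteq> 0" using A B by auto
  have eA: "exp A = 1 / cosh (u / 2)" "exp B = 1 / cosh (v / 2)" using A B c by (auto simp: field_simps)
  show ?thesis unfolding exp_add eA l tanh_def using c  by (smt (verit) Groups.mult_ac(2) diff_divide_distrib diff_divide_eq_iff divide_diff_eq_iff more_arith_simps(6) sinh_diff times_divide_eq_left)
qed

text \<open>What the nodes contribute to the logarithm of the coefficient once the cosh factors have
  cancelled. \<open>Z\<close> are strip coordinates; \<open>l\<close> are logarithms of the
  derivative of the strip map, \<open>\<mu>\<close> of sinh(Z/2), \<open>ld\<close> and
  \<open>le\<close> of the sinh of half the differences to other nodes and to conjugate nodes. The
  terms pi i arise because the interaction with the tip contains w(p) - w(z), whose sinh has the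
  opposite sign.\<close>

definition log_coeff :: "real \<Rightarrow> real \<Rightarrow> nat \<Rightarrow> (nat \<Rightarrow> real) \<Rightarrow> (nat \<Rightarrow> real) \<Rightarrow> real \<Rightarrow> real \<Rightarrow>
    (nat \<Rightarrow> complex) \<Rightarrow> (nat \<Rightarrow> complex) \<Rightarrow> (nat \<Rightarrow> complex) \<Rightarrow> (nat \<Rightarrow> nat \<Rightarrow> complex) \<Rightarrow> (nat \<Rightarrow> nat \<Rightarrow> complex) \<Rightarrow> complex" where
  "log_coeff a b n \<sigma> \<sigma>s \<rho>m \<rho>p Z l \<mu> ld le =
     (\<Sum>k<n. of_real (dim_bulk b (\<sigma> k)) * (l k - of_real (ln 2)) + of_real (dim_bulk b (\<sigma>s k)) * (cnj (l k) - of_real (ln 2))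
        + of_real ((\<rho>m - \<rho>p) / 2) * (of_real (\<sigma> k) * Z k + of_real (\<sigma>s k) * cnj (Z k))
        + of_real (\<sigma> k * \<sigma>s k) * le k k
        + of_real (a * \<sigma> k) * (\<mu> k + of_real pi * \<i>) + of_real (a * \<sigma>s k) * (cnj (\<mu> k) + of_real pi * \<i>))
     + (\<Sum>k<n. \<Sum>j<k. of_real (\<sigma> j * \<sigma> k) * ld j k + of_real (\<sigma> j * \<sigma>s k) * le j k
        + of_real (\<sigma>s j * \<sigma> k) * cnj (le j k) + of_real (\<sigma>s j * \<sigma>s k) * cnj (ld j k))"

text \<open>The neutrality condition removes all factors \<open>cosh\<close> and the free real translation \<open>c\<close> of the strip.\<close>

lemma neutral_log_sum:
  fixes a b \<rho>m \<rho>p c :: real and n :: nat and \<sigma> \<sigma>s :: "nat \<Rightarrow> real" and A Z l \<mu> :: "nat \<Rightarrow> complex" and ld le :: "nat \<Rightarrow> nat \<Rightarrow> complex"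
    and Ap km kp :: complex
  assumes neut: "\<rho>m + \<rho>p + a + (\<Sum>k<n. \<sigma> k + \<sigma>s k) = 0"
  defines "u \<equiv> (\<lambda>k. Z k + of_real c)"
  shows "of_real (dim_root \<rho>m) * (km + of_real c) + of_real (dim_root \<rho>p) * (kp - of_real c)
     + ((of_real (a * (b + \<rho>p)) * (- of_real c / 2 + Ap) + of_real (a * (b + \<rho>m)) * (of_real c / 2 + Ap))
       + (\<Sum>k<n. of_real (dim_bulk b (\<sigma> k)) * (l k + 2 * A k - of_real (ln 2)) + of_real (dim_bulk b (\<sigma>s k)) * (cnj (l k) + 2 * cnj (A k) - of_real (ln 2))
          + of_real (\<sigma> k * (b + \<rho>p)) * (- u k / 2 + A k) + of_real (\<sigma> k * (b + \<rho>m)) * (u k / 2 + A k)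
          + of_real (\<sigma>s k * (b + \<rho>p)) * (- cnj (u k) / 2 + cnj (A k)) + of_real (\<sigma>s k * (b + \<rho>m)) * (cnj (u k) / 2 + cnj (A k))
          + of_real (\<sigma> k * \<sigma>s k) * (le k k + A k + cnj (A k))))
     + (\<Sum>k<n. (of_real (a * \<sigma> k) * (\<mu> k + of_real pi * \<i> + Ap + A k) + of_real (a * \<sigma>s k) * (cnj (\<mu> k) + of_real pi * \<i> + Ap + cnj (A k)))
          + (\<Sum>j<k. of_real (\<sigma> j * \<sigma> k) * (ld j k + A j + A k) + of_real (\<sigma> j * \<sigma>s k) * (le j k + A j + cnj (A k))
            + of_real (\<sigma>s j * \<sigma> k) * (cnj (le j k) + cnj (A j) + A k) + of_real (\<sigma>s j * \<sigma>s k) * (cnj (ld j k) + cnj (A j) + cnj (A k))))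
   = of_real (2 * a * b - a\<^sup>2) * Ap + of_real (dim_root \<rho>m) * km + of_real (dim_root \<rho>p) * kp
     + log_coeff a b n \<sigma> \<sigma>s \<rho>m \<rho>p Z l \<mu> ld le"
    (is "?lhs = ?rhs")
proof -
  \<comment> \<open>Bookkeeping of the cosh factors: the self terms contain T_k R_k and the pairs
    T_j R_k + R_j T_k, which together give the product of the sums \<open>ST\<close> and
    \<open>SR\<close>; roots and tip add (\<rho>m + \<rho>p + a) \<open>ST\<close>, and neutrality
    makes the total vanish.\<close>
  define T where "T = (\<lambda>k. of_real (\<sigma> k) * A k + of_real (\<sigma>s k) * cnj (A k))"
  define R where "R = (\<lambda>k. complex_of_real (\<sigma> k + \<sigma>s k))"
  define M' where "M' = (\<lambda>k. of_real (dim_bulk b (\<sigma> k)) * (l k - of_real (ln 2)) + of_real (dim_bulk b (\<sigma>s k)) * (cnj (l k) - of_real (ln 2))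
        + of_real ((\<rho>m - \<rho>p) / 2) * (of_real (\<sigma> k) * Z k + of_real (\<sigma>s k) * cnj (Z k))
        + of_real (\<sigma> k * \<sigma>s k) * le k k)"
  define P' where "P' = (\<lambda>k. of_real (a * \<sigma> k) * (\<mu> k + of_real pi * \<i>) + of_real (a * \<sigma>s k) * (cnj (\<mu> k) + of_real pi * \<i>))"
  define I' where "I' = (\<lambda>j k. of_real (\<sigma> j * \<sigma> k) * ld j k + of_real (\<sigma> j * \<sigma>s k) * le j k
        + of_real (\<sigma>s j * \<sigma> k) * cnj (le j k) + of_real (\<sigma>s j * \<sigma>s k) * cnj (ld j k))"
  have M: "of_real (dim_bulk b (\<sigma> k)) * (l k + 2 * A k - of_real (ln 2)) + of_real (dim_bulk b (\<sigma>s k)) * (cnj (l k) + 2 * cnj (A k) - of_real (ln 2))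
          + of_real (\<sigma> k * (b + \<rho>p)) * (- u k / 2 + A k) + of_real (\<sigma> k * (b + \<rho>m)) * (u k / 2 + A k)
          + of_real (\<sigma>s k * (b + \<rho>p)) * (- cnj (u k) / 2 + cnj (A k)) + of_real (\<sigma>s k * (b + \<rho>m)) * (cnj (u k) / 2 + cnj (A k))
          + of_real (\<sigma> k * \<sigma>s k) * (le k k + A k + cnj (A k))
     = M' k + T k * R k + of_real (\<rho>m + \<rho>p) * T k + of_real ((\<rho>m - \<rho>p) / 2 * c) * R k" for k
    by (simp add: M'_def T_def R_def u_def dim_bulk_def power2_eq_square field_simps)
  have P: "of_real (a * \<sigma> k) * (\<mu> k + of_real pi * \<i> + Ap + A k) + of_real (a * \<sigma>s k) * (cnj (\<mu> k) + of_real pi * \<i> + Ap + cnj (A k))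
     = P' k + of_real a * T k + of_real a * Ap * R k" for k
    by (simp add: P'_def T_def R_def algebra_simps)
  have I: "of_real (\<sigma> j * \<sigma> k) * (ld j k + A j + A k) + of_real (\<sigma> j * \<sigma>s k) * (le j k + A j + cnj (A k))
            + of_real (\<sigma>s j * \<sigma> k) * (cnj (le j k) + cnj (A j) + A k) + of_real (\<sigma>s j * \<sigma>s k) * (cnj (ld j k) + cnj (A j) + cnj (A k))
     = I' j k + (T j * R k + R j * T k)" for j k
    by (simp add: I'_def T_def R_def algebra_simps)
  define ST SR where "ST = (\<Sum>k<n. T k)" and "SR = (\<Sum>k<n. R k)"
  have neut': "SR = - of_real (\<rho>m + \<rho>p + a)"
  proof -
    have "SR = of_real (\<Sum>k<n. \<sigma> k + \<sigma>s k)" by (simp add: SR_def R_def)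
    moreover have "(\<Sum>k<n. \<sigma> k + \<sigma>s k) = - (\<rho>m + \<rho>p + a)" using neut by linarith
    ultimately show ?thesis by simp
  qed
  have S1: "(\<Sum>k<n. M' k + T k * R k + of_real (\<rho>m + \<rho>p) * T k + of_real ((\<rho>m - \<rho>p) / 2 * c) * R k)
     = (\<Sum>k<n. M' k) + (\<Sum>k<n. T k * R k) + of_real (\<rho>m + \<rho>p) * ST + of_real ((\<rho>m - \<rho>p) / 2 * c) * SR"
    unfolding ST_def SR_def sum.distrib sum_distrib_left ..
  have S2: "(\<Sum>k<n. (P' k + of_real a * T k + of_real a * Ap * R k) + (\<Sum>j<k. I' j k + (T j * R k + R j * T k)))
     = (\<Sum>k<n. P' k) + of_real a * ST + of_real a * Ap * SR + (\<Sum>k<n. \<Sum>j<k. I' j k) + (ST * SR - (\<Sum>k<n. T k * R k))"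
  proof -
    define Q where "Q = (\<lambda>k. \<Sum>j<k. T j * R k + R j * T k)"
    have "(\<Sum>j<k. I' j k + (T j * R k + R j * T k)) = (\<Sum>j<k. I' j k) + Q k" for k
      unfolding Q_def by (rule sum.distrib)
    moreover have "(\<Sum>k<n. Q k) = ST * SR - (\<Sum>k<n. T k * R k)"
      unfolding Q_def ST_def SR_def by (rule sum_pairs_sym)
    moreover have "(\<Sum>k<n. of_real a * T k) = of_real a * ST" "(\<Sum>k<n. of_real a * Ap * R k) = of_real a * Ap * SR"
      unfolding ST_def SR_def sum_distrib_left by auto
    ultimately show ?thesis by (simp only: sum.distrib add.assoc)
  qed
  have "?lhs = of_real (dim_root \<rho>m) * (km + of_real c) + of_real (dim_root \<rho>p) * (kp - of_real c)
     + ((of_real (a * (b + \<rho>p)) * (- of_real c / 2 + Ap) + of_real (a * (b + \<rho>m)) * (of_real c / 2 + Ap))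
       + ((\<Sum>k<n. M' k) + (\<Sum>k<n. T k * R k) + of_real (\<rho>m + \<rho>p) * ST + of_real ((\<rho>m - \<rho>p) / 2 * c) * SR))
     + ((\<Sum>k<n. P' k) + of_real a * ST + of_real a * Ap * SR + (\<Sum>k<n. \<Sum>j<k. I' j k) + (ST * SR - (\<Sum>k<n. T k * R k)))"
    unfolding M P I S1 S2 ..
  \<comment> \<open>The translation \<open>c\<close> drops out as well: its coefficient is (\<rho>m
    - \<rho>p)/2 times \<open>SR\<close> + \<rho>m + \<rho>p + a.\<close>
  also have "\<dots> = of_real (2 * a * b - a\<^sup>2) * Ap + of_real (dim_root \<rho>m) * km + of_real (dim_root \<rho>p) * kp
     + ((\<Sum>k<n. M' k) + (\<Sum>k<n. P' k) + (\<Sum>k<n. \<Sum>j<k. I' j k))"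
    unfolding neut' dim_root_def by (simp add: power2_eq_square field_simps)
  also have "(\<Sum>k<n. M' k) + (\<Sum>k<n. P' k) + (\<Sum>k<n. \<Sum>j<k. I' j k) = log_coeff a b n \<sigma> \<sigma>s \<rho>m \<rho>p Z l \<mu> ld le"
    by (simp add: log_coeff_def M'_def P'_def I'_def add.assoc flip: sum.distrib)
  finally show ?thesis .
qed

section \<open>The flow near the two ends of the strip\<close>

lemma barrier:
  fixes g :: "real \<Rightarrow> real"
  assumes t: "0 \<le> t" and c: "continuous_on {0..t} g" and R: "R < g 0"
    and d: "\<And>s. 0 < s \<Longrightarrow> s < t \<Longrightarrow> R < g s \<Longrightarrow> \<exists>g'. (g has_real_derivative g') (at s) \<and> 0 \<le> g'"
  shows "g 0 \<le> g t"
proof (rule ccontr)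
  assume n: "\<not> g 0 \<le> g t"
  \<comment> \<open>Consider the last time \<open>s0\<close> at which g is at least its initial
    value. Shortly afterwards g still exceeds \<open>R\<close>, so it does not decrease there, and
    \<open>s0\<close> was not the last such time.\<close>
  define K where "K = {s \<in> {0..t}. g 0 \<le> g s}"
  have K: "K = {0..t} \<inter> g -` {g 0..}" by (auto simp: K_def)
  have "closed K" unfolding K by (rule continuous_closed_preimage[OF c]) auto
  moreover have "bounded K" by (rule bounded_subset[of "{0..t}"]) (auto simp: K_def)
  ultimately have cK: "compact K" by (simp add: compact_eq_bounded_closed)
  have "K \<noteq> {}" using t by (auto simp: K_def)
  then obtain s0 where s0: "s0 \<in> K" "\<And>s. s \<in> K \<Longrightarrow> s \<le> s0" using compact_attains_sup[OF cK] by metis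
  have s0t: "0 \<le> s0" "s0 < t" "g 0 \<le> g s0" using s0(1) n by (auto simp: K_def order.order_iff_strict)
  have "s0 \<in> {0..t}" "0 < g s0 - R" using s0t R by auto
  then have "\<exists>e>0. \<forall>s\<in>{0..t}. dist s s0 < e \<longrightarrow> dist (g s) (g s0) < g s0 - R"
    using c unfolding continuous_on_iff by blast
  then obtain e where e: "e > 0" "\<And>s. s \<in> {0..t} \<Longrightarrow> dist s s0 < e \<Longrightarrow> dist (g s) (g s0) < g s0 - R" by blast
  define s2 where "s2 = min t (s0 + e / 2)"
  have s2: "s0 < s2" "s2 \<le> t" "s2 < s0 + e" using s0t e(1) by (auto simp: s2_def)
  have "g s0 \<le> g s2"
  proof (rule DERIV_nonneg_imp_increasing_open[of s0 s2 g])
    show "continuous_on {s0..s2} g" by (rule continuous_on_subset[OF c]) (use s0t s2 in auto)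
    fix s assume s: "s0 < s" "s < s2"
    have "R < g s" using e(2)[of s] s s2 s0t by (auto simp: dist_real_def)
    then show "\<exists>y. (g has_real_derivative y) (at s) \<and> 0 \<le> y" using d[of s] s s2 s0t by auto
  qed (use s2 in auto)
  then have "s2 \<in> K" using s0t s2 by (auto simp: K_def)
  then show False using s0(2) s2(1) by force
qed

text \<open>A path that starts far to the right of the driving function never falls below its
  initial real part (\<open>barrier\<close>), so its velocity stays within 2/X of 1. The bound comes
  from 2 / (exp r - 1) \<le> 2 / r.\<close>

lemma cth_path_end:
  fixes y :: "real \<Rightarrow> complex"
  assumes t: "0 \<le> t" and y: "\<And>s. 0 \<le> s \<Longrightarrow> s \<le> t \<Longrightarrow> (y has_vector_derivative cth (y s - of_real (\<xi> s))) (at s within {0..t})"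
    and R0: "\<And>s. 0 \<le> s \<Longrightarrow> s \<le> t \<Longrightarrow> \<xi> s \<le> R0" and X: "0 < X" and R: "R0 + X < Re (y 0)"
    and c: "continuous_on {0..t} (\<lambda>s. cth (y s - of_real (\<xi> s)))"
  shows "norm (y t - y 0 - of_real t) \<le> 2 / X * t"
proof -
  have mono: "Re (y 0) \<le> Re (y r)" if r: "0 \<le> r" "r \<le> t" for r
  proof (rule barrier[OF r(1), where R = R0])
    have "continuous_on {0..t} y" by (rule continuous_on_vector_derivative) (use y in auto)
    then have "continuous_on {0..r} y" by (rule continuous_on_subset) (use r in auto)
    then show "continuous_on {0..r} (\<lambda>s. Re (y s))" by (intro continuous_intros)
    show "R0 < Re (y 0)" using R X by simp
    fix s assume s: "0 < s" "s < r" "R0 < Re (y s)"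
    have "at s within {0..t} = at s" using s r by (intro at_within_interior) (auto simp: interior_atLeastAtMost_real)
    then have "((\<lambda>s. Re (y s)) has_real_derivative Re (cth (y s - of_real (\<xi> s)))) (at s)"
      using y[of s] s r by (simp add: has_real_derivative_iff_has_vector_derivative has_vector_derivative_complex_iff)
    moreover have "0 \<le> Re (cth (y s - of_real (\<xi> s)))" using R0[of s] s r by (intro Re_cth_nonneg) auto
    ultimately show "\<exists>g'. ((\<lambda>s. Re (y s)) has_real_derivative g') (at s) \<and> 0 \<le> g'" by blast
  qed
  have near: "norm (cth (y s - of_real (\<xi> s)) - 1) \<le> 2 / X" if s: "0 \<le> s" "s \<le> t" for s
  proof -
    define r where "r = Re (y s - of_real (\<xi> s))"
    have r: "X < r" using mono[OF s] R R0[OF s] by (simp add: r_def)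
    have e: "r \<le> exp r - 1" using exp_ge_add_one_self[of r] by linarith
    have "norm (cth (y s - of_real (\<xi> s)) - 1) \<le> exp (- r / 2) / sinh (r / 2)"
      unfolding r_def by (rule cth_near_one) (use r X in \<open>simp add: r_def\<close>)
    also have "exp (- r / 2) / sinh (r / 2) = 2 / (exp r - 1)"
    proof -
      have "exp r = exp (r / 2) * exp (r / 2)" by (simp flip: exp_add)
      moreover have "exp (r / 2) > 1" using r X by simp
      ultimately show ?thesis by (simp add: sinh_field_def exp_minus divide_simps)
    qed
    also have "\<dots> \<le> 2 / X" using e r X by (intro divide_left_mono) auto
    finally show ?thesis .
  qed
  have "((\<lambda>s. cth (y s - of_real (\<xi> s))) has_integral (y t - y 0)) {0..t}"
    by (rule fundamental_theorem_of_calculus[OF t]) (use y in auto)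
  then have "((\<lambda>s. cth (y s - of_real (\<xi> s)) - 1) has_integral (y t - y 0 - of_real t)) {0..t}"
    using has_integral_const_real[of "1::complex" 0 t] t by (auto dest: has_integral_diff simp: scaleR_conv_of_real)
  then have "norm (y t - y 0 - of_real t) \<le> 2 / X * measure lborel {0..t}"
    by (rule has_integral_bound_real[where S = "{}", rotated 2]) (use near X in auto)
  then show ?thesis using t by simp
qed

text \<open>The left end follows from the right end by the reflection Z -> - cnj Z, which turns the
  driving function into its negative.\<close>

lemma fl_end:
  assumes x: "continuous_on {0..} \<xi>" and t: "0 \<le> t" and eta: "0 < \<eta>"
  shows "\<exists>R. \<forall>u\<in>alive \<xi> t. R < Re u \<longrightarrow> norm (fl \<xi> t u - u - of_real t) < \<eta>"
    and "\<exists>R. \<forall>u\<in>alive \<xi> t. Re u < R \<longrightarrow> norm (fl \<xi> t u - u + of_real t) < \<eta>"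
proof -
  have x': "continuous_on {0..t} \<xi>" using x by (rule continuous_on_subset) auto
  then have "bounded (\<xi> ` {0..t})" by (intro compact_imp_bounded compact_continuous_image) auto
  then obtain R0 where "\<forall>s\<in>{0..t}. \<bar>\<xi> s\<bar> \<le> R0" by (auto simp: bounded_iff)
  then have R0: "\<bar>\<xi> s\<bar> \<le> R0" if "0 \<le> s" "s \<le> t" for s using that by auto
  define X where "X = (2 * t + 1) / \<eta>"
  have X: "0 < X" "2 / X * t < \<eta>" using t eta by (auto simp: X_def field_simps)
  have c: "continuous_on {0..t} (\<lambda>s. cth (fl \<xi> s u - of_real (\<xi> s)))" if "u \<in> alive \<xi> t" for u
    by (intro cth_path_continuous x' strip_dstrip(1) alive_path(6)[OF x that] continuous_on_vector_derivative[OF alive_path(5)[OF x that]]) auto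
  show "\<exists>R. \<forall>u\<in>alive \<xi> t. R < Re u \<longrightarrow> norm (fl \<xi> t u - u - of_real t) < \<eta>"
  proof (intro exI[of _ "R0 + X"] ballI impI)
    fix u assume u: "u \<in> alive \<xi> t" and R: "R0 + X < Re u"
    have "norm (fl \<xi> t u - fl \<xi> 0 u - of_real t) \<le> 2 / X * t"
      by (rule cth_path_end[OF t alive_path(5)[OF x u], where ?R0.0 = R0])
        (use R0 R X c[OF u] alive_path(3)[OF x u t order_refl] in \<open>auto simp: abs_le_iff\<close>)
    then show "norm (fl \<xi> t u - u - of_real t) < \<eta>" using X alive_path(3)[OF x u t order_refl] by simp
  qed
  show "\<exists>R. \<forall>u\<in>alive \<xi> t. Re u < R \<longrightarrow> norm (fl \<xi> t u - u + of_real t) < \<eta>"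
  proof (intro exI[of _ "- (R0 + X)"] ballI impI)
    fix u assume u: "u \<in> alive \<xi> t" and R: "Re u < - (R0 + X)"
    define y where "y = (\<lambda>s. - cnj (fl \<xi> s u))"
    have eq: "cth (y s - of_real (- \<xi> s)) = - cnj (cth (fl \<xi> s u - of_real (\<xi> s)))" for s
      using cth_minus_cnj[of "fl \<xi> s u - of_real (\<xi> s)"] by (simp add: y_def)
    have "norm (y t - y 0 - of_real t) \<le> 2 / X * t"
    proof (rule cth_path_end[OF t, where \<xi> = "\<lambda>s. - \<xi> s" and ?R0.0 = R0])
      show "(y has_vector_derivative cth (y s - of_real (- \<xi> s))) (at s within {0..t})" if "0 \<le> s" "s \<le> t" for s
        unfolding eq using has_vector_derivative_minus[OF has_vector_derivative_cnj[OF alive_path(5)[OF x u that]]] by (simp add: y_def)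
      show "continuous_on {0..t} (\<lambda>s. cth (y s - of_real (- \<xi> s)))" unfolding eq by (intro continuous_intros c u)
      show "- \<xi> s \<le> R0" if "0 \<le> s" "s \<le> t" for s using R0[OF that] by (simp add: abs_le_iff)
      show "R0 + X < Re (y 0)" using R alive_path(3)[OF x u t order_refl] by (simp add: y_def)
    qed (use X in auto)
    moreover have "y t - y 0 - of_real t = - cnj (fl \<xi> t u - u + of_real t)"
      using alive_path(3)[OF x u t order_refl] by (simp add: y_def)
    ultimately show "norm (fl \<xi> t u - u + of_real t) < \<eta>" using X by (simp del: complex_cnj_add complex_cnj_diff)
  qed
qed

section \<open>Values of the vertex observable\<close>

text \<open>The exponent has no constant term, so only the zeroth Wick power has a coefficient at
  the empty multiset. This is the normalization of Wick exponentials to expectation 1.\<close>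

lemma wick_exp_vertex_empty: "wick_exp (vertex_exponent qm qp c xs) {#} = 1"
proof -
  have e: "vertex_exponent qm qp c xs {#} = 0"
    by (simp add: vertex_exponent_def generator_def)
  have p: "wick_power X k {#} = (if k = 0 then 1 else 0)" if "X {#} = 0" for X k
  proof (cases k)
    case (Suc m)
    have "{k. k \<subseteq># ({#} :: chiral multiset)} = {{#}}" by auto
    then show ?thesis using Suc that by (simp add: wick_prod_def)
  qed simp
  note pe = p[where X = "vertex_exponent qm qp c xs", OF e]
  have "(\<lambda>k. wick_power (vertex_exponent qm qp c xs) k {#} / fact k) sums (\<Sum>k\<in>{0}. wick_power (vertex_exponent qm qp c xs) k {#} / fact k)"
    by (rule sums_finite) (auto simp: pe)
  then show ?thesis unfolding wick_exp_def by (simp add: pe sums_iff)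
qed

lemma rooted_vertex_expectation:
  "X \<in> rooted_vertex_field b qm qp \<phi> w c xs \<Longrightarrow> fock_expectation X \<in> vertex_coeff b qm qp \<phi> w c xs"
  by (auto simp: rooted_vertex_field_def fock_expectation_def wick_exp_vertex_empty)

text \<open>The terms in front of \<open>log_coeff\<close> come from the tip and the roots; the one
  with \<open>Ap\<close> is common to numerator and denominator.\<close>

definition vertex_log :: "real \<Rightarrow> real \<Rightarrow> nat \<Rightarrow> (nat \<Rightarrow> real) \<Rightarrow> (nat \<Rightarrow> real) \<Rightarrow> real \<Rightarrow> real \<Rightarrow> complex \<Rightarrow> complex \<Rightarrow> complex \<Rightarrow>
    (nat \<Rightarrow> complex) \<Rightarrow> (nat \<Rightarrow> complex) \<Rightarrow> (nat \<Rightarrow> complex) \<Rightarrow> (nat \<Rightarrow> nat \<Rightarrow> complex) \<Rightarrow> (nat \<Rightarrow> nat \<Rightarrow> complex) \<Rightarrow> complex" where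
  "vertex_log a b n \<sigma> \<sigma>s \<rho>m \<rho>p Ap km kp Z l \<mu> ld le =
     of_real (2 * a * b - a\<^sup>2) * Ap + of_real (dim_root \<rho>m) * km + of_real (dim_root \<rho>p) * kp
     + log_coeff a b n \<sigma> \<sigma>s \<rho>m \<rho>p Z l \<mu> ld le"

text \<open>One logarithm for each of the seven factors. The summand ln 2 stems from the factor 1/2
  in the derivative of tanh(u/2).\<close>

lemma near_vertex_self:
  assumes A: "exp A * cosh (u / 2) = 1" and w: "node_val w x = tanh (u / 2)"
    and d: "node_deriv \<phi> w x = exp l / (2 * (cosh (u / 2))\<^sup>2)"
    and le: "exp le = sinh ((u - cnj u) / 2)"
  shows "near (vertex_self b \<phi> w c x)
    (of_real (dim_bulk b (chg c x)) * (l + 2 * A - of_real (ln 2)) + of_real (dim_bulk b (chg_conj c x)) * (cnj l + 2 * cnj A - of_real (ln 2))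
          + of_real (chg c x * (b + root_plus c)) * (- u / 2 + A) + of_real (chg c x * (b + root_minus c)) * (u / 2 + A)
          + of_real (chg_conj c x * (b + root_plus c)) * (- cnj u / 2 + cnj A) + of_real (chg_conj c x * (b + root_minus c)) * (cnj u / 2 + cnj A)
          + of_real (chg c x * chg_conj c x) * (le + A + cnj A))
    (U_self b (root_minus c) (root_plus c) (chg c x) (chg_conj c x))"
proof -
  have c: "cosh (u / 2) \<noteq> 0" using A by auto
  have eA: "exp A = 1 / cosh (u / 2)" using A c by (simp add: field_simps)
  have "exp (2 * A) = exp A * exp A" by (simp flip: exp_add)
  moreover have "exp (complex_of_real (ln 2)) = 2" by (simp add: exp_of_real)
  ultimately have d1: "exp (l + 2 * A - of_real (ln 2)) = node_deriv \<phi> w x"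
    using c unfolding d by (simp add: exp_diff exp_add eA power2_eq_square)
  have d2: "exp (cnj l + 2 * cnj A - of_real (ln 2)) = cnj (node_deriv \<phi> w x)"
    unfolding d1[symmetric] exp_cnj by simp
  have Ac: "exp (cnj A) * cosh (cnj u / 2) = 1"
  proof -
    have "cnj (exp A * cosh (u / 2)) = 1" unfolding A by simp
    moreover have "cosh (cnj u / 2) = cnj (cosh (u / 2))" using sinh_cosh_cnj(2)[of "u / 2"] by simp
    ultimately show ?thesis by (simp add: exp_cnj)
  qed
  have ct: "tanh (cnj u / 2) = cnj (tanh (u / 2))"
    using sinh_cosh_cnj[of "u / 2"] by (simp add: tanh_def)
  have w2: "exp (le + A + cnj A) = node_val w x - cnj (node_val w x)"
    using tanh_diff_log[OF A Ac le] unfolding w ct .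
  note t = tanh_logs[OF A, folded w]
  show ?thesis
    unfolding vertex_self_def Let_def U_self_def
    by (intro near_mult near_mpow d1 d2 t w2)
qed

text \<open>Two of the four factors have the logarithms built from \<open>ld\<close> and
  \<open>le\<close>; the other two are their complex conjugates.\<close>

lemma near_vertex_interaction:
  assumes A: "exp A * cosh (u / 2) = 1" and w: "node_val w x = tanh (u / 2)"
    and B: "exp B * cosh (v / 2) = 1" and w': "node_val w y = tanh (v / 2)"
    and ld: "exp ld = sinh ((u - v) / 2)" and le: "exp le = sinh ((u - cnj v) / 2)"
  shows "near (vertex_interaction w c x y)
    (of_real (chg c x * chg c y) * (ld + A + B) + of_real (chg c x * chg_conj c y) * (le + A + cnj B)
     + of_real (chg_conj c x * chg c y) * (cnj le + cnj A + B) + of_real (chg_conj c x * chg_conj c y) * (cnj ld + cnj A + cnj B))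
    (U_int (chg c x) (chg_conj c x) (chg c y) (chg_conj c y))"
proof -
  have cB: "exp (cnj B) * cosh (cnj v / 2) = 1"
  proof -
    have "cnj (exp B * cosh (v / 2)) = 1" unfolding B by simp
    moreover have "cosh (cnj v / 2) = cnj (cosh (v / 2))" using sinh_cosh_cnj(2)[of "v / 2"] by simp
    ultimately show ?thesis by (simp add: exp_cnj)
  qed
  have ct: "tanh (cnj v / 2) = cnj (tanh (v / 2))"
    using sinh_cosh_cnj[of "v / 2"] by (simp add: tanh_def)
  have 1: "exp (ld + A + B) = node_val w x - node_val w y"
    using tanh_diff_log[OF A B ld] by (simp add: w w')
  have 2: "exp (le + A + cnj B) = node_val w x - cnj (node_val w y)"
    using tanh_diff_log[OF A cB le] unfolding w w' ct .
  have 3: "exp (cnj le + cnj A + B) = cnj (node_val w x) - node_val w y"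
    using arg_cong[OF 2, of cnj] by (simp add: exp_cnj)
  have 4: "exp (cnj ld + cnj A + cnj B) = cnj (node_val w x) - cnj (node_val w y)"
    using arg_cong[OF 1, of cnj] by (simp add: exp_cnj)
  show ?thesis
    unfolding vertex_interaction_def Let_def U_int_def by (intro near_mult near_mpow 1 2 3 4)
qed

lemma prod_one_sets: "{1} * (A :: complex set) = A" "A * {1} = A"
  using mult_1[of A] mult_1_right[of A] by (auto simp: set_one)

text \<open>The power of the derivative at the tip is kept as a separate factor, without a
  logarithm: this derivative is not computed, and the same factor occurs in the denominator.\<close>

lemma vertex_coeff_subset:
  fixes c :: real and n :: nat and z :: "nat \<Rightarrow> complex" and Z l \<mu> :: "nat \<Rightarrow> complex" and ld le :: "nat \<Rightarrow> nat \<Rightarrow> complex"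
  assumes inj: "inj_on z {..<n}"
    and neut: "\<sigma>m + \<sigma>p + (\<Sum>k<n. \<sigma> k + \<sigma>s k) = 0"
    and Ap: "exp Ap * cosh (of_real c / 2) = 1"
    and qm: "node_deriv \<phi> w (Bd qm) = exp (km + of_real c)" and qp: "node_deriv \<phi> w (Bd qp) = exp (kp - of_real c)"
    and p: "node_val w (Bd p) = tanh (of_real c / 2)"
    and ch: "\<And>k. k < n \<Longrightarrow> cosh ((Z k + of_real c) / 2) \<noteq> 0"
    and w: "\<And>k. k < n \<Longrightarrow> w (z k) = tanh ((Z k + of_real c) / 2)"
    and dw: "\<And>k. k < n \<Longrightarrow> deriv w (z k) = exp (l k) / (2 * (cosh ((Z k + of_real c) / 2))\<^sup>2)"
    and \<mu>: "\<And>k. k < n \<Longrightarrow> exp (\<mu> k) = sinh (Z k / 2)"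
    and ld: "\<And>j k. k < n \<Longrightarrow> j < k \<Longrightarrow> exp (ld j k) = sinh ((Z j - Z k) / 2)"
    and le: "\<And>j k. k < n \<Longrightarrow> j \<le> k \<Longrightarrow> exp (le j k) = sinh ((Z j - cnj (Z k)) / 2)"
  shows "vertex_coeff b qm qp \<phi> w (star (Psi_charge a p) (tuple_charge n \<sigma> \<sigma>s \<sigma>m \<sigma>p z)) (Bd p # map (\<lambda>j. Pt (z j)) [0..<n])
    \<subseteq> mpow (node_deriv \<phi> w (Bd p)) (dim_bulk b a) *
      ({exp (vertex_log a b n \<sigma> \<sigma>s (\<sigma>m - a / 2) (\<sigma>p - a / 2) Ap km kp Z l \<mu> ld le)} * U_all a b n \<sigma> \<sigma>s (\<sigma>m - a / 2) (\<sigma>p - a / 2))"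
proof -
  define C where "C = star (Psi_charge a p) (tuple_charge n \<sigma> \<sigma>s \<sigma>m \<sigma>p z)"
  define xs where "xs = Bd p # map (\<lambda>j. Pt (z j)) [0..<n]"
  define u where "u = (\<lambda>k. Z k + of_real c)"
  define A where "A = (\<lambda>k. - Ln (cosh (u k / 2)))"
  have A: "exp (A k) * cosh (u k / 2) = 1" if "k < n" for k
    using ch[OF that] by (simp add: A_def u_def exp_minus)
  have chP: "chg C (Bd p) = a" "chg_conj C (Bd p) = 0" "root_minus C = \<sigma>m - a / 2" "root_plus C = \<sigma>p - a / 2"
    by (simp_all add: C_def star_def Psi_charge_def tuple_charge_def)
  have sel: "(\<Sum>j<n. if z k = z j then f j else 0) = f k" if "k < n" for k and f :: "nat \<Rightarrow> real"
  proof -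
    have "(\<Sum>j<n. if z k = z j then f j else 0) = (\<Sum>j<n. if k = j then f j else 0)"
      using inj that by (intro sum.cong) (auto simp: inj_on_def)
    then show ?thesis using that by simp
  qed
  have chZ: "chg C (Pt (z k)) = \<sigma> k" "chg_conj C (Pt (z k)) = \<sigma>s k" if "k < n" for k
    using sel[OF that] by (simp_all add: C_def star_def Psi_charge_def tuple_charge_def)
  have xs: "length xs = Suc n" "xs ! 0 = Bd p" "\<And>k. k < n \<Longrightarrow> xs ! Suc k = Pt (z k)"
    by (simp_all add: xs_def)
  \<comment> \<open>The conjugate charge at the tip is 0, so the powers with conjugate exponents are
    {1}, including the one whose base w(p) - cnj w(p) vanishes.\<close>
  have S0: "vertex_self b \<phi> w C (Bd p) = mpow (node_deriv \<phi> w (Bd p)) (dim_bulk b a) *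
      (mpow (1 - node_val w (Bd p)) (a * (b + (\<sigma>p - a / 2))) * mpow (1 + node_val w (Bd p)) (a * (b + (\<sigma>m - a / 2))))"
    unfolding vertex_self_def Let_def chP by (simp add: dim_bulk_def mpow_zero prod_one_sets mult_ac)
  have ev: "vertex_coeff b qm qp \<phi> w C xs = mpow (node_deriv \<phi> w (Bd p)) (dim_bulk b a) *
    (mpow (node_deriv \<phi> w (Bd qm)) (dim_root (\<sigma>m - a / 2)) * mpow (node_deriv \<phi> w (Bd qp)) (dim_root (\<sigma>p - a / 2)) *
     ((mpow (1 - node_val w (Bd p)) (a * (b + (\<sigma>p - a / 2))) * mpow (1 + node_val w (Bd p)) (a * (b + (\<sigma>m - a / 2)))) *
      (\<Prod>k<n. vertex_self b \<phi> w C (Pt (z k)))) *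
     (\<Prod>k<n. vertex_interaction w C (Bd p) (Pt (z k)) * (\<Prod>j<k. vertex_interaction w C (Pt (z j)) (Pt (z k)))))"
  proof -
    have 1: "(\<Prod>j<Suc n. vertex_self b \<phi> w C (xs ! j)) = vertex_self b \<phi> w C (Bd p) * (\<Prod>k<n. vertex_self b \<phi> w C (Pt (z k)))"
      unfolding prod.lessThan_Suc_shift xs(2) by (intro arg_cong2[where f = "(*)"] prod.cong refl) (simp add: xs(3))
    have 2: "(\<Prod>k<Suc n. \<Prod>j<k. vertex_interaction w C (xs ! j) (xs ! k))
       = (\<Prod>k<n. vertex_interaction w C (Bd p) (Pt (z k)) * (\<Prod>j<k. vertex_interaction w C (Pt (z j)) (Pt (z k))))"
    proof -
      have "(\<Prod>k<Suc n. \<Prod>j<k. vertex_interaction w C (xs ! j) (xs ! k)) = (\<Prod>k<n. \<Prod>j<Suc k. vertex_interaction w C (xs ! j) (xs ! Suc k))"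
        unfolding prod.lessThan_Suc_shift[of _ n] by (simp add: prod_one_sets)
      also have "\<dots> = (\<Prod>k<n. vertex_interaction w C (Bd p) (Pt (z k)) * (\<Prod>j<k. vertex_interaction w C (Pt (z j)) (Pt (z k))))"
      proof (rule prod.cong[OF refl])
        fix k assume "k \<in> {..<n}"
        then show "(\<Prod>j<Suc k. vertex_interaction w C (xs ! j) (xs ! Suc k)) = vertex_interaction w C (Bd p) (Pt (z k)) * (\<Prod>j<k. vertex_interaction w C (Pt (z j)) (Pt (z k)))"
          unfolding prod.lessThan_Suc_shift xs(2) by (auto simp: xs(3) intro!: arg_cong2[where f = "(*)"] prod.cong)
      qed
      finally show ?thesis .
    qed
    show ?thesis unfolding vertex_coeff_def xs(1) 1 2 S0 chP by (simp only: mult_ac)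
  qed
  have N1: "near (mpow (node_deriv \<phi> w (Bd qm)) (dim_root (\<sigma>m - a / 2))) (of_real (dim_root (\<sigma>m - a / 2)) * (km + of_real c)) (br (dim_root (\<sigma>m - a / 2)))"
    "near (mpow (node_deriv \<phi> w (Bd qp)) (dim_root (\<sigma>p - a / 2))) (of_real (dim_root (\<sigma>p - a / 2)) * (kp - of_real c)) (br (dim_root (\<sigma>p - a / 2)))"
    by (intro near_mpow; simp only: qm qp)+
  have N2: "near (mpow (1 - node_val w (Bd p)) (a * (b + (\<sigma>p - a / 2)))) (of_real (a * (b + (\<sigma>p - a / 2))) * (- of_real c / 2 + Ap)) (br (a * (b + (\<sigma>p - a / 2))))"
    "near (mpow (1 + node_val w (Bd p)) (a * (b + (\<sigma>m - a / 2)))) (of_real (a * (b + (\<sigma>m - a / 2))) * (of_real c / 2 + Ap)) (br (a * (b + (\<sigma>m - a / 2))))"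
    using tanh_logs(1,2)[OF Ap] unfolding p by (intro near_mpow; simp)+
  have N3: "near (vertex_self b \<phi> w C (Pt (z k))) (of_real (dim_bulk b (\<sigma> k)) * (l k + 2 * A k - of_real (ln 2)) + of_real (dim_bulk b (\<sigma>s k)) * (cnj (l k) + 2 * cnj (A k) - of_real (ln 2))
          + of_real (\<sigma> k * (b + (\<sigma>p - a / 2))) * (- u k / 2 + A k) + of_real (\<sigma> k * (b + (\<sigma>m - a / 2))) * (u k / 2 + A k)
          + of_real (\<sigma>s k * (b + (\<sigma>p - a / 2))) * (- cnj (u k) / 2 + cnj (A k)) + of_real (\<sigma>s k * (b + (\<sigma>m - a / 2))) * (cnj (u k) / 2 + cnj (A k))
          + of_real (\<sigma> k * \<sigma>s k) * (le k k + A k + cnj (A k)))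
      (U_self b (\<sigma>m - a / 2) (\<sigma>p - a / 2) (\<sigma> k) (\<sigma>s k))" if k: "k < n" for k
    using near_vertex_self[OF A[OF k], of w "Pt (z k)" \<phi> "l k" "le k k" b C] w[OF k] dw[OF k] le[OF k, of k]
    by (simp add: chP chZ[OF k] u_def)
  have N4: "near (vertex_interaction w C (Bd p) (Pt (z k)))
     (of_real (a * \<sigma> k) * (\<mu> k + of_real pi * \<i> + Ap + A k) + of_real (a * \<sigma>s k) * (cnj (\<mu> k) + of_real pi * \<i> + Ap + cnj (A k)))
     (br (a * \<sigma> k) * br (a * \<sigma>s k))" if k: "k < n" for k
  proof -
    have m: "exp (\<mu> k + of_real pi * \<i>) = sinh ((of_real c - u k) / 2)" "exp (cnj (\<mu> k) + of_real pi * \<i>) = sinh ((of_real c - cnj (u k)) / 2)"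
    proof -
      have e: "exp (of_real pi * \<i>) = (-1 :: complex)" by (metis exp_pi_i mult.commute)
      show "exp (\<mu> k + of_real pi * \<i>) = sinh ((of_real c - u k) / 2)"
        unfolding exp_add e \<mu>[OF k] by (simp add: u_def)
      have "exp (cnj (\<mu> k)) = sinh (cnj (Z k) / 2)" using \<mu>[OF k] sinh_cosh_cnj(1)[of "Z k / 2"]  by (metis complex_cnj_divide complex_cnj_numeral exp_cnj)
      then show "exp (cnj (\<mu> k) + of_real pi * \<i>) = sinh ((of_real c - cnj (u k)) / 2)"
        unfolding exp_add e by (simp add: u_def)
    qed
    have cA: "exp (cnj (A k)) * cosh (cnj (u k) / 2) = 1"
    proof -
      have "cnj (exp (A k) * cosh (u k / 2)) = 1" unfolding A[OF k] by simp
      moreover have "cosh (cnj (u k) / 2) = cnj (cosh (u k / 2))" using sinh_cosh_cnj(2)[of "u k / 2"] by simp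
      ultimately show ?thesis by (simp add: exp_cnj)
    qed
    have ct: "tanh (cnj (u k) / 2) = cnj (tanh (u k / 2))"
      using sinh_cosh_cnj[of "u k / 2"] by (simp add: tanh_def)
    have 1: "exp (\<mu> k + of_real pi * \<i> + Ap + A k) = node_val w (Bd p) - node_val w (Pt (z k))"
      using tanh_diff_log[OF Ap A[OF k] m(1)] by (simp add: p w[OF k] u_def del: node_val.simps(2))
    have 2: "exp (cnj (\<mu> k) + of_real pi * \<i> + Ap + cnj (A k)) = node_val w (Bd p) - cnj (node_val w (Pt (z k)))"
      using tanh_diff_log[OF Ap cA m(2)] unfolding ct by (simp add: p w[OF k] u_def del: node_val.simps(2))
    have "vertex_interaction w C (Bd p) (Pt (z k)) = mpow (node_val w (Bd p) - node_val w (Pt (z k))) (a * \<sigma> k) * mpow (node_val w (Bd p) - cnj (node_val w (Pt (z k)))) (a * \<sigma>s k)"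
      unfolding vertex_interaction_def Let_def chP chZ[OF k] by (simp add: mpow_zero prod_one_sets)
    then show ?thesis by (simp only:) (intro near_mult near_mpow 1 2)
  qed
  have N5: "near (vertex_interaction w C (Pt (z j)) (Pt (z k)))
     (of_real (\<sigma> j * \<sigma> k) * (ld j k + A j + A k) + of_real (\<sigma> j * \<sigma>s k) * (le j k + A j + cnj (A k))
            + of_real (\<sigma>s j * \<sigma> k) * (cnj (le j k) + cnj (A j) + A k) + of_real (\<sigma>s j * \<sigma>s k) * (cnj (ld j k) + cnj (A j) + cnj (A k)))
     (U_int (\<sigma> j) (\<sigma>s j) (\<sigma> k) (\<sigma>s k))" if k: "k < n" and j: "j < k" for j k
    using near_vertex_interaction[OF A[of j] _ A[OF k], of w "Pt (z j)" "Pt (z k)" "ld j k" "le j k" C] w[OF k] w[of j] ld[OF k j] le[OF k, of j] j k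
    by (simp add: chZ u_def)
  have "near (mpow (node_deriv \<phi> w (Bd qm)) (dim_root (\<sigma>m - a / 2)) * mpow (node_deriv \<phi> w (Bd qp)) (dim_root (\<sigma>p - a / 2)) *
     ((mpow (1 - node_val w (Bd p)) (a * (b + (\<sigma>p - a / 2))) * mpow (1 + node_val w (Bd p)) (a * (b + (\<sigma>m - a / 2)))) *
      (\<Prod>k<n. vertex_self b \<phi> w C (Pt (z k)))) *
     (\<Prod>k<n. vertex_interaction w C (Bd p) (Pt (z k)) * (\<Prod>j<k. vertex_interaction w C (Pt (z j)) (Pt (z k)))))
    (vertex_log a b n \<sigma> \<sigma>s (\<sigma>m - a / 2) (\<sigma>p - a / 2) Ap km kp Z l \<mu> ld le)
    (U_all a b n \<sigma> \<sigma>s (\<sigma>m - a / 2) (\<sigma>p - a / 2))"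
  proof -
    have neut': "(\<sigma>m - a / 2) + (\<sigma>p - a / 2) + a + (\<Sum>k<n. \<sigma> k + \<sigma>s k) = 0" using neut by simp
    show ?thesis unfolding vertex_log_def neutral_log_sum[OF neut', symmetric, where c = c and A = A] U_all_def
      by (intro near_mult near_prod N1 N2 N3[unfolded u_def] N4 N5) auto
  qed
  then show ?thesis unfolding near_def C_def[symmetric] xs_def[symmetric] ev by (meson order.refl set_times_mono2)
qed

text \<open>The three components belong to the derivative at the tip, to the numerator and to the
  denominator.\<close>

definition U_obs :: "real \<Rightarrow> real \<Rightarrow> nat \<Rightarrow> (nat \<Rightarrow> real) \<Rightarrow> (nat \<Rightarrow> real) \<Rightarrow> real \<Rightarrow> real \<Rightarrow> complex set" where
  "U_obs a b n \<sigma> \<sigma>s \<sigma>m \<sigma>p = (\<lambda>(m, u, v). m * u / v) ` (br (dim_bulk b a) \<times> U_all a b n \<sigma> \<sigma>s (\<sigma>m - a / 2) (\<sigma>p - a / 2) \<times> U_all a b 0 (\<lambda>_. 0) (\<lambda>_. 0) (- a / 2) (- a / 2))"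

lemma countable_U_obs: "countable (U_obs a b n \<sigma> \<sigma>s \<sigma>m \<sigma>p)"
  unfolding U_obs_def by (intro countable_image countable_SIGMA countable_br countable_U_all)

text \<open>The denominator is the numerator for no nodes and vanishing \<sigma>m, \<sigma>p, so
  \<open>vertex_coeff_subset\<close> serves both. In the quotient the terms with \<open>Ap\<close>
  cancel, and the exponents at the roots become (\<sigma> - a/2)^2 / 2 - a^2 / 8 = \<sigma>
  (\<sigma> - a) / 2.\<close>

lemma observable_value:
  fixes c :: real
  assumes inj: "inj_on z {..<n}"
    and neut: "\<sigma>m + \<sigma>p + (\<Sum>k<n. \<sigma> k + \<sigma>s k) = 0"
    and X: "X \<in> rooted_vertex_field b qm qp \<phi> w (star (Psi_charge a p) (tuple_charge n \<sigma> \<sigma>s \<sigma>m \<sigma>p z)) (Bd p # map (\<lambda>j. Pt (z j)) [0..<n])"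
    and Y: "Y \<in> rooted_vertex_field b qm qp \<phi> w (Psi_charge a p) [Bd p]"
    and qm: "node_deriv \<phi> w (Bd qm) = exp (km + of_real c)" and qp: "node_deriv \<phi> w (Bd qp) = exp (kp - of_real c)"
    and p: "node_val w (Bd p) = tanh (of_real c / 2)"
    and ch: "\<And>k. k < n \<Longrightarrow> cosh ((Z k + of_real c) / 2) \<noteq> 0"
    and w: "\<And>k. k < n \<Longrightarrow> w (z k) = tanh ((Z k + of_real c) / 2)"
    and dw: "\<And>k. k < n \<Longrightarrow> deriv w (z k) = exp (l k) / (2 * (cosh ((Z k + of_real c) / 2))\<^sup>2)"
    and \<mu>: "\<And>k. k < n \<Longrightarrow> exp (\<mu> k) = sinh (Z k / 2)"
    and ld: "\<And>j k. k < n \<Longrightarrow> j < k \<Longrightarrow> exp (ld j k) = sinh ((Z j - Z k) / 2)"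
    and le: "\<And>j k. k < n \<Longrightarrow> j \<le> k \<Longrightarrow> exp (le j k) = sinh ((Z j - cnj (Z k)) / 2)"
  shows "\<exists>g\<in>U_obs a b n \<sigma> \<sigma>s \<sigma>m \<sigma>p. fock_expectation X / fock_expectation Y = g *
     exp (of_real (\<sigma>m * (\<sigma>m - a) / 2) * km + of_real (\<sigma>p * (\<sigma>p - a) / 2) * kp + log_coeff a b n \<sigma> \<sigma>s (\<sigma>m - a / 2) (\<sigma>p - a / 2) Z l \<mu> ld le)"
proof -
  have cr: "cosh (of_real c / 2 :: complex) \<noteq> 0"
  proof -
    have "cosh (of_real c / 2 :: complex) = of_real (cosh (c / 2))" by (simp add: cosh_field_def exp_of_real[symmetric])
    then show ?thesis by (simp add: cosh_real_nonzero)
  qed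
  define Ap where "Ap = - Ln (cosh (of_real c / 2))"
  have Ap: "exp Ap * cosh (of_real c / 2) = 1" using cr by (simp add: Ap_def exp_minus)
  define m0 where "m0 = mpow (node_deriv \<phi> w (Bd p)) (dim_bulk b a)"
  have "fock_expectation X \<in> m0 * ({exp (vertex_log a b n \<sigma> \<sigma>s (\<sigma>m - a / 2) (\<sigma>p - a / 2) Ap km kp Z l \<mu> ld le)} * U_all a b n \<sigma> \<sigma>s (\<sigma>m - a / 2) (\<sigma>p - a / 2))"
    using vertex_coeff_subset[OF inj neut Ap qm qp p ch w dw \<mu> ld le, of b a] rooted_vertex_expectation[OF X] unfolding m0_def by blast
  then obtain m u where mu: "m \<in> m0" "u \<in> U_all a b n \<sigma> \<sigma>s (\<sigma>m - a / 2) (\<sigma>p - a / 2)"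
    "fock_expectation X = m * (exp (vertex_log a b n \<sigma> \<sigma>s (\<sigma>m - a / 2) (\<sigma>p - a / 2) Ap km kp Z l \<mu> ld le) * u)"
    by (auto simp: set_times_def)
  have Y': "fock_expectation Y \<in> vertex_coeff b qm qp \<phi> w (star (Psi_charge a p) (tuple_charge 0 (\<lambda>_. 0) (\<lambda>_. 0) 0 0 z)) (Bd p # map (\<lambda>j. Pt (z j)) [0..<0])"
    using rooted_vertex_expectation[OF Y] by (simp add: star_def Psi_charge_def tuple_charge_def)
  have sub0: "vertex_coeff b qm qp \<phi> w (star (Psi_charge a p) (tuple_charge 0 (\<lambda>_. 0) (\<lambda>_. 0) 0 0 z)) (Bd p # map (\<lambda>j. Pt (z j)) [0..<0])
    \<subseteq> m0 * ({exp (vertex_log a b 0 (\<lambda>_. 0) (\<lambda>_. 0) (0 - a / 2) (0 - a / 2) Ap km kp Z l \<mu> ld le)} * U_all a b 0 (\<lambda>_. 0) (\<lambda>_. 0) (0 - a / 2) (0 - a / 2))"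
    unfolding m0_def by (rule vertex_coeff_subset[OF _ _ Ap qm qp p]) auto
  have "fock_expectation Y \<in> m0 * ({exp (vertex_log a b 0 (\<lambda>_. 0) (\<lambda>_. 0) (0 - a / 2) (0 - a / 2) Ap km kp Z l \<mu> ld le)} * U_all a b 0 (\<lambda>_. 0) (\<lambda>_. 0) (0 - a / 2) (0 - a / 2))"
    using sub0 Y' by blast
  then obtain m' v where mv: "m' \<in> m0" "v \<in> U_all a b 0 (\<lambda>_. 0) (\<lambda>_. 0) (- a / 2) (- a / 2)"
    "fock_expectation Y = m' * (exp (vertex_log a b 0 (\<lambda>_. 0) (\<lambda>_. 0) (- a / 2) (- a / 2) Ap km kp Z l \<mu> ld le) * v)"
    by (auto simp: set_times_def)
  have r: "m' \<noteq> 0" "m / m' \<in> br (dim_bulk b a)" using mpow_ratio mu(1) mv(1) unfolding m0_def by blast+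
  have dif: "vertex_log a b n \<sigma> \<sigma>s (\<sigma>m - a / 2) (\<sigma>p - a / 2) Ap km kp Z l \<mu> ld le - vertex_log a b 0 (\<lambda>_. 0) (\<lambda>_. 0) (- a / 2) (- a / 2) Ap km kp Z l \<mu> ld le
    = of_real (\<sigma>m * (\<sigma>m - a) / 2) * km + of_real (\<sigma>p * (\<sigma>p - a) / 2) * kp + log_coeff a b n \<sigma> \<sigma>s (\<sigma>m - a / 2) (\<sigma>p - a / 2) Z l \<mu> ld le"
    by (simp add: vertex_log_def log_coeff_def[of a b 0] dim_root_def power2_eq_square field_simps)
  have "fock_expectation X / fock_expectation Y = (m / m') * u / v *
     exp (vertex_log a b n \<sigma> \<sigma>s (\<sigma>m - a / 2) (\<sigma>p - a / 2) Ap km kp Z l \<mu> ld le - vertex_log a b 0 (\<lambda>_. 0) (\<lambda>_. 0) (- a / 2) (- a / 2) Ap km kp Z l \<mu> ld le)"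
    unfolding mu(3) mv(3) exp_diff by (simp add: mult_ac)
  moreover have "(m / m') * u / v \<in> U_obs a b n \<sigma> \<sigma>s \<sigma>m \<sigma>p"
    unfolding U_obs_def by (rule image_eqI[of _ _ "(m / m', u, v)"]) (use mu(2) mv(2) r(2) in simp_all)
  ultimately show ?thesis unfolding dif by blast
qed

section \<open>The backward heat equation\<close>

text \<open>On \<open>dstrip\<close> the values of sinh(Z/2) avoid the nonpositive axis, so the
  principal logarithm is holomorphic there. The value 0 elsewhere lets Borel measurability follow
  from continuity on \<open>dstrip\<close>.\<close>

definition lns :: "complex \<Rightarrow> complex" where
  "lns Z = (if Z \<in> dstrip then Ln (sinh (Z / 2)) else 0)"

lemma lns_deriv: "Z \<in> dstrip \<Longrightarrow> ((\<lambda>Z. Ln (sinh (Z / 2))) has_field_derivative cth Z / 2) (at Z within S)"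
proof -
  assume Z: "Z \<in> dstrip"
  have 1: "((\<lambda>Z. sinh (Z / 2)) has_field_derivative cosh (Z / 2) / 2) (at Z within S)" by (auto intro!: derivative_eq_intros)
  show "((\<lambda>Z. Ln (sinh (Z / 2))) has_field_derivative cth Z / 2) (at Z within S)"
    using DERIV_chain2[OF has_field_derivative_Ln[OF sinh_half_nonpos[OF Z]] 1] by (simp add: cth_def field_simps)
qed

lemma continuous_lns: "continuous_on dstrip lns"
proof -
  have "continuous_on dstrip (\<lambda>Z. Ln (sinh (Z / 2)))"
    by (rule DERIV_continuous_on) (rule lns_deriv)
  then show ?thesis by (rule continuous_on_eq) (simp add: lns_def)
qed

lemma continuous_cth: "continuous_on dstrip cth"
  by (rule DERIV_continuous_on) (rule cth_deriv)

text \<open>For positive \<open>e\<close> a compact part of \<open>dstrip\<close>, on which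
  continuous functions such as \<open>lns\<close> and \<open>cth\<close> are bounded.\<close>

definition kbox :: "real \<Rightarrow> real \<Rightarrow> complex set" where
  "kbox e R = {Z. \<bar>Re Z\<bar> \<le> R \<and> e \<le> \<bar>Im Z\<bar> \<and> \<bar>Im Z\<bar> \<le> pi}"

lemma kbox_dstrip: "0 < e \<Longrightarrow> kbox e R \<subseteq> dstrip"
  by (auto simp: kbox_def dstrip_def)

lemma compact_kbox: "compact (kbox e R)"
proof -
  have "closed (kbox e R)" unfolding kbox_def by (intro closed_Collect_conj closed_Collect_le continuous_intros)
  moreover have "bounded (kbox e R)"
  proof (rule boundedI)
    fix Z assume "Z \<in> kbox e R"
    then show "norm Z \<le> R + pi" using cmod_le[of Z] by (auto simp: kbox_def)
  qed
  ultimately show ?thesis by (simp add: compact_eq_bounded_closed)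
qed

lemma kbox_shift: "Z \<in> kbox e R \<Longrightarrow> \<bar>x\<bar> \<le> X \<Longrightarrow> Z - of_real x \<in> kbox e (R + X)"
  by (auto simp: kbox_def)

text \<open>Keeps the driving value bounded during the last time step, which may end after the
  stopping time.\<close>

definition clampr :: "real \<Rightarrow> real \<Rightarrow> real" where "clampr X x = max (- X) (min X x)"

lemma clampr: "0 \<le> X \<Longrightarrow> \<bar>clampr X x\<bar> \<le> X" "\<bar>x\<bar> \<le> X \<Longrightarrow> clampr X x = x"
  "\<bar>clampr X x - clampr X y\<bar> \<le> \<bar>x - y\<bar>"
  by (auto simp: clampr_def max_def min_def)

lemma continuous_clampr: "continuous_on S f \<Longrightarrow> continuous_on S (\<lambda>s. clampr X (f s))"
  unfolding clampr_def by (intro continuous_intros)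

text \<open>The algebra of the heat equation, separated from the flow. In the application
  \<open>I\<close> indexes the nodes and their conjugates, \<open>d\<close> is the difference of the
  root charges, and \<open>\<beta>\<close> and \<open>-\<mu>\<close> are the coefficients of the
  driving function and of time that come from the roots.\<close>

locale heat =
  fixes I :: "'i set" and q :: "'i \<Rightarrow> real" and a b d \<kappa> \<beta> \<mu> :: real
  assumes finI: "finite I"
begin

text \<open>\<open>H0\<close> is the exponential of the path functional, as a function of the position \<open>x\<close> of the driving
  path; \<open>H1\<close>, \<open>H2\<close>, \<open>H3\<close> are its derivatives in \<open>x\<close>, and \<open>Hs\<close> is its derivative in time when the \<open>y i\<close> move
  with velocities \<open>c i\<close> and \<open>A\<close> with velocity \<open>al c\<close>.\<close>

definition rt :: real where "rt = (\<Sum>i\<in>I. q i)"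
definition phi :: "complex \<Rightarrow> complex" where "phi Z = of_real (d / 2) * Z + of_real a * lns Z"
definition phi1 :: "complex \<Rightarrow> complex" where "phi1 Z = of_real (d / 2) + of_real (a / 2) * cth Z"
definition phi2 :: "complex \<Rightarrow> complex" where "phi2 Z = - of_real (a / 4) * ((cth Z)\<^sup>2 - 1)"
definition phi3 :: "complex \<Rightarrow> complex" where "phi3 Z = of_real (a / 4) * cth Z * ((cth Z)\<^sup>2 - 1)"
definition al :: "('i \<Rightarrow> complex) \<Rightarrow> complex" where
  "al c = - of_real \<mu> + (of_real (rt\<^sup>2) - (\<Sum>i\<in>I. of_real (q i) * c i)\<^sup>2) / 4 + of_real (b / 2) * ((\<Sum>i\<in>I. of_real (q i) * (c i)\<^sup>2) - of_real rt)"
definition H0 :: "complex \<Rightarrow> ('i \<Rightarrow> complex) \<Rightarrow> complex \<Rightarrow> complex" where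
  "H0 A y x = exp (A + of_real \<beta> * x + (\<Sum>i\<in>I. of_real (q i) * phi (y i - x)))"
definition L1 :: "('i \<Rightarrow> complex) \<Rightarrow> complex \<Rightarrow> complex" where "L1 y x = of_real \<beta> - (\<Sum>i\<in>I. of_real (q i) * phi1 (y i - x))"
definition L2 :: "('i \<Rightarrow> complex) \<Rightarrow> complex \<Rightarrow> complex" where "L2 y x = (\<Sum>i\<in>I. of_real (q i) * phi2 (y i - x))"
definition L3 :: "('i \<Rightarrow> complex) \<Rightarrow> complex \<Rightarrow> complex" where "L3 y x = - (\<Sum>i\<in>I. of_real (q i) * phi3 (y i - x))"
definition H1 :: "complex \<Rightarrow> ('i \<Rightarrow> complex) \<Rightarrow> complex \<Rightarrow> complex" where "H1 A y x = H0 A y x * L1 y x"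
definition H2 :: "complex \<Rightarrow> ('i \<Rightarrow> complex) \<Rightarrow> complex \<Rightarrow> complex" where "H2 A y x = H0 A y x * ((L1 y x)\<^sup>2 + L2 y x)"
definition H3 :: "complex \<Rightarrow> ('i \<Rightarrow> complex) \<Rightarrow> complex \<Rightarrow> complex" where "H3 A y x = H0 A y x * ((L1 y x)^3 + 3 * L1 y x * L2 y x + L3 y x)"
definition Hs :: "complex \<Rightarrow> ('i \<Rightarrow> complex) \<Rightarrow> complex \<Rightarrow> ('i \<Rightarrow> complex) \<Rightarrow> complex" where
  "Hs A y x c = H0 A y x * (al c + (\<Sum>i\<in>I. of_real (q i) * phi1 (y i - x) * c i))"

text \<open>Let G and r be the sums of q c and q c^2 over the nodes. Then \<open>L1\<close> is a (d
  - G) / 2, for which \<open>\<beta>\<close> is chosen, and \<open>L2\<close> is - a (r - rt) / 4.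
  The terms in G match because \<kappa> a^2 = 2, those in r because b/2 + a/2 = \<kappa> a / 8, and
  the constant terms determine \<mu>.\<close>

lemma pde:
  assumes mu: "\<mu> = (rt\<^sup>2 + d\<^sup>2) / 4 + a * rt / 2" and be: "\<beta> = d * (rt + a) / 2"
    and ka: "\<kappa> * a\<^sup>2 = 2" and bb: "b = \<kappa> * a / 4 - a"
  shows "Hs A y x (\<lambda>i. cth (y i - x)) = - of_real (\<kappa> / 2) * H2 A y x"
proof -
  define G where "G = (\<Sum>i\<in>I. of_real (q i) * cth (y i - x))"
  define r where "r = (\<Sum>i\<in>I. of_real (q i) * (cth (y i - x))\<^sup>2)"
  define R where "R = complex_of_real rt"
  have R: "R = (\<Sum>i\<in>I. of_real (q i))" by (simp add: R_def rt_def)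
  have s1: "(\<Sum>i\<in>I. of_real (q i) * phi1 (y i - x)) = of_real (d / 2) * R + of_real (a / 2) * G"
    unfolding R G_def phi1_def sum_distrib_left by (simp add: sum.distrib distrib_left mult_ac)
  have s2: "(\<Sum>i\<in>I. of_real (q i) * phi2 (y i - x)) = - of_real (a / 4) * (r - R)"
    unfolding R r_def phi2_def sum_subtractf[symmetric] sum_distrib_left by (rule sum.cong) (auto simp: algebra_simps)
  have s3: "(\<Sum>i\<in>I. of_real (q i) * phi1 (y i - x) * cth (y i - x)) = of_real (d / 2) * G + of_real (a / 2) * r"
    unfolding G_def r_def phi1_def sum_distrib_left sum.distrib[symmetric] by (rule sum.cong) (auto simp: algebra_simps power2_eq_square)
  define a' d' k' where "a' = complex_of_real a" and "d' = complex_of_real d" and "k' = complex_of_real \<kappa>"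
  have ka': "k' * a'\<^sup>2 = 2" unfolding a'_def k'_def using arg_cong[OF ka, of complex_of_real] by simp
  have L1: "L1 y x = a' / 2 * (d' - G)"
  proof -
    have "L1 y x = of_real \<beta> - (of_real (d / 2) * R + of_real (a / 2) * G)" by (simp only: L1_def s1)
    moreover have "of_real \<beta> = d' * (R + a') / 2" by (simp add: be a'_def d'_def R_def)
    ultimately have "L1 y x = d' * (R + a') / 2 - (d' / 2 * R + a' / 2 * G)" by (simp add: a'_def d'_def)
    then show ?thesis by (simp add: algebra_simps add_divide_distrib diff_divide_distrib)
  qed
  have L2: "L2 y x = - a' / 4 * (r - R)" unfolding L2_def s2 a'_def by simp
  have al: "al (\<lambda>i. cth (y i - x)) = - ((R\<^sup>2 + d'\<^sup>2) / 4 + a' * R / 2) + (R\<^sup>2 - G\<^sup>2) / 4 + (k' * a' / 4 - a') / 2 * (r - R)"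
  proof -
    have "al (\<lambda>i. cth (y i - x)) = - of_real \<mu> + (of_real (rt\<^sup>2) - G\<^sup>2) / 4 + of_real (b / 2) * (r - of_real rt)"
      by (simp only: al_def G_def r_def)
    moreover have "of_real \<mu> = (R\<^sup>2 + d'\<^sup>2) / 4 + a' * R / 2" by (simp add: mu a'_def d'_def R_def)
    moreover have "of_real (b / 2) = (k' * a' / 4 - a') / 2" by (simp add: bb a'_def k'_def)
    ultimately show ?thesis by (simp add: R_def)
  qed
  have sq: "k' / 2 * (L1 y x)\<^sup>2 = (d' - G)\<^sup>2 / 4"
  proof -
    have "k' / 2 * (L1 y x)\<^sup>2 = (k' * a'\<^sup>2) * (d' - G)\<^sup>2 / 8" unfolding L1 by (simp add: power2_eq_square field_simps)
    then show ?thesis unfolding ka' by simp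
  qed
  have "al (\<lambda>i. cth (y i - x)) + (d' / 2 * G + a' / 2 * r) = - (k' / 2 * (L1 y x)\<^sup>2 + k' / 2 * L2 y x)"
    unfolding sq unfolding L2 al by (simp add: power2_eq_square field_simps)
  then have "al (\<lambda>i. cth (y i - x)) + (d' / 2 * G + a' / 2 * r) = - (k' / 2) * ((L1 y x)\<^sup>2 + L2 y x)"
    by (simp add: algebra_simps)
  then show ?thesis
    unfolding Hs_def H2_def s3 by (simp add: a'_def d'_def k'_def)
qed

lemma phi_deriv:
  assumes "Z \<in> dstrip" "S \<subseteq> dstrip" "Z \<in> S"
  shows "(phi has_field_derivative phi1 Z) (at Z within S)"
proof -
  have "((\<lambda>Z. of_real (d / 2) * Z + of_real a * Ln (sinh (Z / 2))) has_field_derivative phi1 Z) (at Z within S)"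
  proof -
    have "((\<lambda>Z. of_real (d / 2) * Z) has_field_derivative of_real (d / 2)) (at Z within S)" by (auto intro!: derivative_eq_intros)
    from DERIV_add[OF this DERIV_cmult[OF lns_deriv[OF assms(1)], of "of_real a"]] show ?thesis by (simp add: phi1_def)
  qed
  then show ?thesis
    by (rule has_field_derivative_transform_within[of _ _ _ _ 1]) (use assms in \<open>auto simp: phi_def lns_def subset_eq\<close>)
qed

lemma phi12_deriv:
  assumes "Z \<in> dstrip"
  shows "(phi1 has_field_derivative phi2 Z) (at Z within S)" "(phi2 has_field_derivative phi3 Z) (at Z within S)"
  unfolding phi1_def[abs_def] phi2_def[abs_def] phi3_def
  by (rule derivative_eq_intros cth_deriv assms refl | simp add: field_simps power2_eq_square)+

text \<open>Derivatives are taken relative to a set of positions for which all differences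
  \<open>y i - x\<close> lie in \<open>dstrip\<close>, the region where \<open>lns\<close> is a
  logarithm.\<close>

lemma H_derivs:
  fixes S :: "complex set"
  assumes S: "\<And>x i. x \<in> S \<Longrightarrow> i \<in> I \<Longrightarrow> y i - x \<in> dstrip" and x: "x \<in> S"
  shows "((\<lambda>x. H0 A y x) has_field_derivative H1 A y x) (at x within S)"
    "((\<lambda>x. H1 A y x) has_field_derivative H2 A y x) (at x within S)"
    "((\<lambda>x. H2 A y x) has_field_derivative H3 A y x) (at x within S)"
proof -
  have sub: "((\<lambda>x. y i - x) has_field_derivative -1) (at x within S)" for i by (auto intro!: derivative_eq_intros)
  have p: "((\<lambda>x. phi (y i - x)) has_field_derivative - phi1 (y i - x)) (at x within S)"
    "((\<lambda>x. phi1 (y i - x)) has_field_derivative - phi2 (y i - x)) (at x within S)"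
    "((\<lambda>x. phi2 (y i - x)) has_field_derivative - phi3 (y i - x)) (at x within S)" if i: "i \<in> I" for i
  proof -
    have "(phi has_field_derivative phi1 (y i - x)) (at (y i - x) within ((\<lambda>x. y i - x) ` S))"
      by (rule phi_deriv) (use S i x in auto)
    from DERIV_image_chain[OF this sub] show "((\<lambda>x. phi (y i - x)) has_field_derivative - phi1 (y i - x)) (at x within S)"
      by (simp add: comp_def)
    from DERIV_image_chain[OF phi12_deriv(1)[OF S[OF x i]] sub] show "((\<lambda>x. phi1 (y i - x)) has_field_derivative - phi2 (y i - x)) (at x within S)"
      by (simp add: comp_def)
    from DERIV_image_chain[OF phi12_deriv(2)[OF S[OF x i]] sub] show "((\<lambda>x. phi2 (y i - x)) has_field_derivative - phi3 (y i - x)) (at x within S)"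
      by (simp add: comp_def)
  qed
  have s: "((\<lambda>x. \<Sum>i\<in>I. of_real (q i) * phi (y i - x)) has_field_derivative (\<Sum>i\<in>I. of_real (q i) * (- phi1 (y i - x)))) (at x within S)"
    "((\<lambda>x. \<Sum>i\<in>I. of_real (q i) * phi1 (y i - x)) has_field_derivative (\<Sum>i\<in>I. of_real (q i) * (- phi2 (y i - x)))) (at x within S)"
    "((\<lambda>x. \<Sum>i\<in>I. of_real (q i) * phi2 (y i - x)) has_field_derivative (\<Sum>i\<in>I. of_real (q i) * (- phi3 (y i - x)))) (at x within S)"
    by (intro DERIV_sum DERIV_cmult p; assumption)+
  have L1': "((\<lambda>x. L1 y x) has_field_derivative L2 y x) (at x within S)"
    unfolding L1_def L2_def using DERIV_diff[OF DERIV_const[of "of_real \<beta>"] s(2)] by (simp add: sum_negf)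
  have L2': "((\<lambda>x. L2 y x) has_field_derivative L3 y x) (at x within S)"
    unfolding L2_def L3_def using s(3) by (simp add: sum_negf)
  have lin: "((\<lambda>x. A + of_real \<beta> * x + (\<Sum>i\<in>I. of_real (q i) * phi (y i - x))) has_field_derivative L1 y x) (at x within S)"
  proof -
    have "((\<lambda>x. A + of_real \<beta> * x) has_field_derivative of_real \<beta>) (at x within S)" by (auto intro!: derivative_eq_intros)
    from DERIV_add[OF this s(1)] show ?thesis unfolding L1_def by (simp add: sum_negf)
  qed
  show H0': "((\<lambda>x. H0 A y x) has_field_derivative H1 A y x) (at x within S)"
    unfolding H0_def H1_def by (rule DERIV_chain2[OF DERIV_exp lin])
  have 1: "((\<lambda>x. H0 A y x * L1 y x) has_field_derivative H1 A y x * L1 y x + L2 y x * H0 A y x) (at x within S)"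
    by (rule DERIV_mult[OF H0' L1'])
  have eq1: "H1 A y x * L1 y x + L2 y x * H0 A y x = H2 A y x" by (simp add: H1_def H2_def power2_eq_square algebra_simps)
  show H1': "((\<lambda>x. H1 A y x) has_field_derivative H2 A y x) (at x within S)"
    using 1 unfolding eq1 by (simp add: H1_def[abs_def])
  have 2: "((\<lambda>x. H1 A y x * L1 y x + H0 A y x * L2 y x) has_field_derivative
     (H2 A y x * L1 y x + L2 y x * H1 A y x) + (H1 A y x * L2 y x + L3 y x * H0 A y x)) (at x within S)"
    by (intro DERIV_add DERIV_mult H1' L1' H0' L2')
  have eq2: "(H2 A y x * L1 y x + L2 y x * H1 A y x) + (H1 A y x * L2 y x + L3 y x * H0 A y x) = H3 A y x"
    by (simp add: H1_def H2_def H3_def power2_eq_square power3_eq_cube algebra_simps)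
  show "((\<lambda>x. H2 A y x) has_field_derivative H3 A y x) (at x within S)"
    using 2 unfolding eq2 by (simp add: H1_def H2_def[abs_def] power2_eq_square distrib_left mult.assoc)
qed

lemma bounded_on_kbox:
  assumes e: "0 < e"
  obtains C where "0 \<le> C" "\<And>Z. Z \<in> kbox e R \<Longrightarrow> norm (phi Z) \<le> C \<and> norm (phi1 Z) \<le> C \<and> norm (phi2 Z) \<le> C \<and> norm (phi3 Z) \<le> C"
proof -
  have cl: "continuous_on (kbox e R) lns" "continuous_on (kbox e R) cth"
    using continuous_on_subset[OF continuous_lns kbox_dstrip[OF e]] continuous_on_subset[OF continuous_cth kbox_dstrip[OF e]] by auto
  have "bounded (f ` kbox e R)" if "continuous_on (kbox e R) f" for f :: "complex \<Rightarrow> complex"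
    using compact_continuous_image[OF that compact_kbox] by (rule compact_imp_bounded)
  moreover have "continuous_on (kbox e R) phi" "continuous_on (kbox e R) phi1" "continuous_on (kbox e R) phi2" "continuous_on (kbox e R) phi3"
    unfolding phi_def[abs_def] phi1_def[abs_def] phi2_def[abs_def] phi3_def[abs_def] by (intro continuous_intros cl)+
  ultimately obtain B0 B1 B2 B3 where B: "\<And>Z. Z \<in> kbox e R \<Longrightarrow> norm (phi Z) \<le> B0" "\<And>Z. Z \<in> kbox e R \<Longrightarrow> norm (phi1 Z) \<le> B1"
    "\<And>Z. Z \<in> kbox e R \<Longrightarrow> norm (phi2 Z) \<le> B2" "\<And>Z. Z \<in> kbox e R \<Longrightarrow> norm (phi3 Z) \<le> B3"
    unfolding bounded_iff by (metis image_eqI)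
  show thesis
    by (rule that[of "max 0 (max (max B0 B1) (max B2 B3))"]) (use B in \<open>force simp: le_max_iff_disj\<close>)+
qed

lemma norm_weighted_sum:
  assumes "\<And>i. i \<in> I \<Longrightarrow> norm (f i) \<le> C"
  shows "norm (\<Sum>i\<in>I. of_real (q i) * f i :: complex) \<le> (\<Sum>i\<in>I. \<bar>q i\<bar>) * C"
proof -
  have "norm (\<Sum>i\<in>I. of_real (q i) * f i) \<le> (\<Sum>i\<in>I. \<bar>q i\<bar> * C)"
    using assms by (intro sum_norm_le) (auto simp: norm_mult intro!: mult_left_mono)
  then show ?thesis by (simp add: sum_distrib_right)
qed

lemma al_bound:
  assumes "\<And>i. i \<in> I \<Longrightarrow> norm (c i) \<le> M" 
  shows "norm (al c) \<le> \<bar>\<mu>\<bar> + (rt\<^sup>2 + ((\<Sum>i\<in>I. \<bar>q i\<bar>) * M)\<^sup>2) / 4 + \<bar>b / 2\<bar> * ((\<Sum>i\<in>I. \<bar>q i\<bar>) * M\<^sup>2 + \<bar>rt\<bar>)"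
proof -
  have 1: "norm (\<Sum>i\<in>I. of_real (q i) * c i) \<le> (\<Sum>i\<in>I. \<bar>q i\<bar>) * M" by (rule norm_weighted_sum) (rule assms)
  have 2: "norm (\<Sum>i\<in>I. of_real (q i) * (c i)\<^sup>2) \<le> (\<Sum>i\<in>I. \<bar>q i\<bar>) * M\<^sup>2"
    by (rule norm_weighted_sum) (simp add: norm_power assms power_mono)
  have "norm (al c) \<le> norm (- complex_of_real \<mu>) + norm ((of_real (rt\<^sup>2) - (\<Sum>i\<in>I. of_real (q i) * c i)\<^sup>2) / 4)
     + norm (complex_of_real (b / 2) * ((\<Sum>i\<in>I. of_real (q i) * (c i)\<^sup>2) - of_real rt))"
    unfolding al_def by (intro norm_triangle_le add_mono order_refl)
  also have "\<dots> \<le> \<bar>\<mu>\<bar> + (rt\<^sup>2 + ((\<Sum>i\<in>I. \<bar>q i\<bar>) * M)\<^sup>2) / 4 + \<bar>b / 2\<bar> * ((\<Sum>i\<in>I. \<bar>q i\<bar>) * M\<^sup>2 + \<bar>rt\<bar>)"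
  proof (intro add_mono)
    have "norm (complex_of_real (rt\<^sup>2) - (\<Sum>i\<in>I. of_real (q i) * c i)\<^sup>2) \<le> rt\<^sup>2 + (norm (\<Sum>i\<in>I. of_real (q i) * c i))\<^sup>2"
      using norm_triangle_ineq4[of "complex_of_real (rt\<^sup>2)" "(\<Sum>i\<in>I. of_real (q i) * c i)\<^sup>2"] by (simp add: norm_power)
    also have "\<dots> \<le> rt\<^sup>2 + ((\<Sum>i\<in>I. \<bar>q i\<bar>) * M)\<^sup>2" using 1 by (intro add_left_mono power_mono) auto
    finally show "norm ((complex_of_real (rt\<^sup>2) - (\<Sum>i\<in>I. of_real (q i) * c i)\<^sup>2) / 4) \<le> (rt\<^sup>2 + ((\<Sum>i\<in>I. \<bar>q i\<bar>) * M)\<^sup>2) / 4" 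
      by (simp add: norm_divide)
    have "norm ((\<Sum>i\<in>I. of_real (q i) * (c i)\<^sup>2) - complex_of_real rt) \<le> (\<Sum>i\<in>I. \<bar>q i\<bar>) * M\<^sup>2 + \<bar>rt\<bar>"
      using norm_triangle_ineq4[of "\<Sum>i\<in>I. of_real (q i) * (c i)\<^sup>2" "complex_of_real rt"] 2 by simp
    then show "norm (complex_of_real (b / 2) * ((\<Sum>i\<in>I. of_real (q i) * (c i)\<^sup>2) - complex_of_real rt)) \<le> \<bar>b / 2\<bar> * ((\<Sum>i\<in>I. \<bar>q i\<bar>) * M\<^sup>2 + \<bar>rt\<bar>)"
      unfolding norm_mult by (intro mult_mono) auto
  qed simp
  finally show ?thesis .
qed

text \<open>The constant depends only on the bounds for \<open>A\<close>, \<open>x\<close>,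
  \<open>y\<close> and \<open>c\<close>, so it can be used for all paths at once.\<close>

lemma H_bounds:
  assumes e: "0 < e"
  obtains C where "0 \<le> C" "\<And>A y x c. norm A \<le> RA \<Longrightarrow> \<bar>x\<bar> \<le> X \<Longrightarrow> (\<And>i. i \<in> I \<Longrightarrow> y i \<in> kbox e R) \<Longrightarrow> (\<And>i. i \<in> I \<Longrightarrow> norm (c i) \<le> M) \<Longrightarrow>
     norm (H0 A y (of_real x)) \<le> C \<and> norm (H1 A y (of_real x)) \<le> C \<and> norm (H2 A y (of_real x)) \<le> C \<and> norm (H3 A y (of_real x)) \<le> C \<and> norm (Hs A y (of_real x) c) \<le> C"
proof -
  obtain B where B: "0 \<le> B" "\<And>Z. Z \<in> kbox e (R + X) \<Longrightarrow> norm (phi Z) \<le> B \<and> norm (phi1 Z) \<le> B \<and> norm (phi2 Z) \<le> B \<and> norm (phi3 Z) \<le> B"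
    using bounded_on_kbox[OF e, of "R + X"] by metis
  define Q where "Q = (\<Sum>i\<in>I. \<bar>q i\<bar>)"
  have Q: "0 \<le> Q" by (simp add: Q_def sum_nonneg)
  define E where "E = exp (RA + \<bar>\<beta>\<bar> * X + Q * B)"
  define N where "N = \<bar>\<beta>\<bar> + Q * B"
  define Ba where "Ba = \<bar>\<mu>\<bar> + (rt\<^sup>2 + (Q * M)\<^sup>2) / 4 + \<bar>b / 2\<bar> * (Q * M\<^sup>2 + \<bar>rt\<bar>)"
  have N: "0 \<le> N" using Q B(1) by (simp add: N_def)
  define C where "C = E * (1 + N + (N\<^sup>2 + N) + (N^3 + 3 * N * N + N) + \<bar>Ba\<bar> + Q * (B * \<bar>M\<bar>))"
  have C: "0 \<le> C" using N Q B(1) by (simp add: C_def E_def)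
  show thesis
  proof (rule that[OF C])
    fix A :: complex and y c :: "'i \<Rightarrow> complex" and x :: real assume A: "norm A \<le> RA" and x: "\<bar>x\<bar> \<le> X" and y: "\<And>i. i \<in> I \<Longrightarrow> y i \<in> kbox e R" and c: "\<And>i. i \<in> I \<Longrightarrow> norm (c i) \<le> M"
    have yx: "y i - of_real x \<in> kbox e (R + X)" if "i \<in> I" for i using kbox_shift[OF y[OF that] x] .
    have s: "norm (\<Sum>i\<in>I. of_real (q i) * f (y i - of_real x) :: complex) \<le> Q * B" if "f \<in> {phi, phi1, phi2, phi3}" for f
      unfolding Q_def by (rule norm_weighted_sum) (use B(2)[OF yx] that in auto)
    have h0: "norm (H0 A y (of_real x)) \<le> E"
    proof -
      have "Re (A + of_real \<beta> * of_real x + (\<Sum>i\<in>I. of_real (q i) * phi (y i - of_real x))) \<le> norm (A + of_real \<beta> * of_real x + (\<Sum>i\<in>I. of_real (q i) * phi (y i - of_real x)))"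
        by (rule complex_Re_le_cmod)
      also have "\<dots> \<le> RA + \<bar>\<beta>\<bar> * X + Q * B"
        using A x s[of phi] by (intro norm_triangle_le add_mono) (auto simp: norm_mult intro!: mult_left_mono)
      finally show ?thesis by (simp add: H0_def E_def)
    qed
    have l1: "norm (L1 y (of_real x)) \<le> N"
      unfolding L1_def N_def using s[of phi1] by (intro norm_triangle_le_diff add_mono) auto
    have QB: "Q * B \<le> N" by (simp add: N_def)
    have l2: "norm (L2 y (of_real x)) \<le> N" and l3: "norm (L3 y (of_real x)) \<le> N"
      unfolding L2_def L3_def using s[of phi2] s[of phi3] QB by auto
    have m2: "norm ((L1 y (of_real x))\<^sup>2 + L2 y (of_real x)) \<le> N\<^sup>2 + N"
      using l1 l2 by (intro norm_triangle_le add_mono) (auto simp: norm_power intro!: power_mono)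
    have m3: "norm ((L1 y (of_real x))^3 + 3 * L1 y (of_real x) * L2 y (of_real x) + L3 y (of_real x)) \<le> N^3 + 3 * N * N + N"
      using l1 l2 l3 N by (intro norm_triangle_le add_mono) (auto simp: norm_power norm_mult intro!: power_mono mult_mono)
    have ms: "norm (al c + (\<Sum>i\<in>I. of_real (q i) * phi1 (y i - of_real x) * c i)) \<le> \<bar>Ba\<bar> + Q * (B * \<bar>M\<bar>)"
    proof (intro norm_triangle_le add_mono)
      show "norm (al c) \<le> \<bar>Ba\<bar>" using al_bound[of c M, OF c] unfolding Ba_def Q_def by linarith
      have "norm (phi1 (y i - of_real x) * c i) \<le> B * \<bar>M\<bar>" if i: "i \<in> I" for i
        unfolding norm_mult using B(2)[OF yx[OF i]] c[OF i] B(1) by (intro mult_mono) auto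
      then have "norm (\<Sum>i\<in>I. of_real (q i) * (phi1 (y i - of_real x) * c i)) \<le> Q * (B * \<bar>M\<bar>)"
        unfolding Q_def by (rule norm_weighted_sum)
      then show "norm (\<Sum>i\<in>I. of_real (q i) * phi1 (y i - of_real x) * c i) \<le> Q * (B * \<bar>M\<bar>)" by (simp add: mult.assoc)
    qed
    have le: "E * t \<le> C" if "t \<le> 1 + N + (N\<^sup>2 + N) + (N^3 + 3 * N * N + N) + \<bar>Ba\<bar> + Q * (B * \<bar>M\<bar>)" for t
      unfolding C_def using that by (intro mult_left_mono) (auto simp: E_def)
    have pr: "norm (H0 A y (of_real x) * w) \<le> C" if "norm w \<le> t" "t \<le> 1 + N + (N\<^sup>2 + N) + (N^3 + 3 * N * N + N) + \<bar>Ba\<bar> + Q * (B * \<bar>M\<bar>)" for w t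
    proof -
      have "norm (H0 A y (of_real x) * w) \<le> E * t" unfolding norm_mult using h0 that(1) by (intro mult_mono) (auto simp: E_def)
      then show ?thesis using le[OF that(2)] by simp
    qed
    have nn: "0 \<le> N\<^sup>2" "0 \<le> N^3" "0 \<le> 3 * N * N" "0 \<le> \<bar>Ba\<bar>" "0 \<le> Q * (B * \<bar>M\<bar>)" using N Q B(1) by auto
    show "norm (H0 A y (of_real x)) \<le> C \<and> norm (H1 A y (of_real x)) \<le> C \<and> norm (H2 A y (of_real x)) \<le> C \<and> norm (H3 A y (of_real x)) \<le> C \<and> norm (Hs A y (of_real x) c) \<le> C"
      unfolding H1_def H2_def H3_def Hs_def using pr[of 1 1] pr[OF l1] pr[OF m2] pr[OF m3] pr[OF ms] nn N by simp
  qed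
qed

end

context heat begin

section \<open>Increments of the exponential functional along a path\<close>

lemma continuous_phis:
  "continuous_on dstrip phi" "continuous_on dstrip phi1"
  unfolding phi_def[abs_def] phi1_def[abs_def] by (intro continuous_intros continuous_lns continuous_cth)+

text \<open>Taylor's formula for complex functions on the real segment [-X, X], where the third
  derivative is bounded.\<close>

lemma H0_taylor:
  fixes x x' :: real
  assumes e: "0 < e" and X: "\<bar>x\<bar> \<le> X" "\<bar>x'\<bar> \<le> X" and y: "\<And>i. i \<in> I \<Longrightarrow> y i \<in> kbox e R"
    and B: "\<And>x. \<bar>x\<bar> \<le> X \<Longrightarrow> norm (H3 A y (of_real x)) \<le> C"
  shows "norm (H0 A y (of_real x') - H0 A y (of_real x) - (H1 A y (of_real x) * of_real (x' - x) + H2 A y (of_real x) * of_real ((x' - x)\<^sup>2 / 2))) \<le> C * \<bar>x' - x\<bar>^3"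
proof -
  define S where "S = complex_of_real ` {-X..X}"
  have cS: "convex S" unfolding S_def by (intro convex_linear_image bounded_linear.linear[OF bounded_linear_of_real]) auto
  have D: "y i - u \<in> dstrip" if "u \<in> S" "i \<in> I" for u i
    using y[OF that(2)] that(1) e by (auto simp: S_def kbox_def dstrip_def)
  define f where "f = (\<lambda>i::nat. if i = 0 then H0 A y else if i = 1 then H1 A y else if i = 2 then H2 A y else H3 A y)"
  have "norm (f 0 (of_real x') - (\<Sum>i\<le>2. f i (of_real x) * (of_real x' - of_real x) ^ i / fact i)) \<le> C * norm (complex_of_real x' - of_real x) ^ (Suc 2) / fact 2"
  proof (rule complex_Taylor[OF cS])
    fix i u assume u: "u \<in> S" and "i \<le> (2::nat)"
    then consider "i = 0" | "i = 1" | "i = 2" by linarith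
    then show "(f i has_field_derivative f (Suc i) u) (at u within S)"
      by cases (use H_derivs[where S = S and y = y and A = A and x = u, OF D u] in \<open>simp_all add: f_def\<close>)
  next
    fix u assume "u \<in> S" then show "norm (f (Suc 2) u) \<le> C" using B by (auto simp: f_def S_def)
  qed (use X in \<open>auto simp: S_def abs_le_iff intro!: imageI\<close>)
  also have "(\<Sum>i\<le>2. f i (of_real x) * (complex_of_real x' - of_real x) ^ i / fact i) = H0 A y (of_real x) + (H1 A y (of_real x) * of_real (x' - x) + H2 A y (of_real x) * of_real ((x' - x)\<^sup>2 / 2))"
    by (simp add: f_def numeral_2_eq_2)
  also have "norm (complex_of_real x' - of_real x) = \<bar>x' - x\<bar>" by (metis norm_of_real of_real_diff)
  finally have "norm (H0 A y (of_real x') - (H0 A y (of_real x) + (H1 A y (of_real x) * of_real (x' - x) + H2 A y (of_real x) * of_real ((x' - x)\<^sup>2 / 2)))) \<le> C * \<bar>x' - x\<bar>^3 / 2"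
    by (simp add: f_def eval_nat_numeral)
  moreover have "0 \<le> C * \<bar>x' - x\<bar>^3"
  proof -
    have "0 \<le> C" using order_trans[OF norm_ge_zero B[OF X(1)]] .
    then show ?thesis by simp
  qed
  ultimately show ?thesis by (simp add: diff_diff_eq)
qed

lemma H0_time_derivative:
  fixes A :: "real \<Rightarrow> complex" and y c :: "'i \<Rightarrow> real \<Rightarrow> complex"
  assumes A: "(A has_vector_derivative al (\<lambda>i. c i s)) (at s within S)"
    and y: "\<And>i. i \<in> I \<Longrightarrow> (y i has_vector_derivative c i s) (at s within S)"
    and D: "\<And>i r. i \<in> I \<Longrightarrow> r \<in> S \<Longrightarrow> y i r - x \<in> dstrip" and s: "s \<in> S"
  shows "((\<lambda>s. H0 (A s) (\<lambda>i. y i s) x) has_vector_derivative Hs (A s) (\<lambda>i. y i s) x (\<lambda>i. c i s)) (at s within S)"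
proof -
  have p: "((\<lambda>s. phi (y i s - x)) has_vector_derivative c i s * phi1 (y i s - x)) (at s within S)" if i: "i \<in> I" for i
  proof -
    have 1: "((\<lambda>s. y i s - x) has_vector_derivative c i s) (at s within S)"
      using has_vector_derivative_diff[OF y[OF i] has_vector_derivative_const[of x]] by simp
    have 2: "(phi has_field_derivative phi1 (y i s - x)) (at (y i s - x) within ((\<lambda>s. y i s - x) ` S))"
      by (rule phi_deriv) (use D[OF i] s in auto)
    show ?thesis using field_vector_diff_chain_within[OF 1 2] by (simp add: comp_def)
  qed
  have lin: "((\<lambda>s. A s + of_real \<beta> * x + (\<Sum>i\<in>I. of_real (q i) * phi (y i s - x))) has_vector_derivative
      al (\<lambda>i. c i s) + 0 + (\<Sum>i\<in>I. of_real (q i) * (c i s * phi1 (y i s - x)))) (at s within S)"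
    by (intro has_vector_derivative_add A has_vector_derivative_const has_vector_derivative_sum has_vector_derivative_mult_right p)
  have ex: "(exp has_field_derivative exp w) (at w within T)" for w :: complex and T by (rule DERIV_exp[THEN has_field_derivative_at_within])
  show ?thesis
    using field_vector_diff_chain_within[OF lin ex] unfolding H0_def Hs_def by (simp add: comp_def mult_ac)
qed

text \<open>Joint continuity in time and position provides the uniform modulus of continuity behind
  the o(\<delta>) remainder.\<close>

lemma continuous_H:
  fixes A :: "real \<Rightarrow> complex" and y c :: "'i \<Rightarrow> real \<Rightarrow> complex"
  assumes A: "continuous_on T A" and y: "\<And>i. i \<in> I \<Longrightarrow> continuous_on T (y i)" and c: "\<And>i. i \<in> I \<Longrightarrow> continuous_on T (c i)"
    and D: "\<And>i s x. i \<in> I \<Longrightarrow> s \<in> T \<Longrightarrow> y i s - of_real x \<in> dstrip"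
  shows "continuous_on (T \<times> X) (\<lambda>p. Hs (A (fst p)) (\<lambda>i. y i (fst p)) (of_real (snd p)) (\<lambda>i. c i (fst p)))"
    and "continuous_on (T \<times> X) (\<lambda>p. H0 (A (fst p)) (\<lambda>i. y i (fst p)) (of_real (snd p)))"
proof -
  have f: "continuous_on (T \<times> X) (\<lambda>p. g (fst p))" if "continuous_on T g" for g :: "real \<Rightarrow> complex"
    by (rule continuous_on_compose2[OF that]) (auto intro!: continuous_intros)
  have ph: "continuous_on (T \<times> X) (\<lambda>p. h (y i (fst p) - of_real (snd p)))" if "continuous_on dstrip h" "i \<in> I" for h :: "complex \<Rightarrow> complex" and i
    by (rule continuous_on_compose2[OF that(1)]) (use D that(2) in \<open>auto intro!: continuous_intros f y\<close>)
  show "continuous_on (T \<times> X) (\<lambda>p. H0 (A (fst p)) (\<lambda>i. y i (fst p)) (of_real (snd p)))"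
    unfolding H0_def by (intro continuous_intros f A ph continuous_phis)
  then show "continuous_on (T \<times> X) (\<lambda>p. Hs (A (fst p)) (\<lambda>i. y i (fst p)) (of_real (snd p)) (\<lambda>i. c i (fst p)))"
    unfolding Hs_def al_def by (intro continuous_intros f c ph continuous_phis) simp_all
qed

text \<open>The constant depends only on the bounds imposed on the path; for a random path it is uniform.\<close>

lemma path_increments:
  assumes mu: "\<mu> = (rt\<^sup>2 + d\<^sup>2) / 4 + a * rt / 2" and be: "\<beta> = d * (rt + a) / 2"
    and ka: "\<kappa> * a\<^sup>2 = 2" and bb: "b = \<kappa> * a / 4 - a" and e: "0 < e" and k: "0 \<le> k" and ka0: "0 < \<kappa>"
  obtains C where "0 \<le> C" "\<And>(\<xi> :: real \<Rightarrow> real) A y c T d0. continuous_on {0..} \<xi> \<Longrightarrow> 0 \<le> T \<Longrightarrow> 0 < d0 \<Longrightarrow>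
     (\<And>s. 0 \<le> s \<Longrightarrow> s < T \<Longrightarrow> \<bar>\<xi> s\<bar> \<le> k) \<Longrightarrow>
     (\<And>s. 0 \<le> s \<Longrightarrow> (A has_vector_derivative al (\<lambda>i. c i s)) (at s within {0..})) \<Longrightarrow>
     (\<And>i s. i \<in> I \<Longrightarrow> 0 \<le> s \<Longrightarrow> (y i has_vector_derivative c i s) (at s within {0..})) \<Longrightarrow>
     (\<And>i. i \<in> I \<Longrightarrow> continuous_on {0..} (c i)) \<Longrightarrow>
     (\<And>i s. i \<in> I \<Longrightarrow> 0 \<le> s \<Longrightarrow> s < T + d0 \<Longrightarrow> y i s \<in> kbox e R \<and> norm (c i s) \<le> M \<and> c i s = cth (y i s - of_real (\<xi> s))) \<Longrightarrow>
     (\<And>s. 0 \<le> s \<Longrightarrow> s < T + d0 \<Longrightarrow> norm (A s) \<le> RA) \<Longrightarrow>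
     (\<forall>s. 0 \<le> s \<longrightarrow> s < T + d0 \<longrightarrow> norm (H0 (A s) (\<lambda>i. y i s) (of_real (clampr (k + 1) (\<xi> s)))) \<le> C) \<and>
     (\<forall>s. 0 \<le> s \<longrightarrow> s < T \<longrightarrow> norm (H1 (A s) (\<lambda>i. y i s) (of_real (\<xi> s))) \<le> C \<and> norm (H2 (A s) (\<lambda>i. y i s) (of_real (\<xi> s))) \<le> C) \<and>
     continuous_on {0..<T + d0} (\<lambda>s. H0 (A s) (\<lambda>i. y i s) (of_real (clampr (k + 1) (\<xi> s)))) \<and>
     (\<forall>r \<delta>. 0 \<le> r \<longrightarrow> r < T \<longrightarrow> 0 < \<delta> \<longrightarrow> \<delta> < d0 \<longrightarrow>
       norm (H0 (A (r + \<delta>)) (\<lambda>i. y i (r + \<delta>)) (of_real (clampr (k + 1) (\<xi> (r + \<delta>)))) - H0 (A r) (\<lambda>i. y i r) (of_real (clampr (k + 1) (\<xi> r)))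
         - (H1 (A r) (\<lambda>i. y i r) (of_real (\<xi> r)) * of_real (\<xi> (r + \<delta>) - \<xi> r) + H2 (A r) (\<lambda>i. y i r) (of_real (\<xi> r)) * of_real (((\<xi> (r + \<delta>) - \<xi> r)\<^sup>2 - \<kappa> * \<delta>) / 2)))
         \<le> C * \<bar>\<xi> (r + \<delta>) - \<xi> r\<bar>^3 + C * \<delta>) \<and>
     (\<forall>\<eta>>0. \<exists>d1>0. \<forall>r \<delta>. 0 \<le> r \<longrightarrow> r < T \<longrightarrow> 0 < \<delta> \<longrightarrow> \<delta> < d1 \<longrightarrow>
       norm (H0 (A (r + \<delta>)) (\<lambda>i. y i (r + \<delta>)) (of_real (clampr (k + 1) (\<xi> (r + \<delta>)))) - H0 (A r) (\<lambda>i. y i r) (of_real (clampr (k + 1) (\<xi> r)))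
         - (H1 (A r) (\<lambda>i. y i r) (of_real (\<xi> r)) * of_real (\<xi> (r + \<delta>) - \<xi> r) + H2 (A r) (\<lambda>i. y i r) (of_real (\<xi> r)) * of_real (((\<xi> (r + \<delta>) - \<xi> r)\<^sup>2 - \<kappa> * \<delta>) / 2)))
         \<le> C * \<bar>\<xi> (r + \<delta>) - \<xi> r\<bar>^3 + \<eta> * \<delta>)"
proof -
  define X where "X = k + 1"
  have X: "0 \<le> X" "k \<le> X" using k by (auto simp: X_def)
  obtain C where C: "0 \<le> C" "\<And>A y x c. norm A \<le> RA \<Longrightarrow> \<bar>x\<bar> \<le> X \<Longrightarrow> (\<And>i. i \<in> I \<Longrightarrow> y i \<in> kbox e R) \<Longrightarrow> (\<And>i. i \<in> I \<Longrightarrow> norm (c i) \<le> M) \<Longrightarrow>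
     norm (H0 A y (of_real x)) \<le> C \<and> norm (H1 A y (of_real x)) \<le> C \<and> norm (H2 A y (of_real x)) \<le> C \<and> norm (H3 A y (of_real x)) \<le> C \<and> norm (Hs A y (of_real x) c) \<le> C"
    using H_bounds[OF e, of RA X R M] by metis
  show thesis
  proof (rule that[of "4 * C"])
    show "0 \<le> 4 * C" using C(1) by simp
    fix \<xi> :: "real \<Rightarrow> real" and A :: "real \<Rightarrow> complex" and y c :: "'i \<Rightarrow> real \<Rightarrow> complex" and T d0 :: real
    assume x: "continuous_on {0..} \<xi>" and T: "0 \<le> T" and d0: "0 < d0" and xk: "\<And>s. 0 \<le> s \<Longrightarrow> s < T \<Longrightarrow> \<bar>\<xi> s\<bar> \<le> k"
      and A: "\<And>s. 0 \<le> s \<Longrightarrow> (A has_vector_derivative al (\<lambda>i. c i s)) (at s within {0..})"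
      and y: "\<And>i s. i \<in> I \<Longrightarrow> 0 \<le> s \<Longrightarrow> (y i has_vector_derivative c i s) (at s within {0..})"
      and cc: "\<And>i. i \<in> I \<Longrightarrow> continuous_on {0..} (c i)"
      and g: "\<And>i s. i \<in> I \<Longrightarrow> 0 \<le> s \<Longrightarrow> s < T + d0 \<Longrightarrow> y i s \<in> kbox e R \<and> norm (c i s) \<le> M \<and> c i s = cth (y i s - of_real (\<xi> s))"
      and AR: "\<And>s. 0 \<le> s \<Longrightarrow> s < T + d0 \<Longrightarrow> norm (A s) \<le> RA"
    define V where "V = (\<lambda>s. H0 (A s) (\<lambda>i. y i s) (of_real (clampr X (\<xi> s))))"
    define h1 where "h1 = (\<lambda>s. H1 (A s) (\<lambda>i. y i s) (of_real (\<xi> s)))"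
    define h2 where "h2 = (\<lambda>s. H2 (A s) (\<lambda>i. y i s) (of_real (\<xi> s)))"
    define G where "G = (\<lambda>s u. Hs (A s) (\<lambda>i. y i s) (of_real u) (\<lambda>i. c i s))"
    have bds: "norm (H0 (A s) (\<lambda>i. y i s) (of_real u)) \<le> C \<and> norm (H1 (A s) (\<lambda>i. y i s) (of_real u)) \<le> C \<and> norm (H2 (A s) (\<lambda>i. y i s) (of_real u)) \<le> C \<and> norm (H3 (A s) (\<lambda>i. y i s) (of_real u)) \<le> C \<and> norm (G s u) \<le> C"
      if "0 \<le> s" "s < T + d0" "\<bar>u\<bar> \<le> X" for s u
    proof -
      have "y i s \<in> kbox e R" "norm (c i s) \<le> M" if "i \<in> I" for i
        using g[OF that \<open>0 \<le> s\<close> \<open>s < T + d0\<close>] by blast+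
      then show ?thesis unfolding G_def by (intro C(2) AR that) auto
    qed
    have bV: "norm (V s) \<le> C" if "0 \<le> s" "s < T + d0" for s
      unfolding V_def using bds[OF that clampr(1)[OF X(1)]] by blast
    have bh: "norm (h1 s) \<le> C" "norm (h2 s) \<le> C" if "0 \<le> s" "s < T" for s
      unfolding h1_def h2_def using bds[of s "\<xi> s"] xk[OF that] X that d0 by auto
    have Ac: "continuous_on {0..} A" by (rule continuous_on_vector_derivative) (use A in auto)
    have yc: "continuous_on {0..} (y i)" if "i \<in> I" for i by (rule continuous_on_vector_derivative) (use y[OF that] in auto)
    have dst: "y i s - of_real u \<in> dstrip" if "i \<in> I" "s \<in> {0..<T + d0}" for i s u
      using g[OF that(1), of s] that(2) e by (auto simp: kbox_def dstrip_def)
    have sub: "{0..<T + d0} \<subseteq> {0..}" by auto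
    have cH: "continuous_on ({0..<T + d0} \<times> U) (\<lambda>p. Hs (A (fst p)) (\<lambda>i. y i (fst p)) (of_real (snd p)) (\<lambda>i. c i (fst p)))"
      "continuous_on ({0..<T + d0} \<times> U) (\<lambda>p. H0 (A (fst p)) (\<lambda>i. y i (fst p)) (of_real (snd p)))" for U :: "real set"
      by (rule continuous_H; use dst continuous_on_subset[OF Ac sub] continuous_on_subset[OF yc sub] continuous_on_subset[OF cc sub] in blast)+
    have xs: "continuous_on {0..<T + d0} \<xi>" using x sub by (rule continuous_on_subset)
    have cV: "continuous_on {0..<T + d0} V"
    proof -
      have "continuous_on {0..<T + d0} (\<lambda>s. (s, clampr X (\<xi> s)))"
        by (intro continuous_on_Pair continuous_on_id continuous_clampr xs)
      from continuous_on_compose2[OF cH(2)[where U = UNIV] this] show ?thesis by (auto simp: V_def)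
    qed
    have PD: "G r (\<xi> r) = - of_real (\<kappa> / 2) * h2 r" if r: "0 \<le> r" "r < T" for r
    proof -
      have "Hs (A r) (\<lambda>i. y i r) (of_real (\<xi> r)) (\<lambda>i. c i r) = Hs (A r) (\<lambda>i. y i r) (of_real (\<xi> r)) (\<lambda>i. cth (y i r - of_real (\<xi> r)))"
        unfolding Hs_def al_def using g r d0 by (simp cong: sum.cong)
      then show ?thesis unfolding G_def h2_def using pde[OF mu be ka bb] by simp
    qed
    \<comment> \<open>Change of time at a frozen position \<open>u\<close>; \<open>w\<close> is the
      constant velocity with which the increment is compared.\<close>
    have time: "norm (H0 (A (r + \<delta>)) (\<lambda>i. y i (r + \<delta>)) (of_real u) - H0 (A r) (\<lambda>i. y i r) (of_real u) - of_real \<delta> * w) \<le> B * \<delta>"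
      if r: "0 \<le> r" "0 < \<delta>" "r + \<delta> < T + d0" and B: "\<And>s. r \<le> s \<Longrightarrow> s \<le> r + \<delta> \<Longrightarrow> norm (G s u - w) \<le> B" for r \<delta> u w B
    proof -
      have sub': "{r..r+\<delta>} \<subseteq> {0..}" using r by auto
      have "((\<lambda>s. G s u) has_integral (H0 (A (r + \<delta>)) (\<lambda>i. y i (r + \<delta>)) (of_real u) - H0 (A r) (\<lambda>i. y i r) (of_real u))) {r..r+\<delta>}"
      proof (rule fundamental_theorem_of_calculus)
        show "r \<le> r + \<delta>" using r by simp
        fix s assume s: "s \<in> {r..r+\<delta>}"
        show "((\<lambda>s. H0 (A s) (\<lambda>i. y i s) (of_real u)) has_vector_derivative G s u) (at s within {r..r+\<delta>})"
          unfolding G_def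
        proof (rule H0_time_derivative[OF _ _ _ s])
          show "(A has_vector_derivative al (\<lambda>i. c i s)) (at s within {r..r+\<delta>})"
            using A[of s] s r by (intro has_vector_derivative_within_subset[OF _ sub']) auto
          show "(y i has_vector_derivative c i s) (at s within {r..r+\<delta>})" if "i \<in> I" for i
            using y[OF that, of s] s r by (intro has_vector_derivative_within_subset[OF _ sub']) auto
        qed (use dst r in auto)
      qed
      then have "((\<lambda>s. G s u - w) has_integral (H0 (A (r + \<delta>)) (\<lambda>i. y i (r + \<delta>)) (of_real u) - H0 (A r) (\<lambda>i. y i r) (of_real u) - of_real \<delta> * w)) {r..r+\<delta>}"
        using has_integral_const_real[of w r "r + \<delta>"] r by (auto dest: has_integral_diff simp: scaleR_conv_of_real)
      then have "norm (H0 (A (r + \<delta>)) (\<lambda>i. y i (r + \<delta>)) (of_real u) - H0 (A r) (\<lambda>i. y i r) (of_real u) - of_real \<delta> * w) \<le> B * measure lborel {r..r+\<delta>}"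
      proof (rule has_integral_bound_real[where S = "{}", rotated 2])
        show "0 \<le> B" using order_trans[OF norm_ge_zero B[of r]] r by auto
      qed (use B in auto)
      then show ?thesis using r by simp
    qed
    have space: "norm (H0 (A r) (\<lambda>i. y i r) (of_real (clampr X (\<xi> (r + \<delta>)))) - V r - (h1 r * of_real (\<xi> (r + \<delta>) - \<xi> r) + h2 r * of_real ((\<xi> (r + \<delta>) - \<xi> r)\<^sup>2 / 2)))
        \<le> 4 * C * \<bar>\<xi> (r + \<delta>) - \<xi> r\<bar>^3" if r: "0 \<le> r" "r < T" for r \<delta>
    proof -
      define D where "D = \<xi> (r + \<delta>) - \<xi> r"
      have xr: "\<bar>\<xi> r\<bar> \<le> k" "clampr X (\<xi> r) = \<xi> r" using xk[OF r] X by (auto intro!: clampr)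
      show ?thesis
      proof (cases "\<bar>D\<bar> \<le> 1")
        case True
        then have x': "\<bar>\<xi> (r + \<delta>)\<bar> \<le> X" using xr by (auto simp: D_def X_def)
        have "norm (H0 (A r) (\<lambda>i. y i r) (of_real (\<xi> (r + \<delta>))) - H0 (A r) (\<lambda>i. y i r) (of_real (\<xi> r)) -
           (H1 (A r) (\<lambda>i. y i r) (of_real (\<xi> r)) * of_real (\<xi> (r + \<delta>) - \<xi> r) + H2 (A r) (\<lambda>i. y i r) (of_real (\<xi> r)) * of_real ((\<xi> (r + \<delta>) - \<xi> r)\<^sup>2 / 2))) \<le> C * \<bar>\<xi> (r + \<delta>) - \<xi> r\<bar>^3"
        proof (rule H0_taylor[OF e _ x'])
          show "\<bar>\<xi> r\<bar> \<le> X" using xr X by simp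
          show "y i r \<in> kbox e R" if "i \<in> I" for i using g[OF that] r d0 by auto
          show "norm (H3 (A r) (\<lambda>i. y i r) (of_real u)) \<le> C" if "\<bar>u\<bar> \<le> X" for u using bds[of r u] that r d0 by auto
        qed
        moreover have "C * \<bar>\<xi> (r + \<delta>) - \<xi> r\<bar>^3 \<le> 4 * C * \<bar>\<xi> (r + \<delta>) - \<xi> r\<bar>^3" using C(1) by (intro mult_right_mono) auto
        ultimately show ?thesis unfolding V_def h1_def h2_def xr(2) clampr(2)[OF x'] by linarith
      next
        case False
        have p: "1 \<le> \<bar>D\<bar>^3" "\<bar>D\<bar> \<le> \<bar>D\<bar>^3" "D\<^sup>2 / 2 \<le> \<bar>D\<bar>^3"
        proof -
          show "1 \<le> \<bar>D\<bar>^3" using False by (intro one_le_power) auto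
          show "\<bar>D\<bar> \<le> \<bar>D\<bar>^3" using False power_increasing[of 1 3 "\<bar>D\<bar>"] by simp
          have "\<bar>D\<bar>^2 \<le> \<bar>D\<bar>^3" using False power_increasing[of 2 3 "\<bar>D\<bar>"] by simp
          then have "D\<^sup>2 \<le> \<bar>D\<bar>^3" by simp
          then show "D\<^sup>2 / 2 \<le> \<bar>D\<bar>^3" using zero_le_power2[of D] by linarith
        qed
        have "norm (H0 (A r) (\<lambda>i. y i r) (of_real (clampr X (\<xi> (r + \<delta>)))) - V r - (h1 r * of_real D + h2 r * of_real (D\<^sup>2 / 2)))
          \<le> (norm (H0 (A r) (\<lambda>i. y i r) (of_real (clampr X (\<xi> (r + \<delta>))))) + norm (V r)) + (norm (h1 r * of_real D) + norm (h2 r * of_real (D\<^sup>2 / 2)))"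
          by (rule order_trans[OF norm_triangle_ineq4 add_mono[OF norm_triangle_ineq4 norm_triangle_ineq]])
        also have "\<dots> \<le> (C * \<bar>D\<bar>^3 + C * \<bar>D\<bar>^3) + (C * \<bar>D\<bar>^3 + C * \<bar>D\<bar>^3)"
        proof (intro add_mono)
          have C1: "C \<le> C * \<bar>D\<bar>^3" using mult_left_mono[OF p(1) C(1)] by simp
          show "norm (H0 (A r) (\<lambda>i. y i r) (of_real (clampr X (\<xi> (r + \<delta>))))) \<le> C * \<bar>D\<bar>^3"
            by (rule order_trans[OF conjunct1[OF bds[OF _ _ clampr(1)[OF X(1)]]] C1]) (use r d0 in auto)
          show "norm (V r) \<le> C * \<bar>D\<bar>^3" by (rule order_trans[OF bV C1]) (use r d0 in auto)
          show "norm (h1 r * of_real D) \<le> C * \<bar>D\<bar>^3"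
            unfolding norm_mult using bh[OF r] p C(1) by (intro mult_mono) auto
          show "norm (h2 r * of_real (D\<^sup>2 / 2)) \<le> C * \<bar>D\<bar>^3"
            unfolding norm_mult norm_of_real using bh[OF r] p C(1) by (intro mult_mono) auto
        qed
        finally show ?thesis unfolding D_def[symmetric] by (simp add: algebra_simps)
      qed
    qed
    \<comment> \<open>The time step is taken at the new position, the step in position at the old
      time. By the heat equation the drift \<delta> G equals -\<kappa> \<delta> / 2 times the second
      derivative, which is exactly the correction to the squared increment.\<close>
    have total: "norm (V (r + \<delta>) - V r - (h1 r * of_real (\<xi> (r + \<delta>) - \<xi> r) + h2 r * of_real (((\<xi> (r + \<delta>) - \<xi> r)\<^sup>2 - \<kappa> * \<delta>) / 2))) \<le> 4 * C * \<bar>\<xi> (r + \<delta>) - \<xi> r\<bar>^3 + B * \<delta>"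
      if r: "0 \<le> r" "r < T" "0 < \<delta>" "\<delta> < d0" and B: "\<And>s. r \<le> s \<Longrightarrow> s \<le> r + \<delta> \<Longrightarrow> norm (G s (clampr X (\<xi> (r + \<delta>))) - G r (\<xi> r)) \<le> B" for r \<delta> B
    proof -
      define u where "u = clampr X (\<xi> (r + \<delta>))"
      define D where "D = \<xi> (r + \<delta>) - \<xi> r"
      have 1: "norm (H0 (A (r + \<delta>)) (\<lambda>i. y i (r + \<delta>)) (of_real u) - H0 (A r) (\<lambda>i. y i r) (of_real u) - of_real \<delta> * G r (\<xi> r)) \<le> B * \<delta>"
        by (rule time) (use r B in \<open>auto simp: u_def\<close>)
      have 2: "norm (H0 (A r) (\<lambda>i. y i r) (of_real u) - V r - (h1 r * of_real D + h2 r * of_real (D\<^sup>2 / 2))) \<le> 4 * C * \<bar>D\<bar>^3"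
        unfolding u_def D_def by (rule space[OF r(1,2)])
      have eq: "V (r + \<delta>) - V r - (h1 r * of_real D + h2 r * of_real ((D\<^sup>2 - \<kappa> * \<delta>) / 2))
        = (H0 (A (r + \<delta>)) (\<lambda>i. y i (r + \<delta>)) (of_real u) - H0 (A r) (\<lambda>i. y i r) (of_real u) - of_real \<delta> * G r (\<xi> r))
        + (H0 (A r) (\<lambda>i. y i r) (of_real u) - V r - (h1 r * of_real D + h2 r * of_real (D\<^sup>2 / 2)))"
        unfolding PD[OF r(1,2)] by (simp add: V_def u_def field_simps)
      show ?thesis unfolding D_def[symmetric] eq using norm_triangle_mono[OF 1 2] by linarith
    qed
    have rem1: "norm (V (r + \<delta>) - V r - (h1 r * of_real (\<xi> (r + \<delta>) - \<xi> r) + h2 r * of_real (((\<xi> (r + \<delta>) - \<xi> r)\<^sup>2 - \<kappa> * \<delta>) / 2))) \<le> 4 * C * \<bar>\<xi> (r + \<delta>) - \<xi> r\<bar>^3 + 4 * C * \<delta>"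
      if r: "0 \<le> r" "r < T" "0 < \<delta>" "\<delta> < d0" for r \<delta>
    proof (rule total[OF r])
      fix s assume s: "r \<le> s" "s \<le> r + \<delta>"
      have "norm (G s (clampr X (\<xi> (r + \<delta>))) - G r (\<xi> r)) \<le> C + C"
        using bds[of s "clampr X (\<xi> (r + \<delta>))"] bds[of r "\<xi> r"] clampr(1)[OF X(1)] xk[OF r(1,2)] s r d0 X
        by (intro norm_triangle_le_diff add_mono) auto
      then show "norm (G s (clampr X (\<xi> (r + \<delta>))) - G r (\<xi> r)) \<le> 4 * C" using C(1) by simp
    qed
    have rem2: "\<exists>d1>0. \<forall>r \<delta>. 0 \<le> r \<longrightarrow> r < T \<longrightarrow> 0 < \<delta> \<longrightarrow> \<delta> < d1 \<longrightarrow> norm (V (r + \<delta>) - V r - (h1 r * of_real (\<xi> (r + \<delta>) - \<xi> r) + h2 r * of_real (((\<xi> (r + \<delta>) - \<xi> r)\<^sup>2 - \<kappa> * \<delta>) / 2))) \<le> 4 * C * \<bar>\<xi> (r + \<delta>) - \<xi> r\<bar>^3 + \<eta> * \<delta>"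
      if eta: "0 < \<eta>" for \<eta>
    proof -
      \<comment> \<open>The half-open interval up to \<open>T + d0\<close> is not compact; half of
        the margin still leaves room for small steps.\<close>
      define T1 where "T1 = T + d0 / 2"
      have T1: "{0..T1} \<subseteq> {0..<T + d0}" "0 \<le> T1" using d0 T by (auto simp: T1_def)
      have "continuous_on ({0..T1} \<times> {-X..X}) (\<lambda>p. G (fst p) (snd p))"
        unfolding G_def using cH(1)[where U = "{-X..X}"] by (rule continuous_on_subset) (use T1 in auto)
      then have "uniformly_continuous_on ({0..T1} \<times> {-X..X}) (\<lambda>p. G (fst p) (snd p))"
        by (rule compact_uniformly_continuous) (intro compact_Times; simp)
      then obtain \<rho> where rho: "\<rho> > 0" "\<And>p p'. p \<in> {0..T1} \<times> {-X..X} \<Longrightarrow> p' \<in> {0..T1} \<times> {-X..X} \<Longrightarrow> dist p' p < \<rho> \<Longrightarrow> dist (G (fst p') (snd p')) (G (fst p) (snd p)) < \<eta>"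
        using eta unfolding uniformly_continuous_on_def by metis
      have "uniformly_continuous_on {0..T1} \<xi>"
        by (intro compact_uniformly_continuous continuous_on_subset[OF xs T1(1)]) simp
      then obtain \<rho>' where rho': "\<rho>' > 0" "\<And>s s'. s \<in> {0..T1} \<Longrightarrow> s' \<in> {0..T1} \<Longrightarrow> dist s' s < \<rho>' \<Longrightarrow> dist (\<xi> s') (\<xi> s) < \<rho> / 2"
        using rho(1) unfolding uniformly_continuous_on_def by (metis half_gt_zero)
      define d1 where "d1 = min (min \<rho>' (\<rho> / 2)) (d0 / 2)"
      have d1: "d1 > 0" "d1 \<le> \<rho>'" "d1 \<le> \<rho> / 2" "d1 \<le> d0 / 2" using rho(1) rho'(1) d0 by (auto simp: d1_def)
      show ?thesis
      proof (intro exI[of _ d1] conjI allI impI)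
        show "d1 > 0" by (rule d1(1))
        fix r \<delta> assume r: "0 \<le> r" "r < T" "0 < \<delta>" "\<delta> < d1"
        have rd: "\<delta> < d0" using r d1 d0 by simp
        show "norm (V (r + \<delta>) - V r - (h1 r * of_real (\<xi> (r + \<delta>) - \<xi> r) + h2 r * of_real (((\<xi> (r + \<delta>) - \<xi> r)\<^sup>2 - \<kappa> * \<delta>) / 2))) \<le> 4 * C * \<bar>\<xi> (r + \<delta>) - \<xi> r\<bar>^3 + \<eta> * \<delta>"
        proof (rule total[OF r(1-3) rd])
          fix s assume s: "r \<le> s" "s \<le> r + \<delta>"
          have mem: "s \<in> {0..T1}" "r \<in> {0..T1}" "r + \<delta> \<in> {0..T1}" using s r d1 by (auto simp: T1_def)
          have xr: "\<bar>\<xi> r\<bar> \<le> X" using xk[OF r(1,2)] X by simp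
          have "\<bar>clampr X (\<xi> (r + \<delta>)) - clampr X (\<xi> r)\<bar> \<le> \<bar>\<xi> (r + \<delta>) - \<xi> r\<bar>" by (rule clampr(3))
          also have "\<dots> < \<rho> / 2" using rho'(2)[OF mem(2,3)] r d1 by (simp add: dist_real_def)
          finally have x2: "\<bar>clampr X (\<xi> (r + \<delta>)) - \<xi> r\<bar> < \<rho> / 2" unfolding clampr(2)[OF xr] .
          have "dist (s, clampr X (\<xi> (r + \<delta>))) (r, \<xi> r) \<le> \<bar>s - r\<bar> + \<bar>clampr X (\<xi> (r + \<delta>)) - \<xi> r\<bar>"
            unfolding dist_prod_def dist_real_def using sqrt_sum_squares_le_sum_abs[of "\<bar>s - r\<bar>" "\<bar>clampr X (\<xi> (r + \<delta>)) - \<xi> r\<bar>"] by simp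
          also have "\<dots> < \<rho>" using x2 s r d1 by simp
          finally have "dist (s, clampr X (\<xi> (r + \<delta>))) (r, \<xi> r) < \<rho>" .
          then have "dist (G s (clampr X (\<xi> (r + \<delta>)))) (G r (\<xi> r)) < \<eta>"
            using rho(2)[of "(r, \<xi> r)" "(s, clampr X (\<xi> (r + \<delta>)))"] mem xr clampr(1)[OF X(1), of "\<xi> (r + \<delta>)"] by (auto simp: abs_le_iff)
          then show "norm (G s (clampr X (\<xi> (r + \<delta>))) - G r (\<xi> r)) \<le> \<eta>" by (simp add: dist_norm)
        qed
      qed
    qed
    have C4: "C \<le> 4 * C" using C(1) by simp
    show "(\<forall>s. 0 \<le> s \<longrightarrow> s < T + d0 \<longrightarrow> norm (H0 (A s) (\<lambda>i. y i s) (of_real (clampr (k + 1) (\<xi> s)))) \<le> 4 * C) \<and>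
     (\<forall>s. 0 \<le> s \<longrightarrow> s < T \<longrightarrow> norm (H1 (A s) (\<lambda>i. y i s) (of_real (\<xi> s))) \<le> 4 * C \<and> norm (H2 (A s) (\<lambda>i. y i s) (of_real (\<xi> s))) \<le> 4 * C) \<and>
     continuous_on {0..<T + d0} (\<lambda>s. H0 (A s) (\<lambda>i. y i s) (of_real (clampr (k + 1) (\<xi> s)))) \<and>
     (\<forall>r \<delta>. 0 \<le> r \<longrightarrow> r < T \<longrightarrow> 0 < \<delta> \<longrightarrow> \<delta> < d0 \<longrightarrow>
       norm (H0 (A (r + \<delta>)) (\<lambda>i. y i (r + \<delta>)) (of_real (clampr (k + 1) (\<xi> (r + \<delta>)))) - H0 (A r) (\<lambda>i. y i r) (of_real (clampr (k + 1) (\<xi> r)))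
         - (H1 (A r) (\<lambda>i. y i r) (of_real (\<xi> r)) * of_real (\<xi> (r + \<delta>) - \<xi> r) + H2 (A r) (\<lambda>i. y i r) (of_real (\<xi> r)) * of_real (((\<xi> (r + \<delta>) - \<xi> r)\<^sup>2 - \<kappa> * \<delta>) / 2)))
         \<le> 4 * C * \<bar>\<xi> (r + \<delta>) - \<xi> r\<bar>^3 + 4 * C * \<delta>) \<and>
     (\<forall>\<eta>>0. \<exists>d1>0. \<forall>r \<delta>. 0 \<le> r \<longrightarrow> r < T \<longrightarrow> 0 < \<delta> \<longrightarrow> \<delta> < d1 \<longrightarrow>
       norm (H0 (A (r + \<delta>)) (\<lambda>i. y i (r + \<delta>)) (of_real (clampr (k + 1) (\<xi> (r + \<delta>)))) - H0 (A r) (\<lambda>i. y i r) (of_real (clampr (k + 1) (\<xi> r)))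
         - (H1 (A r) (\<lambda>i. y i r) (of_real (\<xi> r)) * of_real (\<xi> (r + \<delta>) - \<xi> r) + H2 (A r) (\<lambda>i. y i r) (of_real (\<xi> r)) * of_real (((\<xi> (r + \<delta>) - \<xi> r)\<^sup>2 - \<kappa> * \<delta>) / 2)))
         \<le> 4 * C * \<bar>\<xi> (r + \<delta>) - \<xi> r\<bar>^3 + \<eta> * \<delta>)"
      using bV bh cV rem1 rem2 C4 unfolding V_def h1_def h2_def X_def by (blast intro: order_trans)
  qed
qed

end

section \<open>The observable along the flow\<close>

lemma tanh_half_exp:
  assumes "exp u \<noteq> (-1::complex)"
  shows "tanh (u / 2) = (exp u - 1) / (exp u + 1)"
proof -
  have e: "exp u = exp (u / 2) * exp (u / 2)" by (simp flip: exp_add)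
  have n: "exp u + 1 \<noteq> 0" using assms by (metis add_eq_0_iff2)
  have "(A / 2) / (B / 2) = A / B" for A B :: complex by simp
  then have "tanh (u / 2) = (exp (u / 2) - exp (- (u / 2))) / (exp (u / 2) + exp (- (u / 2)))"
    by (simp only: tanh_def sinh_field_def cosh_field_def)
  also have "\<dots> = (exp (u / 2) * (exp (u / 2) - exp (- (u / 2)))) / (exp (u / 2) * (exp (u / 2) + exp (- (u / 2))))" by simp
  also have "exp (u / 2) * (exp (u / 2) - exp (- (u / 2))) = exp u - 1" unfolding e by (simp add: algebra_simps flip: exp_add)
  also have "exp (u / 2) * (exp (u / 2) + exp (- (u / 2))) = exp u + 1" unfolding e by (simp add: algebra_simps flip: exp_add)
  finally show ?thesis .
qed

lemma exp_tendsto_0: "filterlim (\<lambda>z. Re (f z)) at_bot F \<Longrightarrow> ((\<lambda>z. exp (f z :: complex)) \<longlongrightarrow> 0) F"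
proof -
  assume "filterlim (\<lambda>z. Re (f z)) at_bot F"
  then have n: "((\<lambda>z. exp (Re (f z))) \<longlongrightarrow> 0) F" by (rule filterlim_compose[OF exp_at_bot])
  show ?thesis by (rule tendsto_norm_zero_cancel) (simp add: n)
qed

lemma filterlim_tendsto_add_at_bot:
  fixes f g :: "'a \<Rightarrow> real"
  assumes "(f \<longlongrightarrow> c) F" "filterlim g at_bot F"
  shows "filterlim (\<lambda>x. f x + g x) at_bot F"
proof -
  have "filterlim (\<lambda>x. - f x + - g x) at_top F"
    using assms by (intro filterlim_tendsto_add_at_top[where c = "- c"] tendsto_minus) (simp_all add: filterlim_uminus_at_bot)
  then show ?thesis by (simp add: filterlim_uminus_at_bot algebra_simps)
qed

lemma exp_strip_ne: "Z \<in> strip \<Longrightarrow> exp (Z + of_real c) \<noteq> -1"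
proof -
  assume Z: "Z \<in> strip"
  then have "0 < sin (Im Z)" by (auto simp: strip_def intro!: sin_gt_zero)
  then have "Im (exp (Z + of_real c)) \<noteq> 0" by (simp add: Im_exp)
  then show ?thesis by auto
qed

lemma cosh_strip_ne: "Z \<in> strip \<Longrightarrow> cosh ((Z + of_real c) / 2) \<noteq> 0"
proof -
  assume "Z \<in> strip"
  then have "0 < cos (Im Z / 2)" by (intro cos_gt_zero_pi) (auto simp: strip_def)
  then have "Re (cosh ((Z + of_real c) / 2)) \<noteq> 0" by (simp add: Re_Im_sinh_cosh)
  then show ?thesis by auto
qed

text \<open>A uniformization is a real Moebius function of E = exp(f). Sending the two ends to -1
  and 1 leaves (r E - 1) / (r E + 1), and r > 0 because a point with E = \<i> goes to the upper
  half-plane. The constant c = ln r is the freedom that neutrality removes.\<close>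

lemma uniformization_tanh:
  assumes f: "conformal_onto f D strip" and D: "open D" and w: "uniformization w D qm qp"
    and m: "filterlim (\<lambda>z. Re (f z)) at_bot qm" and pl: "filterlim (\<lambda>z. Re (f z)) at_top qp"
  obtains c :: real where "\<And>z. z \<in> D \<Longrightarrow> w z = tanh ((f z + of_real c) / 2)"
proof -
  have wc: "conformal_onto w D upper_half_plane" using w by (simp add: uniformization_def)
  have wm: "bmaps w D qm (at (of_real (-1)) within upper_half_plane)" "bmaps w D qp (at (of_real 1) within upper_half_plane)"
    using w by (simp_all add: uniformization_def)
  obtain a b c d :: real where h: "a * d - b * c \<noteq> 0"
    "\<And>z. z \<in> D \<Longrightarrow> of_real c * exp (f z) + of_real d \<noteq> 0"
    "\<And>z. z \<in> D \<Longrightarrow> w z = (of_real a * exp (f z) + of_real b) / (of_real c * exp (f z) + of_real d)"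
    using strip_to_half_plane[OF f D wc] by metis
  note bm = bmaps_half_plane[OF wm(1)] and bp = bmaps_half_plane[OF wm(2)]
  have "\<forall>\<^sub>F z in qm. of_real c * exp (f z) + of_real d \<noteq> 0 \<and> w z = (of_real a * exp (f z) + of_real b) / (of_real c * exp (f z) + of_real d)"
    using bm(3) by eventually_elim (use h(2,3) in blast)
  note L1 = moebius_limit_at_0[OF h(1) bm(1) exp_tendsto_0[OF m] bm(2) this]
  \<comment> \<open>At the right end 1/E takes the place of E, since it tends to 0 there.\<close>
  have pl': "filterlim (\<lambda>z. Re (- f z)) at_bot qp" using pl by (simp add: filterlim_uminus_at_bot)
  have det': "b * c - a * d \<noteq> 0" using h(1) by simp
  have eq2: "of_real d * exp (- f z) + of_real c \<noteq> 0 \<and> w z = (of_real b * exp (- f z) + of_real a) / (of_real d * exp (- f z) + of_real c)"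
    if z: "z \<in> D" for z
  proof -
    have 1: "of_real d * exp (- f z) + of_real c = exp (- f z) * (of_real c * exp (f z) + of_real d)"
      "of_real b * exp (- f z) + of_real a = exp (- f z) * (of_real a * exp (f z) + of_real b)"
      by (simp_all add: algebra_simps exp_minus)
    show ?thesis unfolding 1 using h(2,3)[OF z] by simp
  qed
  have "\<forall>\<^sub>F z in qp. of_real d * exp (- f z) + of_real c \<noteq> 0 \<and> w z = (of_real b * exp (- f z) + of_real a) / (of_real d * exp (- f z) + of_real c)"
    using bp(3) by eventually_elim (use eq2 in blast)
  note L2 = moebius_limit_at_0[OF det' bp(1) exp_tendsto_0[OF pl'] bp(2) this]
  define r where "r = c / d"
  have weq: "w z = (of_real r * exp (f z) - 1) / (of_real r * exp (f z) + 1)" if "z \<in> D" for z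
  proof -
    have dz: "complex_of_real d \<noteq> 0" using L1 by simp
    have "w z = (of_real c * exp (f z) - of_real d) / (of_real c * exp (f z) + of_real d)"
      using h(3)[OF that] L1 L2 by simp
    also have "\<dots> = (of_real d * (of_real r * exp (f z) - 1)) / (of_real d * (of_real r * exp (f z) + 1))"
      using dz by (simp add: r_def algebra_simps)
    finally show ?thesis using dz by simp
  qed
  have "of_real (pi / 2) * \<i> \<in> f ` D" using f by (auto simp: conformal_onto_def bij_betw_def strip_def)
  then obtain z0 where z0: "z0 \<in> D" "f z0 = of_real (pi / 2) * \<i>" by auto
  have ei: "exp (f z0) = \<i>" unfolding z0(2) by (simp add: exp_eq_polar cis_conv_exp[symmetric] mult.commute complex_eq_iff Re_exp Im_exp)
  have "w z0 \<in> upper_half_plane" using wc z0(1) by (auto simp: conformal_onto_def bij_betw_def)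
  then have "0 < 2 * r / (1 + r\<^sup>2)"
    unfolding weq[OF z0(1)] ei by (simp add: upper_half_plane_def Im_divide power2_eq_square)
  then have r: "0 < r" using zero_le_power2[of r] by (auto simp: zero_less_divide_iff)
  have "w z = tanh ((f z + of_real (ln r)) / 2)" if z: "z \<in> D" for z
  proof -
    have fz: "f z \<in> strip" using f z by (auto simp: conformal_onto_def bij_betw_def)
    show ?thesis unfolding weq[OF z] tanh_half_exp[OF exp_strip_ne[OF fz]]
      using r by (simp add: exp_add exp_of_real mult.commute)
  qed
  then show thesis by (rule that)
qed

section \<open>The domains at time t, their uniformizations and the tip\<close>

locale dipolar_setting =
  fixes D p Q qm qp \<phi>m \<phi>p \<psi>\<^sub>0 and n :: nat and z :: "nat \<Rightarrow> complex"
  assumes openD: "open D" and dip: "dipolar_conformal \<psi>\<^sub>0 D p Q qm qp"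
    and chm: "boundary_chart D qm \<phi>m" and chp: "boundary_chart D qp \<phi>p"
    and zD: "\<And>j. j < n \<Longrightarrow> z j \<in> D" and inj: "inj_on z {..<n}"
begin

lemma psi0: "conformal_onto \<psi>\<^sub>0 D strip" "\<And>z. z \<in> D \<Longrightarrow> \<psi>\<^sub>0 z \<in> strip"
  using dip by (auto simp: dipolar_conformal_def conformal_onto_def bij_betw_def)

lemma psi0_ends: "filterlim (\<lambda>z. Re (\<psi>\<^sub>0 z)) at_bot qm" "filterlim (\<lambda>z. Re (\<psi>\<^sub>0 z)) at_top qp"
proof -
  have "filterlim \<psi>\<^sub>0 strip_minus_infinity qm" "filterlim \<psi>\<^sub>0 strip_plus_infinity qp"
    using dip by (auto simp: dipolar_conformal_def intro: bmaps_filterlim)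
  then show "filterlim (\<lambda>z. Re (\<psi>\<^sub>0 z)) at_bot qm" "filterlim (\<lambda>z. Re (\<psi>\<^sub>0 z)) at_top qp"
    by (auto simp: strip_minus_infinity_def strip_plus_infinity_def filterlim_inf filterlim_filtercomap_iff comp_def)
qed

lemma exp_neg_form:
  assumes "conformal_onto v D upper_half_plane"
  shows "\<exists>a b c d :: real. a * d - b * c \<noteq> 0 \<and>
      (\<forall>z\<in>D. of_real c * exp (- \<psi>\<^sub>0 z) + of_real d \<noteq> 0 \<and> v z = (of_real a * exp (- \<psi>\<^sub>0 z) + of_real b) / (of_real c * exp (- \<psi>\<^sub>0 z) + of_real d))"
proof -
  obtain a b c d :: real where h: "a * d - b * c \<noteq> 0"
    "\<And>z. z \<in> D \<Longrightarrow> of_real c * exp (\<psi>\<^sub>0 z) + of_real d \<noteq> 0"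
    "\<And>z. z \<in> D \<Longrightarrow> v z = (of_real a * exp (\<psi>\<^sub>0 z) + of_real b) / (of_real c * exp (\<psi>\<^sub>0 z) + of_real d)"
    using strip_to_half_plane[OF psi0(1) openD assms] by metis
  have eq2: "of_real d * exp (- \<psi>\<^sub>0 z) + of_real c \<noteq> 0 \<and> v z = (of_real b * exp (- \<psi>\<^sub>0 z) + of_real a) / (of_real d * exp (- \<psi>\<^sub>0 z) + of_real c)"
    if z: "z \<in> D" for z
  proof -
    have 1: "of_real d * exp (- \<psi>\<^sub>0 z) + of_real c = exp (- \<psi>\<^sub>0 z) * (of_real c * exp (\<psi>\<^sub>0 z) + of_real d)"
      "of_real b * exp (- \<psi>\<^sub>0 z) + of_real a = exp (- \<psi>\<^sub>0 z) * (of_real a * exp (\<psi>\<^sub>0 z) + of_real b)"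
      by (simp_all add: algebra_simps exp_minus)
    show ?thesis unfolding 1 using h(2,3)[OF z] by simp
  qed
  moreover have "b * c - a * d \<noteq> 0" using h(1) by simp
  ultimately show ?thesis by blast
qed

lemma chart_constants:
  "\<exists>Km. Km \<noteq> 0 \<and> ((\<lambda>z. exp (\<psi>\<^sub>0 z) / (\<phi>m z - Lim qm \<phi>m)) \<longlongrightarrow> Km) qm"
  "\<exists>Kp. Kp \<noteq> 0 \<and> ((\<lambda>z. exp (- \<psi>\<^sub>0 z) / (\<phi>p z - Lim qp \<phi>p)) \<longlongrightarrow> Kp) qp"
proof -
  have moeb: "\<exists>a b c d :: real. a * d - b * c \<noteq> 0 \<and>
      (\<forall>z\<in>D. of_real c * exp (\<psi>\<^sub>0 z) + of_real d \<noteq> 0 \<and> v z = (of_real a * exp (\<psi>\<^sub>0 z) + of_real b) / (of_real c * exp (\<psi>\<^sub>0 z) + of_real d))"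
    if "conformal_onto v D upper_half_plane" for v
    using strip_to_half_plane[OF psi0(1) openD that] by metis
  show "\<exists>Km. Km \<noteq> 0 \<and> ((\<lambda>z. exp (\<psi>\<^sub>0 z) / (\<phi>m z - Lim qm \<phi>m)) \<longlongrightarrow> Km) qm"
    using boundary_chart_limit[OF chm exp_tendsto_0[OF psi0_ends(1)] exp_not_eq_zero moeb] by metis
  have "filterlim (\<lambda>z. Re (- \<psi>\<^sub>0 z)) at_bot qp" using psi0_ends(2) by (simp add: filterlim_uminus_at_bot)
  then show "\<exists>Kp. Kp \<noteq> 0 \<and> ((\<lambda>z. exp (- \<psi>\<^sub>0 z) / (\<phi>p z - Lim qp \<phi>p)) \<longlongrightarrow> Kp) qp"
    using boundary_chart_limit[OF chp exp_tendsto_0 exp_not_eq_zero exp_neg_form] by metis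
qed

text \<open>\<open>Km\<close> and \<open>Kp\<close> express the charts at the roots in the
  coordinates \<open>exp (\<psi>\<^sub>0 z)\<close> and \<open>exp (- \<psi>\<^sub>0 z)\<close>,
  which vanish at the respective root. They do not depend on time.\<close>

definition Km where "Km = (SOME K. K \<noteq> 0 \<and> ((\<lambda>z. exp (\<psi>\<^sub>0 z) / (\<phi>m z - Lim qm \<phi>m)) \<longlongrightarrow> K) qm)"
definition Kp where "Kp = (SOME K. K \<noteq> 0 \<and> ((\<lambda>z. exp (- \<psi>\<^sub>0 z) / (\<phi>p z - Lim qp \<phi>p)) \<longlongrightarrow> K) qp)"

lemma Km: "Km \<noteq> 0" "((\<lambda>z. exp (\<psi>\<^sub>0 z) / (\<phi>m z - Lim qm \<phi>m)) \<longlongrightarrow> Km) qm"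
  using someI_ex[OF chart_constants(1)] unfolding Km_def by auto

lemma Kp: "Kp \<noteq> 0" "((\<lambda>z. exp (- \<psi>\<^sub>0 z) / (\<phi>p z - Lim qp \<phi>p)) \<longlongrightarrow> Kp) qp"
  using someI_ex[OF chart_constants(2)] unfolding Kp_def by auto

text \<open>\<open>cdom\<close> is D_t and \<open>cmap\<close> is w_t, expressed through the
  concrete flow \<open>fl\<close> for a deterministic driving function.\<close>

definition cdom :: "(real \<Rightarrow> real) \<Rightarrow> real \<Rightarrow> complex set" where
  "cdom \<xi> t = {z \<in> D. \<psi>\<^sub>0 z \<in> alive \<xi> t}"

definition cmap :: "(real \<Rightarrow> real) \<Rightarrow> real \<Rightarrow> complex \<Rightarrow> complex" where
  "cmap \<xi> t u = fl \<xi> t (\<psi>\<^sub>0 u) - of_real (\<xi> t)"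

lemma psi0_holomorphic: "\<psi>\<^sub>0 holomorphic_on D" and psi0_inj: "inj_on \<psi>\<^sub>0 D"
  using psi0(1) by (auto simp: conformal_onto_def bij_betw_def)

lemma open_cdom:
  assumes "continuous_on {0..} \<xi>" "0 \<le> t"
  shows "open (cdom \<xi> t)"
proof -
  have "open (D \<inter> \<psi>\<^sub>0 -` alive \<xi> t)"
    by (intro continuous_open_preimage holomorphic_on_imp_continuous_on psi0_holomorphic openD open_alive assms)
  then show ?thesis by (simp add: cdom_def Int_def vimage_def)
qed

lemma cmap_conformal:
  assumes x: "continuous_on {0..} \<xi>" and t: "0 \<le> t"
  shows "conformal_onto (cmap \<xi> t) (cdom \<xi> t) strip"
proof -
  have "conformal_onto \<psi>\<^sub>0 (cdom \<xi> t) (alive \<xi> t)"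
    unfolding conformal_onto_def bij_betw_def
  proof (intro conjI)
    show "\<psi>\<^sub>0 holomorphic_on cdom \<xi> t" by (rule holomorphic_on_subset[OF psi0_holomorphic]) (auto simp: cdom_def)
    show "inj_on \<psi>\<^sub>0 (cdom \<xi> t)" by (rule inj_on_subset[OF psi0_inj]) (auto simp: cdom_def)
    have "alive \<xi> t \<subseteq> strip" by (auto simp: alive_def)
    moreover have "\<psi>\<^sub>0 ` D = strip" using psi0(1) by (simp add: conformal_onto_def bij_betw_def)
    ultimately show "\<psi>\<^sub>0 ` cdom \<xi> t = alive \<xi> t" by (auto simp: cdom_def)
  qed
  from conformal_onto_comp[OF this conformal_flow[OF x t]] show ?thesis by (simp add: cmap_def[abs_def])
qed

text \<open>By \<open>fl_end\<close> the flow shifts the two ends by -t and t; subtracting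
  \<open>\<xi> t\<close> shifts both. A uniformization at time t provides the premise that the
  boundary filter lives on \<open>cdom\<close>.\<close>

lemma cmap_ends:
  assumes x: "continuous_on {0..} \<xi>" and t: "0 \<le> t"
  shows "\<forall>\<^sub>F z in qm. z \<in> cdom \<xi> t \<Longrightarrow> ((\<lambda>z. cmap \<xi> t z - \<psi>\<^sub>0 z) \<longlongrightarrow> of_real (- t - \<xi> t)) qm"
    and "\<forall>\<^sub>F z in qp. z \<in> cdom \<xi> t \<Longrightarrow> ((\<lambda>z. cmap \<xi> t z - \<psi>\<^sub>0 z) \<longlongrightarrow> of_real (t - \<xi> t)) qp"
proof -
  show "((\<lambda>z. cmap \<xi> t z - \<psi>\<^sub>0 z) \<longlongrightarrow> of_real (- t - \<xi> t)) qm" if ev: "\<forall>\<^sub>F z in qm. z \<in> cdom \<xi> t"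
  proof (rule tendstoI)
    fix \<eta> :: real assume "0 < \<eta>"
    then obtain R where R: "\<And>u. u \<in> alive \<xi> t \<Longrightarrow> Re u < R \<Longrightarrow> norm (fl \<xi> t u - u + of_real t) < \<eta>"
      using fl_end(2)[OF x t] by blast
    have "\<forall>\<^sub>F z in qm. Re (\<psi>\<^sub>0 z) < R" using psi0_ends(1) by (simp add: filterlim_at_bot_dense)
    with ev show "\<forall>\<^sub>F z in qm. dist (cmap \<xi> t z - \<psi>\<^sub>0 z) (of_real (- t - \<xi> t)) < \<eta>"
    proof eventually_elim
      case (elim z)
      then have "norm (fl \<xi> t (\<psi>\<^sub>0 z) - \<psi>\<^sub>0 z + of_real t) < \<eta>" using R by (auto simp: cdom_def)
      moreover have "cmap \<xi> t z - \<psi>\<^sub>0 z - of_real (- t - \<xi> t) = fl \<xi> t (\<psi>\<^sub>0 z) - \<psi>\<^sub>0 z + of_real t" by (simp add: cmap_def)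
      ultimately show ?case by (simp only: dist_norm)
    qed
  qed
  show "((\<lambda>z. cmap \<xi> t z - \<psi>\<^sub>0 z) \<longlongrightarrow> of_real (t - \<xi> t)) qp" if ev: "\<forall>\<^sub>F z in qp. z \<in> cdom \<xi> t"
  proof (rule tendstoI)
    fix \<eta> :: real assume "0 < \<eta>"
    then obtain R where R: "\<And>u. u \<in> alive \<xi> t \<Longrightarrow> R < Re u \<Longrightarrow> norm (fl \<xi> t u - u - of_real t) < \<eta>"
      using fl_end(1)[OF x t] by blast
    have "\<forall>\<^sub>F z in qp. R < Re (\<psi>\<^sub>0 z)" using psi0_ends(2) by (simp add: filterlim_at_top_dense)
    with ev show "\<forall>\<^sub>F z in qp. dist (cmap \<xi> t z - \<psi>\<^sub>0 z) (of_real (t - \<xi> t)) < \<eta>"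
    proof eventually_elim
      case (elim z)
      then have "norm (fl \<xi> t (\<psi>\<^sub>0 z) - \<psi>\<^sub>0 z - of_real t) < \<eta>" using R by (auto simp: cdom_def)
      moreover have "cmap \<xi> t z - \<psi>\<^sub>0 z - of_real (t - \<xi> t) = fl \<xi> t (\<psi>\<^sub>0 z) - \<psi>\<^sub>0 z - of_real t" by (simp add: cmap_def)
      ultimately show ?case by (simp only: dist_norm)
    qed
  qed
qed

lemma cmap_Re_ends:
  assumes x: "continuous_on {0..} \<xi>" and t: "0 \<le> t"
  shows "\<forall>\<^sub>F z in qm. z \<in> cdom \<xi> t \<Longrightarrow> filterlim (\<lambda>z. Re (cmap \<xi> t z)) at_bot qm"
    and "\<forall>\<^sub>F z in qp. z \<in> cdom \<xi> t \<Longrightarrow> filterlim (\<lambda>z. Re (cmap \<xi> t z)) at_top qp"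
proof -
  assume "\<forall>\<^sub>F z in qm. z \<in> cdom \<xi> t"
  from tendsto_Re[OF cmap_ends(1)[OF x t this]]
  have "filterlim (\<lambda>z. Re (cmap \<xi> t z - \<psi>\<^sub>0 z) + Re (\<psi>\<^sub>0 z)) at_bot qm"
    by (rule filterlim_tendsto_add_at_bot) (rule psi0_ends(1))
  then show "filterlim (\<lambda>z. Re (cmap \<xi> t z)) at_bot qm" by simp
next
  assume "\<forall>\<^sub>F z in qp. z \<in> cdom \<xi> t"
  from tendsto_Re[OF cmap_ends(2)[OF x t this]]
  have "filterlim (\<lambda>z. Re (cmap \<xi> t z - \<psi>\<^sub>0 z) + Re (\<psi>\<^sub>0 z)) at_top qp"
    by (rule filterlim_tendsto_add_at_top) (rule psi0_ends(2))
  then show "filterlim (\<lambda>z. Re (cmap \<xi> t z)) at_top qp" by simp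
qed

text \<open>With E = exp(cmap + c), w + 1 is 2 E / (E + 1) and w - 1 is -2 (1/E) / (1 + 1/E).
  Comparing E and 1/E with the exponentials of \<open>\<psi>\<^sub>0\<close> and its negative,
  \<open>cmap_ends\<close> yields the factors exp(-t - \<xi> t) and exp(-t + \<xi> t) at the two
  roots.\<close>

lemma uniformization_at_time:
  assumes x: "continuous_on {0..} \<xi>" and t: "0 \<le> t" and w: "uniformization w (cdom \<xi> t) qm qp"
    and ph: "\<phi> qm = \<phi>m" "\<phi> qp = \<phi>p"
  obtains c :: real where "\<And>z. z \<in> cdom \<xi> t \<Longrightarrow> w z = tanh ((cmap \<xi> t z + of_real c) / 2)"
    "node_deriv \<phi> w (Bd qm) = exp ((Ln (2 * Km) + of_real (- t - \<xi> t)) + of_real c)"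
    "node_deriv \<phi> w (Bd qp) = exp ((Ln (- 2 * Kp) + of_real (- t + \<xi> t)) - of_real c)"
proof -
  have wm: "bmaps w (cdom \<xi> t) qm (at (of_real (-1)) within upper_half_plane)" "bmaps w (cdom \<xi> t) qp (at (of_real 1) within upper_half_plane)"
    using w by (simp_all add: uniformization_def)
  note bm = bmaps_half_plane[OF wm(1)] and bp = bmaps_half_plane[OF wm(2)]
  obtain c :: real where c: "\<And>z. z \<in> cdom \<xi> t \<Longrightarrow> w z = tanh ((cmap \<xi> t z + of_real c) / 2)"
    using uniformization_tanh[OF cmap_conformal[OF x t] open_cdom[OF x t] w cmap_Re_ends(1)[OF x t bm(3)] cmap_Re_ends(2)[OF x t bp(3)]] by blast
  have st: "cmap \<xi> t z \<in> strip" if "z \<in> cdom \<xi> t" for z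
    using cmap_conformal[OF x t] that by (auto simp: conformal_onto_def bij_betw_def)
  define E where "E = (\<lambda>z. exp (cmap \<xi> t z + of_real c))"
  have En: "E z \<noteq> -1" "E z + 1 \<noteq> 0" "E z \<noteq> 0" if "z \<in> cdom \<xi> t" for z
    using exp_strip_ne[OF st[OF that], of c] by (auto simp: E_def add_eq_0_iff2)
  have wE: "w z = (E z - 1) / (E z + 1)" if "z \<in> cdom \<xi> t" for z
    unfolding c[OF that] E_def by (rule tanh_half_exp[OF exp_strip_ne[OF st[OF that]]])
  have Lm: "Lim qm w = -1" "Lim qp w = 1"
    using tendsto_Lim[OF bm(1) bm(2)] tendsto_Lim[OF bp(1) bp(2)] by auto
  have "filterlim (\<lambda>z. Re (cmap \<xi> t z + of_real c)) at_bot qm"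
    using filterlim_tendsto_add_at_bot[OF tendsto_const[of c] cmap_Re_ends(1)[OF x t bm(3)]] by (simp add: add.commute)
  then have E0: "(E \<longlongrightarrow> 0) qm" unfolding E_def by (rule exp_tendsto_0)
  have "filterlim (\<lambda>z. Re (cmap \<xi> t z)) at_top qp" by (rule cmap_Re_ends(2)[OF x t bp(3)])
  then have "filterlim (\<lambda>z. - Re (cmap \<xi> t z)) at_bot qp" by (simp add: filterlim_uminus_at_bot)
  then have "filterlim (\<lambda>z. Re (- (cmap \<xi> t z + of_real c))) at_bot qp"
    using filterlim_tendsto_add_at_bot[OF tendsto_const[of "-c"]] by fastforce
  then have E0': "((\<lambda>z. exp (- (cmap \<xi> t z + of_real c))) \<longlongrightarrow> 0) qp" by (rule exp_tendsto_0)
  have "((\<lambda>z. 2 / (E z + 1) * exp ((cmap \<xi> t z - \<psi>\<^sub>0 z) + of_real c) * (exp (\<psi>\<^sub>0 z) / (\<phi>m z - Lim qm \<phi>m))) \<longlongrightarrow>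
      2 / (0 + 1) * exp (of_real (- t - \<xi> t) + of_real c) * Km) qm"
    by (intro tendsto_intros E0 Km(2) cmap_ends(1)[OF x t bm(3)]) simp
  then have "((\<lambda>z. (w z - Lim qm w) / (\<phi>m z - Lim qm \<phi>m)) \<longlongrightarrow> 2 / (0 + 1) * exp (of_real (- t - \<xi> t) + of_real c) * Km) qm"
  proof (rule Lim_transform_eventually)
    show "\<forall>\<^sub>F z in qm. 2 / (E z + 1) * exp ((cmap \<xi> t z - \<psi>\<^sub>0 z) + of_real c) * (exp (\<psi>\<^sub>0 z) / (\<phi>m z - Lim qm \<phi>m)) = (w z - Lim qm w) / (\<phi>m z - Lim qm \<phi>m)"
      using bm(3)
    proof eventually_elim
      case (elim z)
      have "exp ((cmap \<xi> t z - \<psi>\<^sub>0 z) + of_real c) * exp (\<psi>\<^sub>0 z) = E z" unfolding E_def by (simp flip: exp_add)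
      moreover have "w z - Lim qm w = 2 / (E z + 1) * E z" unfolding Lm wE[OF elim] using En(2)[OF elim] by (simp add: field_simps)
      ultimately show ?case by (metis (no_types, lifting) mult.assoc times_divide_eq_right)
    qed
  qed
  then have d1: "node_deriv \<phi> w (Bd qm) = 2 / (0 + 1) * exp (of_real (- t - \<xi> t) + of_real c) * Km"
    using tendsto_Lim[OF bm(1)] by (simp add: ph)
  have "((\<lambda>z. - 2 / (1 + exp (- (cmap \<xi> t z + of_real c))) * exp (- (cmap \<xi> t z - \<psi>\<^sub>0 z) - of_real c) * (exp (- \<psi>\<^sub>0 z) / (\<phi>p z - Lim qp \<phi>p))) \<longlongrightarrow>
      - 2 / (1 + 0) * exp (- of_real (t - \<xi> t) - of_real c) * Kp) qp"
    by (intro tendsto_intros E0' Kp(2) cmap_ends(2)[OF x t bp(3)]) simp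
  then have "((\<lambda>z. (w z - Lim qp w) / (\<phi>p z - Lim qp \<phi>p)) \<longlongrightarrow> - 2 / (1 + 0) * exp (- of_real (t - \<xi> t) - of_real c) * Kp) qp"
  proof (rule Lim_transform_eventually)
    show "\<forall>\<^sub>F z in qp. - 2 / (1 + exp (- (cmap \<xi> t z + of_real c))) * exp (- (cmap \<xi> t z - \<psi>\<^sub>0 z) - of_real c) * (exp (- \<psi>\<^sub>0 z) / (\<phi>p z - Lim qp \<phi>p)) = (w z - Lim qp w) / (\<phi>p z - Lim qp \<phi>p)"
      using bp(3)
    proof eventually_elim
      case (elim z)
      have inv: "exp (- (cmap \<xi> t z + of_real c)) = 1 / E z" unfolding E_def by (simp only: exp_minus inverse_eq_divide)
      have "exp (- (cmap \<xi> t z - \<psi>\<^sub>0 z) - of_real c) * exp (- \<psi>\<^sub>0 z) = exp (- (cmap \<xi> t z + of_real c))" by (simp flip: exp_add)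
      then have e: "exp (- (cmap \<xi> t z - \<psi>\<^sub>0 z) - of_real c) * exp (- \<psi>\<^sub>0 z) = 1 / E z" unfolding inv .
      have "w z - Lim qp w = - 2 / (1 + 1 / E z) * (1 / E z)" unfolding Lm wE[OF elim] using En[OF elim] by (simp add: field_simps)
      then show ?case unfolding inv using e by (metis (no_types, lifting) mult.assoc times_divide_eq_right)
    qed
  qed
  then have d2: "node_deriv \<phi> w (Bd qp) = - 2 / (1 + 0) * exp (- of_real (t - \<xi> t) - of_real c) * Kp"
    using tendsto_Lim[OF bp(1)] by (simp add: ph)
  have k: "exp (Ln (2 * Km)) = 2 * Km" "exp (Ln (- 2 * Kp)) = - 2 * Kp" using Km(1) Kp(1) by auto
  show thesis
  proof (rule that[OF c])
    show "node_deriv \<phi> w (Bd qm) = exp ((Ln (2 * Km) + of_real (- t - \<xi> t)) + of_real c)"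
      unfolding d1 by (simp only: exp_add k) simp
    have "(Ln (- 2 * Kp) + of_real (- t + \<xi> t)) - of_real c = Ln (- 2 * Kp) + (- of_real (t - \<xi> t) - of_real c)" by simp
    then show "node_deriv \<phi> w (Bd qp) = exp ((Ln (- 2 * Kp) + of_real (- t + \<xi> t)) - of_real c)"
      unfolding d2 by (simp only: exp_add k) simp
  qed
qed

end

lemma has_integral_cnj': "(f has_integral i) S \<Longrightarrow> ((\<lambda>x. cnj (f x)) has_integral cnj i) S"
  using has_integral_linear[OF _ bounded_linear_cnj] by (simp add: comp_def)

lemma exp_Ln_minus_half: "d \<noteq> 0 \<Longrightarrow> exp (Ln d - 1 / 2 * i) = d * exp (- (1/2) * i)" for d i :: complex
proof -
  assume d: "d \<noteq> 0"
  have "exp (Ln d - 1 / 2 * i) = exp (Ln d + - (1/2) * i)" by (rule arg_cong[where f = exp]) simp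
  then show ?thesis by (simp only: exp_add exp_Ln[OF d])
qed

context dipolar_setting begin

lemma flow_domain_eq:
  assumes x: "continuous_on {0..} \<xi>" and t: "0 \<le> t" and fw: "dipolar_flow \<xi> D \<psi>\<^sub>0 \<psi> \<tau>"
  shows "flow_domain D \<tau> t = cdom \<xi> t"
    and "z' \<in> cdom \<xi> t \<Longrightarrow> \<psi> t z' - of_real (\<xi> t) = cmap \<xi> t z'"
proof -
  note a = dipolar_flow_alive[OF x fw _ _ t]
  show 1: "flow_domain D \<tau> t = cdom \<xi> t"
    unfolding flow_domain_def cdom_def using a(1) psi0(2) by blast
  show "z' \<in> cdom \<xi> t \<Longrightarrow> \<psi> t z' - of_real (\<xi> t) = cmap \<xi> t z'"
    using a psi0(2) by (auto simp: cdom_def cmap_def)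
qed

text \<open>The tip is the image of the filter at 0 under the inverse of \<open>cmap\<close>, so the
  limit can be taken in the strip coordinate, where \<open>w\<close> is tanh((Z + c)/2).\<close>

lemma tip_value:
  fixes c :: real
  assumes x: "continuous_on {0..} \<xi>" and t: "0 \<le> t"
    and w: "\<And>z. z \<in> cdom \<xi> t \<Longrightarrow> w z = tanh ((cmap \<xi> t z + of_real c) / 2)"
    and g: "\<And>z. z \<in> cdom \<xi> t \<Longrightarrow> g z = cmap \<xi> t z"
  shows "Lim (filtermap (inv_into (cdom \<xi> t) g) (at 0 within strip)) w = tanh (of_real c / 2)"
proof (rule tendsto_Lim)
  show "\<not> trivial_limit (filtermap (inv_into (cdom \<xi> t) g) (at 0 within strip))"
    using at_0_strip_neq_bot by (simp add: filtermap_bot_iff)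
  have gi: "g ` cdom \<xi> t = strip"
    using cmap_conformal[OF x t] g by (auto simp: conformal_onto_def bij_betw_def image_iff set_eq_iff)
  have ev: "tanh ((Z + of_real c) / 2) = w (inv_into (cdom \<xi> t) g Z)" if "Z \<in> strip" for Z
  proof -
    have "inv_into (cdom \<xi> t) g Z \<in> cdom \<xi> t" "g (inv_into (cdom \<xi> t) g Z) = Z"
      using that gi by (metis inv_into_into, metis f_inv_into_f)
    then show ?thesis using w g by metis
  qed
  have cc: "cosh ((0 + of_real c) / 2 :: complex) \<noteq> 0"
  proof -
    have "cosh ((0 + of_real c) / 2 :: complex) = of_real (cosh (c / 2))" by (simp add: cosh_field_def exp_of_real[symmetric])
    then show ?thesis by (simp add: cosh_real_nonzero)
  qed
  have "((\<lambda>Z. tanh ((Z + of_real c) / 2)) \<longlongrightarrow> tanh ((0 + of_real c) / 2)) (at 0 within strip)"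
    unfolding tanh_def by (intro tendsto_intros cc) auto
  then have "((\<lambda>Z. w (inv_into (cdom \<xi> t) g Z)) \<longlongrightarrow> tanh ((0 + of_real c) / 2)) (at 0 within strip)"
    by (rule Lim_transform_eventually) (use ev in \<open>simp add: eventually_at_filter\<close>)
  then show "(w \<longlongrightarrow> tanh (of_real c / 2)) (filtermap (inv_into (cdom \<xi> t) g) (at 0 within strip))"
    by (simp add: filterlim_filtermap)
qed

section \<open>Logarithms along the flow\<close>

definition cpath :: "(real \<Rightarrow> real) \<Rightarrow> nat \<Rightarrow> real \<Rightarrow> complex" where
  "cpath \<xi> k s = cth (fl \<xi> s (\<psi>\<^sub>0 (z k)) - of_real (\<xi> s))"

text \<open>A logarithm that is continuous in time by construction: the principal value is taken at
  time 0 only, and the rest is an integral. The same holds for \<open>ldT\<close> and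
  \<open>leT\<close>.\<close>

definition lT :: "(real \<Rightarrow> real) \<Rightarrow> real \<Rightarrow> nat \<Rightarrow> complex" where
  "lT \<xi> t k = Ln (deriv \<psi>\<^sub>0 (z k)) - 1 / 2 * integral {0..t} (\<lambda>s. cpath \<xi> k s * cpath \<xi> k s - 1)"

definition ldT :: "(real \<Rightarrow> real) \<Rightarrow> real \<Rightarrow> nat \<Rightarrow> nat \<Rightarrow> complex" where
  "ldT \<xi> t j k = Ln (sinh ((\<psi>\<^sub>0 (z j) - \<psi>\<^sub>0 (z k)) / 2)) - 1 / 2 * integral {0..t} (\<lambda>s. cpath \<xi> j s * cpath \<xi> k s - 1)"

definition leT :: "(real \<Rightarrow> real) \<Rightarrow> real \<Rightarrow> nat \<Rightarrow> nat \<Rightarrow> complex" where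
  "leT \<xi> t j k = Ln (sinh ((\<psi>\<^sub>0 (z j) - cnj (\<psi>\<^sub>0 (z k))) / 2)) - 1 / 2 * integral {0..t} (\<lambda>s. cpath \<xi> j s * cnj (cpath \<xi> k s) - 1)"

text \<open>Chain rule through \<open>\<psi>\<^sub>0\<close>, the flow and tanh, with 1 - tanh^2 =
  1/cosh^2.\<close>

lemma deriv_at_time:
  fixes c :: real
  assumes x: "continuous_on {0..} \<xi>" and t: "0 \<le> t"
    and w: "\<And>z. z \<in> cdom \<xi> t \<Longrightarrow> w z = tanh ((cmap \<xi> t z + of_real c) / 2)"
    and k: "z k \<in> cdom \<xi> t"
  shows "deriv w (z k) = exp (lT \<xi> t k) / (2 * (cosh ((cmap \<xi> t (z k) + of_real c) / 2))\<^sup>2)"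
proof -
  have kD: "z k \<in> D" "\<psi>\<^sub>0 (z k) \<in> alive \<xi> t" using k by (auto simp: cdom_def)
  have st: "cmap \<xi> t (z k) \<in> strip" using cmap_conformal[OF x t] k by (auto simp: conformal_onto_def bij_betw_def)
  have ch: "cosh ((cmap \<xi> t (z k) + of_real c) / 2) \<noteq> 0" using cosh_strip_ne[OF st] .
  have d0: "(\<psi>\<^sub>0 has_field_derivative deriv \<psi>\<^sub>0 (z k)) (at (z k))"
    by (rule holomorphic_derivI[OF psi0_holomorphic openD kD(1)])
  have dn: "deriv \<psi>\<^sub>0 (z k) \<noteq> 0"
    using holomorphic_injective_imp_regular[OF psi0_holomorphic openD psi0_inj kD(1)] .
  define F where "F = exp (- (1/2) * integral {0..t} (\<lambda>s. (cth (fl \<xi> s (\<psi>\<^sub>0 (z k)) - of_real (\<xi> s)))\<^sup>2 - 1))"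
  have "((\<lambda>u. fl \<xi> t (\<psi>\<^sub>0 u)) has_field_derivative F * deriv \<psi>\<^sub>0 (z k)) (at (z k))"
    unfolding F_def by (rule DERIV_chain2[OF fl_has_derivative[OF x kD(2) t] d0])
  then have dc: "(cmap \<xi> t has_field_derivative F * deriv \<psi>\<^sub>0 (z k)) (at (z k))"
    unfolding cmap_def[abs_def] by (auto intro!: derivative_eq_intros)
  have eF: "F * deriv \<psi>\<^sub>0 (z k) = exp (lT \<xi> t k)"
    by (simp only: lT_def F_def exp_Ln_minus_half[OF dn] cpath_def power2_eq_square mult.commute)
  have dl: "((\<lambda>u. (cmap \<xi> t u + of_real c) / 2) has_field_derivative exp (lT \<xi> t k) / 2) (at (z k))"
    by (rule derivative_eq_intros dc refl | simp add: eF)+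
  have "((\<lambda>u. tanh ((cmap \<xi> t u + of_real c) / 2)) has_field_derivative (1 - (tanh ((cmap \<xi> t (z k) + of_real c) / 2))\<^sup>2) * (exp (lT \<xi> t k) / 2)) (at (z k))"
    by (rule DERIV_chain2[OF _ dl]) (use ch in \<open>auto intro!: derivative_eq_intros\<close>)
  then have "(w has_field_derivative (1 - (tanh ((cmap \<xi> t (z k) + of_real c) / 2))\<^sup>2) * (exp (lT \<xi> t k) / 2)) (at (z k))"
    by (rule has_field_derivative_transform_within_open[OF _ open_cdom[OF x t] k]) (simp add: w)
  then have "deriv w (z k) = (1 - (tanh ((cmap \<xi> t (z k) + of_real c) / 2))\<^sup>2) * (exp (lT \<xi> t k) / 2)" by (rule DERIV_imp_deriv)
  also have "1 - (tanh ((cmap \<xi> t (z k) + of_real c) / 2))\<^sup>2 = 1 / (cosh ((cmap \<xi> t (z k) + of_real c) / 2))\<^sup>2"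
  proof -
    have *: "1 - (s / c)\<^sup>2 = 1 / c\<^sup>2" if "c\<^sup>2 = s\<^sup>2 + 1" "c\<^sup>2 \<noteq> 0" for s c :: complex
      using that by (simp add: power_divide diff_divide_eq_iff)
    show ?thesis unfolding tanh_def by (rule *) (use ch in \<open>simp_all only: cosh_square_eq[symmetric] power_eq_0_iff not_False_eq_True simp_thms\<close>)
  qed
  finally show ?thesis by simp
qed

text \<open>The conjugate of a path solves the same equation, because \<open>cth\<close> commutes
  with conjugation and the driving function is real; \<open>sinh_half_diff\<close> thus covers a
  node and a conjugate node, including j = k. These lie on different sides of the real line, so the
  sinh does not vanish.\<close>

lemma node_diff_log:
  assumes x: "continuous_on {0..} \<xi>" and t: "0 \<le> t"
    and j: "z j \<in> cdom \<xi> t" and k: "z k \<in> cdom \<xi> t"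
  shows "z j \<noteq> z k \<Longrightarrow> exp (ldT \<xi> t j k) = sinh ((cmap \<xi> t (z j) - cmap \<xi> t (z k)) / 2)"
    and "exp (leT \<xi> t j k) = sinh ((cmap \<xi> t (z j) - cnj (cmap \<xi> t (z k))) / 2)"
proof -
  have J: "\<psi>\<^sub>0 (z j) \<in> alive \<xi> t" "\<psi>\<^sub>0 (z k) \<in> alive \<xi> t" "z j \<in> D" "z k \<in> D" using j k by (auto simp: cdom_def)
  have S: "\<psi>\<^sub>0 (z j) \<in> strip" "\<psi>\<^sub>0 (z k) \<in> strip" using psi0(2) J by auto
  show "exp (ldT \<xi> t j k) = sinh ((cmap \<xi> t (z j) - cmap \<xi> t (z k)) / 2)" if ne: "z j \<noteq> z k"
  proof -
    have "\<psi>\<^sub>0 (z j) \<noteq> \<psi>\<^sub>0 (z k)" using psi0_inj ne J by (auto simp: inj_on_def)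
    then have s0: "sinh ((\<psi>\<^sub>0 (z j) - \<psi>\<^sub>0 (z k)) / 2) \<noteq> 0" using sinh_half_strip_eq_0[OF S] by auto
    have "sinh ((fl \<xi> t (\<psi>\<^sub>0 (z j)) - fl \<xi> t (\<psi>\<^sub>0 (z k))) / 2) = exp (ldT \<xi> t j k)"
      unfolding fl_sinh[OF x J(1,2) t] ldT_def exp_Ln_minus_half[OF s0] cpath_def ..
    then show ?thesis by (simp add: cmap_def)
  qed
  note P = alive_path[OF x J(1)] and Q = alive_path[OF x J(2)]
  have s0: "sinh ((\<psi>\<^sub>0 (z j) - cnj (\<psi>\<^sub>0 (z k))) / 2) \<noteq> 0"
  proof
    assume "sinh ((\<psi>\<^sub>0 (z j) - cnj (\<psi>\<^sub>0 (z k))) / 2) = 0"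
    moreover have "\<bar>Im ((\<psi>\<^sub>0 (z j) - cnj (\<psi>\<^sub>0 (z k))) / 2)\<bar> < pi" "Im ((\<psi>\<^sub>0 (z j) - cnj (\<psi>\<^sub>0 (z k))) / 2) \<noteq> 0"
      using S by (auto simp: strip_def)
    ultimately show False using sinh_eq_0_small by fastforce
  qed
  have "sinh ((fl \<xi> t (\<psi>\<^sub>0 (z j)) - cnj (fl \<xi> t (\<psi>\<^sub>0 (z k)))) / 2) = sinh ((fl \<xi> 0 (\<psi>\<^sub>0 (z j)) - cnj (fl \<xi> 0 (\<psi>\<^sub>0 (z k)))) / 2) *
     exp (- (1/2) * integral {0..t} (\<lambda>s. cth (fl \<xi> s (\<psi>\<^sub>0 (z j)) - of_real (\<xi> s)) * cth (cnj (fl \<xi> s (\<psi>\<^sub>0 (z k))) - of_real (\<xi> s)) - 1))"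
  proof (rule sinh_half_diff[OF t x])
    fix s assume s: "0 \<le> s" "s \<le> t"
    show "((\<lambda>s. fl \<xi> s (\<psi>\<^sub>0 (z j))) has_vector_derivative cth (fl \<xi> s (\<psi>\<^sub>0 (z j)) - of_real (\<xi> s))) (at s within {0..t})" by (rule P(5)[OF s])
    have "cth (cnj (fl \<xi> s (\<psi>\<^sub>0 (z k))) - of_real (\<xi> s)) = cnj (cth (fl \<xi> s (\<psi>\<^sub>0 (z k)) - of_real (\<xi> s)))"
      using cth_cnj[of "fl \<xi> s (\<psi>\<^sub>0 (z k)) - of_real (\<xi> s)"] by simp
    then show "((\<lambda>s. cnj (fl \<xi> s (\<psi>\<^sub>0 (z k)))) has_vector_derivative cth (cnj (fl \<xi> s (\<psi>\<^sub>0 (z k))) - of_real (\<xi> s))) (at s within {0..t})"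
      using has_vector_derivative_cnj[OF Q(5)[OF s]] by simp
    show "fl \<xi> s (\<psi>\<^sub>0 (z j)) - of_real (\<xi> s) \<in> dstrip" by (rule strip_dstrip(1)[OF P(6)[OF s]])
    show "cnj (fl \<xi> s (\<psi>\<^sub>0 (z k))) - of_real (\<xi> s) \<in> dstrip" using strip_dstrip(2)[OF Q(6)[OF s]] by simp
  qed
  moreover have "cth (cnj (fl \<xi> s (\<psi>\<^sub>0 (z k))) - of_real (\<xi> s)) = cnj (cpath \<xi> k s)" for s
    using cth_cnj[of "fl \<xi> s (\<psi>\<^sub>0 (z k)) - of_real (\<xi> s)"] by (simp add: cpath_def)
  ultimately have "sinh ((fl \<xi> t (\<psi>\<^sub>0 (z j)) - cnj (fl \<xi> t (\<psi>\<^sub>0 (z k)))) / 2) = exp (leT \<xi> t j k)"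
    unfolding leT_def exp_Ln_minus_half[OF s0] by (simp only: P(3)[OF t order_refl] Q(3)[OF t order_refl] cpath_def[symmetric])
  then show "exp (leT \<xi> t j k) = sinh ((cmap \<xi> t (z j) - cnj (cmap \<xi> t (z k))) / 2)" by (simp add: cmap_def)
qed

text \<open>A logarithm of the observable at time t for one choice of branches. The two leading
  terms come from the derivatives at the roots, with the translation \<open>c\<close>
  removed.\<close>

definition LT :: "real \<Rightarrow> real \<Rightarrow> (nat \<Rightarrow> real) \<Rightarrow> (nat \<Rightarrow> real) \<Rightarrow> real \<Rightarrow> real \<Rightarrow> (real \<Rightarrow> real) \<Rightarrow> real \<Rightarrow> complex" where
  "LT a b \<sigma> \<sigma>s \<sigma>m \<sigma>p \<xi> t =
     of_real (\<sigma>m * (\<sigma>m - a) / 2) * (Ln (2 * Km) + of_real (- t - \<xi> t)) + of_real (\<sigma>p * (\<sigma>p - a) / 2) * (Ln (- 2 * Kp) + of_real (- t + \<xi> t))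
     + log_coeff a b n \<sigma> \<sigma>s (\<sigma>m - a / 2) (\<sigma>p - a / 2) (\<lambda>k. cmap \<xi> t (z k)) (lT \<xi> t) (\<lambda>k. lns (cmap \<xi> t (z k))) (ldT \<xi> t) (leT \<xi> t)"

text \<open>The uniformization enters only through its unknown translation \<open>c\<close>, which
  is eliminated here; the branch factors lie in a set that depends neither on time nor on the
  driving function.\<close>

lemma observable_at_time:
  assumes x: "continuous_on {0..} \<xi>" and t: "0 \<le> t" and fw: "dipolar_flow \<xi> D \<psi>\<^sub>0 \<psi> \<tau>"
    and zk: "\<And>k. k < n \<Longrightarrow> z k \<in> cdom \<xi> t"
    and neut: "\<sigma>m + \<sigma>p + (\<Sum>k<n. \<sigma> k + \<sigma>s k) = 0"
    and v: "v \<in> vertex_observable a b n \<sigma> \<sigma>s \<sigma>m \<sigma>p (flow_domain D \<tau> t) (flow_tip \<xi> D \<psi> \<tau> t) qm qp \<phi>m \<phi>p z"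
  shows "\<exists>g\<in>U_obs a b n \<sigma> \<sigma>s \<sigma>m \<sigma>p. v = g * exp (LT a b \<sigma> \<sigma>s \<sigma>m \<sigma>p \<xi> t)"
proof -
  define p' where "p' = flow_tip \<xi> D \<psi> \<tau> t"
  obtain X Y w \<phi> where w: "uniformization w (cdom \<xi> t) qm qp" and ph: "\<phi> qm = \<phi>m" "\<phi> qp = \<phi>p"
    and X: "X \<in> rooted_vertex_field b qm qp \<phi> w (star (Psi_charge a p') (tuple_charge n \<sigma> \<sigma>s \<sigma>m \<sigma>p z)) (Bd p' # map (\<lambda>j. Pt (z j)) [0..<n])"
    and Y: "Y \<in> rooted_vertex_field b qm qp \<phi> w (Psi_charge a p') [Bd p']" and vXY: "v = fock_expectation X / fock_expectation Y"
    using v unfolding vertex_observable_def flow_domain_eq(1)[OF x t fw] p'_def by blast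
  obtain c :: real where c: "\<And>z. z \<in> cdom \<xi> t \<Longrightarrow> w z = tanh ((cmap \<xi> t z + of_real c) / 2)"
    "node_deriv \<phi> w (Bd qm) = exp ((Ln (2 * Km) + of_real (- t - \<xi> t)) + of_real c)"
    "node_deriv \<phi> w (Bd qp) = exp ((Ln (- 2 * Kp) + of_real (- t + \<xi> t)) - of_real c)"
    using uniformization_at_time[OF x t w ph] by metis
  have st: "cmap \<xi> t (z k) \<in> strip" if "k < n" for k
    using cmap_conformal[OF x t] zk[OF that] by (auto simp: conformal_onto_def bij_betw_def)
  have tip: "node_val w (Bd p') = tanh (of_real c / 2)"
    unfolding node_val.simps p'_def flow_tip_def flow_domain_eq(1)[OF x t fw]
    by (rule tip_value[OF x t c(1) flow_domain_eq(2)[OF x t fw]])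
  show ?thesis unfolding vXY LT_def
  proof (rule observable_value[OF inj neut X Y c(2,3) tip])
    fix k assume k: "k < n"
    show "cosh ((cmap \<xi> t (z k) + of_real c) / 2) \<noteq> 0" by (rule cosh_strip_ne[OF st[OF k]])
    show "w (z k) = tanh ((cmap \<xi> t (z k) + of_real c) / 2)" by (rule c(1)[OF zk[OF k]])
    show "deriv w (z k) = exp (lT \<xi> t k) / (2 * (cosh ((cmap \<xi> t (z k) + of_real c) / 2))\<^sup>2)"
      by (rule deriv_at_time[OF x t c(1) zk[OF k]])
    show "exp (lns (cmap \<xi> t (z k))) = sinh (cmap \<xi> t (z k) / 2)"
      using sinh_half_nonzero[OF strip_dstrip(1)[OF st[OF k]]] strip_dstrip(1)[OF st[OF k]] by (simp add: lns_def)
    show "exp (ldT \<xi> t j k) = sinh ((cmap \<xi> t (z j) - cmap \<xi> t (z k)) / 2)" if "j < k" for j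
    proof (rule node_diff_log(1)[OF x t zk zk])
      show "z j \<noteq> z k" using inj_onD[OF inj, of j k] that k by auto
    qed (use that k in auto)
    show "exp (leT \<xi> t j k) = sinh ((cmap \<xi> t (z j) - cnj (cmap \<xi> t (z k))) / 2)" if "j \<le> k" for j
      using node_diff_log(2)[OF x t zk zk, of j k] that k by auto
  qed
qed

text \<open>A node and its conjugate count as two points of the flow; the flag \<open>True\<close>
  marks the conjugate, which carries the charge \<open>\<sigma>s\<close>.\<close>

definition nodes :: "(nat \<times> bool) set" where "nodes = {..<n} \<times> UNIV"

fun nq :: "(nat \<Rightarrow> real) \<Rightarrow> (nat \<Rightarrow> real) \<Rightarrow> nat \<times> bool \<Rightarrow> real" where
  "nq \<sigma> \<sigma>s (k, B) = (if B then \<sigma>s k else \<sigma> k)"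

fun nconj :: "bool \<Rightarrow> complex \<Rightarrow> complex" where "nconj B u = (if B then cnj u else u)"

lemma sum_nodes: "(\<Sum>i\<in>nodes. f i) = (\<Sum>k<n. f (k, False) + f (k, True))" for f :: "nat \<times> bool \<Rightarrow> 'b :: comm_monoid_add"
proof -
  have "sum f nodes = (\<Sum>k<n. \<Sum>B\<in>UNIV. f (k, B))" by (simp add: nodes_def sum.cartesian_product split_beta')
  then show ?thesis by (simp add: UNIV_bool)
qed

text \<open>The part of \<open>LT\<close> that does not depend on time: logarithms at time 0 and the
  constants of the charts.\<close>

definition C0 :: "real \<Rightarrow> real \<Rightarrow> (nat \<Rightarrow> real) \<Rightarrow> (nat \<Rightarrow> real) \<Rightarrow> real \<Rightarrow> real \<Rightarrow> complex" where
  "C0 a b \<sigma> \<sigma>s \<sigma>m \<sigma>p = of_real (\<sigma>m * (\<sigma>m - a) / 2) * Ln (2 * Km) + of_real (\<sigma>p * (\<sigma>p - a) / 2) * Ln (- 2 * Kp)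
     + log_coeff a b n \<sigma> \<sigma>s (\<sigma>m - a / 2) (\<sigma>p - a / 2) (\<lambda>_. 0) (\<lambda>k. Ln (deriv \<psi>\<^sub>0 (z k))) (\<lambda>_. 0)
        (\<lambda>j k. Ln (sinh ((\<psi>\<^sub>0 (z j) - \<psi>\<^sub>0 (z k)) / 2))) (\<lambda>j k. Ln (sinh ((\<psi>\<^sub>0 (z j) - cnj (\<psi>\<^sub>0 (z k))) / 2)))"

text \<open>Completing the square: the pair sums give the square of the sum of q c up to its
  diagonal, the parts s^2 / 2 of the dimensions and the self-interaction of a node with its
  conjugate supply the diagonal, and the parts - s b leave the term with b.\<close>

lemma drift_identity:
  fixes c :: "nat \<Rightarrow> complex" and \<sigma> \<sigma>s :: "nat \<Rightarrow> real"
  defines "q \<equiv> nq \<sigma> \<sigma>s" and "g \<equiv> (\<lambda>(k, B). nconj B (c k))"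
  shows "heat.al nodes q b \<mu> g = - of_real \<mu>
     + ((\<Sum>k<n. of_real (dim_bulk b (\<sigma> k)) * (- 1 / 2 * (c k * c k - 1)) + of_real (dim_bulk b (\<sigma>s k)) * (- 1 / 2 * cnj (c k * c k - 1))
          + of_real (\<sigma> k * \<sigma>s k) * (- 1 / 2 * (c k * cnj (c k) - 1)))
       + (\<Sum>k<n. \<Sum>j<k. of_real (\<sigma> j * \<sigma> k) * (- 1 / 2 * (c j * c k - 1)) + of_real (\<sigma> j * \<sigma>s k) * (- 1 / 2 * (c j * cnj (c k) - 1))
          + of_real (\<sigma>s j * \<sigma> k) * (- 1 / 2 * cnj (c j * cnj (c k) - 1)) + of_real (\<sigma>s j * \<sigma>s k) * (- 1 / 2 * cnj (c j * c k - 1))))"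
    (is "?lhs = _ + (?S1 + ?S2)")
proof -
  interpret heat nodes q by unfold_locales (simp add: nodes_def)
  define T where "T = (\<lambda>k. of_real (\<sigma> k) * c k + of_real (\<sigma>s k) * cnj (c k))"
  define R where "R = (\<lambda>k. complex_of_real (\<sigma> k + \<sigma>s k))"
  define r where "r = (\<lambda>k. of_real (\<sigma> k) * (c k)\<^sup>2 + of_real (\<sigma>s k) * (cnj (c k))\<^sup>2)"
  have a: "al g = - of_real \<mu> + ((\<Sum>k<n. R k)\<^sup>2 - (\<Sum>k<n. T k)\<^sup>2) / 4 + of_real (b / 2) * ((\<Sum>k<n. r k) - (\<Sum>k<n. R k))"
    unfolding al_def rt_def sum_nodes by (simp add: q_def g_def T_def R_def r_def)
  have s2: "?S2 = - 1 / 2 * ((\<Sum>k<n. \<Sum>j<k. T j * T k) - (\<Sum>k<n. \<Sum>j<k. R j * R k))"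
    unfolding sum_subtractf[symmetric] sum_distrib_left by (intro sum.cong refl) (simp add: T_def R_def field_simps)
  have s1: "?S1 = (\<Sum>k<n. ((R k)\<^sup>2 - (T k)\<^sup>2) / 4 + of_real (b / 2) * (r k - R k))"
    by (intro sum.cong refl) (simp add: T_def R_def r_def dim_bulk_def power2_eq_square field_simps)
  have s1': "?S1 = ((\<Sum>k<n. (R k)\<^sup>2) - (\<Sum>k<n. (T k)\<^sup>2)) / 4 + of_real (b / 2) * ((\<Sum>k<n. r k) - (\<Sum>k<n. R k))"
    unfolding s1 by (simp add: sum.distrib sum_subtractf sum_divide_distrib[symmetric] sum_distrib_left[symmetric] del: of_real_divide)
  have "?S1 + ?S2 = ((\<Sum>k<n. R k)\<^sup>2 - (\<Sum>k<n. T k)\<^sup>2) / 4 + of_real (b / 2) * ((\<Sum>k<n. r k) - (\<Sum>k<n. R k))"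
    unfolding s1' s2 sum_pairs_square by (simp add: field_simps)
  then show ?thesis unfolding a by simp
qed

text \<open>The integrals in \<open>lT\<close>, \<open>ldT\<close> and \<open>leT\<close> merge by
  \<open>drift_identity\<close> into a single integral of \<open>al\<close>; the roots contribute
  -\<mu> t and \<beta> \<xi> t.\<close>

lemma LT_heat_form:
  fixes a b \<sigma>m \<sigma>p t :: real and \<sigma> \<sigma>s :: "nat \<Rightarrow> real" and \<xi> :: "real \<Rightarrow> real"
  assumes x: "continuous_on {0..} \<xi>" and t: "0 \<le> t" and zk: "\<And>k. k < n \<Longrightarrow> z k \<in> cdom \<xi> t"
  defines "\<mu> \<equiv> \<sigma>m * (\<sigma>m - a) / 2 + \<sigma>p * (\<sigma>p - a) / 2" and "\<beta> \<equiv> \<sigma>p * (\<sigma>p - a) / 2 - \<sigma>m * (\<sigma>m - a) / 2"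
    and "q \<equiv> nq \<sigma> \<sigma>s" and "y \<equiv> (\<lambda>(k, B) s. nconj B (fl \<xi> s (\<psi>\<^sub>0 (z k))))" and "g \<equiv> (\<lambda>s (k, B). nconj B (cpath \<xi> k s))"
  shows "LT a b \<sigma> \<sigma>s \<sigma>m \<sigma>p \<xi> t = C0 a b \<sigma> \<sigma>s \<sigma>m \<sigma>p + (integral {0..t} (\<lambda>s. heat.al nodes q b \<mu> (g s))
      + of_real \<beta> * of_real (\<xi> t) + (\<Sum>i\<in>nodes. of_real (q i) * heat.phi a (\<sigma>m - \<sigma>p) (y i t - of_real (\<xi> t))))"
proof -
  have al: "\<psi>\<^sub>0 (z k) \<in> alive \<xi> t" if "k < n" for k using zk[OF that] by (simp add: cdom_def)
  have x': "continuous_on {0..t} \<xi>" using x by (rule continuous_on_subset) auto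
  have cc: "continuous_on {0..t} (cpath \<xi> k)" if "k < n" for k
    unfolding cpath_def
    by (intro cth_path_continuous x' strip_dstrip(1) alive_path(6)[OF x al[OF that]] continuous_on_vector_derivative[OF alive_path(5)[OF x al[OF that]]]) auto
  define J where "J = (\<lambda>j k. integral {0..t} (\<lambda>s. cpath \<xi> j s * cpath \<xi> k s - 1))"
  define J' where "J' = (\<lambda>j k. integral {0..t} (\<lambda>s. cpath \<xi> j s * cnj (cpath \<xi> k s) - 1))"
  have hJ: "((\<lambda>s. cpath \<xi> j s * cpath \<xi> k s - 1) has_integral J j k) {0..t}"
    and hJ': "((\<lambda>s. cpath \<xi> j s * cnj (cpath \<xi> k s) - 1) has_integral J' j k) {0..t}" if "j < n" "k < n" for j k
    unfolding J_def J'_def using that by (auto intro!: integrable_integral integrable_continuous_interval continuous_intros cc)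
  have "((\<lambda>s. - of_real \<mu> + ((\<Sum>k<n. of_real (dim_bulk b (\<sigma> k)) * (- 1 / 2 * (cpath \<xi> k s * cpath \<xi> k s - 1)) + of_real (dim_bulk b (\<sigma>s k)) * (- 1 / 2 * cnj (cpath \<xi> k s * cpath \<xi> k s - 1))
          + of_real (\<sigma> k * \<sigma>s k) * (- 1 / 2 * (cpath \<xi> k s * cnj (cpath \<xi> k s) - 1)))
       + (\<Sum>k<n. \<Sum>j<k. of_real (\<sigma> j * \<sigma> k) * (- 1 / 2 * (cpath \<xi> j s * cpath \<xi> k s - 1)) + of_real (\<sigma> j * \<sigma>s k) * (- 1 / 2 * (cpath \<xi> j s * cnj (cpath \<xi> k s) - 1))
          + of_real (\<sigma>s j * \<sigma> k) * (- 1 / 2 * cnj (cpath \<xi> j s * cnj (cpath \<xi> k s) - 1)) + of_real (\<sigma>s j * \<sigma>s k) * (- 1 / 2 * cnj (cpath \<xi> j s * cpath \<xi> k s - 1)))))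
     has_integral (t *\<^sub>R (- of_real \<mu>) + ((\<Sum>k<n. of_real (dim_bulk b (\<sigma> k)) * (- 1 / 2 * J k k) + of_real (dim_bulk b (\<sigma>s k)) * (- 1 / 2 * cnj (J k k))
          + of_real (\<sigma> k * \<sigma>s k) * (- 1 / 2 * J' k k))
       + (\<Sum>k<n. \<Sum>j<k. of_real (\<sigma> j * \<sigma> k) * (- 1 / 2 * J j k) + of_real (\<sigma> j * \<sigma>s k) * (- 1 / 2 * J' j k)
          + of_real (\<sigma>s j * \<sigma> k) * (- 1 / 2 * cnj (J' j k)) + of_real (\<sigma>s j * \<sigma>s k) * (- 1 / 2 * cnj (J j k)))))) {0..t}"
    using has_integral_const_real[of "- complex_of_real \<mu>" 0 t] t
    by (intro has_integral_add has_integral_sum has_integral_mult_right has_integral_cnj' hJ hJ') auto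
  then have I: "integral {0..t} (\<lambda>s. heat.al nodes q b \<mu> (g s)) = t *\<^sub>R (- of_real \<mu>) + ((\<Sum>k<n. of_real (dim_bulk b (\<sigma> k)) * (- 1 / 2 * J k k) + of_real (dim_bulk b (\<sigma>s k)) * (- 1 / 2 * cnj (J k k))
          + of_real (\<sigma> k * \<sigma>s k) * (- 1 / 2 * J' k k))
       + (\<Sum>k<n. \<Sum>j<k. of_real (\<sigma> j * \<sigma> k) * (- 1 / 2 * J j k) + of_real (\<sigma> j * \<sigma>s k) * (- 1 / 2 * J' j k)
          + of_real (\<sigma>s j * \<sigma> k) * (- 1 / 2 * cnj (J' j k)) + of_real (\<sigma>s j * \<sigma>s k) * (- 1 / 2 * cnj (J j k))))"
    unfolding q_def g_def drift_identity by (rule integral_unique)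
  interpret heat nodes q a b "\<sigma>m - \<sigma>p" 1 \<beta> \<mu> by unfold_locales (simp add: nodes_def)
  define Z where "Z = (\<lambda>k. cmap \<xi> t (z k))"
  have st: "Z k \<in> strip" if "k < n" for k
    unfolding Z_def using cmap_conformal[OF x t] zk[OF that] by (auto simp: conformal_onto_def bij_betw_def)
  \<comment> \<open>The principal logarithm commutes with conjugation off the nonpositive axis,
    which sinh(Z/2) avoids.\<close>
  have lc: "lns (cnj (Z k)) = cnj (lns (Z k))" if "k < n" for k
    using strip_dstrip[OF st[OF that]] sinh_half_nonpos[of "Z k"] sinh_cosh_cnj(1)[of "Z k / 2"] by (simp add: lns_def cnj_Ln)
  have ph: "(\<Sum>i\<in>nodes. of_real (q i) * phi (y i t - of_real (\<xi> t)))
     = (\<Sum>k<n. of_real ((\<sigma>m - a / 2 - (\<sigma>p - a / 2)) / 2) * (of_real (\<sigma> k) * Z k + of_real (\<sigma>s k) * cnj (Z k)) + of_real (a * \<sigma> k) * lns (Z k) + of_real (a * \<sigma>s k) * cnj (lns (Z k)))"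
    unfolding sum_nodes
  proof (rule sum.cong[OF refl])
    fix k assume "k \<in> {..<n}"
    then have l: "lns (cnj (Z k)) = cnj (lns (Z k))" using lc by simp
    have "y (k, False) t - of_real (\<xi> t) = Z k" "y (k, True) t - of_real (\<xi> t) = cnj (Z k)" by (simp_all add: y_def Z_def cmap_def)
    then show "of_real (q (k, False)) * phi (y (k, False) t - of_real (\<xi> t)) + of_real (q (k, True)) * phi (y (k, True) t - of_real (\<xi> t)) =
        of_real ((\<sigma>m - a / 2 - (\<sigma>p - a / 2)) / 2) * (of_real (\<sigma> k) * Z k + of_real (\<sigma>s k) * cnj (Z k)) + of_real (a * \<sigma> k) * lns (Z k) + of_real (a * \<sigma>s k) * cnj (lns (Z k))"
      by (simp add: q_def phi_def l algebra_simps)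
  qed
  have b1: "of_real (\<sigma>m * (\<sigma>m - a) / 2) * (Ln (2 * Km) + of_real (- t - \<xi> t)) + of_real (\<sigma>p * (\<sigma>p - a) / 2) * (Ln (- 2 * Kp) + of_real (- t + \<xi> t))
     = (of_real (\<sigma>m * (\<sigma>m - a) / 2) * Ln (2 * Km) + of_real (\<sigma>p * (\<sigma>p - a) / 2) * Ln (- 2 * Kp)) + t *\<^sub>R (- of_real \<mu>) + of_real \<beta> * of_real (\<xi> t)"
    unfolding \<mu>_def \<beta>_def scaleR_conv_of_real of_real_add of_real_diff of_real_minus by (simp add: algebra_simps del: of_real_mult of_real_divide of_real_add of_real_diff) (simp add: algebra_simps)?
  define lc0 where "lc0 = log_coeff a b n \<sigma> \<sigma>s (\<sigma>m - a / 2) (\<sigma>p - a / 2) (\<lambda>_. 0) (\<lambda>k. Ln (deriv \<psi>\<^sub>0 (z k))) (\<lambda>_. 0)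
        (\<lambda>j k. Ln (sinh ((\<psi>\<^sub>0 (z j) - \<psi>\<^sub>0 (z k)) / 2))) (\<lambda>j k. Ln (sinh ((\<psi>\<^sub>0 (z j) - cnj (\<psi>\<^sub>0 (z k))) / 2)))"
  define SA where "SA = (\<Sum>k<n. of_real (dim_bulk b (\<sigma> k)) * (- 1 / 2 * J k k) + of_real (dim_bulk b (\<sigma>s k)) * (- 1 / 2 * cnj (J k k))
          + of_real (\<sigma> k * \<sigma>s k) * (- 1 / 2 * J' k k))"
  define SB where "SB = (\<Sum>k<n. \<Sum>j<k. of_real (\<sigma> j * \<sigma> k) * (- 1 / 2 * J j k) + of_real (\<sigma> j * \<sigma>s k) * (- 1 / 2 * J' j k)
          + of_real (\<sigma>s j * \<sigma> k) * (- 1 / 2 * cnj (J' j k)) + of_real (\<sigma>s j * \<sigma>s k) * (- 1 / 2 * cnj (J j k)))"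
  define SC where "SC = (\<Sum>k<n. of_real ((\<sigma>m - a / 2 - (\<sigma>p - a / 2)) / 2) * (of_real (\<sigma> k) * Z k + of_real (\<sigma>s k) * cnj (Z k)) + of_real (a * \<sigma> k) * lns (Z k) + of_real (a * \<sigma>s k) * cnj (lns (Z k)))"
  have L: "log_coeff a b n \<sigma> \<sigma>s (\<sigma>m - a / 2) (\<sigma>p - a / 2) Z (lT \<xi> t) (\<lambda>k. lns (Z k)) (ldT \<xi> t) (leT \<xi> t) = lc0 + SA + SB + SC"
  proof -
    define u1 where "u1 = (\<lambda>k. of_real (dim_bulk b (\<sigma> k)) * (Ln (deriv \<psi>\<^sub>0 (z k)) - of_real (ln 2)) + of_real (dim_bulk b (\<sigma>s k)) * (cnj (Ln (deriv \<psi>\<^sub>0 (z k))) - of_real (ln 2))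
        + of_real ((\<sigma>m - a / 2 - (\<sigma>p - a / 2)) / 2) * (of_real (\<sigma> k) * 0 + of_real (\<sigma>s k) * cnj 0)
        + of_real (\<sigma> k * \<sigma>s k) * Ln (sinh ((\<psi>\<^sub>0 (z k) - cnj (\<psi>\<^sub>0 (z k))) / 2))
        + of_real (a * \<sigma> k) * (0 + of_real pi * \<i>) + of_real (a * \<sigma>s k) * (cnj 0 + of_real pi * \<i>))"
    define u2 where "u2 = (\<lambda>j k. of_real (\<sigma> j * \<sigma> k) * Ln (sinh ((\<psi>\<^sub>0 (z j) - \<psi>\<^sub>0 (z k)) / 2)) + of_real (\<sigma> j * \<sigma>s k) * Ln (sinh ((\<psi>\<^sub>0 (z j) - cnj (\<psi>\<^sub>0 (z k))) / 2))
        + of_real (\<sigma>s j * \<sigma> k) * cnj (Ln (sinh ((\<psi>\<^sub>0 (z j) - cnj (\<psi>\<^sub>0 (z k))) / 2))) + of_real (\<sigma>s j * \<sigma>s k) * cnj (Ln (sinh ((\<psi>\<^sub>0 (z j) - \<psi>\<^sub>0 (z k)) / 2))))"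
    have e0: "lc0 = (\<Sum>k<n. u1 k) + (\<Sum>k<n. \<Sum>j<k. u2 j k)" by (simp only: lc0_def log_coeff_def u1_def u2_def)
    have lx: "lT \<xi> t k = Ln (deriv \<psi>\<^sub>0 (z k)) - 1 / 2 * J k k" "ldT \<xi> t j k = Ln (sinh ((\<psi>\<^sub>0 (z j) - \<psi>\<^sub>0 (z k)) / 2)) - 1 / 2 * J j k"
      "leT \<xi> t j k = Ln (sinh ((\<psi>\<^sub>0 (z j) - cnj (\<psi>\<^sub>0 (z k))) / 2)) - 1 / 2 * J' j k" for j k
      by (simp_all only: lT_def ldT_def leT_def J_def J'_def)
    have e1: "lc0 + SA + SB + SC = (\<Sum>k<n. u1 k + (of_real (dim_bulk b (\<sigma> k)) * (- 1 / 2 * J k k) + of_real (dim_bulk b (\<sigma>s k)) * (- 1 / 2 * cnj (J k k))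
          + of_real (\<sigma> k * \<sigma>s k) * (- 1 / 2 * J' k k)) + (of_real ((\<sigma>m - a / 2 - (\<sigma>p - a / 2)) / 2) * (of_real (\<sigma> k) * Z k + of_real (\<sigma>s k) * cnj (Z k)) + of_real (a * \<sigma> k) * lns (Z k) + of_real (a * \<sigma>s k) * cnj (lns (Z k))))
       + (\<Sum>k<n. \<Sum>j<k. u2 j k + (of_real (\<sigma> j * \<sigma> k) * (- 1 / 2 * J j k) + of_real (\<sigma> j * \<sigma>s k) * (- 1 / 2 * J' j k)
          + of_real (\<sigma>s j * \<sigma> k) * (- 1 / 2 * cnj (J' j k)) + of_real (\<sigma>s j * \<sigma>s k) * (- 1 / 2 * cnj (J j k))))"
      unfolding e0 SA_def SB_def SC_def by (simp only: sum.distrib ac_simps)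
    show ?thesis unfolding e1 unfolding log_coeff_def lx
    proof (rule arg_cong2[where f = "(+)"], goal_cases)
      case 1
      show ?case by (rule sum.cong[OF refl]) (simp add: u1_def algebra_simps)
    next
      case 2
      show ?case by (rule sum.cong[OF refl], rule sum.cong[OF refl]) (simp add: u2_def algebra_simps)
    qed
  qed
  have L': "log_coeff a b n \<sigma> \<sigma>s (\<sigma>m - a / 2) (\<sigma>p - a / 2) (\<lambda>k. cmap \<xi> t (z k)) (lT \<xi> t) (\<lambda>k. lns (cmap \<xi> t (z k))) (ldT \<xi> t) (leT \<xi> t) = lc0 + SA + SB + SC"
    using L by (simp only: Z_def)
  show ?thesis
    unfolding LT_def C0_def I ph b1 L' lc0_def[symmetric] SA_def[symmetric] SB_def[symmetric] SC_def[symmetric]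
    by (simp only: ac_simps)
qed

end

section \<open>The branch of the observable and its cut-off form\<close>

lemma less_INF_finite:
  fixes f :: "nat \<Rightarrow> ereal"
  shows "\<forall>j<n. ereal a < f j \<Longrightarrow> ereal a < (INF j\<in>{..<n}. f j)"
proof (induction n)
  case 0
  then show ?case by (simp add: top_ereal_def)
next
  case (Suc n)
  then show ?case by (simp add: lessThan_Suc inf_min)
qed

text \<open>The image of the interval is connected, and a connected set with two points is
  uncountable.\<close>

lemma continuous_countable_constant:
  fixes f :: "real \<Rightarrow> complex"
  assumes "continuous_on {0..t} f" "countable U" "\<And>s. 0 \<le> s \<Longrightarrow> s \<le> t \<Longrightarrow> f s \<in> U" "0 \<le> t"
  shows "f t = f 0"
proof (rule ccontr)
  assume ne: "f t \<noteq> f 0"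
  have "connected (f ` {0..t})" by (rule connected_continuous_image[OF assms(1)]) simp
  moreover have "f t \<in> f ` {0..t}" "f 0 \<in> f ` {0..t}" using assms(4) by auto
  ultimately have "uncountable (f ` {0..t})" using ne connected_uncountable by blast
  moreover have "countable (f ` {0..t})" by (rule countable_subset[OF _ assms(2)]) (use assms(3) in auto)
  ultimately show False by simp
qed

context dipolar_setting begin

text \<open>\<open>LT\<close> without its constant, in the form whose exponential becomes an
  instance of \<open>H0\<close>.\<close>

definition log_obs :: "real \<Rightarrow> real \<Rightarrow> (nat \<Rightarrow> real) \<Rightarrow> (nat \<Rightarrow> real) \<Rightarrow> real \<Rightarrow> real \<Rightarrow> (real \<Rightarrow> real) \<Rightarrow> real \<Rightarrow> complex" where
  "log_obs a b \<sigma> \<sigma>s \<sigma>m \<sigma>p \<xi> t = integral {0..t} (\<lambda>s. heat.al nodes (nq \<sigma> \<sigma>s) b (\<sigma>m * (\<sigma>m - a) / 2 + \<sigma>p * (\<sigma>p - a) / 2) (\<lambda>(k, B). nconj B (cpath \<xi> k s)))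
      + of_real (\<sigma>p * (\<sigma>p - a) / 2 - \<sigma>m * (\<sigma>m - a) / 2) * of_real (\<xi> t)
      + (\<Sum>i\<in>nodes. of_real (nq \<sigma> \<sigma>s i) * heat.phi a (\<sigma>m - \<sigma>p) (nconj (snd i) (fl \<xi> t (\<psi>\<^sub>0 (z (fst i)))) - of_real (\<xi> t)))"

lemma LT_log_obs:
  assumes x: "continuous_on {0..} \<xi>" and t: "0 \<le> t" and zk: "\<And>k. k < n \<Longrightarrow> z k \<in> cdom \<xi> t"
  shows "LT a b \<sigma> \<sigma>s \<sigma>m \<sigma>p \<xi> t = C0 a b \<sigma> \<sigma>s \<sigma>m \<sigma>p + log_obs a b \<sigma> \<sigma>s \<sigma>m \<sigma>p \<xi> t"
  using LT_heat_form[OF x t zk] by (simp add: log_obs_def case_prod_beta')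

lemma cdom_mono:
  assumes "continuous_on {0..} \<xi>" "0 \<le> s" "s \<le> t" "z' \<in> cdom \<xi> t"
  shows "z' \<in> cdom \<xi> s"
  using assms alive_path(1)[of \<xi> "\<psi>\<^sub>0 z'" t s] by (auto simp: cdom_def)

lemma log_obs_continuous:
  assumes x: "continuous_on {0..} \<xi>" and t: "0 \<le> t" and zk: "\<And>k. k < n \<Longrightarrow> z k \<in> cdom \<xi> t"
  shows "continuous_on {0..t} (log_obs a b \<sigma> \<sigma>s \<sigma>m \<sigma>p \<xi>)"
proof -
  interpret heat nodes "nq \<sigma> \<sigma>s" a b "\<sigma>m - \<sigma>p" 1 "\<sigma>p * (\<sigma>p - a) / 2 - \<sigma>m * (\<sigma>m - a) / 2" "\<sigma>m * (\<sigma>m - a) / 2 + \<sigma>p * (\<sigma>p - a) / 2"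
    by unfold_locales (simp add: nodes_def)
  have al: "\<psi>\<^sub>0 (z k) \<in> alive \<xi> t" if "k < n" for k using zk[OF that] by (simp add: cdom_def)
  have x': "continuous_on {0..t} \<xi>" using x by (rule continuous_on_subset) auto
  have fc: "continuous_on {0..t} (\<lambda>s. fl \<xi> s (\<psi>\<^sub>0 (z k)))" if "k < n" for k
    by (rule continuous_on_vector_derivative[OF alive_path(5)[OF x al[OF that]]]) auto
  have cc: "continuous_on {0..t} (cpath \<xi> k)" if "k < n" for k
    unfolding cpath_def by (intro cth_path_continuous x' strip_dstrip(1) alive_path(6)[OF x al[OF that]] fc that) auto
  have nc: "continuous_on {0..t} (\<lambda>s. nconj B (f s))" if "continuous_on {0..t} f" for B and f :: "real \<Rightarrow> complex"
    using that by (cases B) (auto intro!: continuous_intros)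
  have ac: "continuous_on {0..t} (\<lambda>s. al (\<lambda>(k, B). nconj B (cpath \<xi> k s)))"
    unfolding al_def by (intro continuous_intros) (auto simp: nodes_def simp del: nconj.simps intro!: nc cc)
  have "continuous_on {0..t} (\<lambda>s. integral {0..s} (\<lambda>s. al (\<lambda>(k, B). nconj B (cpath \<xi> k s))))"
    by (intro indefinite_integral_continuous_1 integrable_continuous_interval ac)
  moreover have "continuous_on {0..t} (\<lambda>s. phi (nconj B (fl \<xi> s (\<psi>\<^sub>0 (z k))) - of_real (\<xi> s)))" if k: "k < n" for k B
  proof (rule continuous_on_compose2[OF continuous_phis(1)])
    show "continuous_on {0..t} (\<lambda>s. nconj B (fl \<xi> s (\<psi>\<^sub>0 (z k))) - of_real (\<xi> s))" by (intro continuous_intros nc fc k x')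
    have "nconj B (fl \<xi> s (\<psi>\<^sub>0 (z k))) - of_real (\<xi> s) \<in> dstrip" if "0 \<le> s" "s \<le> t" for s
      using strip_dstrip[OF alive_path(6)[OF x al[OF k] that]] by (cases B) auto
    then show "(\<lambda>s. nconj B (fl \<xi> s (\<psi>\<^sub>0 (z k))) - of_real (\<xi> s)) ` {0..t} \<subseteq> dstrip" by auto
  qed
  ultimately show ?thesis unfolding log_obs_def
    by (intro continuous_intros x') (auto simp: nodes_def)
qed

lemma process_formula:
  assumes x: "continuous_on {0..} \<xi>" and fw: "dipolar_flow \<xi> D \<psi>\<^sub>0 \<psi> \<tau>"
    and neut: "\<sigma>m + \<sigma>p + (\<Sum>k<n. \<sigma> k + \<sigma>s k) = 0"
    and X: "\<And>t. 0 \<le> t \<Longrightarrow> ereal t < (INF j\<in>{..<n}. \<tau> (z j)) \<Longrightarrow>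
        X t \<in> vertex_observable a b n \<sigma> \<sigma>s \<sigma>m \<sigma>p (flow_domain D \<tau> t) (flow_tip \<xi> D \<psi> \<tau> t) qm qp \<phi>m \<phi>p z"
    and Xc: "continuous_on {t. 0 \<le> t \<and> ereal t < (INF j\<in>{..<n}. \<tau> (z j))} X"
    and t: "0 \<le> t" "ereal t < (INF j\<in>{..<n}. \<tau> (z j))"
  shows "X t = X 0 * exp (log_obs a b \<sigma> \<sigma>s \<sigma>m \<sigma>p \<xi> t - log_obs a b \<sigma> \<sigma>s \<sigma>m \<sigma>p \<xi> 0)"
proof -
  have tj: "ereal t < \<tau> (z j)" if "j < n" for j using less_INF_D[OF t(2)] that by auto
  have zt: "z j \<in> cdom \<xi> t" if "j < n" for j
    using dipolar_flow_alive(1)[OF x fw zD[OF that] psi0(2)[OF zD[OF that]] t(1)] tj[OF that] zD[OF that] by (simp add: cdom_def)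
  have sT: "ereal s < (INF j\<in>{..<n}. \<tau> (z j))" if "s \<le> t" for s using t(2) that by (metis ereal_less_eq(3) le_less_trans)
  define L where "L = (\<lambda>s. C0 a b \<sigma> \<sigma>s \<sigma>m \<sigma>p + log_obs a b \<sigma> \<sigma>s \<sigma>m \<sigma>p \<xi> s)"
  define f where "f = (\<lambda>s. X s / exp (L s))"
  have "f t = f 0"
  proof (rule continuous_countable_constant[OF _ countable_U_obs _ t(1)])
    show "continuous_on {0..t} f" unfolding f_def L_def
      by (intro continuous_intros log_obs_continuous[OF x t(1) zt] continuous_on_subset[OF Xc]) (use sT in auto)
    show "f s \<in> U_obs a b n \<sigma> \<sigma>s \<sigma>m \<sigma>p" if s: "0 \<le> s" "s \<le> t" for s
    proof -
      have zs: "z k \<in> cdom \<xi> s" if "k < n" for k using cdom_mono[OF x s zt[OF that]] .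
      obtain g where "g \<in> U_obs a b n \<sigma> \<sigma>s \<sigma>m \<sigma>p" "X s = g * exp (LT a b \<sigma> \<sigma>s \<sigma>m \<sigma>p \<xi> s)"
        using observable_at_time[OF x s(1) fw zs neut X[OF s(1) sT[OF s(2)]]] by blast
      then show ?thesis by (simp add: f_def L_def LT_log_obs[OF x s(1) zs])
    qed
  qed
  then have "X t = X 0 * (exp (L t) / exp (L 0))" by (simp add: f_def field_simps)
  also have "exp (L t) / exp (L 0) = exp (log_obs a b \<sigma> \<sigma>s \<sigma>m \<sigma>p \<xi> t - log_obs a b \<sigma> \<sigma>s \<sigma>m \<sigma>p \<xi> 0)"
    by (simp add: L_def exp_diff[symmetric])
  finally show ?thesis .
qed

text \<open>Unlike the flow itself, the cut-off flow is defined for all times, so that these processes are adapted.\<close>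

definition ye :: "(real \<Rightarrow> real) \<Rightarrow> real \<Rightarrow> nat \<times> bool \<Rightarrow> real \<Rightarrow> complex" where
  "ye \<xi> e i s = nconj (snd i) (tf \<xi> e (\<psi>\<^sub>0 (z (fst i))) s)"

definition ce :: "(real \<Rightarrow> real) \<Rightarrow> real \<Rightarrow> nat \<times> bool \<Rightarrow> real \<Rightarrow> complex" where
  "ce \<xi> e i s = nconj (snd i) (cthe e (tf \<xi> e (\<psi>\<^sub>0 (z (fst i))) s - of_real (\<xi> s)))"

definition Ae :: "real \<Rightarrow> (nat \<Rightarrow> real) \<Rightarrow> (nat \<Rightarrow> real) \<Rightarrow> real \<Rightarrow> (real \<Rightarrow> real) \<Rightarrow> real \<Rightarrow> real \<Rightarrow> complex" where
  "Ae b \<sigma> \<sigma>s \<mu> \<xi> e t = integral {0..t} (\<lambda>s. heat.al nodes (nq \<sigma> \<sigma>s) b \<mu> (\<lambda>i. ce \<xi> e i s))"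

lemma nconj_facts: "norm (nconj B u) = norm u" "\<bar>Im (nconj B u)\<bar> = \<bar>Im u\<bar>" "Re (nconj B u) = Re u"
  "cth (nconj B u) = nconj B (cth u)" "nconj B u - of_real r = nconj B (u - of_real r)"
  using cth_cnj by (cases B; simp)+

lemma nconj_continuous: "continuous_on S f \<Longrightarrow> continuous_on S (\<lambda>s. nconj B (f s))"
  by (cases B) (auto intro!: continuous_intros)

lemma ce_continuous:
  assumes x: "continuous_on {0..} \<xi>" and e: "0 < e" "e \<le> pi"
  shows "continuous_on {0..} (ce \<xi> e i)"
  unfolding ce_def
  by (intro nconj_continuous continuous_on_compose2[OF continuous_cthe[OF e, of UNIV]] continuous_intros tf_cont[OF x e] x) auto

lemma ye_deriv:
  assumes x: "continuous_on {0..} \<xi>" and e: "0 < e" "e \<le> pi" and s: "0 \<le> s"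
  shows "(ye \<xi> e i has_vector_derivative ce \<xi> e i s) (at s within {0..})"
  using tf_deriv[OF x e s] has_vector_derivative_cnj[OF tf_deriv[OF x e s]] by (cases "snd i") (simp_all add: ye_def[abs_def] ce_def)

lemma ye_continuous:
  assumes x: "continuous_on {0..} \<xi>" and e: "0 < e" "e \<le> pi"
  shows "continuous_on {0..} (ye \<xi> e i)"
  unfolding ye_def by (intro nconj_continuous tf_cont[OF x e])

lemma al_continuous:
  assumes "\<And>i. continuous_on S (c i)"
  shows "continuous_on S (\<lambda>s. heat.al nodes (nq \<sigma> \<sigma>s) b \<mu> (\<lambda>i. c i s))"
proof -
  interpret heat nodes "nq \<sigma> \<sigma>s" 0 b 0 0 0 \<mu> by unfold_locales (simp add: nodes_def)
  show ?thesis unfolding al_def by (intro continuous_intros assms) simp_all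
qed

lemma Ae_deriv:
  assumes x: "continuous_on {0..} \<xi>" and e: "0 < e" "e \<le> pi" and s: "0 \<le> s"
  shows "(Ae b \<sigma> \<sigma>s \<mu> \<xi> e has_vector_derivative heat.al nodes (nq \<sigma> \<sigma>s) b \<mu> (\<lambda>i. ce \<xi> e i s)) (at s within {0..})"
proof -
  have c: "continuous_on {0..s+1} (\<lambda>s. heat.al nodes (nq \<sigma> \<sigma>s) b \<mu> (\<lambda>i. ce \<xi> e i s))"
    by (intro al_continuous continuous_on_subset[OF ce_continuous[OF x e]]) auto
  have "(Ae b \<sigma> \<sigma>s \<mu> \<xi> e has_vector_derivative heat.al nodes (nq \<sigma> \<sigma>s) b \<mu> (\<lambda>i. ce \<xi> e i s)) (at s within {0..s+1})"
    unfolding Ae_def[abs_def] using integral_has_vector_derivative[OF c, of s] s by simp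
  moreover have "at s within {0..s+1} = at s within {0..}" by (rule at_within_nhd[of s "{s-1<..<s+1}"]) auto
  ultimately show ?thesis by simp
qed

lemma Ae_continuous:
  assumes x: "continuous_on {0..} \<xi>" and e: "0 < e" "e \<le> pi"
  shows "continuous_on {0..} (Ae b \<sigma> \<sigma>s \<mu> \<xi> e)"
  by (rule continuous_on_vector_derivative) (use Ae_deriv[OF x e] in auto)

text \<open>All nodes have stayed above \<open>e\<close> up to time \<open>s\<close>, so flow and
  cut-off flow agree on [0, s], also under the integral.\<close>

lemma log_obs_truncated:
  assumes x: "continuous_on {0..} \<xi>" and e: "0 < e" "e \<le> pi" and s: "0 \<le> s"
    and I: "\<And>k. k < n \<Longrightarrow> e < Im (tf \<xi> e (\<psi>\<^sub>0 (z k)) s)"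
  shows "exp (log_obs a b \<sigma> \<sigma>s \<sigma>m \<sigma>p \<xi> s) = heat.H0 nodes (nq \<sigma> \<sigma>s) a (\<sigma>m - \<sigma>p) (\<sigma>p * (\<sigma>p - a) / 2 - \<sigma>m * (\<sigma>m - a) / 2)
     (Ae b \<sigma> \<sigma>s (\<sigma>m * (\<sigma>m - a) / 2 + \<sigma>p * (\<sigma>p - a) / 2) \<xi> e s) (\<lambda>i. ye \<xi> e i s) (of_real (\<xi> s))"
proof -
  interpret heat nodes "nq \<sigma> \<sigma>s" a b "\<sigma>m - \<sigma>p" 1 "\<sigma>p * (\<sigma>p - a) / 2 - \<sigma>m * (\<sigma>m - a) / 2" "\<sigma>m * (\<sigma>m - a) / 2 + \<sigma>p * (\<sigma>p - a) / 2"
    by unfold_locales (simp add: nodes_def)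
  have fe: "fl \<xi> r (\<psi>\<^sub>0 (z k)) = tf \<xi> e (\<psi>\<^sub>0 (z k)) r" "e < Im (tf \<xi> e (\<psi>\<^sub>0 (z k)) r)" "Im (tf \<xi> e (\<psi>\<^sub>0 (z k)) r) < pi"
    if "k < n" "0 \<le> r" "r \<le> s" for k r
  proof -
    note st = psi0(2)[OF zD[OF that(1)]]
    show 1: "e < Im (tf \<xi> e (\<psi>\<^sub>0 (z k)) r)" using I[OF that(1)] tf_Im_antimono[OF x e that(2,3), of "\<psi>\<^sub>0 (z k)"] by simp
    show "fl \<xi> r (\<psi>\<^sub>0 (z k)) = tf \<xi> e (\<psi>\<^sub>0 (z k)) r" by (rule fl_eq[OF x e st that(2) 1])
    show "Im (tf \<xi> e (\<psi>\<^sub>0 (z k)) r) < pi" using tf_Im_antimono[OF x e order_refl that(2), of "\<psi>\<^sub>0 (z k)"] tf_0[OF x e, of "\<psi>\<^sub>0 (z k)"] st by (simp add: strip_def)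
  qed
  have ceq: "cpath \<xi> k r = cthe e (tf \<xi> e (\<psi>\<^sub>0 (z k)) r - of_real (\<xi> r))" if "k < n" "0 \<le> r" "r \<le> s" for k r
    unfolding cpath_def fe(1)[OF that] using fe(2,3)[OF that] by (intro cthe_eq[symmetric]) auto
  have "al (\<lambda>(k, B). nconj B (cpath \<xi> k r)) = al (\<lambda>i. ce \<xi> e i r)" if r: "0 \<le> r" "r \<le> s" for r
    unfolding al_def by (intro arg_cong2[where f = "(+)"] arg_cong2[where f = "(-)"] arg_cong2[where f = "(*)"] arg_cong2[where f = "(/)"] arg_cong[where f = "\<lambda>x. x\<^sup>2"] sum.cong refl)
      (auto simp: nodes_def ce_def ceq r)
  then have A: "integral {0..s} (\<lambda>r. al (\<lambda>(k, B). nconj B (cpath \<xi> k r))) = Ae b \<sigma> \<sigma>s (\<sigma>m * (\<sigma>m - a) / 2 + \<sigma>p * (\<sigma>p - a) / 2) \<xi> e s"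
    unfolding Ae_def by (intro Henstock_Kurzweil_Integration.integral_cong) auto
  have S: "(\<Sum>i\<in>nodes. of_real (nq \<sigma> \<sigma>s i) * phi (nconj (snd i) (fl \<xi> s (\<psi>\<^sub>0 (z (fst i)))) - of_real (\<xi> s)))
     = (\<Sum>i\<in>nodes. of_real (nq \<sigma> \<sigma>s i) * phi (ye \<xi> e i s - of_real (\<xi> s)))"
    by (intro sum.cong refl) (use fe(1)[OF _ s order_refl] in \<open>auto simp: nodes_def ye_def\<close>)
  show ?thesis unfolding log_obs_def A S H0_def ..
qed

end

section \<open>The stopped process\<close>

text \<open>Boundedness gives integrability. Conditional expectations are characterized by their
  integrals over the events of \<open>F s\<close>, separately for real and imaginary parts.\<close>

lemma complex_martingaleI:
  assumes bm: "brownian_motion P F B"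
    and meas: "\<And>t. 0 \<le> t \<Longrightarrow> M t \<in> borel_measurable (F t)"
    and bd: "\<And>t \<omega>. 0 \<le> t \<Longrightarrow> \<omega> \<in> space P \<Longrightarrow> norm (M t \<omega>) \<le> C"
    and eq: "\<And>s t A. 0 \<le> s \<Longrightarrow> s \<le> t \<Longrightarrow> A \<in> sets (F s) \<Longrightarrow> (\<integral>\<omega>. indicator A \<omega> *\<^sub>R M t \<omega> \<partial>P) = (\<integral>\<omega>. indicator A \<omega> *\<^sub>R M s \<omega> \<partial>P)"
  shows "complex_martingale P F M"
proof -
  interpret prob_space P using brownian_motionD(1)[OF bm] .
  note sub = brownian_motionD(3)[OF bm]
  have i: "integrable P (M t)" if "0 \<le> t" for t
    by (rule integrable_const_bound[of _ C]) (use bd that measurable_from_subalg[OF sub meas[OF that]] in auto)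
  have c: "(AE \<omega> in P. real_cond_exp P (F s) (\<lambda>\<omega>. Re (M t \<omega>)) \<omega> = Re (M s \<omega>)) \<and>
        (AE \<omega> in P. real_cond_exp P (F s) (\<lambda>\<omega>. Im (M t \<omega>)) \<omega> = Im (M s \<omega>))" if st: "0 \<le> s" "s \<le> t" for s t
  proof -
    interpret S: finite_measure_subalgebra P "F s" by unfold_locales (rule sub)
    have t: "0 \<le> t" using st by simp
    have iA: "integrable P (\<lambda>\<omega>. indicator A \<omega> *\<^sub>R M u \<omega>)" if "A \<in> sets (F s)" "0 \<le> u" for A u
      using sub[of s] that by (intro integrable_mult_indicator i) (auto simp: subalgebra_def)
    have R: "set_lebesgue_integral P A (\<lambda>\<omega>. Re (M t \<omega>)) = set_lebesgue_integral P A (\<lambda>\<omega>. Re (M s \<omega>))"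
      and I: "set_lebesgue_integral P A (\<lambda>\<omega>. Im (M t \<omega>)) = set_lebesgue_integral P A (\<lambda>\<omega>. Im (M s \<omega>))" if A: "A \<in> sets (F s)" for A
    proof -
      have "(\<integral>\<omega>. Re (indicator A \<omega> *\<^sub>R M t \<omega>) \<partial>P) = (\<integral>\<omega>. Re (indicator A \<omega> *\<^sub>R M s \<omega>) \<partial>P)"
        using eq[OF st A] iA[OF A t] iA[OF A st(1)] by (simp only: integral_Re)
      then show "set_lebesgue_integral P A (\<lambda>\<omega>. Re (M t \<omega>)) = set_lebesgue_integral P A (\<lambda>\<omega>. Re (M s \<omega>))"
        by (simp add: set_lebesgue_integral_def)
      have "(\<integral>\<omega>. Im (indicator A \<omega> *\<^sub>R M t \<omega>) \<partial>P) = (\<integral>\<omega>. Im (indicator A \<omega> *\<^sub>R M s \<omega>) \<partial>P)"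
        using eq[OF st A] iA[OF A t] iA[OF A st(1)] by (simp only: integral_Im)
      then show "set_lebesgue_integral P A (\<lambda>\<omega>. Im (M t \<omega>)) = set_lebesgue_integral P A (\<lambda>\<omega>. Im (M s \<omega>))"
        by (simp add: set_lebesgue_integral_def)
    qed
    have mR: "(\<lambda>\<omega>. Re (M s \<omega>)) \<in> borel_measurable (F s)" "(\<lambda>\<omega>. Im (M s \<omega>)) \<in> borel_measurable (F s)"
      using meas[OF st(1)] by measurable
    show ?thesis
      using S.real_cond_exp_charact[OF R integrable_Re[OF i[OF t]] integrable_Re[OF i[OF st(1)]] mR(1)]
        S.real_cond_exp_charact[OF I integrable_Im[OF i[OF t]] integrable_Im[OF i[OF st(1)]] mR(2)] by blast
  qed
  show ?thesis unfolding complex_martingale_def using meas i c by blast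
qed

lemma speed_bound:
  fixes f :: "real \<Rightarrow> complex"
  assumes d: "\<And>s. 0 \<le> s \<Longrightarrow> (f has_vector_derivative f' s) (at s within {0..})"
    and b: "\<And>s. 0 \<le> s \<Longrightarrow> norm (f' s) \<le> M" and r: "0 \<le> r" "r \<le> s"
  shows "norm (f s - f r) \<le> M * (s - r)"
proof -
  have "(f' has_integral (f s - f r)) {r..s}"
    by (rule fundamental_theorem_of_calculus[OF r(2)]) (use r in \<open>auto intro: has_vector_derivative_within_subset[OF d]\<close>)
  then have "norm (f s - f r) \<le> M * measure lborel {r..s}"
    by (rule has_integral_bound_real[where S = "{}", rotated 2]) (use b r order_trans[OF norm_ge_zero b[of 0]] in auto)
  then show ?thesis using r by simp
qed

text \<open>Bounds known before a hitting time extend to the hitting time itself by continuity; the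
  bound at 0 covers \<open>T = 0\<close>.\<close>

lemma left_limit_le:
  fixes g :: "real \<Rightarrow> real"
  assumes c: "continuous_on {0..} g" and T: "0 \<le> T" and l: "\<And>s. 0 \<le> s \<Longrightarrow> s < T \<Longrightarrow> g s \<le> c" and 0: "g 0 \<le> c"
  shows "g T \<le> c"
proof (rule ccontr)
  assume n: "\<not> g T \<le> c"
  then have T: "0 < T" using T 0 by (cases "T = 0") auto
  obtain \<delta> where "\<delta> > 0" "\<And>s. 0 \<le> s \<Longrightarrow> dist s T < \<delta> \<Longrightarrow> dist (g s) (g T) < g T - c"
    using c n T unfolding continuous_on_iff by (metis atLeast_iff diff_gt_0_iff_gt less_imp_le not_less)
  moreover define s where "s = max 0 (T - \<delta> / 2)"
  ultimately have "0 \<le> s" "s < T" "dist (g s) (g T) < g T - c" using T by (auto simp: dist_real_def)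
  then show False using l[of s] by (simp add: dist_real_def)
qed

lemma lns_borel: "lns \<in> borel_measurable borel"
proof -
  have "dstrip \<in> sets borel"
  proof -
    have "dstrip = {Z. \<bar>Im Z\<bar> \<le> pi} - {Z. Im Z = 0}" by (auto simp: dstrip_def)
    moreover have "closed {Z. \<bar>Im Z\<bar> \<le> pi}" "closed {Z. Im Z = 0}" by (intro closed_Collect_le closed_Collect_eq continuous_intros)+
    ultimately show ?thesis by (metis borel_closed sets.Diff)
  qed
  then have "(\<lambda>Z. indicator dstrip Z *\<^sub>R lns Z) \<in> borel_measurable borel"
    by (rule borel_measurable_continuous_on_indicator) (rule continuous_lns)
  moreover have "(\<lambda>Z. indicator dstrip Z *\<^sub>R lns Z) = lns" by (auto simp: lns_def indicator_def)
  ultimately show ?thesis by simp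
qed

lemma cth_borel: "cth \<in> borel_measurable borel"
proof -
  have "(\<lambda>Z. cosh (Z / 2)) \<in> borel_measurable (borel :: complex measure)" "(\<lambda>Z. sinh (Z / 2)) \<in> borel_measurable (borel :: complex measure)"
    by (auto intro!: borel_measurable_continuous_onI continuous_intros)
  then show ?thesis unfolding cth_def[abs_def] by measurable
qed

lemma (in heat) al_measurable:
  assumes "\<And>i. c i \<in> borel_measurable G"
  shows "(\<lambda>\<omega>. al (\<lambda>i. c i \<omega>)) \<in> borel_measurable G"
  unfolding al_def using assms by measurable

lemma (in heat) H_measurable:
  fixes A x :: "'b \<Rightarrow> complex"
  assumes A[measurable]: "A \<in> borel_measurable G" and y[measurable]: "\<And>i. y i \<in> borel_measurable G" and x[measurable]: "x \<in> borel_measurable G"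
  shows "(\<lambda>\<omega>. H0 (A \<omega>) (\<lambda>i. y i \<omega>) (x \<omega>)) \<in> borel_measurable G"
    "(\<lambda>\<omega>. H1 (A \<omega>) (\<lambda>i. y i \<omega>) (x \<omega>)) \<in> borel_measurable G"
    "(\<lambda>\<omega>. H2 (A \<omega>) (\<lambda>i. y i \<omega>) (x \<omega>)) \<in> borel_measurable G"
proof -
  note [measurable] = lns_borel cth_borel
  have [measurable]: "phi \<in> borel_measurable borel" "phi1 \<in> borel_measurable borel" "phi2 \<in> borel_measurable borel"
    unfolding phi_def[abs_def] phi1_def[abs_def] phi2_def[abs_def] by measurable
  show "(\<lambda>\<omega>. H0 (A \<omega>) (\<lambda>i. y i \<omega>) (x \<omega>)) \<in> borel_measurable G" unfolding H0_def by measurable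
  then show "(\<lambda>\<omega>. H1 (A \<omega>) (\<lambda>i. y i \<omega>) (x \<omega>)) \<in> borel_measurable G" "(\<lambda>\<omega>. H2 (A \<omega>) (\<lambda>i. y i \<omega>) (x \<omega>)) \<in> borel_measurable G"
    unfolding H1_def H2_def L1_def L2_def by measurable
qed

section \<open>Adaptedness of the cut-off processes\<close>

locale driven_setting = dipolar_setting D p Q qm qp \<phi>m \<phi>p \<psi>\<^sub>0 n z
  for D p Q qm qp \<phi>m \<phi>p \<psi>\<^sub>0 and n :: nat and z :: "nat \<Rightarrow> complex" +
  fixes P :: "'w measure" and F :: "real \<Rightarrow> 'w measure" and B :: "real \<Rightarrow> 'w \<Rightarrow> real" and \<kappa> :: real
  assumes kap: "0 < \<kappa>" and bm: "brownian_motion P F B"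
begin

definition xi :: "'w \<Rightarrow> real \<Rightarrow> real" where "xi \<omega> t = sqrt \<kappa> * B t \<omega>"

lemma xi_cont: "\<omega> \<in> space P \<Longrightarrow> continuous_on {0..} (xi \<omega>)"
  unfolding xi_def by (intro continuous_intros brownian_motionD(7)[OF bm])

lemma xi_0: "\<omega> \<in> space P \<Longrightarrow> xi \<omega> 0 = 0"
  using brownian_motionD(6)[OF bm] by (simp add: xi_def)

lemma F_mono: "s \<le> t \<Longrightarrow> subalgebra (F t) (F s)"
  using filtration.sets_F_mono[OF brownian_motionD(2)[OF bm]] brownian_motionD(10)[OF bm] by (auto simp: subalgebra_def)

lemma xi_meas: "0 \<le> s \<Longrightarrow> s \<le> t \<Longrightarrow> (\<lambda>\<omega>. xi \<omega> s) \<in> borel_measurable (F t)"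
  using measurable_from_subalg[OF F_mono brownian_motionD(4)[OF bm]] by (simp add: xi_def)

lemma space_F: "space (F t) = space P" using brownian_motionD(10)[OF bm] .

lemma tf_adapted:
  assumes e: "0 < e" "e \<le> pi" and t: "0 \<le> s" "s \<le> t"
  shows "(\<lambda>\<omega>. tf (xi \<omega>) e u s) \<in> borel_measurable (F t)"
proof (rule measurable_from_subalg[OF F_mono[OF t(2)]])
  show "(\<lambda>\<omega>. tf (xi \<omega>) e u s) \<in> borel_measurable (F s)"
  proof (rule adapted_solution[where b = "\<lambda>\<omega> s u. cthe e (u - of_real (xi \<omega> s))" and L = "Lc e", OF t(1) Lc_nonneg])
    show "tf (xi \<omega>) e u 0 = u" if "\<omega> \<in> space (F s)" for \<omega>
      using tf_0[OF xi_cont e] that by (simp add: space_F)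
    show "((\<lambda>s. tf (xi \<omega>) e u s) has_vector_derivative cthe e (tf (xi \<omega>) e u r - of_real (xi \<omega> r))) (at r within {0..s})"
      if "\<omega> \<in> space (F s)" "0 \<le> r" "r \<le> s" for r \<omega>
      using tf_deriv'[OF xi_cont e that(2,3)] that by (simp add: space_F)
    show "continuous_on {0..s} (\<lambda>s. cthe e (tf (xi \<omega>) e u s - of_real (xi \<omega> s)))" if "\<omega> \<in> space (F s)" for \<omega>
    proof -
      have w: "\<omega> \<in> space P" using that by (simp add: space_F)
      show ?thesis
        by (intro continuous_on_compose2[OF continuous_cthe[OF e, of UNIV]] continuous_intros continuous_on_subset[OF tf_cont[OF xi_cont[OF w] e]] continuous_on_subset[OF xi_cont[OF w]]) auto
    qed
    show "norm (cthe e (u - of_real (xi \<omega> r)) - cthe e (v - of_real (xi \<omega> r))) \<le> Lc e * norm (u - v)" for \<omega> r u v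
      using cthe_lipschitz[OF e, of "u - of_real (xi \<omega> r)" "v - of_real (xi \<omega> r)"] by (simp add: Lc_def)
    show "(\<lambda>\<omega>. cthe e (U \<omega> - of_real (xi \<omega> r))) \<in> borel_measurable (F s)" if "0 \<le> r" "r \<le> s" "U \<in> borel_measurable (F s)" for r U
      by (rule measurable_compose[OF _ cthe_borel[OF e]]) (use xi_meas[OF that(1,2)] that(3) in measurable)
  qed
qed

lemma nconj_measurable: "f \<in> borel_measurable G \<Longrightarrow> (\<lambda>\<omega>. nconj B' (f \<omega>)) \<in> borel_measurable G"
proof (cases B')
  case True
  assume f: "f \<in> borel_measurable G"
  have "cnj \<in> borel_measurable borel" by (intro borel_measurable_continuous_onI continuous_intros)
  then show ?thesis using True measurable_compose[OF f] by simp
qed simp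

lemma ye_adapted:
  assumes e: "0 < e" "e \<le> pi" and t: "0 \<le> s" "s \<le> t"
  shows "(\<lambda>\<omega>. ye (xi \<omega>) e i s) \<in> borel_measurable (F t)"
  unfolding ye_def by (intro nconj_measurable tf_adapted assms)

lemma ce_adapted:
  assumes e: "0 < e" "e \<le> pi" and t: "0 \<le> s" "s \<le> t"
  shows "(\<lambda>\<omega>. ce (xi \<omega>) e i s) \<in> borel_measurable (F t)"
proof -
  have "(\<lambda>\<omega>. complex_of_real (xi \<omega> s)) \<in> borel_measurable (F t)" using xi_meas[OF t] by measurable
  then show ?thesis unfolding ce_def
    by (intro nconj_measurable measurable_compose[OF _ cthe_borel[OF e]] borel_measurable_diff tf_adapted assms)
qed

text \<open>An integral solves an equation whose right-hand side ignores the state, so the Euler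
  argument applies with Lipschitz constant 0.\<close>

lemma Ae_adapted:
  assumes e: "0 < e" "e \<le> pi" and t: "0 \<le> t"
  shows "(\<lambda>\<omega>. Ae b \<sigma> \<sigma>s \<mu> (xi \<omega>) e t) \<in> borel_measurable (F t)"
proof -
  interpret heat nodes "nq \<sigma> \<sigma>s" 0 b 0 0 0 \<mu> by unfold_locales (simp add: nodes_def)
  show ?thesis
  proof (rule adapted_solution[where b = "\<lambda>\<omega> s u. al (\<lambda>i. ce (xi \<omega>) e i s)" and L = 0 and ?z0.0 = 0, OF t order_refl])
    show "Ae b \<sigma> \<sigma>s \<mu> (xi \<omega>) e 0 = 0" for \<omega> by (simp add: Ae_def)
    show "((\<lambda>t. Ae b \<sigma> \<sigma>s \<mu> (xi \<omega>) e t) has_vector_derivative al (\<lambda>i. ce (xi \<omega>) e i s)) (at s within {0..t})"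
      if "\<omega> \<in> space (F t)" "0 \<le> s" "s \<le> t" for s \<omega>
    proof -
      have w: "\<omega> \<in> space P" using that by (simp add: space_F)
      show ?thesis by (rule has_vector_derivative_within_subset[OF Ae_deriv[OF xi_cont[OF w] e that(2)]]) auto
    qed
    show "continuous_on {0..t} (\<lambda>s. al (\<lambda>i. ce (xi \<omega>) e i s))" if "\<omega> \<in> space (F t)" for \<omega>
      by (intro al_continuous continuous_on_subset[OF ce_continuous[OF xi_cont e]]) (use that in \<open>auto simp: space_F\<close>)
    show "(\<lambda>\<omega>. al (\<lambda>i. ce (xi \<omega>) e i s)) \<in> borel_measurable (F t)" if "0 \<le> s" "s \<le> t" for s
      by (intro al_measurable ce_adapted e that)
  qed auto
qed

end

section \<open>The localizing sequence of stopping times\<close>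

context driven_setting begin

text \<open>At most a quarter of the least initial height, so that every node starts above the
  stopping height \<open>2 * ek k\<close>. The element 1 keeps the minimum defined when there are no
  nodes.\<close>

definition e0 :: real where "e0 = Min (insert 1 ((\<lambda>j. Im (\<psi>\<^sub>0 (z j)) / 4) ` {..<n}))"

definition ek :: "nat \<Rightarrow> real" where "ek k = e0 / (real k + 1)"

lemma e0: "0 < e0" "e0 \<le> 1" "j < n \<Longrightarrow> e0 \<le> Im (\<psi>\<^sub>0 (z j)) / 4"
proof -
  show "0 < e0" "e0 \<le> 1" unfolding e0_def using psi0(2)[OF zD] by (auto simp: strip_def)
  show "e0 \<le> Im (\<psi>\<^sub>0 (z j)) / 4" if "j < n" unfolding e0_def by (rule Min_le) (use that in auto)
qed

lemma ek: "0 < ek k" "ek k \<le> 1" "ek k \<le> pi" "ek (Suc k) \<le> ek k" "j < n \<Longrightarrow> 4 * ek k \<le> Im (\<psi>\<^sub>0 (z j))"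
proof -
  show "0 < ek k" using e0(1) by (simp add: ek_def)
  have le: "ek k \<le> e0" unfolding ek_def using e0(1) by (simp add: divide_le_eq)
  then show 1: "ek k \<le> 1" using e0(2) by simp
  show "ek k \<le> pi" using 1 pi_gt3 by simp
  show "ek (Suc k) \<le> ek k" unfolding ek_def using e0(1) by (intro divide_left_mono) auto
  show "4 * ek k \<le> Im (\<psi>\<^sub>0 (z j))" if "j < n" using le e0(3)[OF that] by simp
qed

text \<open>All stopping conditions in one family: elapsed time for \<open>i = n\<close>, size of
  the driving function for \<open>i = Suc n\<close>, and the height of a node for
  \<open>i < n\<close>. Stopping at twice the cut-off height leaves a margin for the last time step;
  the time condition makes \<open>Tk\<close> finite.\<close>

definition Gk :: "nat \<Rightarrow> nat \<Rightarrow> real \<Rightarrow> 'w \<Rightarrow> real" where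
  "Gk k i t \<omega> = (if i = n then t - real k else if i = Suc n then \<bar>xi \<omega> t\<bar> - real k else 2 * ek k - Im (tf (xi \<omega>) (ek k) (\<psi>\<^sub>0 (z i)) t))"

definition Tk :: "nat \<Rightarrow> 'w \<Rightarrow> real" where
  "Tk k \<omega> = Inf {t. 0 \<le> t \<and> (\<exists>i\<in>{..<n + 2}. 0 \<le> Gk k i t \<omega>)}"

lemma Gk_cont: "\<omega> \<in> space P \<Longrightarrow> continuous_on {0..} (\<lambda>t. Gk k i t \<omega>)"
proof -
  assume w: "\<omega> \<in> space P"
  note c = xi_cont[OF w] tf_cont[OF xi_cont[OF w] ek(1,3)]
  show ?thesis unfolding Gk_def
    by (cases "i = n"; cases "i = Suc n") (auto intro!: continuous_intros c)
qed

lemma Gk_ex: "\<exists>i\<in>{..<n + 2}. \<exists>s\<ge>0. 0 \<le> Gk k i s \<omega>"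
  by (intro bexI[of _ n] exI[of _ "real k"]) (auto simp: Gk_def)

lemma Tk_stopping: "stopping_time F (Tk k)"
  unfolding Tk_def[abs_def]
proof (rule stopping_time_hitting[OF brownian_motionD(2)[OF bm]])
  show "Gk k i s \<in> borel_measurable (F s)" if "0 \<le> s" for i s
  proof -
    have [measurable]: "(\<lambda>\<omega>. xi \<omega> s) \<in> borel_measurable (F s)" "(\<lambda>\<omega>. tf (xi \<omega>) (ek k) (\<psi>\<^sub>0 (z i)) s) \<in> borel_measurable (F s)"
      using xi_meas[OF that order_refl] tf_adapted[OF ek(1,3) that order_refl] by auto
    show ?thesis unfolding Gk_def[abs_def] by measurable
  qed
qed (use Gk_cont Gk_ex in auto)

lemma Tk_hit:
  assumes w: "\<omega> \<in> space P"
  shows "0 \<le> Tk k \<omega>" "\<exists>i\<in>{..<n + 2}. 0 \<le> Gk k i (Tk k \<omega>) \<omega>"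
    "0 \<le> s \<Longrightarrow> s < Tk k \<omega> \<Longrightarrow> i < n + 2 \<Longrightarrow> Gk k i s \<omega> < 0"
    "Tk k \<omega> \<le> t \<longleftrightarrow> (\<exists>i\<in>{..<n + 2}. \<exists>s\<in>{0..t}. 0 \<le> Gk k i s \<omega>)"
  using hitting_time[of "{..<n + 2}" "\<lambda>i t. Gk k i t \<omega>", OF _ Gk_cont[OF w] Gk_ex] by (simp_all add: Tk_def)

lemma Tk_facts:
  assumes w: "\<omega> \<in> space P"
  shows "Tk k \<omega> \<le> real k"
    and "0 \<le> s \<Longrightarrow> s \<le> Tk k \<omega> \<Longrightarrow> \<bar>xi \<omega> s\<bar> \<le> real k"
    and "0 \<le> s \<Longrightarrow> s \<le> Tk k \<omega> \<Longrightarrow> j < n \<Longrightarrow> 2 * ek k \<le> Im (tf (xi \<omega>) (ek k) (\<psi>\<^sub>0 (z j)) s)"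
proof -
  show "Tk k \<omega> \<le> real k" unfolding Tk_hit(4)[OF w]
    by (intro bexI[of _ n] bexI[of _ "real k"]) (auto simp: Gk_def)
  show "\<bar>xi \<omega> s\<bar> \<le> real k" if "0 \<le> s" "s \<le> Tk k \<omega>"
  proof (rule left_limit_le[where g = "\<lambda>s. \<bar>xi \<omega> s\<bar>"])
    show "\<bar>xi \<omega> r\<bar> \<le> real k" if r: "0 \<le> r" "r < s" for r
      using Tk_hit(3)[OF w, of r k "Suc n"] r \<open>s \<le> Tk k \<omega>\<close> by (simp add: Gk_def)
  qed (use that xi_0[OF w] in \<open>auto intro!: continuous_intros xi_cont[OF w]\<close>)
  show "2 * ek k \<le> Im (tf (xi \<omega>) (ek k) (\<psi>\<^sub>0 (z j)) s)" if "0 \<le> s" "s \<le> Tk k \<omega>" "j < n"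
  proof -
    have "- Im (tf (xi \<omega>) (ek k) (\<psi>\<^sub>0 (z j)) s) \<le> - (2 * ek k)"
    proof (rule left_limit_le[where g = "\<lambda>s. - Im (tf (xi \<omega>) (ek k) (\<psi>\<^sub>0 (z j)) s)"])
      show "- Im (tf (xi \<omega>) (ek k) (\<psi>\<^sub>0 (z j)) r) \<le> - (2 * ek k)" if r: "0 \<le> r" "r < s" for r
        using Tk_hit(3)[OF w, of r k j] r \<open>s \<le> Tk k \<omega>\<close> \<open>j < n\<close> by (simp add: Gk_def)
      show "- Im (tf (xi \<omega>) (ek k) (\<psi>\<^sub>0 (z j)) 0) \<le> - (2 * ek k)"
        using tf_0[OF xi_cont[OF w] ek(1,3)] ek(5)[OF \<open>j < n\<close>, of k] ek(1)[of k] by simp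
    qed (use that in \<open>auto intro!: continuous_intros tf_cont[OF xi_cont[OF w] ek(1,3)]\<close>)
    then show ?thesis by simp
  qed
qed

lemma Tk_mono:
  assumes w: "\<omega> \<in> space P"
  shows "Tk k \<omega> \<le> Tk (Suc k) \<omega>"
proof (rule ccontr)
  assume "\<not> ?thesis"
  then have lt: "Tk (Suc k) \<omega> < Tk k \<omega>" by simp
  note T0 = Tk_hit(1)[OF w, of "Suc k"]
  obtain i where i: "i < n + 2" "0 \<le> Gk (Suc k) i (Tk (Suc k) \<omega>) \<omega>" using Tk_hit(2)[OF w] by blast
  have neg: "Gk k i (Tk (Suc k) \<omega>) \<omega> < 0" by (rule Tk_hit(3)[OF w T0 lt i(1)])
  show False
  proof (cases "i < n")
    case True
    have I: "2 * ek k < Im (tf (xi \<omega>) (ek k) (\<psi>\<^sub>0 (z i)) (Tk (Suc k) \<omega>))" using neg True by (simp add: Gk_def)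
    then have "ek k \<le> Im (tf (xi \<omega>) (ek k) (\<psi>\<^sub>0 (z i)) (Tk (Suc k) \<omega>))" using ek(1)[of k] by simp
    \<comment> \<open>Above height \<open>ek k\<close> the two cut-offs produce the same path, so
      both stopping levels refer to one path.\<close>
    then have "tf (xi \<omega>) (ek (Suc k)) (\<psi>\<^sub>0 (z i)) (Tk (Suc k) \<omega>) = tf (xi \<omega>) (ek k) (\<psi>\<^sub>0 (z i)) (Tk (Suc k) \<omega>)"
      by (rule tf_decrease_e[OF xi_cont[OF w] ek(1,4,3) psi0(2)[OF zD[OF True]] T0])
    then show False using i(2) I True ek(4)[of k] by (simp add: Gk_def)
  next
    case False
    then have "i = n \<or> i = Suc n" using i(1) by auto
    then show False using i(2) neg by (auto simp: Gk_def)
  qed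
qed

text \<open>At time \<open>Tk k \<omega>\<close> every node is still at height
  \<open>2 * ek k\<close> or more, strictly above the cut-off, so its lifetime is strictly
  longer.\<close>

lemma Tk_less:
  assumes w: "\<omega> \<in> space P" and fw: "dipolar_flow (xi \<omega>) D \<psi>\<^sub>0 \<psi> \<tau>"
  shows "ereal (Tk k \<omega>) < (INF j\<in>{..<n}. \<tau> (z j))"
proof (rule less_INF_finite, intro allI impI)
  fix j assume j: "j < n"
  have "2 * ek k \<le> Im (tf (xi \<omega>) (ek k) (\<psi>\<^sub>0 (z j)) (Tk k \<omega>))" by (rule Tk_facts(3)[OF w Tk_hit(1)[OF w] order_refl j])
  then have "ek k < Im (tf (xi \<omega>) (ek k) (\<psi>\<^sub>0 (z j)) (Tk k \<omega>))" using ek(1)[of k] by simp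
  then have "\<psi>\<^sub>0 (z j) \<in> alive (xi \<omega>) (Tk k \<omega>)" unfolding alive_def using psi0(2)[OF zD[OF j]] ek(1,3)[of k] by blast
  then show "ereal (Tk k \<omega>) < \<tau> (z j)"
    using dipolar_flow_alive(1)[OF xi_cont[OF w] fw zD[OF j] psi0(2)[OF zD[OF j]] Tk_hit(1)[OF w]] by blast
qed

text \<open>Otherwise some t lies strictly between the supremum and the lifetime. On [0, t] the
  nodes stay above a common height and the driving function is bounded, so for large k no stopping
  condition is met up to time t, against \<open>Tk k \<omega> < t\<close>.\<close>

lemma Tk_limit:
  assumes w: "\<omega> \<in> space P" and fw: "dipolar_flow (xi \<omega>) D \<psi>\<^sub>0 \<psi> \<tau>"
  shows "(\<lambda>k. ereal (Tk k \<omega>)) \<longlonglongrightarrow> (INF j\<in>{..<n}. \<tau> (z j))"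
proof -
  have inc: "incseq (\<lambda>k. ereal (Tk k \<omega>))" by (rule incseq_SucI) (simp add: Tk_mono[OF w])
  have "(SUP k. ereal (Tk k \<omega>)) = (INF j\<in>{..<n}. \<tau> (z j))"
  proof (rule antisym)
    show "(SUP k. ereal (Tk k \<omega>)) \<le> (INF j\<in>{..<n}. \<tau> (z j))" by (intro SUP_least less_imp_le Tk_less[OF w fw])
    show "(INF j\<in>{..<n}. \<tau> (z j)) \<le> (SUP k. ereal (Tk k \<omega>))"
    proof (rule ccontr)
      assume "\<not> ?thesis"
      then obtain t where t: "(SUP k. ereal (Tk k \<omega>)) < ereal t" "ereal t < (INF j\<in>{..<n}. \<tau> (z j))"
        using ereal_dense2 by (metis not_le)
      have Tt: "Tk k \<omega> < t" for k
        using le_less_trans[OF SUP_upper[of k UNIV "\<lambda>k. ereal (Tk k \<omega>)"] t(1)] by simp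
      have t0: "0 \<le> t" using Tk_hit(1)[OF w, of 0] Tt[of 0] by simp
      have "\<exists>e. 0 < e \<and> e \<le> pi \<and> e < Im (tf (xi \<omega>) e (\<psi>\<^sub>0 (z j)) t)" if j: "j < n" for j
      proof -
        have "ereal t < \<tau> (z j)" using less_INF_D[OF t(2)] j by auto
        then show ?thesis using dipolar_flow_alive(1)[OF xi_cont[OF w] fw zD[OF j] psi0(2)[OF zD[OF j]] t0]
          by (auto simp: alive_def)
      qed
      then obtain \<epsilon> where eps: "\<And>j. j < n \<Longrightarrow> 0 < \<epsilon> j \<and> \<epsilon> j \<le> pi \<and> \<epsilon> j < Im (tf (xi \<omega>) (\<epsilon> j) (\<psi>\<^sub>0 (z j)) t)" by metis
      define E where "E = Min (insert 1 (\<epsilon> ` {..<n}))"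
      have E: "0 < E" "\<And>j. j < n \<Longrightarrow> E \<le> \<epsilon> j" unfolding E_def using eps by auto
      have cp: "compact (xi \<omega> ` {0..t})"
        by (intro compact_continuous_image continuous_on_subset[OF xi_cont[OF w]]) auto
      obtain K where "\<forall>x\<in>xi \<omega> ` {0..t}. norm x \<le> K" using compact_imp_bounded[OF cp] unfolding bounded_iff by blast
      then have K: "\<bar>xi \<omega> s\<bar> \<le> K" if "0 \<le> s" "s \<le> t" for s using that by auto
      \<comment> \<open>The bound \<open>2 / E\<close> ensures \<open>2 * ek k < E\<close>, because
        \<open>e0 \<le> 1\<close>.\<close>
      obtain k :: nat where k: "max t (max K (2 / E)) < real k" using reals_Archimedean2 by blast
      have ekE: "2 * ek k < E"
      proof -
        have "2 < E * real k" using k E(1) by (simp add: divide_less_eq mult.commute)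
        then have "2 * e0 < E * (real k + 1)" using e0(2) E(1) by (simp add: distrib_left)
        then show ?thesis unfolding ek_def by (simp add: divide_less_eq)
      qed
      have "Gk k i s \<omega> < 0" if i: "i < n + 2" and s: "0 \<le> s" "s \<le> t" for i s
      proof (cases "i < n")
        case True
        have I: "\<epsilon> i < Im (tf (xi \<omega>) (\<epsilon> i) (\<psi>\<^sub>0 (z i)) s)"
          using eps[OF True] tf_Im_antimono[OF xi_cont[OF w] _ _ s, of "\<epsilon> i" "\<psi>\<^sub>0 (z i)"] by simp
        have "ek k \<le> \<epsilon> i" using ekE E(2)[OF True] ek(1)[of k] by simp
        then have "tf (xi \<omega>) (ek k) (\<psi>\<^sub>0 (z i)) s = tf (xi \<omega>) (\<epsilon> i) (\<psi>\<^sub>0 (z i)) s"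
          using tf_decrease_e[OF xi_cont[OF w] ek(1) _ _ psi0(2)[OF zD[OF True]] s(1), of k "\<epsilon> i"] eps[OF True] I by simp
        then show ?thesis using I ekE E(2)[OF True] True by (simp add: Gk_def)
      next
        case False
        then have "i = n \<or> i = Suc n" using i by auto
        then show ?thesis using k K[OF s] s by (auto simp: Gk_def)
      qed
      then have "\<not> Tk k \<omega> \<le> t" unfolding Tk_hit(4)[OF w] by force
      then show False using Tt[of k] by simp
    qed
  qed
  then show ?thesis using LIMSEQ_SUP[OF inc] by simp
qed

end

section \<open>The martingale property of the stopped process\<close>

context driven_setting begin

text \<open>\<open>M\<close> bounds the speed of the cut-off flow. In the extra time
  \<open>ek k / M\<close> a node loses at most the height \<open>ek k\<close>; having been at
  \<open>2 * ek k\<close> or more it is still at least at \<open>ek k\<close>, where the cut-off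
  field equals \<open>cth\<close>.\<close>

lemma stopped_path_bounds:
  assumes w: "\<omega> \<in> space P" and M: "M = 1 + 1 / sin (ek k / 2)" and s: "0 \<le> s" "s < Tk k \<omega> + ek k / M"
    and i: "i \<in> nodes"
  shows "s \<le> real k + 1"
    and "ye (xi \<omega>) (ek k) i s \<in> kbox (ek k) ((\<Sum>j<n. norm (\<psi>\<^sub>0 (z j))) + M * (real k + 1))"
    and "norm (ce (xi \<omega>) (ek k) i s) \<le> M"
    and "ce (xi \<omega>) (ek k) i s = cth (ye (xi \<omega>) (ek k) i s - of_real (xi \<omega> s))"
proof -
  define e where "e = ek k"
  define T where "T = Tk k \<omega>"
  note ee = ek(1-3)[of k, folded e_def]
  obtain j B' where ij: "i = (j, B')" "j < n" using i by (auto simp: nodes_def)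
  define f where "f = tf (xi \<omega>) e (\<psi>\<^sub>0 (z j))"
  have "0 < sin (e / 2)" using ee pi_gt3 by (intro sin_gt_zero) auto
  then have M1: "1 \<le> M" unfolding M e_def[symmetric] by simp
  have T: "0 \<le> T" "T \<le> real k" unfolding T_def by (rule Tk_hit(1)[OF w], rule Tk_facts(1)[OF w])
  have "e / M \<le> 1" using M1 ee by (simp add: divide_le_eq)
  then show sk: "s \<le> real k + 1" using s(2) T unfolding e_def[symmetric] T_def[symmetric] by simp
  note st = psi0(2)[OF zD[OF ij(2)]]
  have f0: "f 0 = \<psi>\<^sub>0 (z j)" unfolding f_def by (rule tf_0[OF xi_cont[OF w] ee(1,3)])
  have dist: "norm (f u - f r) \<le> M * (u - r)" if "0 \<le> r" "r \<le> u" for r u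
  proof (rule speed_bound[OF _ _ that])
    show "(f has_vector_derivative cthe e (f r - of_real (xi \<omega> r))) (at r within {0..})" if "0 \<le> r" for r
      unfolding f_def by (rule tf_deriv[OF xi_cont[OF w] ee(1,3) that])
    show "norm (cthe e (f r - of_real (xi \<omega> r))) \<le> M" for r
      unfolding M e_def[symmetric] by (rule cthe_bound[OF ee(1,3)])
  qed
  have IT: "2 * e \<le> Im (f r)" if "0 \<le> r" "r \<le> T" for r
    using Tk_facts(3)[OF w, of r k j] that ij(2) by (simp add: f_def e_def T_def)
  have lo: "e \<le> Im (f s)"
  proof (cases "s \<le> T")
    case True
    then show ?thesis using IT[OF s(1)] ee by simp
  next
    case False
    have "s - T \<le> e / M" using s(2) by (simp add: e_def T_def)
    then have "M * (s - T) \<le> e" using M1 by (simp add: le_divide_eq mult.commute)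
    then have "\<bar>Im (f s - f T)\<bar> \<le> e" using dist[OF T(1), of s] False abs_Im_le_cmod[of "f s - f T"] by simp
    then show ?thesis using IT[OF T(1) order_refl] by simp
  qed
  have hi: "Im (f s) \<le> pi"
    using tf_Im_antimono[OF xi_cont[OF w] ee(1,3) order_refl s(1), of "\<psi>\<^sub>0 (z j)"] f0 st by (simp add: f_def strip_def)
  have "norm (f s - f 0) \<le> M * (real k + 1)"
  proof -
    have "M * (s - 0) \<le> M * (real k + 1)" using sk M1 by (intro mult_left_mono) auto
    then show ?thesis using dist[OF order_refl s(1)] by linarith
  qed
  moreover have "norm (f s) \<le> norm (f 0) + norm (f s - f 0)" using norm_triangle_ineq[of "f 0" "f s - f 0"] by simp
  moreover have "norm (\<psi>\<^sub>0 (z j)) \<le> (\<Sum>j<n. norm (\<psi>\<^sub>0 (z j)))" by (rule member_le_sum) (use ij(2) in auto)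
  ultimately have re: "\<bar>Re (f s)\<bar> \<le> (\<Sum>j<n. norm (\<psi>\<^sub>0 (z j))) + M * (real k + 1)"
    using abs_Re_le_cmod[of "f s"] f0 by simp
  have y: "ye (xi \<omega>) e i s = nconj B' (f s)" by (simp add: ye_def ij f_def del: nconj.simps)
  have c: "ce (xi \<omega>) e i s = nconj B' (cthe e (f s - of_real (xi \<omega> s)))" by (simp add: ce_def ij f_def del: nconj.simps)
  show "ye (xi \<omega>) (ek k) i s \<in> kbox (ek k) ((\<Sum>j<n. norm (\<psi>\<^sub>0 (z j))) + M * (real k + 1))"
    unfolding e_def[symmetric] y kbox_def mem_Collect_eq nconj_facts using re lo hi ee by simp
  show "norm (ce (xi \<omega>) (ek k) i s) \<le> M"
    unfolding e_def[symmetric] c nconj_facts(1) M using cthe_bound[OF ee(1,3)] by (simp add: e_def)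
  have "cthe e (f s - of_real (xi \<omega> s)) = cth (f s - of_real (xi \<omega> s))" using lo hi by (intro cthe_eq) auto
  then show "ce (xi \<omega>) (ek k) i s = cth (ye (xi \<omega>) (ek k) i s - of_real (xi \<omega> s))"
    unfolding e_def[symmetric] c y nconj_facts(5) nconj_facts(4) by simp
qed

text \<open>The formula for \<open>N\<close> is assumed only up to \<open>Tk k\<close>. The process
  \<open>V\<close> continues it by the cut-off flow and the clamped driving function, and at stopped
  times \<open>N\<close> is \<open>c0\<close> times \<open>V\<close>.\<close>

lemma stopped_martingale:
  fixes a b \<sigma>m \<sigma>p :: real and \<sigma> \<sigma>s :: "nat \<Rightarrow> real" and c0 :: complex
  assumes a: "a = sqrt (2 / \<kappa>)" and b: "b = sqrt (\<kappa> / 8) - sqrt (2 / \<kappa>)"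
    and neut: "\<sigma>m + \<sigma>p + (\<Sum>j<n. \<sigma> j + \<sigma>s j) = 0"
  assumes N: "\<And>t \<omega>. 0 \<le> t \<Longrightarrow> \<omega> \<in> space P \<Longrightarrow> t \<le> Tk k \<omega> \<Longrightarrow> N t \<omega> = c0 * heat.H0 nodes (nq \<sigma> \<sigma>s) a (\<sigma>m - \<sigma>p) (\<sigma>p * (\<sigma>p - a) / 2 - \<sigma>m * (\<sigma>m - a) / 2)
     (Ae b \<sigma> \<sigma>s (\<sigma>m * (\<sigma>m - a) / 2 + \<sigma>p * (\<sigma>p - a) / 2) (xi \<omega>) (ek k) t) (\<lambda>i. ye (xi \<omega>) (ek k) i t) (of_real (xi \<omega> t))"
  shows "complex_martingale P F (\<lambda>t \<omega>. N (min t (Tk k \<omega>)) \<omega>)"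
proof -
  define \<mu> where "\<mu> = \<sigma>m * (\<sigma>m - a) / 2 + \<sigma>p * (\<sigma>p - a) / 2"
  define \<beta> where "\<beta> = \<sigma>p * (\<sigma>p - a) / 2 - \<sigma>m * (\<sigma>m - a) / 2"
  interpret H: heat nodes "nq \<sigma> \<sigma>s" a b "\<sigma>m - \<sigma>p" \<kappa> \<beta> \<mu> by unfold_locales (simp add: nodes_def)
  \<comment> \<open>Neutrality expresses the total charge by the root charges, which brings \<mu>
    and \<beta> into the form required by \<open>H.pde\<close>.\<close>
  have rt: "H.rt = - (\<sigma>m + \<sigma>p)" using neut unfolding H.rt_def sum_nodes by simp
  have mu: "\<mu> = ((H.rt)\<^sup>2 + (\<sigma>m - \<sigma>p)\<^sup>2) / 4 + a * H.rt / 2" by (simp add: rt \<mu>_def field_simps power2_eq_square)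
  have be: "\<beta> = (\<sigma>m - \<sigma>p) * (H.rt + a) / 2" by (simp add: rt \<beta>_def field_simps)
  have ka: "\<kappa> * a\<^sup>2 = 2" using kap by (simp add: a)
  have bb: "b = \<kappa> * a / 4 - a"
  proof -
    have "(\<kappa> * a / 4)\<^sup>2 = \<kappa> / 8" using kap by (simp add: a power_mult_distrib power_divide) (simp add: power2_eq_square)
    then have "sqrt (\<kappa> / 8) = \<kappa> * a / 4" using kap by (intro real_sqrt_unique) (auto simp: a)
    then show ?thesis by (simp add: b a)
  qed
  define e where "e = ek k"
  note ee = ek(1-3)[of k, folded e_def]
  define M where "M = 1 + 1 / sin (e / 2)"
  have "0 < sin (e / 2)" using ee pi_gt3 by (intro sin_gt_zero) auto
  then have M1: "1 \<le> M" unfolding M_def by simp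
  define d0 where "d0 = e / M"
  have d0: "0 < d0" unfolding d0_def using ee M1 by simp
  define R where "R = (\<Sum>j<n. norm (\<psi>\<^sub>0 (z j))) + M * (real k + 1)"
  \<comment> \<open>Bound on the speed of \<open>A\<close>, taken from
    \<open>H.al_bound\<close>.\<close>
  define Ma where "Ma = \<bar>\<mu>\<bar> + ((H.rt)\<^sup>2 + ((\<Sum>i\<in>nodes. \<bar>nq \<sigma> \<sigma>s i\<bar>) * M)\<^sup>2) / 4 + \<bar>b / 2\<bar> * ((\<Sum>i\<in>nodes. \<bar>nq \<sigma> \<sigma>s i\<bar>) * M\<^sup>2 + \<bar>H.rt\<bar>)"
  define A where "A = (\<lambda>\<omega>. Ae b \<sigma> \<sigma>s \<mu> (xi \<omega>) e)"
  define y where "y = (\<lambda>\<omega>. ye (xi \<omega>) e)"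
  define V where "V = (\<lambda>r \<omega>. H.H0 (A \<omega> r) (\<lambda>i. y \<omega> i r) (of_real (clampr (real k + 1) (xi \<omega> r))))"
  define h1 where "h1 = (\<lambda>r \<omega>. H.H1 (A \<omega> r) (\<lambda>i. y \<omega> i r) (of_real (xi \<omega> r)))"
  define h2 where "h2 = (\<lambda>r \<omega>. H.H2 (A \<omega> r) (\<lambda>i. y \<omega> i r) (of_real (xi \<omega> r)))"
  have cb: "norm (ce (xi \<omega>) e i s) \<le> M" for \<omega> i s
    unfolding ce_def nconj_facts(1) M_def by (rule cthe_bound[OF ee(1,3)])
  \<comment> \<open>The constant is chosen before \<omega>, as the argument with expectations
    requires.\<close>
  have inc: "\<exists>C\<ge>0. \<forall>\<omega>\<in>space P.
     (\<forall>s. 0 \<le> s \<longrightarrow> s < Tk k \<omega> + d0 \<longrightarrow> norm (V s \<omega>) \<le> C) \<and>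
     (\<forall>s. 0 \<le> s \<longrightarrow> s < Tk k \<omega> \<longrightarrow> norm (h1 s \<omega>) \<le> C \<and> norm (h2 s \<omega>) \<le> C) \<and>
     continuous_on {0..<Tk k \<omega> + d0} (\<lambda>s. V s \<omega>) \<and>
     (\<forall>r \<delta>. 0 \<le> r \<longrightarrow> r < Tk k \<omega> \<longrightarrow> 0 < \<delta> \<longrightarrow> \<delta> < d0 \<longrightarrow>
       norm (V (r + \<delta>) \<omega> - V r \<omega> - (h1 r \<omega> * of_real (xi \<omega> (r + \<delta>) - xi \<omega> r) + h2 r \<omega> * of_real (((xi \<omega> (r + \<delta>) - xi \<omega> r)\<^sup>2 - \<kappa> * \<delta>) / 2)))
         \<le> C * \<bar>xi \<omega> (r + \<delta>) - xi \<omega> r\<bar>^3 + C * \<delta>) \<and>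
     (\<forall>\<eta>>0. \<exists>d1>0. \<forall>r \<delta>. 0 \<le> r \<longrightarrow> r < Tk k \<omega> \<longrightarrow> 0 < \<delta> \<longrightarrow> \<delta> < d1 \<longrightarrow>
       norm (V (r + \<delta>) \<omega> - V r \<omega> - (h1 r \<omega> * of_real (xi \<omega> (r + \<delta>) - xi \<omega> r) + h2 r \<omega> * of_real (((xi \<omega> (r + \<delta>) - xi \<omega> r)\<^sup>2 - \<kappa> * \<delta>) / 2)))
         \<le> C * \<bar>xi \<omega> (r + \<delta>) - xi \<omega> r\<bar>^3 + \<eta> * \<delta>)" (is "\<exists>C\<ge>0. ?W C")
  proof (rule H.path_increments[OF mu be ka bb ee(1) of_nat_0_le_iff[of k] kap, where R = R and M = M and RA = "Ma * (real k + 1)"], goal_cases)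
    case (1 C)
    show ?case
    proof (rule exI[of _ C], rule conjI[OF 1(1)], rule ballI)
      fix \<omega> assume w: "\<omega> \<in> space P"
      note xc = xi_cont[OF w]
      have p4: "\<bar>xi \<omega> s\<bar> \<le> real k" if "0 \<le> s" "s < Tk k \<omega>" for s using Tk_facts(2)[OF w, of s k] that by simp
      have p5: "(A \<omega> has_vector_derivative H.al (\<lambda>i. ce (xi \<omega>) e i s)) (at s within {0..})" if "0 \<le> s" for s
        unfolding A_def by (rule Ae_deriv[OF xc ee(1,3) that])
      have p6: "(y \<omega> i has_vector_derivative ce (xi \<omega>) e i s) (at s within {0..})" if "i \<in> nodes" "0 \<le> s" for i s
        unfolding y_def by (rule ye_deriv[OF xc ee(1,3) that(2)])
      have p7: "continuous_on {0..} (ce (xi \<omega>) e i)" if "i \<in> nodes" for i by (rule ce_continuous[OF xc ee(1,3)])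
      have p8: "y \<omega> i s \<in> kbox e R \<and> norm (ce (xi \<omega>) e i s) \<le> M \<and> ce (xi \<omega>) e i s = cth (y \<omega> i s - of_real (xi \<omega> s))"
        if "i \<in> nodes" "0 \<le> s" "s < Tk k \<omega> + d0" for i s
        using stopped_path_bounds(2-4)[OF w M_def[unfolded e_def] that(2) that(3)[unfolded d0_def e_def] that(1)]
        unfolding y_def e_def R_def by blast
      have p9: "norm (A \<omega> s) \<le> Ma * (real k + 1)" if "0 \<le> s" "s < Tk k \<omega> + d0" for s
      proof -
        have al: "norm (H.al (\<lambda>i. ce (xi \<omega>) e i r)) \<le> Ma" for r unfolding Ma_def by (rule H.al_bound) (rule cb)
        have "norm (A \<omega> s - A \<omega> 0) \<le> Ma * (s - 0)" by (rule speed_bound[OF p5 al order_refl that(1)])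
        moreover have "A \<omega> 0 = 0" by (simp add: A_def Ae_def)
        moreover have "d0 \<le> 1" unfolding d0_def using M1 ee by (simp add: divide_le_eq)
        moreover have "Tk k \<omega> \<le> real k" by (rule Tk_facts(1)[OF w])
        ultimately show ?thesis
          using mult_left_mono[of s "real k + 1" Ma] that order_trans[OF norm_ge_zero al[of 0]] by simp
      qed
      show "(\<forall>s. 0 \<le> s \<longrightarrow> s < Tk k \<omega> + d0 \<longrightarrow> norm (V s \<omega>) \<le> C) \<and>
     (\<forall>s. 0 \<le> s \<longrightarrow> s < Tk k \<omega> \<longrightarrow> norm (h1 s \<omega>) \<le> C \<and> norm (h2 s \<omega>) \<le> C) \<and>
     continuous_on {0..<Tk k \<omega> + d0} (\<lambda>s. V s \<omega>) \<and>
     (\<forall>r \<delta>. 0 \<le> r \<longrightarrow> r < Tk k \<omega> \<longrightarrow> 0 < \<delta> \<longrightarrow> \<delta> < d0 \<longrightarrow>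
       norm (V (r + \<delta>) \<omega> - V r \<omega> - (h1 r \<omega> * of_real (xi \<omega> (r + \<delta>) - xi \<omega> r) + h2 r \<omega> * of_real (((xi \<omega> (r + \<delta>) - xi \<omega> r)\<^sup>2 - \<kappa> * \<delta>) / 2)))
         \<le> C * \<bar>xi \<omega> (r + \<delta>) - xi \<omega> r\<bar>^3 + C * \<delta>) \<and>
     (\<forall>\<eta>>0. \<exists>d1>0. \<forall>r \<delta>. 0 \<le> r \<longrightarrow> r < Tk k \<omega> \<longrightarrow> 0 < \<delta> \<longrightarrow> \<delta> < d1 \<longrightarrow>
       norm (V (r + \<delta>) \<omega> - V r \<omega> - (h1 r \<omega> * of_real (xi \<omega> (r + \<delta>) - xi \<omega> r) + h2 r \<omega> * of_real (((xi \<omega> (r + \<delta>) - xi \<omega> r)\<^sup>2 - \<kappa> * \<delta>) / 2)))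
         \<le> C * \<bar>xi \<omega> (r + \<delta>) - xi \<omega> r\<bar>^3 + \<eta> * \<delta>)"
        unfolding V_def h1_def h2_def by (rule 1(2)[OF xc Tk_hit(1)[OF w] d0 p4 p5 p6 p7 p8 p9])
    qed
  qed
  then obtain C where C: "0 \<le> C" and W: "?W C" by blast
  have Vb: "norm (V s \<omega>) \<le> C" if "\<omega> \<in> space P" "0 \<le> s" "s < Tk k \<omega> + d0" for s \<omega>
    by (rule conjunct1[OF bspec[OF W that(1)], rule_format, OF that(2,3)])
  have hb: "norm (h1 s \<omega>) \<le> C \<and> norm (h2 s \<omega>) \<le> C" if "\<omega> \<in> space P" "0 \<le> s" "s < Tk k \<omega>" for s \<omega>
    by (rule conjunct1[OF conjunct2[OF bspec[OF W that(1)]], rule_format, OF that(2,3)])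
  have Vc: "continuous_on {0..<Tk k \<omega> + d0} (\<lambda>s. V s \<omega>)" if "\<omega> \<in> space P" for \<omega>
    by (rule conjunct1[OF conjunct2[OF conjunct2[OF bspec[OF W that]]]])
  have r1: "\<And>r \<delta> \<omega>. \<omega> \<in> space P \<Longrightarrow> 0 \<le> r \<Longrightarrow> r < Tk k \<omega> \<Longrightarrow> 0 < \<delta> \<Longrightarrow> \<delta> < d0 \<Longrightarrow>
       norm (V (r + \<delta>) \<omega> - V r \<omega> - (h1 r \<omega> * of_real (xi \<omega> (r + \<delta>) - xi \<omega> r) + h2 r \<omega> * of_real (((xi \<omega> (r + \<delta>) - xi \<omega> r)\<^sup>2 - \<kappa> * \<delta>) / 2)))
         \<le> C * \<bar>xi \<omega> (r + \<delta>) - xi \<omega> r\<bar>^3 + C * \<delta>"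
    by (rule conjunct1[OF conjunct2[OF conjunct2[OF conjunct2[OF bspec[OF W]]]], rule_format])
  have r2: "\<And>\<eta> \<omega>. \<omega> \<in> space P \<Longrightarrow> 0 < \<eta> \<Longrightarrow> \<exists>d1>0. \<forall>r \<delta>. 0 \<le> r \<longrightarrow> r < Tk k \<omega> \<longrightarrow> 0 < \<delta> \<longrightarrow> \<delta> < d1 \<longrightarrow>
       norm (V (r + \<delta>) \<omega> - V r \<omega> - (h1 r \<omega> * of_real (xi \<omega> (r + \<delta>) - xi \<omega> r) + h2 r \<omega> * of_real (((xi \<omega> (r + \<delta>) - xi \<omega> r)\<^sup>2 - \<kappa> * \<delta>) / 2)))
         \<le> C * \<bar>xi \<omega> (r + \<delta>) - xi \<omega> r\<bar>^3 + \<eta> * \<delta>"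
    by (rule conjunct2[OF conjunct2[OF conjunct2[OF conjunct2[OF bspec[OF W]]]], THEN spec, THEN mp])
  \<comment> \<open>The expansion is in increments of \<open>xi\<close>, which are \<open>q\<close>
    times those of \<open>B\<close>; the factors q, \<kappa> and q^3 are absorbed into the
    constant.\<close>
  define q where "q = sqrt \<kappa>"
  have q: "0 \<le> q" "q * q = \<kappa>" using kap by (auto simp: q_def)
  define C' where "C' = C * (1 + q + \<kappa> + q ^ 3)"
  have C': "0 \<le> C'" "q * C \<le> C'" "\<kappa> * C \<le> C'" "C * q ^ 3 \<le> C'" "C \<le> C'"
  proof -
    have nn: "0 \<le> C * q" "0 \<le> C * \<kappa>" "0 \<le> C * q ^ 3" using C q(1) kap by auto
    show "0 \<le> C'" "q * C \<le> C'" "\<kappa> * C \<le> C'" "C * q ^ 3 \<le> C'" "C \<le> C'"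
      using nn C by (simp_all add: C'_def distrib_left mult.commute)
  qed
  define D1 where "D1 = (\<lambda>r \<omega>. of_real q * h1 r \<omega>)"
  define D2 where "D2 = (\<lambda>r \<omega>. of_real \<kappa> * h2 r \<omega>)"
  have scale: "D1 r \<omega> * of_real (B u \<omega> - B r \<omega>) + D2 r \<omega> * of_real (((B u \<omega> - B r \<omega>)\<^sup>2 - \<delta>) / 2)
      = h1 r \<omega> * of_real (xi \<omega> u - xi \<omega> r) + h2 r \<omega> * of_real (((xi \<omega> u - xi \<omega> r)\<^sup>2 - \<kappa> * \<delta>) / 2)" for r u \<delta> \<omega>
  proof -
    have x: "xi \<omega> u - xi \<omega> r = q * (B u \<omega> - B r \<omega>)" by (simp add: xi_def q_def algebra_simps)
    have sq: "(q * v)\<^sup>2 - \<kappa> * \<delta> = \<kappa> * (v\<^sup>2 - \<delta>)" for v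
      by (simp add: q(2)[symmetric] power2_eq_square algebra_simps)
    have half: "complex_of_real (\<kappa> * v / 2) = of_real \<kappa> * of_real (v / 2)" for v by simp
    show ?thesis unfolding x sq half D1_def D2_def of_real_mult[of q] by (simp only: mult_ac)
  qed
  have cube: "C * \<bar>xi \<omega> u - xi \<omega> r\<bar> ^ 3 \<le> C' * \<bar>B u \<omega> - B r \<omega>\<bar> ^ 3" for \<omega> u r
  proof -
    have x: "\<bar>xi \<omega> u - xi \<omega> r\<bar> = q * \<bar>B u \<omega> - B r \<omega>\<bar>"
      using q(1) by (simp add: xi_def q_def[symmetric] right_diff_distrib[symmetric] abs_mult)
    have "C * \<bar>xi \<omega> u - xi \<omega> r\<bar> ^ 3 = (C * q ^ 3) * \<bar>B u \<omega> - B r \<omega>\<bar> ^ 3" unfolding x by (simp add: power_mult_distrib)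
    also have "\<dots> \<le> C' * \<bar>B u \<omega> - B r \<omega>\<bar> ^ 3" by (intro mult_right_mono C') simp
    finally show ?thesis .
  qed
  have mA: "(\<lambda>\<omega>. A \<omega> r) \<in> borel_measurable (F r)" if "0 \<le> r" for r unfolding A_def by (rule Ae_adapted[OF ee(1,3) that])
  have my: "(\<lambda>\<omega>. y \<omega> i r) \<in> borel_measurable (F r)" if "0 \<le> r" for r i unfolding y_def by (rule ye_adapted[OF ee(1,3) that order_refl])
  have mx: "(\<lambda>\<omega>. complex_of_real (xi \<omega> r)) \<in> borel_measurable (F r)" if "0 \<le> r" for r
    using xi_meas[OF that order_refl] by measurable
  have mxc: "(\<lambda>\<omega>. complex_of_real (clampr (real k + 1) (xi \<omega> r))) \<in> borel_measurable (F r)" if "0 \<le> r" for r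
    using xi_meas[OF that order_refl] unfolding clampr_def by measurable
  have mV: "V r \<in> borel_measurable (F r)" if "0 \<le> r" for r
    unfolding V_def by (rule H.H_measurable(1)[OF mA[OF that] my[OF that] mxc[OF that]])
  have mD1: "D1 r \<in> borel_measurable (F r)" if "0 \<le> r" for r
    unfolding D1_def h1_def by (intro borel_measurable_times borel_measurable_const H.H_measurable(2)[OF mA[OF that] my[OF that] mx[OF that]])
  have mD2: "D2 r \<in> borel_measurable (F r)" if "0 \<le> r" for r
    unfolding D2_def h2_def by (intro borel_measurable_times borel_measurable_const H.H_measurable(3)[OF mA[OF that] my[OF that] mx[OF that]])
  have sub: "f \<in> borel_measurable (F r) \<Longrightarrow> f \<in> borel_measurable P" for f :: "'w \<Rightarrow> complex" and r
    by (rule measurable_from_subalg[OF brownian_motionD(3)[OF bm]])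
  \<comment> \<open>\<open>V\<close> may jump at late times, when a cut-off path leaves
    \<open>dstrip\<close>. Therefore its continuous ingredients are stopped separately and inserted
    into \<open>H0\<close> afterwards.\<close>
  have mVT: "(\<lambda>\<omega>. V (min r (Tk k \<omega>)) \<omega>) \<in> borel_measurable (F r)" if r: "0 \<le> r" for r
  proof -
    note st = adapted_stopped[OF brownian_motionD(2)[OF bm] Tk_stopping Tk_hit(1) r]
    have 1: "(\<lambda>\<omega>. A \<omega> (min r (Tk k \<omega>))) \<in> borel_measurable (F r)"
      by (rule st[of "\<lambda>s \<omega>. A \<omega> s"]) (use mA Ae_continuous[OF xi_cont ee(1,3)] in \<open>simp_all add: A_def\<close>)
    have 2: "(\<lambda>\<omega>. y \<omega> i (min r (Tk k \<omega>))) \<in> borel_measurable (F r)" for i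
      by (rule st[of "\<lambda>s \<omega>. y \<omega> i s"]) (use my ye_continuous[OF xi_cont ee(1,3)] in \<open>simp_all add: y_def\<close>)
    have 3: "(\<lambda>\<omega>. complex_of_real (clampr (real k + 1) (xi \<omega> (min r (Tk k \<omega>))))) \<in> borel_measurable (F r)"
      by (rule st[of "\<lambda>s \<omega>. complex_of_real (clampr (real k + 1) (xi \<omega> s))"])
        (use mxc in \<open>auto intro!: continuous_intros continuous_clampr xi_cont\<close>)
    show ?thesis unfolding V_def by (rule H.H_measurable(1)[OF 1 2 3])
  qed
  have eqV: "(\<integral>\<omega>. indicator S \<omega> *\<^sub>R V (min t (Tk k \<omega>)) \<omega> \<partial>P) = (\<integral>\<omega>. indicator S \<omega> *\<^sub>R V (min s (Tk k \<omega>)) \<omega> \<partial>P)"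
    if "S \<in> sets (F s)" "0 \<le> s" "s \<le> t" for s t S
  proof (rule stopped_increment_expectation[OF bm Tk_stopping Tk_hit(1) d0 C'(1), where ?D1.0 = D1 and ?D2.0 = D2 and V = V])
    show "V r \<in> borel_measurable P" if "0 \<le> r" for r by (rule sub[OF mV[OF that]])
    show "(\<lambda>\<omega>. V (min r (Tk k \<omega>)) \<omega>) \<in> borel_measurable P" if "0 \<le> r" for r by (rule sub[OF mVT[OF that]])
    show "D1 r \<in> borel_measurable (F r)" "D2 r \<in> borel_measurable (F r)" if "0 \<le> r" for r by (rule mD1[OF that], rule mD2[OF that])
    show "norm (D1 r \<omega>) \<le> C'" if "\<omega> \<in> space P" "0 \<le> r" "r < Tk k \<omega>" for r \<omega>
      using mult_left_mono[OF conjunct1[OF hb[OF that]] q(1)] C'(2) q(1) by (simp add: D1_def norm_mult)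
    show "norm (D2 r \<omega>) \<le> C'" if "\<omega> \<in> space P" "0 \<le> r" "r < Tk k \<omega>" for r \<omega>
    proof -
      have "norm (D2 r \<omega>) = \<kappa> * norm (h2 r \<omega>)" using kap by (simp add: D2_def norm_mult)
      then show ?thesis using mult_left_mono[OF conjunct2[OF hb[OF that]] less_imp_le[OF kap]] C'(3) by linarith
    qed
    show "norm (V r \<omega>) \<le> C'" if "\<omega> \<in> space P" "0 \<le> r" "r < Tk k \<omega> + d0" for r \<omega>
      using Vb[OF that] C'(5) by simp
    show "continuous_on {0..<Tk k \<omega> + d0} (\<lambda>r. V r \<omega>)" if "\<omega> \<in> space P" for \<omega> by (rule Vc[OF that])
    show "norm (V (r + d) \<omega> - V r \<omega> - (D1 r \<omega> * of_real (B (r + d) \<omega> - B r \<omega>) + D2 r \<omega> * of_real (((B (r + d) \<omega> - B r \<omega>)\<^sup>2 - d) / 2)))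
        \<le> C' * \<bar>B (r + d) \<omega> - B r \<omega>\<bar> ^ 3 + C' * d"
      if "\<omega> \<in> space P" "0 \<le> r" "r < Tk k \<omega>" "0 < d" "d < d0" for r d \<omega>
    proof -
      have "C * d \<le> C' * d" using C'(5) that by (intro mult_right_mono) auto
      then show ?thesis unfolding scale using r1[OF that] cube[of \<omega> "r + d" r] by linarith
    qed
    show "\<exists>d1>0. \<forall>r d. 0 \<le> r \<and> r < Tk k \<omega> \<and> r \<le> t \<and> 0 < d \<and> d < d1 \<longrightarrow>
       norm (V (r + d) \<omega> - V r \<omega> - (D1 r \<omega> * of_real (B (r + d) \<omega> - B r \<omega>) + D2 r \<omega> * of_real (((B (r + d) \<omega> - B r \<omega>)\<^sup>2 - d) / 2)))
        \<le> C' * \<bar>B (r + d) \<omega> - B r \<omega>\<bar> ^ 3 + \<eta> * d"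
      if "\<omega> \<in> space P" "0 < \<eta>" for \<omega> \<eta>
      unfolding scale using r2[OF that] cube[of \<omega>] by (meson add_right_mono order_trans)
  qed (use that in auto)
  have NV: "N (min t (Tk k \<omega>)) \<omega> = c0 * V (min t (Tk k \<omega>)) \<omega>" if t: "0 \<le> t" and w: "\<omega> \<in> space P" for t \<omega>
  proof -
    have T: "0 \<le> min t (Tk k \<omega>)" "min t (Tk k \<omega>) \<le> Tk k \<omega>" using t Tk_hit(1)[OF w] by auto
    have "clampr (real k + 1) (xi \<omega> (min t (Tk k \<omega>))) = xi \<omega> (min t (Tk k \<omega>))"
      using Tk_facts(2)[OF w T] by (intro clampr(2)) simp
    then show ?thesis using N[OF T(1) w T(2)] by (simp add: V_def A_def y_def e_def \<mu>_def \<beta>_def)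
  qed
  show ?thesis
  proof (rule complex_martingaleI[OF bm])
    show "(\<lambda>\<omega>. N (min t (Tk k \<omega>)) \<omega>) \<in> borel_measurable (F t)" if t: "0 \<le> t" for t
    proof -
      have "(\<lambda>\<omega>. c0 * V (min t (Tk k \<omega>)) \<omega>) \<in> borel_measurable (F t)" by (intro borel_measurable_times borel_measurable_const mVT t)
      then show ?thesis using NV[OF t] by (subst measurable_cong[where g = "\<lambda>\<omega>. c0 * V (min t (Tk k \<omega>)) \<omega>"]) (auto simp: space_F)
    qed
    show "norm (N (min t (Tk k \<omega>)) \<omega>) \<le> norm c0 * C" if t: "0 \<le> t" and w: "\<omega> \<in> space P" for t \<omega>
      unfolding NV[OF t w] norm_mult using Tk_hit(1)[OF w, of k] t d0 by (intro mult_left_mono Vb w) auto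
    show "(\<integral>\<omega>. indicator S \<omega> *\<^sub>R N (min t (Tk k \<omega>)) \<omega> \<partial>P) = (\<integral>\<omega>. indicator S \<omega> *\<^sub>R N (min s (Tk k \<omega>)) \<omega> \<partial>P)"
      if st: "0 \<le> s" "s \<le> t" and S: "S \<in> sets (F s)" for s t S
    proof -
      have *: "(\<integral>\<omega>. indicator S \<omega> *\<^sub>R N (min u (Tk k \<omega>)) \<omega> \<partial>P) = c0 * (\<integral>\<omega>. indicator S \<omega> *\<^sub>R V (min u (Tk k \<omega>)) \<omega> \<partial>P)" if u: "0 \<le> u" for u
      proof -
        have "(\<integral>\<omega>. indicator S \<omega> *\<^sub>R N (min u (Tk k \<omega>)) \<omega> \<partial>P) = (\<integral>\<omega>. c0 * (indicator S \<omega> *\<^sub>R V (min u (Tk k \<omega>)) \<omega>) \<partial>P)"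
          by (rule Bochner_Integration.integral_cong[OF refl]) (simp add: NV[OF u] scaleR_conv_of_real mult_ac)
        then show ?thesis by (simp only: integral_mult_right_zero)
      qed
      have "0 \<le> t" using st by simp
      then show ?thesis by (simp only: *[OF st(1)] *[OF \<open>0 \<le> t\<close>] eqV[OF S st])
    qed
  qed
qed

lemma local_martingale:
  assumes a: "a = sqrt (2 / \<kappa>)" and b: "b = sqrt (\<kappa> / 8) - sqrt (2 / \<kappa>)"
    and neut: "\<sigma>m + \<sigma>p + (\<Sum>j<n. \<sigma> j + \<sigma>s j) = 0"
    and fw: "\<And>\<omega>. \<omega> \<in> space P \<Longrightarrow> dipolar_flow (xi \<omega>) D \<psi>\<^sub>0 (\<psi> \<omega>) (\<tau> \<omega>)"
    and X: "\<And>\<omega> t. \<omega> \<in> space P \<Longrightarrow> 0 \<le> t \<Longrightarrow> ereal t < (INF j\<in>{..<n}. \<tau> \<omega> (z j)) \<Longrightarrow>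
        X t \<omega> \<in> vertex_observable a b n \<sigma> \<sigma>s \<sigma>m \<sigma>p (flow_domain D (\<tau> \<omega>) t) (flow_tip (xi \<omega>) D (\<psi> \<omega>) (\<tau> \<omega>) t) qm qp \<phi>m \<phi>p z"
    and Xc: "\<And>\<omega>. \<omega> \<in> space P \<Longrightarrow> continuous_on {t. 0 \<le> t \<and> ereal t < (INF j\<in>{..<n}. \<tau> \<omega> (z j))} (\<lambda>t. X t \<omega>)"
    and X0: "\<And>\<omega>. \<omega> \<in> space P \<Longrightarrow> X 0 \<omega> = x0"
  shows "local_martingale_upto P F (\<lambda>\<omega>. INF j\<in>{..<n}. \<tau> \<omega> (z j)) X"
  unfolding local_martingale_upto_def
proof (intro exI[of _ Tk] conjI allI ballI)
  show "stopping_time F (Tk k)" for k by (rule Tk_stopping)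
  show "AE \<omega> in P. (\<lambda>k. ereal (Tk k \<omega>)) \<longlonglongrightarrow> (INF j\<in>{..<n}. \<tau> \<omega> (z j))"
    by (rule AE_I2) (rule Tk_limit[OF _ fw])
  fix k
  define H where "H = heat.H0 nodes (nq \<sigma> \<sigma>s) a (\<sigma>m - \<sigma>p) (\<sigma>p * (\<sigma>p - a) / 2 - \<sigma>m * (\<sigma>m - a) / 2)"
  define A where "A = (\<lambda>\<omega>. Ae b \<sigma> \<sigma>s (\<sigma>m * (\<sigma>m - a) / 2 + \<sigma>p * (\<sigma>p - a) / 2) (xi \<omega>) (ek k))"
  \<comment> \<open>The initial value is the same for all \<omega>, because the driving function
    starts at 0 and the integral \<open>A\<close> vanishes there.\<close>
  define v0 where "v0 = H 0 (\<lambda>i. nconj (snd i) (\<psi>\<^sub>0 (z (fst i)))) 0"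
  have ex: "exp (log_obs a b \<sigma> \<sigma>s \<sigma>m \<sigma>p (xi \<omega>) t) = H (A \<omega> t) (\<lambda>i. ye (xi \<omega>) (ek k) i t) (of_real (xi \<omega> t))"
    if w: "\<omega> \<in> space P" and t: "0 \<le> t" "t \<le> Tk k \<omega>" for t \<omega>
    unfolding H_def A_def
  proof (rule log_obs_truncated[OF xi_cont[OF w] ek(1,3) t(1)])
    show "ek k < Im (tf (xi \<omega>) (ek k) (\<psi>\<^sub>0 (z j)) t)" if "j < n" for j
      using Tk_facts(3)[OF w t that] ek(1)[of k] by simp
  qed
  have ex0: "exp (log_obs a b \<sigma> \<sigma>s \<sigma>m \<sigma>p (xi \<omega>) 0) = v0" if w: "\<omega> \<in> space P" for \<omega>
    unfolding ex[OF w order_refl Tk_hit(1)[OF w]] v0_def ye_def tf_0[OF xi_cont[OF w] ek(1,3)] xi_0[OF w]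
    by (simp add: A_def Ae_def)
  show "complex_martingale P F (\<lambda>t \<omega>. X (min t (Tk k \<omega>)) \<omega>)"
  proof (rule stopped_martingale[OF a b neut, where ?c0.0 = "x0 / v0"])
    fix t \<omega> assume t: "0 \<le> t" and w: "\<omega> \<in> space P" and tT: "t \<le> Tk k \<omega>"
    have lt: "ereal t < (INF j\<in>{..<n}. \<tau> \<omega> (z j))"
      by (rule le_less_trans[OF _ Tk_less[OF w fw[OF w], of k]]) (simp add: tT)
    have "X t \<omega> = X 0 \<omega> * exp (log_obs a b \<sigma> \<sigma>s \<sigma>m \<sigma>p (xi \<omega>) t - log_obs a b \<sigma> \<sigma>s \<sigma>m \<sigma>p (xi \<omega>) 0)"
      by (rule process_formula[where X = "\<lambda>t. X t \<omega>", OF xi_cont[OF w] fw[OF w] neut X[OF w] Xc[OF w] t lt])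
    then have "X t \<omega> = x0 / v0 * H (A \<omega> t) (\<lambda>i. ye (xi \<omega>) (ek k) i t) (of_real (xi \<omega> t))"
      by (simp add: X0[OF w] exp_diff ex0[OF w] ex[OF w t tT])
    then show "X t \<omega> = x0 / v0 * heat.H0 nodes (nq \<sigma> \<sigma>s) a (\<sigma>m - \<sigma>p) (\<sigma>p * (\<sigma>p - a) / 2 - \<sigma>m * (\<sigma>m - a) / 2)
     (Ae b \<sigma> \<sigma>s (\<sigma>m * (\<sigma>m - a) / 2 + \<sigma>p * (\<sigma>p - a) / 2) (xi \<omega>) (ek k) t) (\<lambda>i. ye (xi \<omega>) (ek k) i t) (of_real (xi \<omega> t))"
      by (simp add: H_def A_def)
  qed
  fix \<omega> assume w: "\<omega> \<in> space P"
  show "0 \<le> Tk k \<omega>" "Tk k \<omega> \<le> Tk (Suc k) \<omega>" "ereal (Tk k \<omega>) < (INF j\<in>{..<n}. \<tau> \<omega> (z j))"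
    by (rule Tk_hit(1)[OF w], rule Tk_mono[OF w], rule Tk_less[OF w fw[OF w]])
qed

end

theorem theorem2p2:
  fixes P :: "'a measure" and F :: "real \<Rightarrow> 'a measure" and B :: "real \<Rightarrow> 'a \<Rightarrow> real"
    and \<kappa> a b :: real
    and n :: nat and \<sigma> \<sigma>s :: "nat \<Rightarrow> real" and \<sigma>m \<sigma>p :: real
  assumes "\<kappa> > 0"
    and "a = sqrt (2 / \<kappa>)"
    and "b = sqrt (\<kappa> / 8) - sqrt (2 / \<kappa>)"
    and "brownian_motion P F B"
    and neutrality: "\<sigma>m + \<sigma>p + (\<Sum>j<n. \<sigma> j + \<sigma>s j) = 0"
  shows "dipolar_martingale_observable P F B \<kappa> n (vertex_observable a b n \<sigma> \<sigma>s \<sigma>m \<sigma>p)"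
  unfolding dipolar_martingale_observable_def
proof (intro allI impI, elim conjE exE)
  fix D p Q qm qp \<phi>m \<phi>p \<psi>\<^sub>0 \<xi> \<psi> \<tau> z X x\<^sub>0
  assume dom: "open D" "dipolar_conformal \<psi>\<^sub>0 D p Q qm qp" "boundary_chart D qm \<phi>m" "boundary_chart D qp \<phi>p"
    and xi: "\<xi> = (\<lambda>\<omega> t. sqrt \<kappa> * B t \<omega>)"
    and fw: "\<forall>\<omega>\<in>space P. dipolar_flow (\<xi> \<omega>) D \<psi>\<^sub>0 (\<psi> \<omega>) (\<tau> \<omega>)"
    and z: "\<forall>j<n. z j \<in> D" "inj_on z {..<n}"
    and X: "\<forall>\<omega>\<in>space P. \<forall>t. 0 \<le> t \<and> ereal t < (INF j\<in>{..<n}. \<tau> \<omega> (z j)) \<longrightarrow>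
           X t \<omega> \<in> vertex_observable a b n \<sigma> \<sigma>s \<sigma>m \<sigma>p (flow_domain D (\<tau> \<omega>) t) (flow_tip (\<xi> \<omega>) D (\<psi> \<omega>) (\<tau> \<omega>) t) qm qp \<phi>m \<phi>p z"
    and Xc: "\<forall>\<omega>\<in>space P. continuous_on {t. 0 \<le> t \<and> ereal t < (INF j\<in>{..<n}. \<tau> \<omega> (z j))} (\<lambda>t. X t \<omega>)"
    and X0: "\<forall>\<omega>\<in>space P. X 0 \<omega> = x\<^sub>0"
  interpret driven_setting D p Q qm qp \<phi>m \<phi>p \<psi>\<^sub>0 n z P F B \<kappa>
    by unfold_locales (use dom z assms(1,4) in auto)
  have x: "\<xi> = xi" by (intro ext) (simp add: xi xi_def)
  show "local_martingale_upto P F (\<lambda>\<omega>. INF j\<in>{..<n}. \<tau> \<omega> (z j)) X"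
    by (rule local_martingale[OF assms(2,3) neutrality]) (use fw X Xc X0 in \<open>auto simp: x\<close>)
qed

end
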